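(* For a Dedekind complete vector lattice $E$ and $T\in\mathrm{Orth}(E)$, let $\rho_T=\lambda_T:\mathrm{Orth}(E)\to\mathrm{Orth}(E)$ be the multiplication map $S\mapsto ST=TS$. Consider the six modes of convergence $\mathrm{o}$, $\mathrm{uo}$, $\widehat\tau_{\mathrm{Orth}(E)}$, $\mathrm{SO}$, $\mathrm{SUO}$, $\mathrm{S}\widehat\tau_E$ for nets in $\mathrm{Orth}(E)$. Below, $E$ ranges over the Dedekind complete vector lattices (admitting a Hausdorff uo-Lebesgue topology in case one of the two modes under consideration is $\widehat\tau_{\mathrm{Orth}(E)}$ or $\mathrm{S}\widehat\tau_E$). For the following pairs $(c_1,c_2)$, the map $\rho_T=\lambda_T$ is $c_1$-$c_2$ continuous on $\mathrm{Orth}(E)$ for every such $E$ and every $T\in\mathrm{Orth}(E)$: - $c_1=\mathrm{o}$ and $c_2$ any of the six modes; - $c_1=\mathrm{uo}$ and $c_2\in\{\mathrm{uo},\widehat\tau_{\mathrm{Orth}(E)},\mathrm{SUO},\mathrm{S}\widehat\tau_E\}$; - $c_1=\widehat\tau_{\mathrm{Orth}(E)}$ and $c_2\in\{\widehat\tau_{\mathrm{Orth}(E)},\mathrm{S}\widehat\tau_E\}$; - $c_1=\mathrm{SO}$ and $c_2\in\{\mathrm{uo},\widehat\tau_{\mathrm{Orth}(E)},\mathrm{SO},\mathrm{SUO},\mathrm{S}\widehat\tau_E\}$; - $c_1=\mathrm{SUO}$ and $c_2\in\{\mathrm{uo},\widehat\tau_{\mathrm{Orth}(E)},\mathrm{SUO},\mathrm{S}\widehat\tau_E\}$;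 - $c_1=\mathrm{S}\widehat\tau_E$ and $c_2\in\{\widehat\tau_{\mathrm{Orth}(E)},\mathrm{S}\widehat\tau_E\}$. For each of the remaining pairs $(c_1,c_2)$ there exist such an $E$ and a $T\in\mathrm{Orth}(E)$ for which $\rho_T=\lambda_T$ is not $c_1$-$c_2$ continuous on $\mathrm{Orth}(E)$.
   Context: All vector lattices are real and Archimedean. $\mathrm{Orth}(E)$ is the vector lattice of orthomorphisms on $E$, i.e. of order bounded linear operators $T:E\to E$ with $T(B)\subseteq B$ for every band $B$ of $E$; it is commutative under composition. In a vector lattice $G$, a net $(x_\alpha)_{\alpha\in A}$ is order convergent to $x$ (mode o; $x_\alpha\xrightarrow{\mathrm{o}}x$) if there is a net $(y_\beta)_{\beta\in B}$ in $G$ with $y_\beta\downarrow 0$ such that for every $\beta_0\in B$ there is $\alpha_0\in A$ with $|x-x_\alpha|\le y_{\beta_0}$ for all $\alpha\ge\alpha_0$. It is unbounded order convergent to $x$ (mode uo; $x_\alpha\xrightarrow{\mathrm{uo}}x$) if $|x_\alpha-x|\wedge y\xrightarrow{\mathrm{o}}0$ for all $y\in G^+$. A uo-Lebesgue topology on $G$ is a locally solid linear topology $\tau$ on $G$ such that $x_\alpha\xrightarrow{\mathrm{uo}}0$ implies $x_\alpha\xrightarrow{\tau}0$ for every net. $G$ admits at most one Hausdorff uo-Lebesgue topology, denoted $\widehat\tau_G$ if it exists. For Dedekind complete $E$, $\mathrm{Orth}(E)$ admits one if and only if $E$ does. For nets in $\mathrm{Orth}(E)$, the modes o, uo and $\widehat\tau_{\mathrm{Orth}(E)}$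 are taken in the vector lattice $\mathrm{Orth}(E)$. The strong modes are pointwise: $S_\alpha\to S$ in the sense of SO (resp. SUO, resp. $\mathrm{S}\widehat\tau_E$) means that $S_\alpha x\to Sx$ in order (resp. in unbounded order, resp. in $\widehat\tau_E$) in $E$ for every $x\in E$. A map $\Phi:\mathrm{Orth}(E)\to\mathrm{Orth}(E)$ is $c_1$-$c_2$ continuous if, for every net $(S_\alpha)$ and every $S$ in $\mathrm{Orth}(E)$, $S_\alpha\to S$ in the sense of $c_1$ implies $\Phi(S_\alpha)\to\Phi(S)$ in the sense of $c_2$. *)

theory Defs
  imports "HOL-Analysis.Analysis" "HOL-Algebra.Module" "HOL-Algebra.Lattice"
begin

text \<open>
  Vector lattices are carrier-based structures, because the vector lattice of orthomorphisms on a
  vector lattice has to be treated on a par with the vector lattice itself, and because vector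
  lattices have to be quantified existentially. As always for HOL-Algebra modules, the record has
  fields for a multiplication and a unit; these are irrelevant for a vector lattice, and they are
  the composition and the identity for the orthomorphisms.
\<close>

record 'a vlat = "(real, 'a) module" +
  vle :: "'a \<Rightarrow> 'a \<Rightarrow> bool" (infixl \<open>\<preceq>\<index>\<close> 50)

definition real_ring :: "real ring" where
  "real_ring = \<lparr>carrier = UNIV, mult = (*), one = 1, zero = 0, add = (+)\<rparr>"

definition ord_of :: "'a vlat \<Rightarrow> 'a gorder" where
  "ord_of E = \<lparr>carrier = carrier E, eq = (=), le = vle E\<rparr>"

definition vector_lattice :: "'a vlat \<Rightarrow> bool" where
  "vector_lattice E \<longleftrightarrow>
     Module.module real_ring E \<and> Lattice.lattice (ord_of E) \<and>
     (\<forall>x\<in>carrier E. \<forall>y\<in>carrier E. \<forall>z\<in>carrier E. x \<preceq>\<^bsub>E\<^esub> y \<longrightarrow> x \<oplus>\<^bsub>E\<^esub> z \<preceq>\<^bsub>E\<^esub> y \<oplus>\<^bsub>E\<^esub> z) \<and>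
     (\<forall>x\<in>carrier E. \<forall>y\<in>carrier E. \<forall>r\<ge>0. x \<preceq>\<^bsub>E\<^esub> y \<longrightarrow> r \<odot>\<^bsub>E\<^esub> x \<preceq>\<^bsub>E\<^esub> r \<odot>\<^bsub>E\<^esub> y)"

definition archimedean :: "'a vlat \<Rightarrow> bool" where
  "archimedean E \<longleftrightarrow>
     (\<forall>x\<in>carrier E. \<forall>y\<in>carrier E. \<zero>\<^bsub>E\<^esub> \<preceq>\<^bsub>E\<^esub> x \<and> (\<forall>n::nat. real n \<odot>\<^bsub>E\<^esub> x \<preceq>\<^bsub>E\<^esub> y) \<longrightarrow> x = \<zero>\<^bsub>E\<^esub>)"

definition dedekind_complete :: "'a vlat \<Rightarrow> bool" where
  "dedekind_complete E \<longleftrightarrow>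
     (\<forall>D. D \<subseteq> carrier E \<and> D \<noteq> {} \<and> Upper (ord_of E) D \<noteq> {} \<longrightarrow>
          (\<exists>s. least (ord_of E) s (Upper (ord_of E) D)))"

definition vabs :: "'a vlat \<Rightarrow> 'a \<Rightarrow> 'a" where
  "vabs E x = x \<squnion>\<^bsub>ord_of E\<^esub> (\<ominus>\<^bsub>E\<^esub> x)"


subsection \<open>Orthomorphisms\<close>

definition solid_in :: "'a vlat \<Rightarrow> 'a set \<Rightarrow> bool" where
  "solid_in E V \<longleftrightarrow> V \<subseteq> carrier E \<and>
     (\<forall>x\<in>carrier E. \<forall>y\<in>V. vabs E x \<preceq>\<^bsub>E\<^esub> vabs E y \<longrightarrow> x \<in> V)"

definition band :: "'a vlat \<Rightarrow> 'a set \<Rightarrow> bool" where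
  "band E B \<longleftrightarrow> submodule B real_ring E \<and> solid_in E B \<and>
     (\<forall>D s. D \<subseteq> B \<and> least (ord_of E) s (Upper (ord_of E) D) \<longrightarrow> s \<in> B)"

definition linear_operator :: "'a vlat \<Rightarrow> ('a \<Rightarrow> 'a) \<Rightarrow> bool" where
  "linear_operator E T \<longleftrightarrow> T \<in> carrier E \<rightarrow> carrier E \<and>
     (\<forall>x\<in>carrier E. \<forall>y\<in>carrier E. T (x \<oplus>\<^bsub>E\<^esub> y) = T x \<oplus>\<^bsub>E\<^esub> T y) \<and>
     (\<forall>r. \<forall>x\<in>carrier E. T (r \<odot>\<^bsub>E\<^esub> x) = r \<odot>\<^bsub>E\<^esub> T x)"

definition order_bounded_operator :: "'a vlat \<Rightarrow> ('a \<Rightarrow> 'a) \<Rightarrow> bool" where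
  "order_bounded_operator E T \<longleftrightarrow>
     (\<forall>a\<in>carrier E. \<forall>b\<in>carrier E. \<exists>c\<in>carrier E. \<exists>d\<in>carrier E.
        \<forall>x\<in>carrier E. a \<preceq>\<^bsub>E\<^esub> x \<and> x \<preceq>\<^bsub>E\<^esub> b \<longrightarrow> c \<preceq>\<^bsub>E\<^esub> T x \<and> T x \<preceq>\<^bsub>E\<^esub> d)"

text \<open>Operators on the carrier are extensional, so that they are determined by their values there.\<close>

definition Orth :: "'a vlat \<Rightarrow> ('a \<Rightarrow> 'a) vlat" where
  "Orth E =
     \<lparr>carrier = {T \<in> extensional (carrier E). linear_operator E T \<and> order_bounded_operator E T \<and>
                   (\<forall>B. band E B \<longrightarrow> T ` B \<subseteq> B)},
      mult = (\<lambda>S T. compose (carrier E) S T),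
      one = (\<lambda>x\<in>carrier E. x),
      zero = (\<lambda>x\<in>carrier E. \<zero>\<^bsub>E\<^esub>),
      add = (\<lambda>S T. \<lambda>x\<in>carrier E. S x \<oplus>\<^bsub>E\<^esub> T x),
      smult = (\<lambda>r T. \<lambda>x\<in>carrier E. r \<odot>\<^bsub>E\<^esub> T x),
      vle = (\<lambda>S T. \<forall>x\<in>carrier E. \<zero>\<^bsub>E\<^esub> \<preceq>\<^bsub>E\<^esub> x \<longrightarrow> S x \<preceq>\<^bsub>E\<^esub> T x)\<rparr>"


subsection \<open>Nets and order convergence\<close>

definition directed :: "'i set \<Rightarrow> ('i \<Rightarrow> 'i \<Rightarrow> bool) \<Rightarrow> bool" where
  "directed A leq \<longleftrightarrow> A \<noteq> {} \<and> reflp_on A leq \<and> transp_on A leq \<and>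
     (\<forall>a\<in>A. \<forall>b\<in>A. \<exists>c\<in>A. leq a c \<and> leq b c)"

definition net_in :: "'a vlat \<Rightarrow> 'i set \<Rightarrow> ('i \<Rightarrow> 'i \<Rightarrow> bool) \<Rightarrow> ('i \<Rightarrow> 'a) \<Rightarrow> bool" where
  "net_in G A leq x \<longleftrightarrow> directed A leq \<and> x \<in> A \<rightarrow> carrier G"

definition decreases_to_zero :: "'a vlat \<Rightarrow> 'i set \<Rightarrow> ('i \<Rightarrow> 'i \<Rightarrow> bool) \<Rightarrow> ('i \<Rightarrow> 'a) \<Rightarrow> bool" where
  "decreases_to_zero G B leq y \<longleftrightarrow> net_in G B leq y \<and>
     (\<forall>b\<in>B. \<forall>c\<in>B. leq b c \<longrightarrow> y c \<preceq>\<^bsub>G\<^esub> y b) \<and>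
     greatest (ord_of G) \<zero>\<^bsub>G\<^esub> (Lower (ord_of G) (y ` B))"

text \<open>
  The net decreasing to zero has indices in the type of the elements of the vector lattice. This is
  no restriction (see order_conv_any_index below): a decreasing net can be indexed by its own range.
\<close>

definition order_conv ::
  "'a vlat \<Rightarrow> 'i set \<Rightarrow> ('i \<Rightarrow> 'i \<Rightarrow> bool) \<Rightarrow> ('i \<Rightarrow> 'a) \<Rightarrow> 'a \<Rightarrow> bool" where
  "order_conv G A leq x l \<longleftrightarrow>
     (\<exists>(B::'a set) leqB (y::'a \<Rightarrow> 'a). decreases_to_zero G B leqB y \<and>
        (\<forall>b\<in>B. \<exists>a\<^sub>0\<in>A. \<forall>a\<in>A. leq a\<^sub>0 a \<longrightarrow> vabs G (l \<ominus>\<^bsub>G\<^esub> x a) \<preceq>\<^bsub>G\<^esub> y b))"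

definition uo_conv ::
  "'a vlat \<Rightarrow> 'i set \<Rightarrow> ('i \<Rightarrow> 'i \<Rightarrow> bool) \<Rightarrow> ('i \<Rightarrow> 'a) \<Rightarrow> 'a \<Rightarrow> bool" where
  "uo_conv G A leq x l \<longleftrightarrow>
     (\<forall>y\<in>carrier G. \<zero>\<^bsub>G\<^esub> \<preceq>\<^bsub>G\<^esub> y \<longrightarrow>
        order_conv G A leq (\<lambda>a. vabs G (x a \<ominus>\<^bsub>G\<^esub> l) \<sqinter>\<^bsub>ord_of G\<^esub> y) \<zero>\<^bsub>G\<^esub>)"


subsection \<open>Unbounded order Lebesgue topologies\<close>

definition tail_filter :: "'i set \<Rightarrow> ('i \<Rightarrow> 'i \<Rightarrow> bool) \<Rightarrow> 'i filter" where
  "tail_filter A leq = (INF a\<in>A. principal {b\<in>A. leq a b})"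

definition locally_solid_linear_topology :: "'a vlat \<Rightarrow> 'a topology \<Rightarrow> bool" where
  "locally_solid_linear_topology G \<tau> \<longleftrightarrow> topspace \<tau> = carrier G \<and>
     continuous_map (prod_topology \<tau> \<tau>) \<tau> (\<lambda>(x, y). x \<oplus>\<^bsub>G\<^esub> y) \<and>
     continuous_map (prod_topology euclideanreal \<tau>) \<tau> (\<lambda>(r, x). r \<odot>\<^bsub>G\<^esub> x) \<and>
     (\<forall>U. openin \<tau> U \<and> \<zero>\<^bsub>G\<^esub> \<in> U \<longrightarrow>
        (\<exists>V W. solid_in G V \<and> V \<subseteq> U \<and> openin \<tau> W \<and> \<zero>\<^bsub>G\<^esub> \<in> W \<and> W \<subseteq> V))"

text \<open>
  HOL cannot quantify over all index types in a definition. The index type used here is large enough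
  to obtain all nets; this is the content of uo_Lebesgue_any_index below.
\<close>

definition uo_Lebesgue :: "'a vlat \<Rightarrow> 'a topology \<Rightarrow> bool" where
  "uo_Lebesgue G \<tau> \<longleftrightarrow> locally_solid_linear_topology G \<tau> \<and>
     (\<forall>(A::('a set \<times> 'a) set) leq x. net_in G A leq x \<and> uo_conv G A leq x \<zero>\<^bsub>G\<^esub> \<longrightarrow>
        limitin \<tau> x \<zero>\<^bsub>G\<^esub> (tail_filter A leq))"

definition Hausdorff_uo_Lebesgue :: "'a vlat \<Rightarrow> 'a topology \<Rightarrow> bool" where
  "Hausdorff_uo_Lebesgue G \<tau> \<longleftrightarrow> uo_Lebesgue G \<tau> \<and> Hausdorff_space \<tau>"

text \<open>Meaningful only if the topology exists; it is then unique.\<close>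

definition tau_hat :: "'a vlat \<Rightarrow> 'a topology" where
  "tau_hat G = (THE \<tau>. Hausdorff_uo_Lebesgue G \<tau>)"


subsection \<open>The six modes of convergence for nets of orthomorphisms\<close>

datatype mode = Mo | Muo | Mtau | MSO | MSUO | MStau

fun converges ::
  "mode \<Rightarrow> 'a vlat \<Rightarrow> 'i set \<Rightarrow> ('i \<Rightarrow> 'i \<Rightarrow> bool) \<Rightarrow> ('i \<Rightarrow> 'a \<Rightarrow> 'a) \<Rightarrow> ('a \<Rightarrow> 'a) \<Rightarrow> bool" where
  "converges Mo E A leq S S' = order_conv (Orth E) A leq S S'"
| "converges Muo E A leq S S' = uo_conv (Orth E) A leq S S'"
| "converges Mtau E A leq S S' = limitin (tau_hat (Orth E)) S S' (tail_filter A leq)"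
| "converges MSO E A leq S S' = (\<forall>x\<in>carrier E. order_conv E A leq (\<lambda>a. S a x) (S' x))"
| "converges MSUO E A leq S S' = (\<forall>x\<in>carrier E. uo_conv E A leq (\<lambda>a. S a x) (S' x))"
| "converges MStau E A leq S S' =
     (\<forall>x\<in>carrier E. limitin (tau_hat E) (\<lambda>a. S a x) (S' x) (tail_filter A leq))"

definition mode_continuous ::
  "'i itself \<Rightarrow> 'a vlat \<Rightarrow> mode \<Rightarrow> mode \<Rightarrow> (('a \<Rightarrow> 'a) \<Rightarrow> ('a \<Rightarrow> 'a)) \<Rightarrow> bool" where
  "mode_continuous _ E c\<^sub>1 c\<^sub>2 \<Phi> \<longleftrightarrow>
     (\<forall>(A::'i set) leq S. \<forall>S'\<in>carrier (Orth E).
        net_in (Orth E) A leq S \<and> converges c\<^sub>1 E A leq S S' \<longrightarrow>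
        converges c\<^sub>2 E A leq (\<lambda>a. \<Phi> (S a)) (\<Phi> S'))"

definition rho :: "'a vlat \<Rightarrow> ('a \<Rightarrow> 'a) \<Rightarrow> ('a \<Rightarrow> 'a) \<Rightarrow> ('a \<Rightarrow> 'a)" where
  "rho E T = (\<lambda>S\<in>carrier (Orth E). S \<otimes>\<^bsub>Orth E\<^esub> T)"

definition lam :: "'a vlat \<Rightarrow> ('a \<Rightarrow> 'a) \<Rightarrow> ('a \<Rightarrow> 'a) \<Rightarrow> ('a \<Rightarrow> 'a)" where
  "lam E T = (\<lambda>S\<in>carrier (Orth E). T \<otimes>\<^bsub>Orth E\<^esub> S)"

definition admissible :: "mode \<Rightarrow> mode \<Rightarrow> 'a vlat \<Rightarrow> bool" where
  "admissible c\<^sub>1 c\<^sub>2 E \<longleftrightarrow> vector_lattice E \<and> archimedean E \<and> dedekind_complete E \<and>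
     ({c\<^sub>1, c\<^sub>2} \<inter> {Mtau, MStau} \<noteq> {} \<longrightarrow> (\<exists>\<tau>. Hausdorff_uo_Lebesgue E \<tau>))"

definition continuity_pairs :: "(mode \<times> mode) set" where
  "continuity_pairs =
     {Mo} \<times> UNIV \<union>
     {Muo} \<times> {Muo, Mtau, MSUO, MStau} \<union>
     {Mtau} \<times> {Mtau, MStau} \<union>
     {MSO} \<times> {Muo, Mtau, MSO, MSUO, MStau} \<union>
     {MSUO} \<times> {Muo, Mtau, MSUO, MStau} \<union>
     {MStau} \<times> {Mtau, MStau}"


subsection \<open>Independence of the index types\<close>

lemma eventually_tail_filter:
  assumes "directed A leq"
  shows "eventually P (tail_filter A leq) \<longleftrightarrow> (\<exists>a\<in>A. \<forall>b\<in>A. leq a b \<longrightarrow> P b)"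
proof -
  have base: "\<exists>c\<in>A. principal {d\<in>A. leq c d} \<le> inf (principal {d\<in>A. leq a d}) (principal {d\<in>A. leq b d})"
    if "a \<in> A" "b \<in> A" for a b
  proof -
    obtain c where c: "c \<in> A" "leq a c" "leq b c"
      using assms \<open>a \<in> A\<close> \<open>b \<in> A\<close> unfolding directed_def by blast
    have "transp_on A leq" using assms unfolding directed_def by blast
    then have "{d\<in>A. leq c d} \<subseteq> {d\<in>A. leq a d} \<inter> {d\<in>A. leq b d}"
      using c \<open>a \<in> A\<close> \<open>b \<in> A\<close> by (auto dest: transp_onD)
    then show ?thesis using c(1) by auto
  qed
  have "A \<noteq> {}" using assms unfolding directed_def by blast
  show ?thesis
    unfolding tail_filter_def
    by (subst eventually_INF_base[OF \<open>A \<noteq> {}\<close> base]) (auto simp: eventually_principal)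
qed

lemma order_conv_any_index:
  fixes B :: "'j set"
  assumes po: "Lattice.lattice (ord_of G)"
    and y: "decreases_to_zero G B leqB y"
    and dom: "\<And>b. b \<in> B \<Longrightarrow> \<exists>a\<^sub>0\<in>A. \<forall>a\<in>A. leq a\<^sub>0 a \<longrightarrow> vabs G (l \<ominus>\<^bsub>G\<^esub> x a) \<preceq>\<^bsub>G\<^esub> y b"
  shows "order_conv G A leq x l"
proof -
  interpret L: Lattice.lattice "ord_of G" by (rule po)
  have B: "B \<noteq> {}" "y ` B \<subseteq> carrier G" and dir: "\<And>a b. a \<in> B \<Longrightarrow> b \<in> B \<Longrightarrow> \<exists>c\<in>B. leqB a c \<and> leqB b c"
    and mono: "\<And>b c. b \<in> B \<Longrightarrow> c \<in> B \<Longrightarrow> leqB b c \<Longrightarrow> y c \<preceq>\<^bsub>G\<^esub> y b"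
    and inf0: "greatest (ord_of G) \<zero>\<^bsub>G\<^esub> (Lower (ord_of G) (y ` B))"
    using y unfolding decreases_to_zero_def net_in_def directed_def by blast+
  let ?ge = "\<lambda>u v. v \<preceq>\<^bsub>G\<^esub> u"
  have refl: "reflp_on (y ` B) ?ge"
    using B(2) L.le_refl by (intro reflp_onI) (auto simp: ord_of_def)
  have tr: "w \<preceq>\<^bsub>G\<^esub> u" if "v \<preceq>\<^bsub>G\<^esub> u" "w \<preceq>\<^bsub>G\<^esub> v" "u \<in> y ` B" "v \<in> y ` B" "w \<in> y ` B" for u v w
    using L.le_trans[of w v u] that(1,2) subsetD[OF B(2) that(3)] subsetD[OF B(2) that(4)]
      subsetD[OF B(2) that(5)] unfolding ord_of_def by simp
  have trans: "transp_on (y ` B) ?ge"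
    using tr by (intro transp_onI)
  have upper: "\<exists>w\<in>y ` B. w \<preceq>\<^bsub>G\<^esub> u \<and> w \<preceq>\<^bsub>G\<^esub> v" if uv: "u \<in> y ` B" "v \<in> y ` B" for u v
  proof -
    obtain a b where ab: "a \<in> B" "u = y a" "b \<in> B" "v = y b" using uv by (elim imageE)
    obtain c where c: "c \<in> B" "leqB a c" "leqB b c" using dir[OF ab(1,3)] by (elim bexE conjE)
    have "y c \<preceq>\<^bsub>G\<^esub> u" "y c \<preceq>\<^bsub>G\<^esub> v"
      unfolding ab(2,4) using mono[OF ab(1) c(1,2)] mono[OF ab(3) c(1,3)] .
    then show ?thesis using imageI[OF c(1), of y] by (intro bexI conjI)
  qed
  have "directed (y ` B) ?ge"
    unfolding directed_def using refl trans B(1) upper by simp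
  then have "decreases_to_zero G (y ` B) ?ge (\<lambda>u. u)"
    using B(2) inf0 unfolding decreases_to_zero_def net_in_def by auto
  then show ?thesis
    unfolding order_conv_def using dom by blast
qed

lemma uo_Lebesgue_any_index:
  fixes A :: "'i set"
  assumes \<tau>: "uo_Lebesgue G \<tau>" and net: "net_in G A leq x" and uo: "uo_conv G A leq x \<zero>\<^bsub>G\<^esub>"
  shows "limitin \<tau> x \<zero>\<^bsub>G\<^esub> (tail_filter A leq)"
proof -
  define tl where "tl a = {b\<in>A. leq a b}" for a
  define A' where "A' = {(x ` tl a, z) | a z. a \<in> A \<and> z \<in> x ` tl a}"
  define leq' where "leq' = (\<lambda>(p :: 'a set \<times> 'a) (q :: 'a set \<times> 'a). fst q \<subseteq> fst p)"
  have dA: "directed A leq" and xc: "x \<in> A \<rightarrow> carrier G" using net unfolding net_in_def by auto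
  have tl_ne: "a \<in> tl a" if "a \<in> A" for a
    using dA that unfolding directed_def tl_def by (auto dest: reflp_onD)
  have tl_mono: "tl b \<subseteq> tl a" if "a \<in> A" "b \<in> A" "leq a b" for a b
  proof -
    have "transp_on A leq" using dA unfolding directed_def by blast
    then show ?thesis using that unfolding tl_def by (auto dest: transp_onD)
  qed
  have inA': "(x ` tl a, x b) \<in> A'" if "a \<in> A" "b \<in> tl a" for a b
    using that unfolding A'_def by auto
  have A'E: "\<exists>a b. a \<in> A \<and> b \<in> tl a \<and> p = (x ` tl a, x b)" if "p \<in> A'" for p
    using that unfolding A'_def by auto
  have "directed A' leq'"
    unfolding directed_def
  proof (intro conjI ballI)
    obtain a where "a \<in> A" using dA unfolding directed_def by blast
    then show "A' \<noteq> {}" using inA'[OF _ tl_ne] by blast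
    show "reflp_on A' leq'" unfolding leq'_def by (rule reflp_onI) auto
    show "transp_on A' leq'" unfolding leq'_def by (rule transp_onI) auto
  next
    fix p q assume "p \<in> A'" "q \<in> A'"
    then obtain a a' b b' where ab: "a \<in> A" "p = (x ` tl a, x a')" "b \<in> A" "q = (x ` tl b, x b')"
      by (blast dest: A'E)
    then obtain c where c: "c \<in> A" "leq a c" "leq b c" using dA unfolding directed_def by blast
    have "x ` tl c \<subseteq> x ` tl a" "x ` tl c \<subseteq> x ` tl b"
      using tl_mono ab(1,3) c by (auto intro!: image_mono)
    then have "leq' p (x ` tl c, x c)" "leq' q (x ` tl c, x c)"
      unfolding leq'_def by (simp_all add: ab(2,4))
    then show "\<exists>r\<in>A'. leq' p r \<and> leq' q r" using inA'[OF c(1) tl_ne[OF c(1)]] by blast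
  qed
  have net': "net_in G A' leq' snd"
  proof -
    have "snd p \<in> carrier G" if "p \<in> A'" for p
      using A'E[OF that] xc unfolding tl_def by auto
    then show ?thesis using \<open>directed A' leq'\<close> unfolding net_in_def by auto
  qed
  have ev: "(\<exists>p\<in>A'. \<forall>q\<in>A'. leq' p q \<longrightarrow> P (snd q)) \<longleftrightarrow> (\<exists>a\<in>A. \<forall>b\<in>A. leq a b \<longrightarrow> P (x b))" for P
  proof
    assume "\<exists>p\<in>A'. \<forall>q\<in>A'. leq' p q \<longrightarrow> P (snd q)"
    then obtain p where p: "p \<in> A'" "\<And>q. q \<in> A' \<Longrightarrow> leq' p q \<Longrightarrow> P (snd q)" by blast
    then obtain a a' where a: "a \<in> A" "p = (x ` tl a, x a')" by (blast dest: A'E)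
    have "P (x b)" if "b \<in> A" "leq a b" for b
    proof -
      have "b \<in> tl a" using that unfolding tl_def by simp
      then have "(x ` tl a, x b) \<in> A'" using inA' a(1) by blast
      then show ?thesis using p(2) unfolding leq'_def a(2) by fastforce
    qed
    then show "\<exists>a\<in>A. \<forall>b\<in>A. leq a b \<longrightarrow> P (x b)" using a(1) by blast
  next
    assume "\<exists>a\<in>A. \<forall>b\<in>A. leq a b \<longrightarrow> P (x b)"
    then obtain a where a: "a \<in> A" "\<And>b. b \<in> tl a \<Longrightarrow> P (x b)" unfolding tl_def by blast
    have "P (snd q)" if q: "q \<in> A'" "leq' (x ` tl a, x a) q" for q
    proof -
      obtain c b where cb: "b \<in> tl c" "q = (x ` tl c, x b)" using A'E[OF q(1)] by blast
      then have "x b \<in> x ` tl a" using q(2) unfolding leq'_def by auto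
      then obtain b' where "b' \<in> tl a" "x b = x b'" by blast
      then show ?thesis using a(2) cb(2) by simp
    qed
    then show "\<exists>p\<in>A'. \<forall>q\<in>A'. leq' p q \<longrightarrow> P (snd q)" using inA'[OF a(1) tl_ne[OF a(1)]] by blast
  qed
  have transfer: "order_conv G A' leq' (\<lambda>p. f (snd p)) l \<longleftrightarrow> order_conv G A leq (\<lambda>a. f (x a)) l" for f l
  proof -
    have "(\<exists>p\<in>A'. \<forall>q\<in>A'. leq' p q \<longrightarrow> vabs G (l \<ominus>\<^bsub>G\<^esub> f (snd q)) \<preceq>\<^bsub>G\<^esub> w) \<longleftrightarrow>
          (\<exists>a\<in>A. \<forall>b\<in>A. leq a b \<longrightarrow> vabs G (l \<ominus>\<^bsub>G\<^esub> f (x b)) \<preceq>\<^bsub>G\<^esub> w)" for w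
      by (rule ev)
    then show ?thesis unfolding order_conv_def by simp
  qed
  have "uo_conv G A' leq' snd \<zero>\<^bsub>G\<^esub>"
    using uo transfer[of "\<lambda>z. vabs G (z \<ominus>\<^bsub>G\<^esub> \<zero>\<^bsub>G\<^esub>) \<sqinter>\<^bsub>ord_of G\<^esub> w" "\<zero>\<^bsub>G\<^esub>" for w]
    unfolding uo_conv_def by simp
  then have "limitin \<tau> snd \<zero>\<^bsub>G\<^esub> (tail_filter A' leq')"
    using \<tau> net' unfolding uo_Lebesgue_def by blast
  then show ?thesis
    unfolding limitin_def eventually_tail_filter[OF dA] eventually_tail_filter[OF \<open>directed A' leq'\<close>]
    using ev[of "\<lambda>z. z \<in> U" for U] by simp
qed

end

theory Submission
  imports Defs
begin

text \<open>
  Composition with \<open>T\<close> cannot disturb a strong mode, because \<open>(S\<^sub>\<alpha> T) x\<close> is the net \<open>S\<^sub>\<alpha>\<close> evaluated at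
  the point \<open>T x\<close> (\<open>strong_rho\<close>). Hence, except from order convergence to order convergence, continuity
  from one mode to another only asks for comparisons of modes: pass from the first mode to a strong
  one, compose, and pass from there to the second mode (\<open>rho_continuous\<close>). The comparisons rest on three
  facts.

  The lattice operations of \<open>Orth E\<close>, and infima of arbitrary families, are computed pointwise on the
  positive cone (\<open>Orth_abs\<close>, \<open>Orth_glb_pointwise\<close>). Behind this is \<open>orth_sign\<close>: an orthomorphism that is
  nonnegative at \<open>x \<ge> 0\<close> is nonnegative on the whole interval from \<open>0\<close> to \<open>x\<close>. It is proved by a bisection
  that uses band projections, and the same bisection shows that orthomorphisms commute
  (\<open>orth_commute\<close>), so that the left and the right multiplications agree. Pointwise infima show that order
  convergence in \<open>Orth E\<close> implies strong order convergence and is preserved under composition.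

  Unbounded order convergence in \<open>Orth E\<close> is the same as strong unbounded order convergence
  (\<open>uo_imp_SUO\<close>, \<open>SUO_imp_uo\<close>). In one direction the bound supplied by the identity operator suffices,
  since an orthomorphism maps \<open>x\<close> into the band generated by \<open>x\<close>; in the other, suprema of tails are
  pointwise.

  The topology of pointwise convergence that \<open>Orth E\<close> inherits from a Hausdorff uo-Lebesgue topology on \<open>E\<close>
  is again one (\<open>Hausdorff_uo_Lebesgue_ptw\<close>). As a Dedekind complete vector lattice has at most one
  such topology (\<open>Hausdorff_uo_Lebesgue_unique\<close>), topological and strong topological convergence coincide.
  The uniqueness combines two statements: a uo-Lebesgue topology is determined by its
  restrictions to order intervals (\<open>uo_Lebesgue_unbounded\<close>), and on an order interval every Hausdorff
  uo-Lebesgue topology is at least as fine as every other uo-Lebesgue topology (\<open>Amemiya\<close>).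

  For the remaining pairs take \<open>T\<close> to be the identity, on classes of measurable functions on the
  unit interval. Multiplication by \<open>k\<close> times the indicator of \<open>(0, 1/(n+1))\<close>, where only \<open>n\<close> is used to direct
  the index set, is null in all modes but the two order modes, as no tail is bounded; on the classes that
  vanish near zero it is strongly order null, but still not order null. Multiplication by the indicators
  of the intervals \<open>[k/(n+1), (k+1)/(n+1))\<close>, directed in the same way, converges to zero in measure, while
  each tail covers the whole interval.
\<close>

section \<open>Arithmetic in vector lattices\<close>

lemma ord_of_simps [simp]:
  "carrier (ord_of E) = carrier E" "le (ord_of E) = vle E" "eq (ord_of E) = (=)"
  by (simp_all add: ord_of_def)

lemma real_ring_simps [simp]:
  "carrier real_ring = UNIV" "\<one>\<^bsub>real_ring\<^esub> = 1" "\<zero>\<^bsub>real_ring\<^esub> = 0"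
  "x \<oplus>\<^bsub>real_ring\<^esub> y = x + y" "x \<otimes>\<^bsub>real_ring\<^esub> y = x * y"
  by (simp_all add: real_ring_def)

lemma cring_real_ring: "cring real_ring"
  by (rule cringI, rule abelian_groupI, simp_all add: algebra_simps comm_monoid_def monoid_def comm_monoid_axioms_def)
     (metis add.right_inverse add.commute)

locale vlattice =
  fixes E :: "'a vlat" (structure)
  assumes vlattice: "vector_lattice E"
begin

abbreviation vsup (infixl "\<curlyvee>" 65) where "x \<curlyvee> y \<equiv> x \<squnion>\<^bsub>ord_of E\<^esub> y"
abbreviation vinf (infixl "\<curlywedge>" 65) where "x \<curlywedge> y \<equiv> x \<sqinter>\<^bsub>ord_of E\<^esub> y"
abbreviation av where "av x \<equiv> vabs E x"

end

sublocale vlattice \<subseteq> module real_ring E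
  using vlattice by (simp add: vector_lattice_def)

sublocale vlattice \<subseteq> L: lattice "ord_of E"
  using vlattice by (simp add: vector_lattice_def)

context vlattice
begin

lemma minus_real_ring [simp]: "\<ominus>\<^bsub>real_ring\<^esub> x = - x"
  using R.minus_equality[of "-x" x] by simp

lemma smult_closed' [simp, intro]: "x \<in> carrier E \<Longrightarrow> r \<odot> x \<in> carrier E"
  by simp
lemma smult_add_left: "x \<in> carrier E \<Longrightarrow> (r + s) \<odot> x = r \<odot> x \<oplus> s \<odot> x"
  using smult_l_distr[of r s x] by simp
lemma smult_add_right: "x \<in> carrier E \<Longrightarrow> y \<in> carrier E \<Longrightarrow> r \<odot> (x \<oplus> y) = r \<odot> x \<oplus> r \<odot> y"
  using smult_r_distr[of r x y] by simp
lemma smult_smult [simp]: "x \<in> carrier E \<Longrightarrow> r \<odot> (s \<odot> x) = (r * s) \<odot> x"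
  using smult_assoc1[of r s x] by simp
lemma smult_1 [simp]: "x \<in> carrier E \<Longrightarrow> 1 \<odot> x = x"
  using smult_one[of x] by simp
lemma smult_0 [simp]: "x \<in> carrier E \<Longrightarrow> 0 \<odot> x = \<zero>"
  using smult_l_null[of x] by simp
lemma smult_zero [simp]: "r \<odot> \<zero> = \<zero>"
  using smult_r_null[of r] by simp
lemma smult_neg: "x \<in> carrier E \<Longrightarrow> (- r) \<odot> x = \<ominus> (r \<odot> x)"
  using smult_l_minus[of r x] by simp
lemma smult_a_inv: "x \<in> carrier E \<Longrightarrow> r \<odot> (\<ominus> x) = \<ominus> (r \<odot> x)"
  using smult_r_minus[of r x] by simp
lemma smult_2: "x \<in> carrier E \<Longrightarrow> 2 \<odot> x = x \<oplus> x"
  using smult_add_left[of x 1 1] by simp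
lemma smult_minus: "x \<in> carrier E \<Longrightarrow> y \<in> carrier E \<Longrightarrow> r \<odot> (x \<ominus> y) = r \<odot> x \<ominus> r \<odot> y"
  by (simp add: a_minus_def smult_add_right smult_a_inv)

lemma minus_closed' [simp, intro]: "x \<in> carrier E \<Longrightarrow> y \<in> carrier E \<Longrightarrow> x \<ominus> y \<in> carrier E"
  by (rule minus_closed)

lemma neg_zero [simp]: "\<ominus> \<zero> = \<zero>" by (rule minus_equality) simp_all
lemma minus_self [simp]: "x \<in> carrier E \<Longrightarrow> x \<ominus> x = \<zero>" by (simp add: a_minus_def r_neg)
lemma minus_zero_right [simp]: "x \<in> carrier E \<Longrightarrow> x \<ominus> \<zero> = x" by (simp add: a_minus_def)
lemma minus_zero_left [simp]: "x \<in> carrier E \<Longrightarrow> \<zero> \<ominus> x = \<ominus> x" by (simp add: a_minus_def)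

lemma add_minus_cancel [simp]:
  assumes "x \<in> carrier E" "y \<in> carrier E"
  shows "(x \<oplus> y) \<ominus> y = x" "(x \<oplus> y) \<ominus> x = y" "(x \<ominus> y) \<oplus> y = x" "y \<oplus> (x \<ominus> y) = x"
proof -
  show "(x \<oplus> y) \<ominus> y = x" "(x \<ominus> y) \<oplus> y = x" using assms by (simp_all add: a_minus_def a_assoc r_neg l_neg)
  then show "(x \<oplus> y) \<ominus> x = y" "y \<oplus> (x \<ominus> y) = x"
    using assms a_comm[of x y] a_comm[of y "x \<ominus> y"] by (simp_all add: a_minus_def a_assoc r_neg)
qed

lemma minus_eq_iff:
  assumes "x \<in> carrier E" "y \<in> carrier E" "z \<in> carrier E"
  shows "(x \<ominus> y = z) = (x = z \<oplus> y)" "(z = x \<ominus> y) = (z \<oplus> y = x)"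
  using assms add_minus_cancel by metis+

lemma diff_normalize3:
  assumes "x \<in> carrier E" "y \<in> carrier E" "z \<in> carrier E"
  shows "x \<oplus> (y \<ominus> z) = (x \<oplus> y) \<ominus> z" "(x \<ominus> y) \<oplus> z = (x \<oplus> z) \<ominus> y"
    "(x \<ominus> y) \<ominus> z = x \<ominus> (y \<oplus> z)" "x \<ominus> (y \<ominus> z) = (x \<oplus> z) \<ominus> y"
  using assms by (simp_all add: a_minus_def minus_add a_ac)

lemma diff_normalize2:
  assumes "x \<in> carrier E" "y \<in> carrier E"
  shows "x \<oplus> \<ominus> y = x \<ominus> y" "\<ominus> x \<oplus> y = y \<ominus> x" "\<ominus> (x \<ominus> y) = y \<ominus> x" "x \<ominus> (\<ominus> y) = x \<oplus> y"
    "\<ominus> x \<ominus> y = \<ominus> (x \<oplus> y)" "(\<ominus> x = y) = (\<zero> = y \<oplus> x)" "(y = \<ominus> x) = (y \<oplus> x = \<zero>)"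
proof -
  show "x \<oplus> \<ominus> y = x \<ominus> y" "\<ominus> x \<oplus> y = y \<ominus> x" "\<ominus> (x \<ominus> y) = y \<ominus> x" "x \<ominus> (\<ominus> y) = x \<oplus> y"
    "\<ominus> x \<ominus> y = \<ominus> (x \<oplus> y)" using assms by (simp_all add: a_minus_def minus_add a_ac)
  show "(\<ominus> x = y) = (\<zero> = y \<oplus> x)" "(y = \<ominus> x) = (y \<oplus> x = \<zero>)"
    using assms minus_equality l_neg by metis+
qed

lemmas diff_normalize = diff_normalize3 diff_normalize2

lemma ord_refl [simp]: "x \<in> carrier E \<Longrightarrow> x \<preceq> x"
  using L.le_refl[of x] by simp
lemma ord_trans [trans]: "x \<preceq> y \<Longrightarrow> y \<preceq> z \<Longrightarrow> x \<in> carrier E \<Longrightarrow> y \<in> carrier E \<Longrightarrow> z \<in> carrier E \<Longrightarrow> x \<preceq> z"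
  using L.le_trans[of x y z] by simp
lemma ord_antisym: "x \<preceq> y \<Longrightarrow> y \<preceq> x \<Longrightarrow> x \<in> carrier E \<Longrightarrow> y \<in> carrier E \<Longrightarrow> x = y"
  using L.weak_le_antisym[of x y] by simp

lemma add_right_mono':
  "x \<preceq> y \<Longrightarrow> x \<in> carrier E \<Longrightarrow> y \<in> carrier E \<Longrightarrow> z \<in> carrier E \<Longrightarrow> x \<oplus> z \<preceq> y \<oplus> z"
  using vlattice by (simp add: vector_lattice_def)
lemma smult_mono:
  "x \<preceq> y \<Longrightarrow> 0 \<le> r \<Longrightarrow> x \<in> carrier E \<Longrightarrow> y \<in> carrier E \<Longrightarrow> r \<odot> x \<preceq> r \<odot> y"
  using vlattice by (simp add: vector_lattice_def)

lemma add_le_cancel [simp]: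
  assumes "x \<in> carrier E" "y \<in> carrier E" "z \<in> carrier E"
  shows "(x \<oplus> z \<preceq> y \<oplus> z) = (x \<preceq> y)" "(z \<oplus> x \<preceq> z \<oplus> y) = (x \<preceq> y)"
proof -
  show "(x \<oplus> z \<preceq> y \<oplus> z) = (x \<preceq> y)"
    using assms add_right_mono'[of x y z] add_right_mono'[of "x \<oplus> z" "y \<oplus> z" "\<ominus> z"] by (auto simp: a_assoc r_neg)
  then show "(z \<oplus> x \<preceq> z \<oplus> y) = (x \<preceq> y)" using assms by (simp add: a_comm)
qed

lemma le_diff_iff:
  assumes "x \<in> carrier E" "y \<in> carrier E" "z \<in> carrier E"
  shows "(x \<ominus> y \<preceq> z) = (x \<preceq> z \<oplus> y)" "(z \<preceq> x \<ominus> y) = (z \<oplus> y \<preceq> x)"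
  using assms add_le_cancel(1)[of "x \<ominus> y" z y] add_le_cancel(1)[of z "x \<ominus> y" y] by simp_all

lemma le_neg_iff:
  assumes "x \<in> carrier E" "y \<in> carrier E"
  shows "(\<ominus> x \<preceq> y) = (\<zero> \<preceq> y \<oplus> x)" "(y \<preceq> \<ominus> x) = (y \<oplus> x \<preceq> \<zero>)"
  using assms le_diff_iff[of \<zero> x y] by simp_all

lemma neg_le_neg [simp]: "x \<in> carrier E \<Longrightarrow> y \<in> carrier E \<Longrightarrow> (\<ominus> x \<preceq> \<ominus> y) = (y \<preceq> x)"
  using le_diff_iff[of \<zero> x "\<ominus> y"] by (simp add: diff_normalize le_diff_iff)

lemma add_mono':
  assumes "x \<preceq> y" "u \<preceq> v" "x \<in> carrier E" "y \<in> carrier E" "u \<in> carrier E" "v \<in> carrier E"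
  shows "x \<oplus> u \<preceq> y \<oplus> v"
  using assms ord_trans[of "x \<oplus> u" "y \<oplus> u" "y \<oplus> v"] by simp

lemma add_nonneg [simp]: "\<zero> \<preceq> x \<Longrightarrow> \<zero> \<preceq> y \<Longrightarrow> x \<in> carrier E \<Longrightarrow> y \<in> carrier E \<Longrightarrow> \<zero> \<preceq> x \<oplus> y"
  using add_mono'[of \<zero> x \<zero> y] by simp

lemma le_add_nonneg:
  assumes "\<zero> \<preceq> y" "x \<in> carrier E" "y \<in> carrier E" shows "x \<preceq> x \<oplus> y" "x \<preceq> y \<oplus> x"
  using assms add_le_cancel(2)[of \<zero> y x] add_le_cancel(1)[of \<zero> y x] by simp_all

lemma smult_nonneg [simp]: "\<zero> \<preceq> x \<Longrightarrow> 0 \<le> r \<Longrightarrow> x \<in> carrier E \<Longrightarrow> \<zero> \<preceq> r \<odot> x"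
  using smult_mono[of \<zero> x r] by simp

lemma diff_nonneg_iff: "x \<in> carrier E \<Longrightarrow> y \<in> carrier E \<Longrightarrow> (\<zero> \<preceq> y \<ominus> x) = (x \<preceq> y)"
  by (simp add: le_diff_iff)

lemma smult_le_cancel:
  assumes "r \<odot> x \<preceq> r \<odot> y" "0 < r" "x \<in> carrier E" "y \<in> carrier E"
  shows "x \<preceq> y"
  using smult_mono[OF assms(1), of "1/r"] assms(2-) by simp

lemma smult_mono_left:
  assumes "\<zero> \<preceq> x" "r \<le> s" "x \<in> carrier E" shows "r \<odot> x \<preceq> s \<odot> x"
  using assms smult_add_left[of x "s - r" r] le_add_nonneg(2)[of "(s - r) \<odot> x" "r \<odot> x"] by simp

lemma sup_closed [simp, intro]: "x \<in> carrier E \<Longrightarrow> y \<in> carrier E \<Longrightarrow> x \<curlyvee> y \<in> carrier E"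
  using L.join_closed[of x y] by simp
lemma inf_closed' [simp, intro]: "x \<in> carrier E \<Longrightarrow> y \<in> carrier E \<Longrightarrow> x \<curlywedge> y \<in> carrier E"
  using L.meet_closed[of x y] by simp
lemma sup_ge [simp]:
  assumes "x \<in> carrier E" "y \<in> carrier E" shows "x \<preceq> x \<curlyvee> y" "y \<preceq> x \<curlyvee> y"
  using assms L.join_left[of x y] L.join_right[of x y] by simp_all
lemma inf_le [simp]:
  assumes "x \<in> carrier E" "y \<in> carrier E" shows "x \<curlywedge> y \<preceq> x" "x \<curlywedge> y \<preceq> y"
  using assms L.meet_left[of x y] L.meet_right[of x y] by simp_all
lemma sup_le_iff:
  assumes "x \<in> carrier E" "y \<in> carrier E" "z \<in> carrier E" shows "(x \<curlyvee> y \<preceq> z) = (x \<preceq> z \<and> y \<preceq> z)"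
  using assms L.join_le[of x z y] ord_trans[of x "x \<curlyvee> y" z] ord_trans[of y "x \<curlyvee> y" z] by auto
lemma le_inf_iff:
  assumes "x \<in> carrier E" "y \<in> carrier E" "z \<in> carrier E" shows "(z \<preceq> x \<curlywedge> y) = (z \<preceq> x \<and> z \<preceq> y)"
  using assms L.meet_le[of z x y] ord_trans[of z "x \<curlywedge> y" x] ord_trans[of z "x \<curlywedge> y" y] by auto

lemma sup_eqI:
  assumes "x \<in> carrier E" "y \<in> carrier E" "s \<in> carrier E" "x \<preceq> s" "y \<preceq> s"
    "\<And>u. u \<in> carrier E \<Longrightarrow> x \<preceq> u \<Longrightarrow> y \<preceq> u \<Longrightarrow> s \<preceq> u"
  shows "x \<curlyvee> y = s"
  using assms by (intro ord_antisym) (auto simp: sup_le_iff)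
lemma inf_eqI:
  assumes "x \<in> carrier E" "y \<in> carrier E" "s \<in> carrier E" "s \<preceq> x" "s \<preceq> y"
    "\<And>u. u \<in> carrier E \<Longrightarrow> u \<preceq> x \<Longrightarrow> u \<preceq> y \<Longrightarrow> u \<preceq> s"
  shows "x \<curlywedge> y = s"
  using assms by (intro ord_antisym) (auto simp: le_inf_iff)

lemma sup_commute: "x \<in> carrier E \<Longrightarrow> y \<in> carrier E \<Longrightarrow> x \<curlyvee> y = y \<curlyvee> x"
  by (rule sup_eqI) (simp_all add: sup_le_iff)
lemma inf_commute: "x \<in> carrier E \<Longrightarrow> y \<in> carrier E \<Longrightarrow> x \<curlywedge> y = y \<curlywedge> x"
  by (rule inf_eqI) (simp_all add: le_inf_iff)
lemma sup_absorb: "x \<preceq> y \<Longrightarrow> x \<in> carrier E \<Longrightarrow> y \<in> carrier E \<Longrightarrow> x \<curlyvee> y = y"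
  by (rule sup_eqI) simp_all
lemma inf_absorb: "x \<preceq> y \<Longrightarrow> x \<in> carrier E \<Longrightarrow> y \<in> carrier E \<Longrightarrow> x \<curlywedge> y = x"
  by (rule inf_eqI) simp_all
lemma inf_mono:
  assumes "x \<preceq> y" "u \<preceq> v" "x \<in> carrier E" "y \<in> carrier E" "u \<in> carrier E" "v \<in> carrier E"
  shows "x \<curlywedge> u \<preceq> y \<curlywedge> v"
  using assms ord_trans[OF inf_le(1)[of x u] assms(1)] ord_trans[OF inf_le(2)[of x u] assms(2)]
  by (simp add: le_inf_iff)
lemma sup_mono:
  assumes "x \<preceq> y" "u \<preceq> v" "x \<in> carrier E" "y \<in> carrier E" "u \<in> carrier E" "v \<in> carrier E"
  shows "x \<curlyvee> u \<preceq> y \<curlyvee> v"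
  using assms ord_trans[OF assms(1) sup_ge(1)[of y v]] ord_trans[OF assms(2) sup_ge(2)[of y v]]
  by (simp add: sup_le_iff)

lemma sup_add:
  assumes "x \<in> carrier E" "y \<in> carrier E" "z \<in> carrier E"
  shows "(x \<oplus> z) \<curlyvee> (y \<oplus> z) = (x \<curlyvee> y) \<oplus> z"
proof (rule sup_eqI)
  fix u assume u: "u \<in> carrier E" "x \<oplus> z \<preceq> u" "y \<oplus> z \<preceq> u"
  then have "x \<preceq> u \<ominus> z" "y \<preceq> u \<ominus> z" using assms by (simp_all add: le_diff_iff)
  then have "x \<curlyvee> y \<preceq> u \<ominus> z" using assms u(1) by (simp add: sup_le_iff)
  then show "(x \<curlyvee> y) \<oplus> z \<preceq> u" using assms u le_diff_iff(2)[of u z "x \<curlyvee> y"] by blast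
qed (use assms in simp_all)

lemma inf_add:
  assumes "x \<in> carrier E" "y \<in> carrier E" "z \<in> carrier E"
  shows "(x \<oplus> z) \<curlywedge> (y \<oplus> z) = (x \<curlywedge> y) \<oplus> z"
proof (rule inf_eqI)
  fix u assume u: "u \<in> carrier E" "u \<preceq> x \<oplus> z" "u \<preceq> y \<oplus> z"
  then have "u \<ominus> z \<preceq> x \<curlywedge> y" using assms by (simp add: le_inf_iff le_diff_iff)
  then show "u \<preceq> (x \<curlywedge> y) \<oplus> z" using assms u le_diff_iff(1)[of u z "x \<curlywedge> y"] by blast
qed (use assms in simp_all)

lemma neg_sup:
  assumes "x \<in> carrier E" "y \<in> carrier E" shows "\<ominus> x \<curlywedge> \<ominus> y = \<ominus> (x \<curlyvee> y)"
proof (rule inf_eqI)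
  fix u assume u: "u \<in> carrier E" "u \<preceq> \<ominus> x" "u \<preceq> \<ominus> y"
  then have "\<ominus> (\<ominus> x) \<preceq> \<ominus> u" "\<ominus> (\<ominus> y) \<preceq> \<ominus> u" using assms by (simp_all del: minus_minus)
  then have "x \<curlyvee> y \<preceq> \<ominus> u" using assms u by (simp add: sup_le_iff)
  then have "\<ominus> (\<ominus> u) \<preceq> \<ominus> (x \<curlyvee> y)" using assms u by (simp del: minus_minus)
  then show "u \<preceq> \<ominus> (x \<curlyvee> y)" using u by simp
qed (use assms in simp_all)

lemma neg_inf:
  assumes "x \<in> carrier E" "y \<in> carrier E" shows "\<ominus> x \<curlyvee> \<ominus> y = \<ominus> (x \<curlywedge> y)"
  using assms neg_sup[of "\<ominus> x" "\<ominus> y"] by simp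

lemma sup_plus_inf:
  assumes [simp]: "x \<in> carrier E" "y \<in> carrier E" shows "(x \<curlyvee> y) \<oplus> (x \<curlywedge> y) = x \<oplus> y"
proof -
  have "\<ominus> y \<oplus> (x \<oplus> y) = x" "\<ominus> x \<oplus> (x \<oplus> y) = y" by (simp_all add: diff_normalize2(2))
  then have "x \<curlyvee> y = (\<ominus> y \<curlyvee> \<ominus> x) \<oplus> (x \<oplus> y)" using sup_add[of "\<ominus> y" "\<ominus> x" "x \<oplus> y"] by simp
  also have "\<dots> = (x \<oplus> y) \<ominus> (x \<curlywedge> y)" by (simp add: neg_inf inf_commute[of y x] diff_normalize2(2))
  finally show ?thesis by simp
qed

lemma smult_sup:
  assumes [simp]: "0 \<le> r" "x \<in> carrier E" "y \<in> carrier E"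
  shows "r \<odot> (x \<curlyvee> y) = (r \<odot> x) \<curlyvee> (r \<odot> y)"
proof (cases "r = 0")
  case False
  then have r: "0 < r" using \<open>0 \<le> r\<close> by linarith
  show ?thesis
  proof (rule sup_eqI[symmetric])
    fix u assume u: "u \<in> carrier E" "r \<odot> x \<preceq> u" "r \<odot> y \<preceq> u"
    have "r \<odot> ((1/r) \<odot> u) = u" using u(1) r by simp
    then have "x \<curlyvee> y \<preceq> (1/r) \<odot> u"
      using u r smult_le_cancel[of r x "(1/r) \<odot> u"] smult_le_cancel[of r y "(1/r) \<odot> u"] by (simp add: sup_le_iff)
    then show "r \<odot> (x \<curlyvee> y) \<preceq> u" using smult_mono[of "x \<curlyvee> y" "(1/r) \<odot> u" r] u r by simp
  qed (simp_all add: smult_mono)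
qed (simp add: sup_absorb)

lemma smult_inf:
  assumes [simp]: "0 \<le> r" "x \<in> carrier E" "y \<in> carrier E"
  shows "r \<odot> (x \<curlywedge> y) = (r \<odot> x) \<curlywedge> (r \<odot> y)"
proof -
  have "r \<odot> (\<ominus> x \<curlyvee> \<ominus> y) = (r \<odot> \<ominus> x) \<curlyvee> (r \<odot> \<ominus> y)" by (rule smult_sup) simp_all
  then have "\<ominus> (r \<odot> (x \<curlywedge> y)) = \<ominus> ((r \<odot> x) \<curlywedge> (r \<odot> y))" by (simp add: smult_a_inv neg_inf)
  then have "\<ominus> (\<ominus> (r \<odot> (x \<curlywedge> y))) = \<ominus> (\<ominus> ((r \<odot> x) \<curlywedge> (r \<odot> y)))" by simp
  then show ?thesis by (simp del: diff_normalize)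
qed

abbreviation pp where "pp x \<equiv> x \<curlyvee> \<zero>"

lemma pp_minus_pp: "x \<in> carrier E \<Longrightarrow> pp x \<ominus> pp (\<ominus> x) = x"
  using sup_plus_inf[of x \<zero>] neg_sup[of "\<ominus> x" \<zero>] by (simp add: a_minus_def[of _ "pp x"])

lemma pp_nonneg [simp]: "x \<in> carrier E \<Longrightarrow> \<zero> \<preceq> pp x" by simp

lemma sup_eq_pp: "x \<in> carrier E \<Longrightarrow> y \<in> carrier E \<Longrightarrow> x \<oplus> pp (y \<ominus> x) = x \<curlyvee> y"
  using sup_add[of "y \<ominus> x" \<zero> x] by (simp add: a_comm sup_commute)

lemma minus_inf_eq_pp: "x \<in> carrier E \<Longrightarrow> y \<in> carrier E \<Longrightarrow> x \<ominus> (x \<curlywedge> y) = pp (x \<ominus> y)"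
proof -
  assume [simp]: "x \<in> carrier E" "y \<in> carrier E"
  have "pp (x \<ominus> y) \<oplus> (x \<curlywedge> y) \<oplus> y = x \<oplus> y"
    using sup_add[of "x \<ominus> y" \<zero> y] sup_plus_inf[of x y] by (simp add: a_ac)
  then have "pp (x \<ominus> y) \<oplus> (x \<curlywedge> y) = x" using add.right_cancel[of y "pp (x \<ominus> y) \<oplus> (x \<curlywedge> y)" x] by simp
  then show "x \<ominus> (x \<curlywedge> y) = pp (x \<ominus> y)" by (simp add: minus_eq_iff)
qed

lemma av_closed [simp, intro]: "x \<in> carrier E \<Longrightarrow> av x \<in> carrier E" by (simp add: vabs_def)
lemma av_le_iff: "x \<in> carrier E \<Longrightarrow> y \<in> carrier E \<Longrightarrow> (av x \<preceq> y) = (x \<preceq> y \<and> \<ominus> x \<preceq> y)"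
  by (simp add: vabs_def sup_le_iff)
lemma av_ge [simp]: "x \<in> carrier E \<Longrightarrow> x \<preceq> av x" "x \<in> carrier E \<Longrightarrow> \<ominus> x \<preceq> av x"
  by (simp_all add: vabs_def)
lemma av_nonneg [simp]: "x \<in> carrier E \<Longrightarrow> \<zero> \<preceq> av x"
  using add_mono'[OF av_ge(1)[of x] av_ge(2)[of x]] smult_le_cancel[of 2 \<zero> "av x"]
  by (simp add: smult_2 r_neg)
lemma av_neg [simp]: "x \<in> carrier E \<Longrightarrow> av (\<ominus> x) = av x"
  by (simp add: vabs_def sup_commute)
lemma av_minus_commute: "x \<in> carrier E \<Longrightarrow> y \<in> carrier E \<Longrightarrow> av (x \<ominus> y) = av (y \<ominus> x)"
  using av_neg[of "x \<ominus> y"] by (simp add: diff_normalize)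
lemma av_of_nonneg [simp]: "\<zero> \<preceq> x \<Longrightarrow> x \<in> carrier E \<Longrightarrow> av x = x"
  unfolding vabs_def by (rule sup_eqI) (auto simp: le_neg_iff)
lemma av_zero [simp]: "av \<zero> = \<zero>" by simp
lemma av_eq_zero_iff: "x \<in> carrier E \<Longrightarrow> (av x = \<zero>) = (x = \<zero>)"
  using av_ge[of x] ord_antisym[of x \<zero>] by (auto simp: le_neg_iff)

lemma av_eq_pp: assumes [simp]: "x \<in> carrier E" shows "av x = pp x \<oplus> pp (\<ominus> x)"
proof -
  have "av x = ((2 \<odot> x) \<ominus> x) \<curlyvee> (\<zero> \<ominus> x)" by (simp add: vabs_def smult_2)
  also have "\<dots> = 2 \<odot> pp x \<ominus> x" using sup_add[of "2 \<odot> x" \<zero> "\<ominus> x"] smult_sup[of 2 x \<zero>] by (simp add: a_minus_def)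
  also have "\<dots> = (pp x \<oplus> pp x) \<ominus> (pp x \<ominus> pp (\<ominus> x))" using pp_minus_pp[of x] by (simp add: smult_2)
  also have "\<dots> = pp x \<oplus> pp (\<ominus> x)" by (simp add: diff_normalize minus_eq_iff a_ac)
  finally show ?thesis .
qed

lemma av_triangle:
  assumes [simp]: "x \<in> carrier E" "y \<in> carrier E" shows "av (x \<oplus> y) \<preceq> av x \<oplus> av y"
  using add_mono'[OF av_ge(1)[of x] av_ge(1)[of y]] add_mono'[OF av_ge(2)[of x] av_ge(2)[of y]]
  by (simp add: av_le_iff minus_add)

lemma av_triangle_minus:
  assumes [simp]: "x \<in> carrier E" "y \<in> carrier E" shows "av (x \<ominus> y) \<preceq> av x \<oplus> av y"
  using av_triangle[of x "\<ominus> y"] by (simp add: a_minus_def)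

lemma av_smult: assumes [simp]: "x \<in> carrier E" shows "av (r \<odot> x) = \<bar>r\<bar> \<odot> av x"
proof (cases "r \<ge> 0")
  case True then show ?thesis by (simp add: vabs_def smult_sup smult_a_inv)
next
  case False
  then have "av (r \<odot> x) = av ((-r) \<odot> x)" by (simp add: smult_neg)
  with False show ?thesis by (simp add: vabs_def smult_sup smult_a_inv)
qed

text \<open>
  Subtracting \<open>x \<curlywedge> z\<close> from the left-hand side leaves at most \<open>y\<close> and at most \<open>z\<close>.
\<close>

lemma inf_add_le:
  assumes [simp]: "x \<in> carrier E" "y \<in> carrier E" "z \<in> carrier E"
    and pos [simp]: "\<zero> \<preceq> x" "\<zero> \<preceq> y" "\<zero> \<preceq> z"
  shows "(x \<oplus> y) \<curlywedge> z \<preceq> (x \<curlywedge> z) \<oplus> (y \<curlywedge> z)"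
proof -
  let ?w = "(x \<oplus> y) \<curlywedge> z"
  have "?w \<ominus> (x \<curlywedge> z) = (?w \<ominus> x) \<curlyvee> (?w \<ominus> z)"
    using neg_inf[of x z] sup_add[of "\<ominus> x" "\<ominus> z" ?w] by (simp add: a_minus_def a_comm)
  also have "\<dots> \<preceq> y \<curlywedge> z"
    using ord_trans[OF inf_le(2)[of "x \<oplus> y" z] le_add_nonneg(1)[of x z]]
      inf_le[of "x \<oplus> y" z] ord_trans[OF inf_le(2)[of "x \<oplus> y" z] le_add_nonneg(2)[of y z]]
      ord_trans[OF inf_le(2)[of "x \<oplus> y" z] le_add_nonneg(2)[of z z]]
    by (auto simp: sup_le_iff le_inf_iff le_diff_iff a_comm)
  finally show ?thesis by (simp add: le_diff_iff a_comm)
qed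

lemma inf_nonneg [simp]: "\<zero> \<preceq> x \<Longrightarrow> \<zero> \<preceq> y \<Longrightarrow> x \<in> carrier E \<Longrightarrow> y \<in> carrier E \<Longrightarrow> \<zero> \<preceq> x \<curlywedge> y"
  by (simp add: le_inf_iff)

lemma pp_inf_pp: assumes [simp]: "x \<in> carrier E" shows "pp x \<curlywedge> pp (\<ominus> x) = \<zero>"
proof -
  have "pp x = x \<oplus> pp (\<ominus> x)" using pp_minus_pp[of x] minus_eq_iff(1)[of "pp x" "pp (\<ominus> x)" x] by simp
  then have "pp x \<curlywedge> pp (\<ominus> x) = (x \<curlywedge> \<zero>) \<oplus> pp (\<ominus> x)" using inf_add[of x \<zero> "pp (\<ominus> x)"] by simp
  also have "x \<curlywedge> \<zero> = \<ominus> pp (\<ominus> x)" using neg_sup[of "\<ominus> x" \<zero>] by simp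
  finally show ?thesis by (simp add: l_neg)
qed

lemma inf_eq_zeroI:
  assumes "x \<curlywedge> y = \<zero>" "\<zero> \<preceq> u" "u \<preceq> x" "\<zero> \<preceq> v" "v \<preceq> y"
    and [simp]: "x \<in> carrier E" "y \<in> carrier E" "u \<in> carrier E" "v \<in> carrier E"
  shows "u \<curlywedge> v = \<zero>"
  using assms inf_mono[of u x v y] by (intro ord_antisym) simp_all

end

section \<open>Suprema, infima, bands and order convergence\<close>

context vlattice
begin

text \<open>
  Suprema and infima relative to the carrier. They agree with the least upper and greatest lower bounds of
  the order structure (\<open>least_Upper_iff\<close>), but do not need the sets of all bounds.
\<close>

definition islub where
  "islub D s \<longleftrightarrow> s \<in> carrier E \<and> (\<forall>d\<in>D. d \<preceq> s) \<and> (\<forall>u\<in>carrier E. (\<forall>d\<in>D. d \<preceq> u) \<longrightarrow> s \<preceq> u)"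

definition isglb where
  "isglb D s \<longleftrightarrow> s \<in> carrier E \<and> (\<forall>d\<in>D. s \<preceq> d) \<and> (\<forall>u\<in>carrier E. (\<forall>d\<in>D. u \<preceq> d) \<longrightarrow> u \<preceq> s)"

lemma islubI:
  assumes "s \<in> carrier E" "\<And>d. d \<in> D \<Longrightarrow> d \<preceq> s"
    "\<And>u. u \<in> carrier E \<Longrightarrow> (\<And>d. d \<in> D \<Longrightarrow> d \<preceq> u) \<Longrightarrow> s \<preceq> u"
  shows "islub D s"
  using assms by (auto simp: islub_def)

lemma isglbI:
  assumes "s \<in> carrier E" "\<And>d. d \<in> D \<Longrightarrow> s \<preceq> d"
    "\<And>u. u \<in> carrier E \<Longrightarrow> (\<And>d. d \<in> D \<Longrightarrow> u \<preceq> d) \<Longrightarrow> u \<preceq> s"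
  shows "isglb D s"
  using assms by (auto simp: isglb_def)

lemma islubD:
  assumes "islub D s"
  shows "s \<in> carrier E" "d \<in> D \<Longrightarrow> d \<preceq> s" "u \<in> carrier E \<Longrightarrow> (\<And>d. d \<in> D \<Longrightarrow> d \<preceq> u) \<Longrightarrow> s \<preceq> u"
  using assms by (auto simp: islub_def)

lemma isglbD:
  assumes "isglb D s"
  shows "s \<in> carrier E" "d \<in> D \<Longrightarrow> s \<preceq> d" "u \<in> carrier E \<Longrightarrow> (\<And>d. d \<in> D \<Longrightarrow> u \<preceq> d) \<Longrightarrow> u \<preceq> s"
  using assms by (auto simp: isglb_def)

lemma least_Upper_iff: "D \<subseteq> carrier E \<Longrightarrow> least (ord_of E) s (Upper (ord_of E) D) \<longleftrightarrow> islub D s"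
  unfolding least_def Upper_def islub_def by (auto 0 3)

lemma greatest_Lower_iff: "D \<subseteq> carrier E \<Longrightarrow> greatest (ord_of E) s (Lower (ord_of E) D) \<longleftrightarrow> isglb D s"
  unfolding greatest_def Lower_def isglb_def by (auto 0 3)


text \<open>
  Infinite distributivity: \<open>d = (d \<curlywedge> z) + (d \<curlyvee> z) - z\<close>, where \<open>d \<curlyvee> z \<le> s \<curlyvee> z\<close>, so that an upper bound \<open>u\<close> of
  the elements \<open>d \<curlywedge> z\<close> yields the upper bound \<open>u + (s \<curlyvee> z) - z\<close> of \<open>D\<close>.
\<close>

lemma islub_inf:
  assumes D: "D \<subseteq> carrier E" and s: "islub D s" and [simp]: "z \<in> carrier E"
  shows "islub ((\<lambda>d. d \<curlywedge> z) ` D) (s \<curlywedge> z)"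
proof (rule islubI)
  note [simp] = islubD(1)[OF s]
  show "s \<curlywedge> z \<in> carrier E" by simp
  show "d \<preceq> s \<curlywedge> z" if "d \<in> (\<lambda>d. d \<curlywedge> z) ` D" for d
    using that D islubD(2)[OF s] by (auto intro!: inf_mono)
  fix u assume [simp]: "u \<in> carrier E" and u: "\<And>d. d \<in> (\<lambda>d. d \<curlywedge> z) ` D \<Longrightarrow> d \<preceq> u"
  have "d \<preceq> u \<oplus> ((s \<curlyvee> z) \<ominus> z)" if d: "d \<in> D" for d
  proof -
    have [simp]: "d \<in> carrier E" using d D by auto
    have "d \<oplus> z = (d \<curlywedge> z) \<oplus> (d \<curlyvee> z)" using sup_plus_inf[of d z] by (simp add: a_comm)
    also have "\<dots> \<preceq> u \<oplus> (s \<curlyvee> z)"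
      using u d islubD(2)[OF s d] by (intro add_mono' sup_mono) auto
    finally show ?thesis by (simp add: diff_normalize le_diff_iff)
  qed
  then have "s \<preceq> u \<oplus> ((s \<curlyvee> z) \<ominus> z)" using islubD(3)[OF s] by simp
  then have "s \<oplus> z \<preceq> u \<oplus> (s \<curlyvee> z)" by (simp add: diff_normalize le_diff_iff)
  then have "(s \<curlywedge> z) \<oplus> (s \<curlyvee> z) \<preceq> u \<oplus> (s \<curlyvee> z)" using sup_plus_inf[of s z] by (simp add: a_comm)
  then show "s \<curlywedge> z \<preceq> u" by simp
qed

lemma islub_pair: "x \<in> carrier E \<Longrightarrow> y \<in> carrier E \<Longrightarrow> islub {x, y} (x \<curlyvee> y)"
  by (rule islubI) (auto simp: sup_le_iff)

lemma pp_inf_le: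
  assumes [simp]: "s \<in> carrier E" "t \<in> carrier E" "u \<in> carrier E" and "s \<curlywedge> t \<preceq> u" "\<zero> \<preceq> u" "\<zero> \<preceq> t"
  shows "pp s \<curlywedge> t \<preceq> u"
  using islubD(3)[OF islub_inf[OF _ islub_pair[of s \<zero>], of t], of u] assms by (auto simp: inf_absorb)

lemma isglb_diff:
  assumes D: "D \<subseteq> carrier E" and s: "islub D s"
  shows "isglb ((\<lambda>d. s \<ominus> d) ` D) \<zero>"
proof (rule isglbI)
  note [simp] = islubD(1)[OF s]
  show "\<zero> \<preceq> d" if "d \<in> (\<lambda>d. s \<ominus> d) ` D" for d
    using that D islubD(2)[OF s] by (auto simp: le_diff_iff)
  fix u assume [simp]: "u \<in> carrier E" and u: "\<And>d. d \<in> (\<lambda>d. s \<ominus> d) ` D \<Longrightarrow> u \<preceq> d"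
  have "d \<preceq> s \<ominus> u" if d: "d \<in> D" for d
    using u[of "s \<ominus> d"] d D by (auto simp: le_diff_iff a_comm)
  then have "s \<preceq> s \<ominus> u" using islubD(3)[OF s] by simp
  then have "u \<oplus> s \<preceq> \<zero> \<oplus> s" by (simp add: le_diff_iff a_comm)
  then show "u \<preceq> \<zero>" by (simp only: add_le_cancel \<open>u \<in> carrier E\<close> islubD(1)[OF s] zero_closed)
qed simp

subsection \<open>Bands\<close>

definition dcomp where
  "dcomp Y = {x \<in> carrier E. \<forall>y\<in>Y. av x \<curlywedge> av y = \<zero>}"

lemma smult_inf_zero:
  assumes "x \<curlywedge> y = \<zero>" "0 \<le> r" "\<zero> \<preceq> x" "\<zero> \<preceq> y" and [simp]: "x \<in> carrier E" "y \<in> carrier E"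
  shows "(r \<odot> x) \<curlywedge> y = \<zero>"
proof -
  let ?r = "max 1 r"
  have 1: "(?r \<odot> x) \<curlywedge> (?r \<odot> y) = \<zero>" using smult_inf[of ?r x y] assms by simp
  have "r \<odot> x \<preceq> ?r \<odot> x" "y \<preceq> ?r \<odot> y"
    using smult_mono_left[of x r ?r] smult_mono_left[of y 1 ?r] assms by simp_all
  then show ?thesis by (rule_tac inf_eq_zeroI[OF 1]) (use assms in simp_all)
qed

lemma add_inf_zero:
  assumes "x \<curlywedge> z = \<zero>" "y \<curlywedge> z = \<zero>" "\<zero> \<preceq> x" "\<zero> \<preceq> y" "\<zero> \<preceq> z"
    and [simp]: "x \<in> carrier E" "y \<in> carrier E" "z \<in> carrier E"
  shows "(x \<oplus> y) \<curlywedge> z = \<zero>"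
  using inf_add_le[of x y z] assms by (intro ord_antisym) simp_all


lemma dcomp_closed: "x \<in> dcomp Y \<Longrightarrow> x \<in> carrier E"
  by (simp add: dcomp_def)

lemma band_dcomp:
  assumes Y: "Y \<subseteq> carrier E"
  shows "band E (dcomp Y)"
proof -
  have sub: "submodule (dcomp Y) real_ring E"
  proof (rule module.submoduleI)
    show "module real_ring E" by (rule module_axioms)
    show "dcomp Y \<subseteq> carrier E" by (auto simp: dcomp_def)
    show "\<zero> \<in> dcomp Y" using Y by (auto simp: dcomp_def inf_absorb)
    show "\<ominus> a \<in> dcomp Y" if "a \<in> dcomp Y" for a using that by (auto simp: dcomp_def)
    show "a \<oplus> b \<in> dcomp Y" if "a \<in> dcomp Y" "b \<in> dcomp Y" for a b
    proof -
      have [simp]: "a \<in> carrier E" "b \<in> carrier E" using that dcomp_closed by auto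
      have "av (a \<oplus> b) \<curlywedge> av y = \<zero>" if y: "y \<in> Y" for y
      proof -
        have [simp]: "y \<in> carrier E" using Y y by auto
        have "av a \<curlywedge> av y = \<zero>" "av b \<curlywedge> av y = \<zero>"
          using y \<open>a \<in> dcomp Y\<close> \<open>b \<in> dcomp Y\<close> by (simp_all add: dcomp_def)
        then have "(av a \<oplus> av b) \<curlywedge> av y = \<zero>" by (intro add_inf_zero) simp_all
        then show ?thesis by (rule inf_eq_zeroI[OF _ _ av_triangle]) simp_all
      qed
      then show ?thesis by (simp add: dcomp_def)
    qed
    show "r \<odot> a \<in> dcomp Y" if "r \<in> carrier real_ring" "a \<in> dcomp Y" for r a
      using that Y by (auto simp: dcomp_def av_smult intro!: smult_inf_zero)
  qed
  have sol: "solid_in E (dcomp Y)"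
    unfolding solid_in_def
  proof (intro conjI ballI impI)
    show "dcomp Y \<subseteq> carrier E" by (auto simp: dcomp_def)
    fix x y assume [simp]: "x \<in> carrier E" and y: "y \<in> dcomp Y" and le: "av x \<preceq> av y"
    have [simp]: "y \<in> carrier E" using y dcomp_closed by auto
    have "av x \<curlywedge> av z = \<zero>" if "z \<in> Y" for z
    proof -
      have [simp]: "z \<in> carrier E" using Y that by auto
      have "av y \<curlywedge> av z = \<zero>" using y that by (simp add: dcomp_def)
      then show ?thesis by (rule inf_eq_zeroI) (use le in simp_all)
    qed
    then show "x \<in> dcomp Y" by (simp add: dcomp_def)
  qed
  have lub: "s \<in> dcomp Y" if D: "D \<subseteq> dcomp Y" and "least (ord_of E) s (Upper (ord_of E) D)" for D s
  proof -
    have DC: "D \<subseteq> carrier E" using D by (auto simp: dcomp_def)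
    then have s: "islub D s" using that by (simp add: least_Upper_iff)
    note [simp] = islubD(1)[OF s]
    have "av s \<curlywedge> av y = \<zero>" if y: "y \<in> Y" for y
    proof (cases "D = {}")
      case True
      then have least: "s \<preceq> u" if "u \<in> carrier E" for u using islubD(3)[OF s that] by simp
      have "s \<oplus> \<zero> \<preceq> s \<oplus> s" using least[of "s \<oplus> s"] by simp
      then have "\<zero> \<preceq> s" by (simp only: add_le_cancel islubD(1)[OF s] zero_closed)
      then have "s = \<zero>" using least[of \<zero>] by (intro ord_antisym) simp_all
      then show ?thesis using Y y by (auto simp: inf_absorb)
    next
      case False
      then obtain d where d: "d \<in> D" by auto
      have [simp]: "y \<in> carrier E" "d \<in> carrier E" using Y y d DC by auto
      have dis: "av e \<curlywedge> av y = \<zero>" if "e \<in> D" for e using D y that by (auto simp: dcomp_def)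
      have "s \<curlywedge> av y \<preceq> \<zero>"
      proof (rule islubD(3)[OF islub_inf[OF DC s]])
        fix e assume "e \<in> (\<lambda>d. d \<curlywedge> av y) ` D"
        then obtain f where f: "f \<in> D" "e = f \<curlywedge> av y" by auto
        have [simp]: "f \<in> carrier E" using f(1) DC by auto
        show "e \<preceq> \<zero>" using inf_mono[of f "av f" "av y" "av y"] dis[OF f(1)] f(2) by simp
      qed simp_all
      then have 1: "pp s \<curlywedge> av y = \<zero>" by (intro ord_antisym pp_inf_le) simp_all
      have "pp (\<ominus> s) \<preceq> av d"
        using islubD(2)[OF s d] ord_trans[of "\<ominus> s" "\<ominus> d" "av d"] by (simp add: sup_le_iff)
      then have 2: "pp (\<ominus> s) \<curlywedge> av y = \<zero>" by (rule_tac inf_eq_zeroI[OF dis[OF d]]) simp_all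
      show ?thesis unfolding av_eq_pp[OF islubD(1)[OF s]] using 1 2 by (intro add_inf_zero) simp_all
    qed
    then show ?thesis by (simp add: dcomp_def)
  qed
  show ?thesis unfolding band_def using sub sol lub by blast
qed

lemma bandD:
  assumes "band E B"
  shows "B \<subseteq> carrier E" "\<zero> \<in> B" "x \<in> B \<Longrightarrow> y \<in> B \<Longrightarrow> x \<oplus> y \<in> B" "x \<in> B \<Longrightarrow> \<ominus> x \<in> B"
    "x \<in> B \<Longrightarrow> y \<in> B \<Longrightarrow> x \<ominus> y \<in> B" "x \<in> B \<Longrightarrow> r \<odot> x \<in> B"
    "x \<in> carrier E \<Longrightarrow> y \<in> B \<Longrightarrow> av x \<preceq> av y \<Longrightarrow> x \<in> B"
    "D \<subseteq> B \<Longrightarrow> islub D s \<Longrightarrow> s \<in> B"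
proof -
  have sm: "submodule B real_ring E" and sol: "solid_in E B" using assms by (auto simp: band_def)

  show 1: "B \<subseteq> carrier E" using sol by (simp add: solid_in_def)
  show add: "x \<oplus> y \<in> B" if "x \<in> B" "y \<in> B" for x y using submoduleE(5)[OF sm] that by blast
  show neg: "\<ominus> x \<in> B" if "x \<in> B" for x using submoduleE(3)[OF sm] that by blast
  show sm': "r \<odot> x \<in> B" if "x \<in> B" for r x using submoduleE(4)[OF sm] that by simp
  obtain b where "b \<in> B" using submoduleE(2)[OF sm] by blast
  then show "\<zero> \<in> B" using sm'[of b 0] 1 by auto
  show "x \<ominus> y \<in> B" if "x \<in> B" "y \<in> B" for x y using add[OF that(1) neg[OF that(2)]] by (simp add: a_minus_def)
  show "x \<in> carrier E \<Longrightarrow> y \<in> B \<Longrightarrow> av x \<preceq> av y \<Longrightarrow> x \<in> B" using sol by (auto simp: solid_in_def)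
  show "D \<subseteq> B \<Longrightarrow> islub D s \<Longrightarrow> s \<in> B" using assms 1 least_Upper_iff[of D s] by (auto simp: band_def)
qed

lemma band_pp: assumes B: "band E B" and x: "x \<in> B" shows "pp x \<in> B" "av x \<in> B"
proof -
  have [simp]: "x \<in> carrier E" using bandD(1)[OF B] x by auto
  show "pp x \<in> B" using x by (rule bandD(7)[OF B, rotated]) (simp_all add: sup_le_iff)
  show "av x \<in> B" using x by (rule bandD(7)[OF B, rotated]) simp_all
qed

lemma band_dcomp_inter: "band E B \<Longrightarrow> x \<in> B \<Longrightarrow> x \<in> dcomp B \<Longrightarrow> x = \<zero>"
  using bandD(1)[of B] by (auto simp: dcomp_def inf_absorb av_eq_zero_iff)

subsection \<open>Order convergence and unbounded order convergence\<close>

text \<open>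
  The elements that eventually dominate the net. For a positive net, \<open>onull\<close> says that their infimum
  is zero; this is order convergence to zero, and it mentions no auxiliary net.
\<close>

definition evub :: "'i set \<Rightarrow> ('i \<Rightarrow> 'i \<Rightarrow> bool) \<Rightarrow> ('i \<Rightarrow> 'a) \<Rightarrow> 'a set" where
  "evub A leq z = {d \<in> carrier E. \<exists>a\<^sub>0\<in>A. \<forall>a\<in>A. leq a\<^sub>0 a \<longrightarrow> z a \<preceq> d}"

definition onull :: "'i set \<Rightarrow> ('i \<Rightarrow> 'i \<Rightarrow> bool) \<Rightarrow> ('i \<Rightarrow> 'a) \<Rightarrow> bool" where
  "onull A leq z \<longleftrightarrow> (\<forall>w\<in>carrier E. (\<forall>d\<in>evub A leq z. w \<preceq> d) \<longrightarrow> w \<preceq> \<zero>)"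

lemma evubI: "d \<in> carrier E \<Longrightarrow> a\<^sub>0 \<in> A \<Longrightarrow> (\<And>a. a \<in> A \<Longrightarrow> leq a\<^sub>0 a \<Longrightarrow> z a \<preceq> d) \<Longrightarrow> d \<in> evub A leq z"
  by (auto simp: evub_def)

lemma evubE:
  assumes "d \<in> evub A leq z"
  obtains a\<^sub>0 where "d \<in> carrier E" "a\<^sub>0 \<in> A" "\<And>a. a \<in> A \<Longrightarrow> leq a\<^sub>0 a \<Longrightarrow> z a \<preceq> d"
  using assms by (auto simp: evub_def)

lemma onullD: "onull A leq z \<Longrightarrow> w \<in> carrier E \<Longrightarrow> (\<And>d. d \<in> evub A leq z \<Longrightarrow> w \<preceq> d) \<Longrightarrow> w \<preceq> \<zero>"
  by (auto simp: onull_def)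

lemma onull_mono:
  assumes z': "onull A leq z'" and le: "\<And>a. a \<in> A \<Longrightarrow> z a \<preceq> z' a" 
    and c: "\<And>a. a \<in> A \<Longrightarrow> z a \<in> carrier E" "\<And>a. a \<in> A \<Longrightarrow> z' a \<in> carrier E"
  shows "onull A leq z"
proof -
  have "d \<in> evub A leq z" if "d \<in> evub A leq z'" for d
    using that
  proof (rule evubE)
    fix a\<^sub>0 assume d: "d \<in> carrier E" and "a\<^sub>0 \<in> A" and "\<And>a. a \<in> A \<Longrightarrow> leq a\<^sub>0 a \<Longrightarrow> z' a \<preceq> d"
    then show "d \<in> evub A leq z" using ord_trans[OF le _ c d] by (intro evubI[of _ a\<^sub>0]) auto
  qed
  then show ?thesis using z' by (auto simp: onull_def)
qed

lemma onull_cong: "(\<And>a. a \<in> A \<Longrightarrow> z a = z' a) \<Longrightarrow> onull A leq z = onull A leq z'"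
  unfolding onull_def evub_def by (intro ball_cong refl imp_cong Collect_cong conj_cong bex_cong) auto

lemma directedD:
  assumes "directed A leq"
  shows "\<exists>a. a \<in> A" "a \<in> A \<Longrightarrow> leq a a" "a \<in> A \<Longrightarrow> b \<in> A \<Longrightarrow> \<exists>c\<in>A. leq a c \<and> leq b c"
    "a \<in> A \<Longrightarrow> b \<in> A \<Longrightarrow> c \<in> A \<Longrightarrow> leq a b \<Longrightarrow> leq b c \<Longrightarrow> leq a c"
  using assms by (auto simp: directed_def dest: reflp_onD transp_onD)

text \<open>
  The eventual upper bounds of a net are closed under binary infima. If their infimum is zero, then they
  therefore form a decreasing net of their own that witnesses order convergence.
\<close>

lemma order_conv_iff:
  assumes dir: "directed A leq" and x: "\<And>a. a \<in> A \<Longrightarrow> x a \<in> carrier E" and [simp]: "l \<in> carrier E"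
  shows "order_conv E A leq x l \<longleftrightarrow> onull A leq (\<lambda>a. av (l \<ominus> x a))"
proof
  let ?z = "\<lambda>a. av (l \<ominus> x a)"
  have z [simp]: "?z a \<in> carrier E" "\<zero> \<preceq> ?z a" if "a \<in> A" for a using x that by simp_all
  assume "order_conv E A leq x l"
  then obtain B :: "'a set" and leqB y where y: "decreases_to_zero E B leqB y"
    and dom: "\<And>b. b \<in> B \<Longrightarrow> \<exists>a\<^sub>0\<in>A. \<forall>a\<in>A. leq a\<^sub>0 a \<longrightarrow> ?z a \<preceq> y b"
    by (auto simp: order_conv_def)
  have yC: "y ` B \<subseteq> carrier E" using y by (auto simp: decreases_to_zero_def net_in_def)
  have g: "isglb (y ` B) \<zero>" using y greatest_Lower_iff[OF yC] by (simp add: decreases_to_zero_def)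
  have "y b \<in> evub A leq ?z" if "b \<in> B" for b using dom[OF that] yC that by (auto simp: evub_def)
  then show "onull A leq ?z" using isglbD(3)[OF g] by (auto simp: onull_def)
next
  let ?z = "\<lambda>a. av (l \<ominus> x a)"
  let ?D = "evub A leq ?z"
  assume n: "onull A leq ?z"
  have z [simp]: "?z a \<in> carrier E" "\<zero> \<preceq> ?z a" if "a \<in> A" for a using x that by simp_all
  have Dpos: "\<zero> \<preceq> d" "d \<in> carrier E" if "d \<in> ?D" for d
  proof -
    obtain a where a: "d \<in> carrier E" "a \<in> A" "?z a \<preceq> d"
      using \<open>d \<in> ?D\<close> by (rule evubE) (use directedD(2)[OF dir] in blast)
    then show "d \<in> carrier E" "\<zero> \<preceq> d" using ord_trans[OF z(2) a(3) zero_closed z(1)] by simp_all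
  qed
  have inf: "d \<curlywedge> e \<in> ?D" if d: "d \<in> ?D" and e: "e \<in> ?D" for d e
  proof -
    obtain a where a: "a \<in> A" "\<And>c. c \<in> A \<Longrightarrow> leq a c \<Longrightarrow> ?z c \<preceq> d" using d by (auto simp: evub_def)
    obtain b where b: "b \<in> A" "\<And>c. c \<in> A \<Longrightarrow> leq b c \<Longrightarrow> ?z c \<preceq> e" using e by (auto simp: evub_def)
    obtain c where c: "c \<in> A" "leq a c" "leq b c" using directedD(3)[OF dir a(1) b(1)] by auto
    show ?thesis
      using Dpos(2)[OF d] Dpos(2)[OF e] c directedD(4)[OF dir a(1) c(1)] directedD(4)[OF dir b(1) c(1)] a b
      by (intro evubI[of _ c]) (auto simp: le_inf_iff)
  qed
  have ne: "?D \<noteq> {}"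
  proof
    assume e: "?D = {}"
    have "w \<preceq> \<zero>" if "w \<in> carrier E" for w using n that e by (auto simp: onull_def)
    then have "\<zero> \<in> ?D" using directedD(1)[OF dir] by (auto simp: evub_def x)
    then show False using e by simp
  qed
  have dirD: "directed ?D (\<lambda>u v. v \<preceq> u)"
    unfolding directed_def
  proof (intro conjI ballI)
    show "?D \<noteq> {}" by fact
    show "reflp_on ?D (\<lambda>u v. v \<preceq> u)" using Dpos(2) by (intro reflp_onI) simp
    show "transp_on ?D (\<lambda>u v. v \<preceq> u)" using Dpos(2) by (intro transp_onI) (rule ord_trans)
    show "\<exists>c\<in>?D. c \<preceq> u \<and> c \<preceq> v" if "u \<in> ?D" "v \<in> ?D" for u v
      using inf[OF that] Dpos(2)[OF that(1)] Dpos(2)[OF that(2)] inf_le by blast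
  qed
  have "isglb ?D \<zero>" using Dpos n by (intro isglbI) (auto simp: onull_def)
  then have "decreases_to_zero E ?D (\<lambda>u v. v \<preceq> u) (\<lambda>u. u)"
    using dirD Dpos(2) greatest_Lower_iff[of ?D \<zero>] by (auto simp: decreases_to_zero_def net_in_def)
  moreover have "\<forall>d\<in>?D. \<exists>a\<^sub>0\<in>A. \<forall>a\<in>A. leq a\<^sub>0 a \<longrightarrow> ?z a \<preceq> d" by (auto simp: evub_def)
  ultimately show "order_conv E A leq x l" unfolding order_conv_def by blast
qed

lemma order_conv_zero_iff:
  assumes dir: "directed A leq" and x: "\<And>a. a \<in> A \<Longrightarrow> x a \<in> carrier E" "\<And>a. a \<in> A \<Longrightarrow> \<zero> \<preceq> x a"
  shows "order_conv E A leq x \<zero> \<longleftrightarrow> onull A leq x"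
  using order_conv_iff[of A leq x \<zero>, OF dir x(1) zero_closed] onull_cong[of A "\<lambda>a. av (\<zero> \<ominus> x a)" x leq] x by simp

lemma uo_conv_iff:
  assumes dir: "directed A leq" and x: "\<And>a. a \<in> A \<Longrightarrow> x a \<in> carrier E" and l: "l \<in> carrier E"
  shows "uo_conv E A leq x l \<longleftrightarrow> (\<forall>y\<in>carrier E. \<zero> \<preceq> y \<longrightarrow> onull A leq (\<lambda>a. av (x a \<ominus> l) \<curlywedge> y))"
  unfolding uo_conv_def using assms by (simp add: order_conv_zero_iff)

lemma order_conv_imp_uo_conv:
  assumes dir: "directed A leq" and x: "\<And>a. a \<in> A \<Longrightarrow> x a \<in> carrier E" and l: "l \<in> carrier E"
    and "order_conv E A leq x l"
  shows "uo_conv E A leq x l"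
proof -
  have "onull A leq (\<lambda>a. av (x a \<ominus> l) \<curlywedge> y)" if "y \<in> carrier E" for y
  proof (rule onull_mono)
    show "onull A leq (\<lambda>a. av (l \<ominus> x a))" using assms(4) order_conv_iff[of A leq x l, OF dir x l] by simp
  qed (use that l x in \<open>simp_all add: av_minus_commute[of l]\<close>)
  then show ?thesis using uo_conv_iff[of A leq x l, OF dir x l] by blast
qed

end

subsection \<open>Dedekind complete vector lattices\<close>

locale dc_vlattice = vlattice +
  assumes dedekind: "dedekind_complete E"
begin

lemma lub_exists:
  assumes "D \<subseteq> carrier E" "D \<noteq> {}" "u \<in> carrier E" "\<And>d. d \<in> D \<Longrightarrow> d \<preceq> u"
  shows "\<exists>s. islub D s"
proof -
  have "u \<in> Upper (ord_of E) D" using assms by (auto simp: Upper_def)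
  then have "\<exists>s. least (ord_of E) s (Upper (ord_of E) D)" using dedekind assms(1,2) unfolding dedekind_complete_def by blast
  then show ?thesis by (simp add: least_Upper_iff[OF assms(1)])
qed

lemma glb_exists:
  assumes D: "D \<subseteq> carrier E" "D \<noteq> {}" and [simp]: "u \<in> carrier E" and u: "\<And>d. d \<in> D \<Longrightarrow> u \<preceq> d"
  shows "\<exists>s. isglb D s"
proof -
  let ?L = "{v \<in> carrier E. \<forall>d\<in>D. v \<preceq> d}"
  obtain d where d: "d \<in> D" using D by auto
  have "u \<in> ?L" using u by simp
  then have ne: "?L \<noteq> {}" by blast
  have "?L \<subseteq> carrier E" "d \<in> carrier E" "\<And>v. v \<in> ?L \<Longrightarrow> v \<preceq> d" using d D(1) by blast+
  then have "\<exists>s. islub ?L s" by (intro lub_exists[OF _ ne])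
  then obtain s where s: "islub ?L s" ..
  have "isglb D s"
  proof (rule isglbI)
    show "s \<preceq> e" if "e \<in> D" for e using islubD(3)[OF s, of e] that D(1) by blast
    fix v assume "v \<in> carrier E" "\<And>d. d \<in> D \<Longrightarrow> v \<preceq> d"
    then show "v \<preceq> s" by (intro islubD(2)[OF s]) simp
  qed (rule islubD(1)[OF s])
  then show ?thesis ..
qed

text \<open>
  If the net lies in the band generated by \<open>x\<close>, then \<open>x\<close> alone decides about unbounded order convergence: a
  lower bound \<open>w\<close> of the eventual bounds for \<open>z \<curlywedge> y\<close> satisfies \<open>w\<^sup>+ \<curlywedge> x = 0\<close>, by distributivity, and is then
  disjoint from the whole net, hence from its suprema that dominate it.
\<close>

lemma onull_inf_of_carrying:
  assumes dir: "directed A leq" and z: "\<And>a. a \<in> A \<Longrightarrow> z a \<in> carrier E" "\<And>a. a \<in> A \<Longrightarrow> \<zero> \<preceq> z a"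
    and [simp]: "x \<in> carrier E" "\<zero> \<preceq> x" "y \<in> carrier E" "\<zero> \<preceq> y"
    and dis: "\<And>a t. a \<in> A \<Longrightarrow> t \<in> carrier E \<Longrightarrow> \<zero> \<preceq> t \<Longrightarrow> t \<curlywedge> x = \<zero> \<Longrightarrow> t \<curlywedge> z a = \<zero>"
    and null: "onull A leq (\<lambda>a. z a \<curlywedge> x)"
  shows "onull A leq (\<lambda>a. z a \<curlywedge> y)"
  unfolding onull_def
proof (intro ballI impI)
  fix w assume [simp]: "w \<in> carrier E" and w: "\<forall>d\<in>evub A leq (\<lambda>a. z a \<curlywedge> y). w \<preceq> d"
  let ?p = "pp w"
  have sup: "\<exists>s. islub ((\<lambda>a. z a \<curlywedge> y) ` {a\<in>A. leq a\<^sub>0 a}) s \<and> ?p \<preceq> s" if a0: "a\<^sub>0 \<in> A" for a\<^sub>0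
  proof -
    have "leq a\<^sub>0 a\<^sub>0" using directedD(2)[OF dir a0] .
    have "(\<lambda>a. z a \<curlywedge> y) ` {a\<in>A. leq a\<^sub>0 a} \<subseteq> carrier E" using z by auto
    moreover have "(\<lambda>a. z a \<curlywedge> y) ` {a\<in>A. leq a\<^sub>0 a} \<noteq> {}" using a0 \<open>leq a\<^sub>0 a\<^sub>0\<close> by blast
    ultimately have "\<exists>s. islub ((\<lambda>a. z a \<curlywedge> y) ` {a\<in>A. leq a\<^sub>0 a}) s"
      by (rule lub_exists[where u = y]) (use z in auto)
    then obtain s where s: "islub ((\<lambda>a. z a \<curlywedge> y) ` {a\<in>A. leq a\<^sub>0 a}) s" ..
    note [simp] = islubD(1)[OF s]
    have ub: "z a \<curlywedge> y \<preceq> s" if "a \<in> A" "leq a\<^sub>0 a" for a using islubD(2)[OF s, of "z a \<curlywedge> y"] that by blast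
    have "s \<in> evub A leq (\<lambda>a. z a \<curlywedge> y)" using a0 ub by (intro evubI[of _ a\<^sub>0]) simp_all
    moreover have "\<zero> \<preceq> s"
      using ub[OF a0 \<open>leq a\<^sub>0 a\<^sub>0\<close>] a0 z ord_trans[of \<zero> "z a\<^sub>0 \<curlywedge> y" s] by simp
    ultimately have "?p \<preceq> s" using w by (simp add: sup_le_iff)
    with s show ?thesis by blast
  qed
  have sub: "(\<lambda>a. z a \<curlywedge> y) ` {a\<in>A. leq a\<^sub>0 a} \<subseteq> carrier E" for a\<^sub>0 using z by auto
  have "?p \<curlywedge> x \<preceq> \<zero>"
  proof (rule onullD[OF null])
    fix e assume "e \<in> evub A leq (\<lambda>a. z a \<curlywedge> x)"
    then obtain a\<^sub>0 where [simp]: "e \<in> carrier E" and a0: "a\<^sub>0 \<in> A" and e: "\<And>a. a \<in> A \<Longrightarrow> leq a\<^sub>0 a \<Longrightarrow> z a \<curlywedge> x \<preceq> e"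
      unfolding evub_def by blast
    obtain s where s: "islub ((\<lambda>a. z a \<curlywedge> y) ` {a\<in>A. leq a\<^sub>0 a}) s" "?p \<preceq> s" using sup[OF a0] by auto
    note [simp] = islubD(1)[OF s(1)]
    have "s \<curlywedge> x \<preceq> e"
    proof (rule islubD(3)[OF islub_inf[OF sub s(1)]])
      fix d assume "d \<in> (\<lambda>d. d \<curlywedge> x) ` (\<lambda>a. z a \<curlywedge> y) ` {a \<in> A. leq a\<^sub>0 a}"
      then obtain a where a: "a \<in> A" "leq a\<^sub>0 a" "d = (z a \<curlywedge> y) \<curlywedge> x" by auto
      have "d \<preceq> z a \<curlywedge> x" unfolding a(3) using z(1)[OF a(1)] by (intro inf_mono) simp_all
      then show "d \<preceq> e" using e[OF a(1,2)] ord_trans[of d "z a \<curlywedge> x" e] a z(1)[OF a(1)] by simp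
    qed simp_all
    then show "?p \<curlywedge> x \<preceq> e" using inf_mono[OF s(2), of x x] ord_trans[of "?p \<curlywedge> x" "s \<curlywedge> x" e] by simp
  qed simp
  then have px: "?p \<curlywedge> x = \<zero>" by (intro ord_antisym) simp_all
  obtain a\<^sub>0 where a0: "a\<^sub>0 \<in> A" using directedD(1)[OF dir] by auto
  obtain s where s: "islub ((\<lambda>a. z a \<curlywedge> y) ` {a\<in>A. leq a\<^sub>0 a}) s" "?p \<preceq> s" using sup[OF a0] by auto
  note [simp] = islubD(1)[OF s(1)]
  have "s \<curlywedge> ?p \<preceq> \<zero>"
  proof (rule islubD(3)[OF islub_inf[OF sub s(1)]])
    fix d assume "d \<in> (\<lambda>d. d \<curlywedge> ?p) ` (\<lambda>a. z a \<curlywedge> y) ` {a \<in> A. leq a\<^sub>0 a}"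
    then obtain a where a: "a \<in> A" "d = (z a \<curlywedge> y) \<curlywedge> ?p" by auto
    have [simp]: "z a \<in> carrier E" "\<zero> \<preceq> z a" using z a by auto
    have "d \<preceq> z a \<curlywedge> ?p" unfolding a(2) by (intro inf_mono) simp_all
    also have "z a \<curlywedge> ?p = \<zero>" using dis[OF a(1) _ _ px] by (simp add: inf_commute)
    finally show "d \<preceq> \<zero>" .
  qed simp_all
  moreover have "s \<curlywedge> ?p = ?p" using inf_commute[of s ?p] inf_absorb[OF s(2)] by simp
  ultimately have "?p \<preceq> \<zero>" by simp
  then show "w \<preceq> \<zero>" using ord_trans[of w ?p \<zero>] by simp
qed

end

section \<open>Orthomorphisms\<close>

locale orth_vlattice = dc_vlattice +
  assumes arch: "archimedean E"
begin

abbreviation "orth \<equiv> carrier (Orth E)"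

lemma arch_zero:
  assumes "\<zero> \<preceq> x" "\<And>n::nat. real n \<odot> x \<preceq> y" "x \<in> carrier E" "y \<in> carrier E"
  shows "x = \<zero>"
  using arch assms unfolding archimedean_def by blast

text \<open>
  The form in which bisections use the Archimedean property.
\<close>

lemma nonneg_of_halving:
  assumes c [simp]: "c \<in> carrier E" "t \<in> carrier E" and le: "\<And>n::nat. (1/2)^n \<odot> c \<preceq> t"
  shows "\<zero> \<preceq> t"
proof -
  let ?p = "pp (\<ominus> t)"
  have "real n \<odot> ?p \<preceq> av c" for n
  proof -
    have "\<ominus> t \<preceq> \<ominus> ((1/2)^n \<odot> c)" using le[of n] by simp
    also have "\<dots> = (1/2)^n \<odot> (\<ominus> c)" by (simp add: smult_a_inv)
    also have "\<dots> \<preceq> (1/2)^n \<odot> av c" by (rule smult_mono) simp_all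
    finally have "?p \<preceq> (1/2)^n \<odot> av c" by (simp add: sup_le_iff)
    then have "2^n \<odot> ?p \<preceq> 2^n \<odot> ((1/2)^n \<odot> av c)" by (rule smult_mono) simp_all
    also have "\<dots> = av c" by (simp add: power_mult_distrib[symmetric])
    finally have "2^n \<odot> ?p \<preceq> av c" by simp
    moreover have "real n \<odot> ?p \<preceq> 2^n \<odot> ?p" by (rule smult_mono_left) (simp_all add: of_nat_less_two_power less_imp_le)
    ultimately show ?thesis using ord_trans[of "real n \<odot> ?p" "2^n \<odot> ?p" "av c"] by simp
  qed
  then have "?p = \<zero>" by (intro arch_zero[of ?p "av c"]) simp_all
  then have "t = pp t" using pp_minus_pp[of t] by simp
  then show ?thesis using pp_nonneg[of t] by simp
qed

lemma orth_iff:
  "T \<in> orth \<longleftrightarrow> T \<in> extensional (carrier E) \<and> linear_operator E T \<and> order_bounded_operator E T \<and>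
     (\<forall>B. band E B \<longrightarrow> T ` B \<subseteq> B)"
  by (simp add: Orth_def)

lemma
  assumes "T \<in> orth"
  shows orth_closed [simp, intro]: "x \<in> carrier E \<Longrightarrow> T x \<in> carrier E"
    and orth_add: "x \<in> carrier E \<Longrightarrow> y \<in> carrier E \<Longrightarrow> T (x \<oplus> y) = T x \<oplus> T y"
    and orth_smult: "x \<in> carrier E \<Longrightarrow> T (r \<odot> x) = r \<odot> T x"
    and orth_band: "band E B \<Longrightarrow> x \<in> B \<Longrightarrow> T x \<in> B"
    and orth_extensional: "T \<in> extensional (carrier E)"
  using assms by (auto simp: orth_iff linear_operator_def image_subset_iff)

lemma orth_zero [simp]: "T \<in> orth \<Longrightarrow> T \<zero> = \<zero>"
  using orth_smult[of T \<zero> 0] by simp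

lemma orth_neg: "T \<in> orth \<Longrightarrow> x \<in> carrier E \<Longrightarrow> T (\<ominus> x) = \<ominus> T x"
  using orth_smult[of T x "-1"] by (simp add: smult_neg)

lemma orth_minus: "T \<in> orth \<Longrightarrow> x \<in> carrier E \<Longrightarrow> y \<in> carrier E \<Longrightarrow> T (x \<ominus> y) = T x \<ominus> T y"
  by (simp add: a_minus_def orth_add orth_neg)

lemma orth_eqI:
  assumes S: "S \<in> orth" and T: "T \<in> orth" and eq: "\<And>x. x \<in> carrier E \<Longrightarrow> \<zero> \<preceq> x \<Longrightarrow> S x = T x"
  shows "S = T"
proof (rule extensionalityI)
  show "S \<in> extensional (carrier E)" "T \<in> extensional (carrier E)" using S T orth_extensional by auto
  fix x assume [simp]: "x \<in> carrier E"
  have "S (pp x \<ominus> pp (\<ominus> x)) = T (pp x \<ominus> pp (\<ominus> x))" using S T by (simp add: orth_minus eq)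
  then show "S x = T x" by (simp add: pp_minus_pp)
qed

lemma orth_bounded:
  assumes "T \<in> orth" "a \<in> carrier E" "b \<in> carrier E"
  shows "\<exists>c\<in>carrier E. \<exists>d\<in>carrier E. \<forall>x\<in>carrier E. a \<preceq> x \<and> x \<preceq> b \<longrightarrow> c \<preceq> T x \<and> T x \<preceq> d"
  using assms by (simp add: orth_iff order_bounded_operator_def)

lemma orthI:
  assumes cl: "\<And>x. x \<in> carrier E \<Longrightarrow> f x \<in> carrier E"
    and add: "\<And>x y. x \<in> carrier E \<Longrightarrow> y \<in> carrier E \<Longrightarrow> f (x \<oplus> y) = f x \<oplus> f y"
    and sm: "\<And>r x. x \<in> carrier E \<Longrightarrow> f (r \<odot> x) = r \<odot> f x"
    and bd: "\<And>a b. a \<in> carrier E \<Longrightarrow> b \<in> carrier E \<Longrightarrow>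
      \<exists>c\<in>carrier E. \<exists>d\<in>carrier E. \<forall>x\<in>carrier E. a \<preceq> x \<and> x \<preceq> b \<longrightarrow> c \<preceq> f x \<and> f x \<preceq> d"
    and band: "\<And>B x. band E B \<Longrightarrow> x \<in> B \<Longrightarrow> f x \<in> B"
  shows "restrict f (carrier E) \<in> orth"
proof -
  have "order_bounded_operator E (restrict f (carrier E))"
    using bd unfolding order_bounded_operator_def by (simp cong: ball_cong)
  moreover have "linear_operator E (restrict f (carrier E))"
    using cl add sm by (simp add: linear_operator_def)
  moreover have "restrict f (carrier E) ` B \<subseteq> B" if "band E B" for B
    using band[OF that] bandD(1)[OF that] by (auto simp: subset_iff)
  ultimately show ?thesis by (simp add: orth_iff)
qed

lemma orthI_pos:
  assumes cl: "\<And>x. x \<in> carrier E \<Longrightarrow> f x \<in> carrier E"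
    and add: "\<And>x y. x \<in> carrier E \<Longrightarrow> y \<in> carrier E \<Longrightarrow> f (x \<oplus> y) = f x \<oplus> f y"
    and sm: "\<And>r x. x \<in> carrier E \<Longrightarrow> f (r \<odot> x) = r \<odot> f x"
    and pos: "\<And>x. x \<in> carrier E \<Longrightarrow> \<zero> \<preceq> x \<Longrightarrow> \<zero> \<preceq> f x"
    and band: "\<And>B x. band E B \<Longrightarrow> x \<in> B \<Longrightarrow> \<zero> \<preceq> x \<Longrightarrow> f x \<in> B"
  shows "restrict f (carrier E) \<in> orth"
proof (rule orthI)
  have neg: "f (\<ominus> x) = \<ominus> f x" if "x \<in> carrier E" for x
    using sm[of x "-1"] that cl by (simp add: smult_neg)
  have minus: "f (x \<ominus> y) = f x \<ominus> f y" if "x \<in> carrier E" "y \<in> carrier E" for x y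
    using that by (simp add: a_minus_def add neg)
  have mono: "f x \<preceq> f y" if "x \<preceq> y" "x \<in> carrier E" "y \<in> carrier E" for x y
    using pos[of "y \<ominus> x"] that by (simp add: minus diff_nonneg_iff cl)
  show "\<exists>c\<in>carrier E. \<exists>d\<in>carrier E. \<forall>x\<in>carrier E. a \<preceq> x \<and> x \<preceq> b \<longrightarrow> c \<preceq> f x \<and> f x \<preceq> d"
    if "a \<in> carrier E" "b \<in> carrier E" for a b
    using that mono cl by blast
  fix B x assume B: "band E B" and x: "x \<in> B"
  have [simp]: "x \<in> carrier E" using bandD(1)[OF B] x by auto
  have "f x = f (pp x) \<ominus> f (pp (\<ominus> x))" using minus[of "pp x" "pp (\<ominus> x)"] by (simp add: pp_minus_pp)
  also have "\<dots> \<in> B"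
    using band[OF B band_pp(1)[OF B x]] band[OF B band_pp(1)[OF B bandD(4)[OF B x]]]
    by (intro bandD(5)[OF B]) simp_all
  finally show "f x \<in> B" .
qed (use cl add sm in auto)

text \<open>
  Orthomorphisms are constructed below from their values on the positive cone. The extension
  \<open>x \<mapsto> f(x\<^sup>+) - f(x\<^sup>-)\<close> is additive because its value depends only on the difference of any two
  positive elements that represent \<open>x\<close>.
\<close>

lemma orth_extend:
  assumes cl: "\<And>x. x \<in> carrier E \<Longrightarrow> \<zero> \<preceq> x \<Longrightarrow> f x \<in> carrier E"
    and add: "\<And>x y. x \<in> carrier E \<Longrightarrow> y \<in> carrier E \<Longrightarrow> \<zero> \<preceq> x \<Longrightarrow> \<zero> \<preceq> y \<Longrightarrow> f (x \<oplus> y) = f x \<oplus> f y"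
    and sm: "\<And>r x. x \<in> carrier E \<Longrightarrow> \<zero> \<preceq> x \<Longrightarrow> 0 \<le> r \<Longrightarrow> f (r \<odot> x) = r \<odot> f x"
    and pos: "\<And>x. x \<in> carrier E \<Longrightarrow> \<zero> \<preceq> x \<Longrightarrow> \<zero> \<preceq> f x"
    and band: "\<And>B x. band E B \<Longrightarrow> x \<in> B \<Longrightarrow> \<zero> \<preceq> x \<Longrightarrow> f x \<in> B"
  obtains F where "F \<in> orth" "\<And>x. x \<in> carrier E \<Longrightarrow> \<zero> \<preceq> x \<Longrightarrow> F x = f x"
proof -
  define g where "g x = f (pp x) \<ominus> f (pp (\<ominus> x))" for x
  have f0: "f \<zero> = \<zero>" using sm[of \<zero> 0] cl[of \<zero>] by simp
  have g_diff: "g (a \<ominus> b) = f a \<ominus> f b"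
    if [simp]: "a \<in> carrier E" "b \<in> carrier E" "\<zero> \<preceq> a" "\<zero> \<preceq> b" for a b
  proof -
    let ?x = "a \<ominus> b"
    have "pp ?x \<ominus> pp (\<ominus> ?x) = a \<ominus> b" by (simp only: pp_minus_pp minus_closed' that)
    then have "pp ?x \<oplus> b = a \<oplus> pp (\<ominus> ?x)" by (simp add: minus_eq_iff diff_normalize3)
    then have "f (pp ?x) \<oplus> f b = f a \<oplus> f (pp (\<ominus> ?x))" by (simp add: add[symmetric])
    then show ?thesis unfolding g_def by (simp add: cl minus_eq_iff diff_normalize3)
  qed
  have g_pos: "g x = f x" if "x \<in> carrier E" "\<zero> \<preceq> x" for x
    using g_diff[of x \<zero>] that by (simp add: f0 cl)
  have "restrict g (carrier E) \<in> orth"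
  proof (rule orthI_pos)
    show "g x \<in> carrier E" if "x \<in> carrier E" for x using that by (simp add: g_def cl)
    show "g (x \<oplus> y) = g x \<oplus> g y" if [simp]: "x \<in> carrier E" "y \<in> carrier E" for x y
    proof -
      have "x \<oplus> y = (pp x \<ominus> pp (\<ominus> x)) \<oplus> (pp y \<ominus> pp (\<ominus> y))" by (simp add: pp_minus_pp)
      also have "\<dots> = (pp x \<oplus> pp y) \<ominus> (pp (\<ominus> x) \<oplus> pp (\<ominus> y))" by (simp add: diff_normalize3 a_ac)
      finally have "g (x \<oplus> y) = f (pp x \<oplus> pp y) \<ominus> f (pp (\<ominus> x) \<oplus> pp (\<ominus> y))" by (simp add: g_diff)
      then show ?thesis by (simp add: g_def add cl diff_normalize3 a_ac)
    qed
    show "g (r \<odot> x) = r \<odot> g x" if [simp]: "x \<in> carrier E" for r x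
    proof (cases "0 \<le> r")
      case True
      have "r \<odot> x = r \<odot> pp x \<ominus> r \<odot> pp (\<ominus> x)" using smult_minus[of "pp x" "pp (\<ominus> x)" r] by (simp add: pp_minus_pp)
      then have "g (r \<odot> x) = f (r \<odot> pp x) \<ominus> f (r \<odot> pp (\<ominus> x))" using True by (simp add: g_diff)
      then show ?thesis using True by (simp add: sm g_def smult_minus cl)
    next
      case False
      have "r \<odot> x = \<ominus> ((- r) \<odot> (pp x \<ominus> pp (\<ominus> x)))" by (simp add: pp_minus_pp smult_neg)
      also have "\<dots> = (- r) \<odot> pp (\<ominus> x) \<ominus> (- r) \<odot> pp x" by (simp add: smult_minus diff_normalize2)
      finally have "g (r \<odot> x) = f ((- r) \<odot> pp (\<ominus> x)) \<ominus> f ((- r) \<odot> pp x)" using False by (simp add: g_diff)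
      also have "\<dots> = (- r) \<odot> (f (pp (\<ominus> x)) \<ominus> f (pp x))" using False by (simp add: sm smult_minus cl)
      also have "\<dots> = r \<odot> g x" by (simp add: smult_neg g_def cl smult_a_inv[symmetric] diff_normalize2)
      finally show ?thesis .
    qed
    show "\<zero> \<preceq> g x" if "x \<in> carrier E" "\<zero> \<preceq> x" for x using that by (simp add: g_pos pos)
    show "g x \<in> B" if "band E B" "x \<in> B" "\<zero> \<preceq> x" for B x
      using band[OF that] g_pos[OF _ that(3)] bandD(1)[OF that(1)] that(2) by auto
  qed
  then show ?thesis by (rule that) (simp add: g_pos)
qed

lemma compose_orth [simp, intro]:
  assumes S: "S \<in> orth" and T: "T \<in> orth" shows "compose (carrier E) S T \<in> orth"
  unfolding compose_def
proof (rule orthI)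
  show "\<exists>c\<in>carrier E. \<exists>d\<in>carrier E. \<forall>x\<in>carrier E. a \<preceq> x \<and> x \<preceq> b \<longrightarrow> c \<preceq> S (T x) \<and> S (T x) \<preceq> d"
    if ab: "a \<in> carrier E" "b \<in> carrier E" for a b
  proof -
    obtain c d where cd: "c \<in> carrier E" "d \<in> carrier E"
      "\<forall>x\<in>carrier E. a \<preceq> x \<and> x \<preceq> b \<longrightarrow> c \<preceq> T x \<and> T x \<preceq> d"
      using orth_bounded[OF T ab] by blast
    obtain c' d' where cd': "c' \<in> carrier E" "d' \<in> carrier E"
      "\<forall>x\<in>carrier E. c \<preceq> x \<and> x \<preceq> d \<longrightarrow> c' \<preceq> S x \<and> S x \<preceq> d'"
      using orth_bounded[OF S cd(1,2)] by blast
    have "c' \<preceq> S (T x) \<and> S (T x) \<preceq> d'" if "x \<in> carrier E" "a \<preceq> x \<and> x \<preceq> b" for x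
      using cd(3) cd'(3) that orth_closed[OF T that(1)] by blast
    then show ?thesis using cd' by blast
  qed
qed (use S T in \<open>auto simp: orth_add orth_smult intro: orth_band\<close>)

lemma add_orth:
  assumes S: "S \<in> orth" and T: "T \<in> orth" shows "(\<lambda>x\<in>carrier E. S x \<oplus> T x) \<in> orth"
proof (rule orthI)
  show "S (x \<oplus> y) \<oplus> T (x \<oplus> y) = S x \<oplus> T x \<oplus> (S y \<oplus> T y)" if "x \<in> carrier E" "y \<in> carrier E" for x y
    using S T that by (simp add: orth_add a_ac)
  show "\<exists>c\<in>carrier E. \<exists>d\<in>carrier E. \<forall>x\<in>carrier E. a \<preceq> x \<and> x \<preceq> b \<longrightarrow> c \<preceq> S x \<oplus> T x \<and> S x \<oplus> T x \<preceq> d"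
    if ab: "a \<in> carrier E" "b \<in> carrier E" for a b
  proof -
    obtain c d where cd: "c \<in> carrier E" "d \<in> carrier E"
      "\<forall>x\<in>carrier E. a \<preceq> x \<and> x \<preceq> b \<longrightarrow> c \<preceq> T x \<and> T x \<preceq> d"
      using orth_bounded[OF T ab] by blast
    obtain c' d' where cd': "c' \<in> carrier E" "d' \<in> carrier E"
      "\<forall>x\<in>carrier E. a \<preceq> x \<and> x \<preceq> b \<longrightarrow> c' \<preceq> S x \<and> S x \<preceq> d'"
      using orth_bounded[OF S ab] by blast
    have "c' \<oplus> c \<preceq> S x \<oplus> T x \<and> S x \<oplus> T x \<preceq> d' \<oplus> d" if x: "x \<in> carrier E" "a \<preceq> x \<and> x \<preceq> b" for x
      using cd cd' x S T by (simp add: add_mono')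
    then show ?thesis using cd cd' a_closed by blast
  qed
qed (use S T in \<open>auto simp: orth_smult smult_add_right intro: orth_band bandD(3)\<close>)

lemma smult_orth:
  assumes T: "T \<in> orth" shows "(\<lambda>x\<in>carrier E. r \<odot> T x) \<in> orth"
proof (rule orthI)
  show "\<exists>c\<in>carrier E. \<exists>d\<in>carrier E. \<forall>x\<in>carrier E. a \<preceq> x \<and> x \<preceq> b \<longrightarrow> c \<preceq> r \<odot> T x \<and> r \<odot> T x \<preceq> d"
    if ab: "a \<in> carrier E" "b \<in> carrier E" for a b
  proof -
    obtain c d where cd: "c \<in> carrier E" "d \<in> carrier E"
      "\<forall>x\<in>carrier E. a \<preceq> x \<and> x \<preceq> b \<longrightarrow> c \<preceq> T x \<and> T x \<preceq> d"
      using orth_bounded[OF T ab] by blast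
    show ?thesis
    proof (cases "0 \<le> r")
      case True
      have "r \<odot> c \<preceq> r \<odot> T x \<and> r \<odot> T x \<preceq> r \<odot> d" if "x \<in> carrier E" "a \<preceq> x \<and> x \<preceq> b" for x
        using cd that T True by (simp add: smult_mono)
      then show ?thesis using cd smult_closed' by blast
    next
      case False
      have "r \<odot> u \<preceq> r \<odot> v" if "v \<preceq> u" "u \<in> carrier E" "v \<in> carrier E" for u v
        using smult_mono[of v u "- r"] that False by (simp add: smult_neg)
      then have "r \<odot> d \<preceq> r \<odot> T x \<and> r \<odot> T x \<preceq> r \<odot> c" if "x \<in> carrier E" "a \<preceq> x \<and> x \<preceq> b" for x
        using cd that T by simp
      then show ?thesis using cd smult_closed' by blast
    qed
  qed
qed (use T in \<open>auto simp: orth_add orth_smult smult_add_right mult.commute intro: orth_band bandD(6)\<close>)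

lemma minus_orth:
  assumes S: "S \<in> orth" and T: "T \<in> orth" shows "(\<lambda>x\<in>carrier E. S x \<ominus> T x) \<in> orth"
proof -
  have "(\<lambda>x\<in>carrier E. S x \<oplus> (\<lambda>x\<in>carrier E. (-1) \<odot> T x) x) \<in> orth"
    by (intro add_orth S smult_orth T)
  also have "(\<lambda>x\<in>carrier E. S x \<oplus> (\<lambda>x\<in>carrier E. (-1) \<odot> T x) x) = (\<lambda>x\<in>carrier E. S x \<ominus> T x)"
    using T by (intro restrict_ext) (simp add: smult_neg a_minus_def)
  finally show ?thesis .
qed

lemma id_orth: "(\<lambda>x\<in>carrier E. x) \<in> orth"
  by (rule orthI_pos) auto

subsection \<open>Band projections\<close>

text \<open>
  The component in \<open>B\<close> is the largest element of \<open>B\<close> below \<open>x\<close>: an element of \<open>B\<close> below the remainder could be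
  added to it.
\<close>

lemma band_decomposition_pos:
  assumes B: "band E B" and [simp]: "x \<in> carrier E" "\<zero> \<preceq> x"
  shows "\<exists>u\<in>B. x \<ominus> u \<in> dcomp B \<and> \<zero> \<preceq> u \<and> u \<preceq> x"
proof -
  let ?D = "{z\<in>B. \<zero> \<preceq> z \<and> z \<preceq> x}"
  have BC: "B \<subseteq> carrier E" using bandD(1)[OF B] .
  have zD: "\<zero> \<in> ?D" using bandD(2)[OF B] by simp
  then have ne: "?D \<noteq> {}" by blast
  have "\<exists>s. islub ?D s" by (rule lub_exists[where u = x, OF _ ne]) (use BC in auto)
  then obtain s where s: "islub ?D s" ..
  note [simp] = islubD(1)[OF s]
  have sx: "s \<preceq> x" by (rule islubD(3)[OF s]) auto
  have s0: "\<zero> \<preceq> s" by (rule islubD(2)[OF s zD])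
  have sB: "s \<in> B" by (rule bandD(8)[OF B _ s]) auto
  have "av (x \<ominus> s) \<curlywedge> av b = \<zero>" if b: "b \<in> B" for b
  proof -
    have [simp]: "b \<in> carrier E" using b BC by auto
    let ?w = "av (x \<ominus> s) \<curlywedge> av b"
    have xs: "av (x \<ominus> s) = x \<ominus> s" using sx by (simp add: diff_nonneg_iff)
    have wB: "?w \<in> B" using b by (rule bandD(7)[OF B, rotated]) simp_all
    have wx: "?w \<preceq> x \<ominus> s" using inf_le(1)[of "av (x \<ominus> s)" "av b"] xs by simp
    have "z \<preceq> s \<ominus> ?w" if z: "z \<in> ?D" for z
    proof -
      have [simp]: "z \<in> carrier E" using z BC by auto
      have "z \<oplus> ?w \<preceq> s \<oplus> (x \<ominus> s)" using islubD(2)[OF s z] wx by (intro add_mono') simp_all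
      then have "z \<oplus> ?w \<in> ?D" using z wB bandD(3)[OF B] by simp
      then show ?thesis using islubD(2)[OF s] by (simp add: le_diff_iff)
    qed
    then have "s \<preceq> s \<ominus> ?w" using islubD(3)[OF s, of "s \<ominus> ?w"] by simp
    then have "?w \<oplus> s \<preceq> \<zero> \<oplus> s" by (simp add: le_diff_iff a_comm)
    then have "?w \<preceq> \<zero>" using add_le_cancel(1)[of ?w \<zero> s] by simp
    then show ?thesis by (intro ord_antisym) simp_all
  qed
  then have "x \<ominus> s \<in> dcomp B" by (simp add: dcomp_def)
  then show ?thesis using sB s0 sx by blast
qed

lemma band_decomposition_unique:
  assumes B: "band E B" and x: "x \<in> carrier E" and u: "u \<in> B" "x \<ominus> u \<in> dcomp B" and v: "v \<in> B" "x \<ominus> v \<in> dcomp B"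
  shows "u = v"
proof -
  note [simp] = x
  have [simp]: "u \<in> carrier E" "v \<in> carrier E" using bandD(1)[OF B] u v by auto
  have "u \<ominus> v = (x \<ominus> v) \<ominus> (x \<ominus> u)" by (simp add: diff_normalize3 minus_eq_iff a_ac)
  also have "\<dots> \<in> dcomp B" by (rule bandD(5)[OF band_dcomp]) (use bandD(1)[OF B] u v in auto)
  finally have "u \<ominus> v = \<zero>" using bandD(5)[OF B u(1) v(1)] band_dcomp_inter[OF B] by blast
  then show ?thesis by (simp add: minus_eq_iff)
qed

lemma band_projection:
  assumes B: "band E B"
  shows "\<exists>P\<in>orth. (\<forall>x\<in>carrier E. \<zero> \<preceq> x \<longrightarrow> \<zero> \<preceq> P x \<and> P x \<preceq> x) \<and>
    (\<forall>x\<in>carrier E. \<forall>u\<in>B. x \<ominus> u \<in> dcomp B \<longrightarrow> P x = u) \<and>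
    (\<forall>T\<in>orth. \<forall>x\<in>carrier E. T (P x) = P (T x))"
proof -
  have BC: "B \<subseteq> carrier E" using bandD(1)[OF B] .
  have dB: "band E (dcomp B)" using band_dcomp[OF BC] .
  have ex: "\<exists>u. u \<in> B \<and> x \<ominus> u \<in> dcomp B" if [simp]: "x \<in> carrier E" for x
  proof -
    obtain u v where u: "u \<in> B" "pp x \<ominus> u \<in> dcomp B" and v: "v \<in> B" "pp (\<ominus> x) \<ominus> v \<in> dcomp B"
      using band_decomposition_pos[OF B, of "pp x"] band_decomposition_pos[OF B, of "pp (\<ominus> x)"] by auto
    have [simp]: "u \<in> carrier E" "v \<in> carrier E" using BC u v by auto
    have "x \<ominus> (u \<ominus> v) = (pp x \<ominus> pp (\<ominus> x)) \<ominus> (u \<ominus> v)" by (simp add: pp_minus_pp)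
    also have "\<dots> = (pp x \<ominus> u) \<ominus> (pp (\<ominus> x) \<ominus> v)" by (simp add: diff_normalize3 minus_eq_iff a_ac)
    also have "\<dots> \<in> dcomp B" using bandD(5)[OF dB u(2) v(2)] .
    finally show ?thesis using bandD(5)[OF B u(1) v(1)] by blast
  qed
  define f where "f x = (THE u. u \<in> B \<and> x \<ominus> u \<in> dcomp B)" for x
  have f: "f x \<in> B \<and> x \<ominus> f x \<in> dcomp B" if "x \<in> carrier E" for x
  proof -
    have "\<exists>!u. u \<in> B \<and> x \<ominus> u \<in> dcomp B"
      using ex[OF that] band_decomposition_unique[OF B that] by (elim exE) (rule ex1I, assumption, blast)
    then show ?thesis unfolding f_def by (rule theI')
  qed
  have f_eq: "f x = u" if "x \<in> carrier E" "u \<in> B" "x \<ominus> u \<in> dcomp B" for x u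
    using band_decomposition_unique[OF B that(1)] f[OF that(1)] that by blast
  have fC [simp]: "f x \<in> carrier E" if "x \<in> carrier E" for x using f[OF that] BC by auto
  have f_pos: "\<zero> \<preceq> f x \<and> f x \<preceq> x" if "x \<in> carrier E" "\<zero> \<preceq> x" for x
    using band_decomposition_pos[OF B that] f_eq[OF that(1)] by auto
  have P: "restrict f (carrier E) \<in> orth"
  proof (rule orthI_pos)
    show "f (x \<oplus> y) = f x \<oplus> f y" if [simp]: "x \<in> carrier E" "y \<in> carrier E" for x y
    proof (rule f_eq)
      show "f x \<oplus> f y \<in> B" using f bandD(3)[OF B] by simp
      have "(x \<oplus> y) \<ominus> (f x \<oplus> f y) = (x \<ominus> f x) \<oplus> (y \<ominus> f y)" by (simp add: diff_normalize3 a_ac)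
      then show "(x \<oplus> y) \<ominus> (f x \<oplus> f y) \<in> dcomp B" using bandD(3)[OF dB] f by simp
    qed simp
    show "f (r \<odot> x) = r \<odot> f x" if [simp]: "x \<in> carrier E" for r x
      using f[OF that] bandD(6)[OF B] bandD(6)[OF dB, of "x \<ominus> f x" r] by (intro f_eq) (simp_all add: smult_minus)
    show "f x \<in> B'" if B': "band E B'" "x \<in> B'" "\<zero> \<preceq> x" for B' x
    proof -
      have [simp]: "x \<in> carrier E" using bandD(1)[OF B'(1)] B'(2) by auto
      show ?thesis using f_pos[of x] B' by (intro bandD(7)[OF B'(1) _ B'(2)]) simp_all
    qed
  qed (use f_pos in auto)
  have comm: "T (f x) = f (T x)" if T: "T \<in> orth" and [simp]: "x \<in> carrier E" for T x
  proof (rule f_eq[symmetric])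
    show "T (f x) \<in> B" using orth_band[OF T B] f by simp
    show "T x \<ominus> T (f x) \<in> dcomp B" using orth_band[OF T dB] f T by (simp add: orth_minus[symmetric])
  qed (use T in simp)
  show ?thesis
  proof (rule bexI[OF _ P], intro conjI ballI impI)
    show "T (restrict f (carrier E) x) = restrict f (carrier E) (T x)" if "T \<in> orth" "x \<in> carrier E" for T x
      using comm[OF that] that by simp
  qed (use f_pos f_eq in simp_all)
qed

text \<open>
  The projection onto the band disjoint from \<open>v\<^sup>-\<close>. It commutes with all orthomorphisms, which preserve
  both this band and its complement.
\<close>

lemma positivity_projection:
  assumes [simp]: "v \<in> carrier E"
  shows "\<exists>P\<in>orth. (\<forall>x\<in>carrier E. \<zero> \<preceq> x \<longrightarrow> \<zero> \<preceq> P x \<and> P x \<preceq> x) \<and> P v = pp v \<and>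
    (\<forall>T\<in>orth. \<forall>x\<in>carrier E. T (P x) = P (T x))"
proof -
  let ?B = "dcomp {pp (\<ominus> v)}"
  have B: "band E ?B" by (rule band_dcomp) simp
  obtain P where P: "P \<in> orth" "\<forall>x\<in>carrier E. \<zero> \<preceq> x \<longrightarrow> \<zero> \<preceq> P x \<and> P x \<preceq> x"
    "\<forall>x\<in>carrier E. \<forall>u\<in>?B. x \<ominus> u \<in> dcomp ?B \<longrightarrow> P x = u"
    "\<forall>T\<in>orth. \<forall>x\<in>carrier E. T (P x) = P (T x)"
    using band_projection[OF B] by blast
  have 1: "pp v \<in> ?B" using pp_inf_pp[of v] by (simp add: dcomp_def)
  have "v \<oplus> pp (\<ominus> v) = pp v" using pp_minus_pp[of v] minus_eq_iff(1)[of "pp v" "pp (\<ominus> v)" v] by simp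
  then have "v \<ominus> pp v = v \<ominus> (v \<oplus> pp (\<ominus> v))" by simp
  also have "\<dots> = \<ominus> pp (\<ominus> v)" by (simp add: diff_normalize3(3)[symmetric])
  finally have eq: "v \<ominus> pp v = \<ominus> pp (\<ominus> v)" .
  have in_dcomp: "pp (\<ominus> v) \<in> dcomp ?B"
  proof -
    have "av (pp (\<ominus> v)) \<curlywedge> av y = \<zero>" if "y \<in> ?B" for y
      using that inf_commute[of "av (pp (\<ominus> v))" "av y"] by (simp add: dcomp_def)
    then show ?thesis by (simp add: dcomp_def)
  qed
  have 2: "v \<ominus> pp v \<in> dcomp ?B" unfolding eq by (rule bandD(4)[OF band_dcomp[OF bandD(1)[OF B]] in_dcomp])
  have "P v = pp v" using P(3) 1 2 assms by blast
  then show ?thesis using P(1,2,4) by (intro bexI[of _ P] conjI)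
qed

subsection \<open>The sign of an orthomorphism\<close>

text \<open>
  Bisection. Let \<open>P\<close> project onto the band where \<open>2 y \<ge> x\<close>. Then \<open>2 y - P x\<close> lies again between \<open>0\<close> and \<open>x\<close>, and
  \<open>2 T y = T (2 y - P x) + P T x \<ge> T (2 y - P x)\<close>. A lower bound \<open>c\<close> of \<open>T\<close> on the interval, which exists since \<open>T\<close>
  is order bounded, thus improves to \<open>c/2\<close>, and so on.
\<close>

lemma orth_sign:
  assumes T: "T \<in> orth" and [simp]: "x \<in> carrier E" "\<zero> \<preceq> x" and Tx: "\<zero> \<preceq> T x"
    and y: "y \<in> carrier E" "\<zero> \<preceq> y" "y \<preceq> x"
  shows "\<zero> \<preceq> T y"
proof -
  obtain c where [simp]: "c \<in> carrier E" and c: "\<And>y. y \<in> carrier E \<Longrightarrow> \<zero> \<preceq> y \<Longrightarrow> y \<preceq> x \<Longrightarrow> c \<preceq> T y"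
    using orth_bounded[OF T zero_closed \<open>x \<in> carrier E\<close>] by blast
  have "(1/2)^n \<odot> c \<preceq> T y" if "y \<in> carrier E" "\<zero> \<preceq> y" "y \<preceq> x" for n y
    using that
  proof (induction n arbitrary: y)
    case 0 then show ?case using c by simp
  next
    case (Suc n)
    note y [simp] = Suc.prems(1,2)
    have "2 \<odot> y \<ominus> x \<in> carrier E" by simp
    then obtain P where P0: "P \<in> orth" "\<forall>x\<in>carrier E. \<zero> \<preceq> x \<longrightarrow> \<zero> \<preceq> P x \<and> P x \<preceq> x"
      "P (2 \<odot> y \<ominus> x) = pp (2 \<odot> y \<ominus> x)" "\<forall>T\<in>orth. \<forall>x\<in>carrier E. T (P x) = P (T x)"
      using positivity_projection by blast
    note P = P0(1) P0(2)[rule_format] P0(3) P0(4)[rule_format]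
    note [simp] = P(1)
    let ?y = "2 \<odot> y \<ominus> P x"
    have Pv: "P (2 \<odot> y) \<ominus> P x = pp (2 \<odot> y \<ominus> x)" using P(3) by (simp add: orth_minus)
    have "P x \<preceq> P (2 \<odot> y)"
      using pp_nonneg[of "2 \<odot> y \<ominus> x"] diff_nonneg_iff[of "P x" "P (2 \<odot> y)"] by (simp add: Pv)
    also have "\<dots> \<preceq> 2 \<odot> y" using P(2) by simp
    finally have 1: "\<zero> \<preceq> ?y" by (simp add: diff_nonneg_iff)
    have "2 \<odot> y \<ominus> x \<preceq> pp (2 \<odot> y \<ominus> x)" by simp
    also have "\<dots> \<preceq> P x"
    proof -
      have "2 \<odot> y \<preceq> 2 \<odot> x" using Suc.prems by (intro smult_mono) simp_all
      then have "\<zero> \<preceq> P (2 \<odot> x \<ominus> 2 \<odot> y)" using P(2) by (simp add: diff_nonneg_iff)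
      then have "P (2 \<odot> y) \<preceq> P (2 \<odot> x)" by (simp add: orth_minus diff_nonneg_iff)
      then have "P (2 \<odot> y) \<preceq> P x \<oplus> P x" using orth_smult[OF P(1), of x 2] by (simp add: smult_2[of "P x"])
      then have "P (2 \<odot> y) \<ominus> P x \<preceq> P x" by (simp add: le_diff_iff)
      then show ?thesis by (simp add: Pv)
    qed
    finally have 2: "?y \<preceq> x" by (simp add: le_diff_iff a_comm)
    have "(1/2)^n \<odot> c \<preceq> T ?y" using Suc.IH[OF _ 1 2] by simp
    also have "T ?y = 2 \<odot> T y \<ominus> P (T x)" using T P(4)[OF T] by (simp add: orth_minus orth_smult)
    also have "\<dots> \<preceq> 2 \<odot> T y" using P(2)[OF _ Tx] T by (simp add: le_diff_iff le_add_nonneg)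
    finally have "(1/2)^n \<odot> c \<preceq> 2 \<odot> T y" using T by simp
    then have "(1/2) \<odot> ((1/2)^n \<odot> c) \<preceq> (1/2) \<odot> (2 \<odot> T y)" by (rule smult_mono) (use T in simp_all)
    then show ?case using T by simp
  qed
  then show ?thesis using nonneg_of_halving[of c "T y"] y T by simp
qed

text \<open>
  A projection that picks out the positive part of \<open>T v\<close> does so for \<open>T x\<close> with \<open>x\<close> below \<open>v\<close>: \<open>P T\<close> and
  \<open>P T - T\<close> are nonnegative at \<open>v\<close>, hence at \<open>x\<close>. This makes \<open>x \<mapsto> (T x)\<^sup>+\<close> additive on the positive cone.
\<close>

lemma orth_pp_eq:
  assumes T: "T \<in> orth" and P: "P \<in> orth" "\<And>x. x \<in> carrier E \<Longrightarrow> \<zero> \<preceq> x \<Longrightarrow> \<zero> \<preceq> P x \<and> P x \<preceq> x"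
    and v: "v \<in> carrier E" "\<zero> \<preceq> v" "P (T v) = pp (T v)" and x: "x \<in> carrier E" "\<zero> \<preceq> x" "x \<preceq> v"
  shows "P (T x) = pp (T x)"
proof -
  note [simp] = T P(1) x(1) v(1)
  have mono: "P a \<preceq> P b" if "a \<preceq> b" "a \<in> carrier E" "b \<in> carrier E" for a b
    using P(2)[of "b \<ominus> a"] that by (simp add: orth_minus diff_nonneg_iff)
  have 1: "\<zero> \<preceq> compose (carrier E) P T x"
    by (rule orth_sign[of _ v, OF compose_orth[OF P(1) T]]) (use v x in \<open>simp_all add: compose_def\<close>)
  have "\<zero> \<preceq> (\<lambda>x\<in>carrier E. compose (carrier E) P T x \<ominus> T x) x"
    by (rule orth_sign[of _ v, OF minus_orth[OF compose_orth[OF P(1) T] T]])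
      (use v x in \<open>simp_all add: compose_def diff_nonneg_iff\<close>)
  then have 2: "T x \<preceq> P (T x)" by (simp add: compose_def diff_nonneg_iff)
  have "P (T x) \<preceq> P (pp (T x))" by (rule mono) simp_all
  also have "\<dots> \<preceq> pp (T x)" using P(2) by simp
  finally show ?thesis using 1 2 by (intro ord_antisym) (simp_all add: sup_le_iff compose_def)
qed

lemma orth_pp:
  assumes T: "T \<in> orth"
  obtains F where "F \<in> orth" "\<And>x. x \<in> carrier E \<Longrightarrow> \<zero> \<preceq> x \<Longrightarrow> F x = pp (T x)"
proof (rule orth_extend[of "\<lambda>x. pp (T x)"])
  show "pp (T (x \<oplus> y)) = pp (T x) \<oplus> pp (T y)"
    if [simp]: "x \<in> carrier E" "y \<in> carrier E" "\<zero> \<preceq> x" "\<zero> \<preceq> y" for x y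
  proof -
    note [simp] = T
    have "T (x \<oplus> y) \<in> carrier E" by simp
    then obtain P where P0: "P \<in> orth" "\<forall>x\<in>carrier E. \<zero> \<preceq> x \<longrightarrow> \<zero> \<preceq> P x \<and> P x \<preceq> x"
      "P (T (x \<oplus> y)) = pp (T (x \<oplus> y))"
      using positivity_projection by blast
    note P = P0(1) P0(2)[rule_format] P0(3)
    have "P (T x) = pp (T x)" "P (T y) = pp (T y)"
      using le_add_nonneg[of y x] le_add_nonneg[of x y] orth_add[OF T, of x y] P(3)
      by (simp_all add: orth_pp_eq[OF T P(1,2) _ _ P(3)])
    then show ?thesis using P(1,3) by (simp add: orth_add)
  qed
  show "pp (T x) \<in> B" if B: "band E B" and x: "x \<in> B" for B x
    using band_pp(1)[OF B] orth_band[OF T B x] by blast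
  show "pp (T (r \<odot> x)) = r \<odot> pp (T x)" if "x \<in> carrier E" "0 \<le> r" for r x
    using that T smult_sup[of r "T x" \<zero>] by (simp add: orth_smult)
qed (use T in auto)

subsection \<open>Orthomorphisms commute\<close>

lemma orth_mono:
  assumes "T \<in> orth" "\<And>x. x \<in> carrier E \<Longrightarrow> \<zero> \<preceq> x \<Longrightarrow> \<zero> \<preceq> T x" "a \<preceq> b" "a \<in> carrier E" "b \<in> carrier E"
  shows "T a \<preceq> T b"
  using assms(2)[of "b \<ominus> a"] assms by (simp add: orth_minus diff_nonneg_iff)

text \<open>
  The commutator \<open>S T - T S\<close> doubles when \<open>S\<close> is replaced by \<open>2 S - P\<close>, where \<open>P\<close> projects onto the band where
  \<open>2 S\<close> exceeds the identity, while \<open>2 S - P\<close> is still between zero and the identity on the interval up to \<open>z\<close>.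
  As the commutator at \<open>u\<close> stays bounded by \<open>T u\<close> all along, it vanishes.
\<close>

lemma orth_commute_bounded:
  assumes S: "S \<in> orth" and S1: "\<And>y. y \<in> carrier E \<Longrightarrow> \<zero> \<preceq> y \<Longrightarrow> y \<preceq> z \<Longrightarrow> \<zero> \<preceq> S y \<and> S y \<preceq> y"
    and T: "T \<in> orth" and Tpos: "\<And>x. x \<in> carrier E \<Longrightarrow> \<zero> \<preceq> x \<Longrightarrow> \<zero> \<preceq> T x"
    and [simp]: "z \<in> carrier E" "u \<in> carrier E" "\<zero> \<preceq> u" and uz: "u \<preceq> z" "T u \<preceq> z"
  shows "S (T u) = T (S u)"
proof -
  note [simp] = T
  have [simp]: "\<zero> \<preceq> T u" by (rule Tpos) simp_all
  have [simp]: "\<zero> \<preceq> z" using ord_trans[of \<zero> u z] uz by simp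
  have bound: "(1/2)^n \<odot> (\<ominus> (T u)) \<preceq> S (T u) \<ominus> T (S u) \<and> (1/2)^n \<odot> (\<ominus> (T u)) \<preceq> T (S u) \<ominus> S (T u)"
    if "S \<in> orth" "\<And>y. y \<in> carrier E \<Longrightarrow> \<zero> \<preceq> y \<Longrightarrow> y \<preceq> z \<Longrightarrow> \<zero> \<preceq> S y \<and> S y \<preceq> y" for n S
    using that
  proof (induction n arbitrary: S)
    case 0
    note [simp] = 0(1)
    have a: "\<zero> \<preceq> S (T u)" "S (T u) \<preceq> T u" using 0(2) uz by simp_all
    have b: "\<zero> \<preceq> T (S u)" "T (S u) \<preceq> T u" using 0(2)[of u] uz by (auto intro: Tpos orth_mono)
    have "p \<preceq> q \<oplus> t" if "p \<preceq> t" "\<zero> \<preceq> q" "p \<in> carrier E" "q \<in> carrier E" "t \<in> carrier E" for p q t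
      using ord_trans[OF that(1) le_add_nonneg(2)[OF that(2,5,4)]] that by simp
    then have "T (S u) \<preceq> S (T u) \<oplus> T u" "S (T u) \<preceq> T (S u) \<oplus> T u" using a b by simp_all
    then show ?case by (simp add: le_diff_iff diff_normalize)
  next
    case (Suc n)
    note S [simp] = Suc.prems(1) and S1 = Suc.prems(2)
    have "2 \<odot> S z \<ominus> z \<in> carrier E" by simp
    then obtain P where P0: "P \<in> orth" "\<forall>x\<in>carrier E. \<zero> \<preceq> x \<longrightarrow> \<zero> \<preceq> P x \<and> P x \<preceq> x"
      "P (2 \<odot> S z \<ominus> z) = pp (2 \<odot> S z \<ominus> z)" "\<forall>T\<in>orth. \<forall>x\<in>carrier E. T (P x) = P (T x)"
      using positivity_projection by blast
    note P = P0(1) P0(2)[rule_format] P0(3) P0(4)[rule_format]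
    note [simp] = P(1)
    define R where "R = (\<lambda>x\<in>carrier E. (\<lambda>x\<in>carrier E. 2 \<odot> S x) x \<ominus> (\<lambda>x\<in>carrier E. x) x)"
    have R [simp]: "R \<in> orth" unfolding R_def by (intro minus_orth smult_orth id_orth S)
    have Rx: "R x = 2 \<odot> S x \<ominus> x" if "x \<in> carrier E" for x using that by (simp add: R_def)
    have PR: "P (R y) = pp (R y)" if "y \<in> carrier E" "\<zero> \<preceq> y" "y \<preceq> z" for y
      by (rule orth_pp_eq[OF R P(1,2) _ _ _ that]) (simp_all add: Rx P(3))
    define S' where "S' = (\<lambda>x\<in>carrier E. (\<lambda>x\<in>carrier E. 2 \<odot> S x) x \<ominus> P x)"
    have S' [simp]: "S' \<in> orth" unfolding S'_def by (intro minus_orth smult_orth P S)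
    have S'x: "S' x = 2 \<odot> S x \<ominus> P x" if "x \<in> carrier E" for x using that by (simp add: S'_def)
    have S'1: "\<zero> \<preceq> S' y \<and> S' y \<preceq> y" if y: "y \<in> carrier E" "\<zero> \<preceq> y" "y \<preceq> z" for y
    proof
      note [simp] = y(1)
      have S2: "P (R y) = 2 \<odot> P (S y) \<ominus> P y" by (simp add: Rx orth_minus orth_smult)
      have Sy: "\<zero> \<preceq> S y" "S y \<preceq> y" using S1 y by auto
      have "P y \<preceq> 2 \<odot> P (S y)"
        using PR[OF y] pp_nonneg[of "R y"] diff_nonneg_iff[of "P y" "2 \<odot> P (S y)"] by (simp add: S2)
      also have "\<dots> \<preceq> 2 \<odot> S y" using P(2)[OF _ Sy(1)] by (intro smult_mono) simp_all
      finally show "\<zero> \<preceq> S' y" by (simp add: S'x diff_nonneg_iff)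
      have "2 \<odot> S y \<ominus> y \<preceq> pp (R y)" by (simp add: Rx)
      also have "\<dots> = 2 \<odot> P (S y) \<ominus> P y" using PR[OF y] S2 by simp
      also have "\<dots> \<preceq> P y"
      proof -
        have "P (S y) \<preceq> P y" by (rule orth_mono[OF P(1) _ Sy(2)]) (use P(2) in simp_all)
        then have "2 \<odot> P (S y) \<preceq> 2 \<odot> P y" by (rule smult_mono) simp_all
        then show ?thesis by (simp add: le_diff_iff smult_2)
      qed
      finally show "S' y \<preceq> y" by (simp add: S'x le_diff_iff a_comm)
    qed
    note IH = Suc.IH[OF S' S'1]
    have d: "S' (T u) \<ominus> T (S' u) = 2 \<odot> (S (T u) \<ominus> T (S u))"
      by (simp add: S'x orth_minus orth_smult P(4) smult_minus diff_normalize3 minus_eq_iff a_ac)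
    have e: "T (S' u) \<ominus> S' (T u) = 2 \<odot> (T (S u) \<ominus> S (T u))"
      by (simp add: S'x orth_minus orth_smult P(4) smult_minus diff_normalize3 minus_eq_iff a_ac)
    have half: "(1/2)^Suc n \<odot> w \<preceq> t" if "(1/2)^n \<odot> w \<preceq> 2 \<odot> t" "w \<in> carrier E" "t \<in> carrier E" for w t
      using smult_mono[OF that(1), of "1/2"] that(2,3) by simp
    show ?case using IH unfolding d e by (intro conjI half) simp_all
  qed
  note [simp] = S
  have "\<zero> \<preceq> S (T u) \<ominus> T (S u)" by (rule nonneg_of_halving[of "\<ominus> T u"]) (use bound[OF S S1] in simp_all)
  moreover have "\<zero> \<preceq> T (S u) \<ominus> S (T u)" by (rule nonneg_of_halving[of "\<ominus> T u"]) (use bound[OF S S1] in simp_all)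
  ultimately show ?thesis by (intro ord_antisym) (simp_all add: diff_nonneg_iff)
qed

lemma restrict_orth_eq [simp]: "restrict T (carrier E) = T" if "T \<in> orth"
  using orth_extensional[OF that] by (rule extensional_restrict)

text \<open>
  On the band where \<open>S\<close> is at most \<open>m\<close>, the bounded case applies to \<open>S/m\<close>. So the commutator at \<open>u\<close> lies in the band
  where \<open>S\<close> is at least \<open>m\<close>, for all \<open>m\<close>, which the Archimedean property forbids unless it is zero.
\<close>

lemma orth_commute_pos:
  assumes S: "S \<in> orth" and Spos: "\<And>x. x \<in> carrier E \<Longrightarrow> \<zero> \<preceq> x \<Longrightarrow> \<zero> \<preceq> S x"
    and T: "T \<in> orth" and Tpos: "\<And>x. x \<in> carrier E \<Longrightarrow> \<zero> \<preceq> x \<Longrightarrow> \<zero> \<preceq> T x"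
    and [simp]: "u \<in> carrier E" "\<zero> \<preceq> u"
  shows "S (T u) = T (S u)"
proof -
  note [simp] = S T
  have [simp]: "\<zero> \<preceq> T u" "\<zero> \<preceq> S u" "\<zero> \<preceq> S (T u)" "\<zero> \<preceq> T (S u)" by (simp_all add: Spos Tpos)
  define z where "z = u \<oplus> T u \<oplus> S (T u) \<oplus> T (S u)"
  have [simp]: "z \<in> carrier E" "\<zero> \<preceq> z" by (simp_all add: z_def)
  define w where "w = av (S (T u) \<ominus> T (S u))"
  have w [simp]: "w \<in> carrier E" "\<zero> \<preceq> w" by (simp_all add: w_def)
  have le: "a \<preceq> a \<oplus> b" "b \<preceq> a \<oplus> b" if "\<zero> \<preceq> a" "\<zero> \<preceq> b" "a \<in> carrier E" "b \<in> carrier E" for a b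
    using le_add_nonneg that by simp_all
  have uz: "u \<preceq> z" "T u \<preceq> z"
    unfolding z_def by (rule ord_trans[OF _ le(1)], rule ord_trans[OF _ le(1)], rule le, simp_all)+
  have "w \<preceq> S (T u) \<oplus> T (S u)" unfolding w_def using av_triangle_minus[of "S (T u)" "T (S u)"] by simp
  also have "\<dots> \<preceq> (u \<oplus> T u) \<oplus> (S (T u) \<oplus> T (S u))" by (rule le) simp_all
  also have "\<dots> = z" by (simp add: z_def a_ac)
  finally have wz: "w \<preceq> z" by simp
  have "real m \<odot> w \<preceq> S w" for m
  proof (cases "m = 0")
    case True then show ?thesis by (simp add: Spos)
  next
    case False
    then have m: "0 < real m" by simp
    define R where "R = (\<lambda>x\<in>carrier E. (\<lambda>x\<in>carrier E. real m \<odot> (\<lambda>x\<in>carrier E. x) x) x \<ominus> S x)"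
    have R [simp]: "R \<in> orth" unfolding R_def by (intro minus_orth smult_orth id_orth S)
    have Rx: "R x = real m \<odot> x \<ominus> S x" if "x \<in> carrier E" for x using that by (simp add: R_def)
    have "R z \<in> carrier E" by simp
    then obtain P where P0: "P \<in> orth" "\<forall>x\<in>carrier E. \<zero> \<preceq> x \<longrightarrow> \<zero> \<preceq> P x \<and> P x \<preceq> x" "P (R z) = pp (R z)"
      "\<forall>T\<in>orth. \<forall>x\<in>carrier E. T (P x) = P (T x)"
      using positivity_projection by blast
    note P = P0(1) P0(2)[rule_format] P0(3) P0(4)[rule_format]
    note [simp] = P(1)
    have PR: "P (R y) = pp (R y)" if "y \<in> carrier E" "\<zero> \<preceq> y" "y \<preceq> z" for y
      by (rule orth_pp_eq[OF R P(1,2) _ _ P(3) that]) simp_all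
    define S' where "S' = (\<lambda>x\<in>carrier E. (1/m) \<odot> compose (carrier E) P S x)"
    have S' [simp]: "S' \<in> orth" unfolding S'_def by (intro smult_orth compose_orth P S)
    have S'x: "S' x = (1/m) \<odot> P (S x)" if "x \<in> carrier E" for x using that by (simp add: S'_def compose_def)
    have S'1: "\<zero> \<preceq> S' y \<and> S' y \<preceq> y" if y: "y \<in> carrier E" "\<zero> \<preceq> y" "y \<preceq> z" for y
    proof
      note [simp] = y(1,2)
      show "\<zero> \<preceq> S' y" using P(2)[OF _ Spos] by (simp add: S'x)
      have "\<zero> \<preceq> P (real m \<odot> y) \<ominus> P (S y)"
        using PR[OF y] pp_nonneg[of "R y"] by (simp add: Rx orth_minus[OF P(1)])
      then have "P (S y) \<preceq> P (real m \<odot> y)" by (simp add: diff_nonneg_iff)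
      also have "\<dots> \<preceq> real m \<odot> y" using P(2) by simp
      finally have "(1/m) \<odot> P (S y) \<preceq> (1/m) \<odot> (real m \<odot> y)" by (rule smult_mono) simp_all
      then show "S' y \<preceq> y" using m by (simp add: S'x)
    qed
    have "S' (T u) = T (S' u)"
      by (rule orth_commute_bounded[OF S' S'1 T Tpos]) (use uz in simp_all)
    then have "(1/m) \<odot> P (S (T u)) = (1/m) \<odot> P (T (S u))" by (simp add: S'x orth_smult P(4))
    then have "real m \<odot> ((1/m) \<odot> P (S (T u))) = real m \<odot> ((1/m) \<odot> P (T (S u)))" by simp
    then have eq: "P (S (T u)) = P (T (S u))" using m by simp
    have "P w = \<zero>"
    proof -
      let ?v = "S (T u) \<ominus> T (S u)"
      let ?a = "P (pp ?v)" and ?b = "P (pp (\<ominus> ?v))"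
      have [simp]: "?v \<in> carrier E" by simp
      have "P (pp ?v \<ominus> pp (\<ominus> ?v)) = \<zero>" using eq by (simp only: pp_minus_pp \<open>?v \<in> carrier E\<close>) (simp add: orth_minus)
      then have ab: "?a = ?b" by (simp only: orth_minus[OF P(1)] sup_closed \<open>?v \<in> carrier E\<close> zero_closed a_inv_closed
        minus_eq_iff orth_closed[OF P(1)] l_zero)
      have "?a \<curlywedge> ?b = \<zero>"
        by (rule inf_eq_zeroI[OF pp_inf_pp[of ?v]]) (use P(2) in simp_all)
      then have "?a = \<zero>" using inf_absorb[of ?a ?a] ab by simp
      moreover have "P w = ?a \<oplus> ?b" unfolding w_def by (simp only: av_eq_pp \<open>?v \<in> carrier E\<close> orth_add[OF P(1)]
        sup_closed zero_closed a_inv_closed)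
      ultimately show ?thesis using ab by simp
    qed
    then have "pp (R w) = \<zero>" using PR[OF w wz] P(4)[OF R w(1)] by simp
    then have "R w \<preceq> \<zero>" using sup_ge(1)[of "R w" \<zero>] by simp
    then show ?thesis by (simp add: Rx le_diff_iff)
  qed
  then have "w = \<zero>" by (intro arch_zero[of w "S w"]) simp_all
  then show ?thesis by (simp add: w_def av_eq_zero_iff minus_eq_iff)
qed

lemma orth_decompose:
  assumes "T \<in> orth"
  shows "\<exists>F\<in>orth. \<exists>G\<in>orth. (\<forall>x\<in>carrier E. \<zero> \<preceq> x \<longrightarrow> \<zero> \<preceq> F x \<and> \<zero> \<preceq> G x) \<and> (\<forall>x\<in>carrier E. T x = F x \<ominus> G x)"
proof -
  note [simp] = assms
  obtain F where F: "F \<in> orth" "\<And>x. x \<in> carrier E \<Longrightarrow> \<zero> \<preceq> x \<Longrightarrow> F x = pp (T x)" using orth_pp[OF assms] by blast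
  note [simp] = F(1)
  let ?G = "\<lambda>x\<in>carrier E. F x \<ominus> T x"
  have "?G \<in> orth" by (rule minus_orth) simp_all
  moreover have "\<zero> \<preceq> F x \<and> \<zero> \<preceq> ?G x" if "x \<in> carrier E" "\<zero> \<preceq> x" for x
    using that F(2) by (simp add: diff_nonneg_iff)
  moreover have "T x = F x \<ominus> ?G x" if "x \<in> carrier E" for x
    using that by (simp add: diff_normalize3 minus_eq_iff a_ac)
  ultimately show ?thesis using F(1) by blast
qed

lemma orth_commute:
  assumes S: "S \<in> orth" and T: "T \<in> orth" and x: "x \<in> carrier E"
  shows "S (T x) = T (S x)"
proof -
  obtain F G where F: "F \<in> orth" "\<forall>x\<in>carrier E. \<zero> \<preceq> x \<longrightarrow> \<zero> \<preceq> F x \<and> \<zero> \<preceq> G x" "G \<in> orth" "\<forall>x\<in>carrier E. S x = F x \<ominus> G x"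
    using orth_decompose[OF S] by blast
  obtain F' G' where F': "F' \<in> orth" "\<forall>x\<in>carrier E. \<zero> \<preceq> x \<longrightarrow> \<zero> \<preceq> F' x \<and> \<zero> \<preceq> G' x" "G' \<in> orth"
    "\<forall>x\<in>carrier E. T x = F' x \<ominus> G' x" using orth_decompose[OF T] by blast
  note [simp] = S T F(1,3) F'(1,3)
  have pos: "S (T u) = T (S u)" if [simp]: "u \<in> carrier E" "\<zero> \<preceq> u" for u
  proof -
    have [simp]: "F (F' u) = F' (F u)" "G (F' u) = F' (G u)" "F (G' u) = G' (F u)" "G (G' u) = G' (G u)"
      using F(2) F'(2) by (auto intro!: orth_commute_pos)
    have Sy: "S y = F y \<ominus> G y" and Ty: "T y = F' y \<ominus> G' y" if "y \<in> carrier E" for y using that F(4) F'(4) by blast+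
    show ?thesis by (simp add: Sy Ty orth_minus[OF F(1)] orth_minus[OF F(3)] orth_minus[OF F'(1)] orth_minus[OF F'(3)]
      diff_normalize3 minus_eq_iff a_ac)
  qed
  have "S (T (pp x \<ominus> pp (\<ominus> x))) = T (S (pp x \<ominus> pp (\<ominus> x)))" using x by (simp add: orth_minus pos)
  then show ?thesis using x by (simp add: pp_minus_pp)
qed

lemma compose_orth_commute:
  assumes "S \<in> orth" "T \<in> orth" shows "compose (carrier E) S T = compose (carrier E) T S"
  using orth_commute[OF assms] by (auto simp: compose_def)

end

lemma orth_vlatticeI: "vector_lattice E \<Longrightarrow> dedekind_complete E \<Longrightarrow> archimedean E \<Longrightarrow> orth_vlattice E"
  by (intro orth_vlattice.intro dc_vlattice.intro vlattice.intro dc_vlattice_axioms.intro orth_vlattice_axioms.intro)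

section \<open>The vector lattice of orthomorphisms\<close>

lemma Orth_simps:
  "add (Orth E) S T = (\<lambda>x\<in>carrier E. add E (S x) (T x))"
  "zero (Orth E) = (\<lambda>x\<in>carrier E. zero E)"
  "smult (Orth E) r T = (\<lambda>x\<in>carrier E. smult E r (T x))"
  "mult (Orth E) S T = compose (carrier E) S T"
  "one (Orth E) = (\<lambda>x\<in>carrier E. x)"
  "vle (Orth E) S T \<longleftrightarrow> (\<forall>x\<in>carrier E. vle E (zero E) x \<longrightarrow> vle E (S x) (T x))"
  unfolding Orth_def by simp_all

context orth_vlattice
begin

declare Orth_simps [simp]

lemma zero_orth: "(\<lambda>x\<in>carrier E. \<zero>) \<in> orth"
  using smult_orth[OF id_orth, of 0] by (simp cong: restrict_cong)

lemma neg_orth: "T \<in> orth \<Longrightarrow> (\<lambda>x\<in>carrier E. \<ominus> T x) \<in> orth"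
  using minus_orth[OF zero_orth] by (simp cong: restrict_cong)


lemma abelian_group_Orth: "abelian_group (Orth E)"
proof (rule abelian_groupI)
  show "\<exists>y\<in>orth. y \<oplus>\<^bsub>Orth E\<^esub> x = \<zero>\<^bsub>Orth E\<^esub>" if "x \<in> orth" for x
    using that by (intro bexI[OF _ neg_orth[OF that]]) (auto simp: l_neg intro!: restrict_ext)
  show "x \<oplus>\<^bsub>Orth E\<^esub> y \<oplus>\<^bsub>Orth E\<^esub> z = x \<oplus>\<^bsub>Orth E\<^esub> (y \<oplus>\<^bsub>Orth E\<^esub> z)" if "x \<in> orth" "y \<in> orth" "z \<in> orth" for x y z
    using that by (auto simp: a_assoc intro!: restrict_ext)
  show "x \<oplus>\<^bsub>Orth E\<^esub> y = y \<oplus>\<^bsub>Orth E\<^esub> x" if "x \<in> orth" "y \<in> orth" for x y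
    using that by (auto simp: a_comm intro!: restrict_ext)
  show "\<zero>\<^bsub>Orth E\<^esub> \<oplus>\<^bsub>Orth E\<^esub> x = x" if "x \<in> orth" for x
    using that restrict_orth_eq[OF that] by (simp cong: restrict_cong)
qed (use add_orth zero_orth in auto)

lemma module_Orth: "Module.module real_ring (Orth E)"
proof (rule moduleI[OF cring_real_ring abelian_group_Orth])
  show "\<one>\<^bsub>real_ring\<^esub> \<odot>\<^bsub>Orth E\<^esub> x = x" if "x \<in> orth" for x
    using that restrict_orth_eq[OF that] by (simp cong: restrict_cong)
qed (auto simp: smult_orth smult_add_left smult_add_right intro!: restrict_ext)

lemma orth_sup2:
  assumes S: "S \<in> orth" and T: "T \<in> orth"
  shows "\<exists>U\<in>orth. \<forall>x\<in>carrier E. \<zero> \<preceq> x \<longrightarrow> U x = S x \<curlyvee> T x"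
proof -
  note [simp] = S T
  obtain F where F: "F \<in> orth" "\<And>x. x \<in> carrier E \<Longrightarrow> \<zero> \<preceq> x \<Longrightarrow> F x = pp ((\<lambda>x\<in>carrier E. T x \<ominus> S x) x)"
    using orth_pp[OF minus_orth[OF T S]] by blast
  show ?thesis by (rule bexI[OF _ add_orth[OF S F(1)]]) (simp add: F(2) sup_eq_pp)
qed

lemma orth_inf2:
  assumes S: "S \<in> orth" and T: "T \<in> orth"
  shows "\<exists>U\<in>orth. \<forall>x\<in>carrier E. \<zero> \<preceq> x \<longrightarrow> U x = S x \<curlywedge> T x"
proof -
  note [simp] = S T
  obtain F where F: "F \<in> orth" "\<And>x. x \<in> carrier E \<Longrightarrow> \<zero> \<preceq> x \<Longrightarrow> F x = pp ((\<lambda>x\<in>carrier E. S x \<ominus> T x) x)"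
    using orth_pp[OF minus_orth[OF S T]] by blast
  have "S x \<ominus> pp (S x \<ominus> T x) = S x \<curlywedge> T x" if "x \<in> carrier E" for x
    using that by (simp add: minus_inf_eq_pp[symmetric] diff_normalize3)
  then show ?thesis by (intro bexI[OF _ minus_orth[OF S F(1)]]) (simp add: F(2))
qed

lemma lattice_Orth: "Lattice.lattice (ord_of (Orth E))"
proof -
  have sup: "\<exists>s. least (ord_of (Orth E)) s (Upper (ord_of (Orth E)) {S, T})" if ST: "S \<in> orth" "T \<in> orth" for S T
  proof -
    obtain U where "U \<in> orth" "\<forall>x\<in>carrier E. \<zero> \<preceq> x \<longrightarrow> U x = S x \<curlyvee> T x" using orth_sup2[OF ST] by blast
    then have "least (ord_of (Orth E)) U (Upper (ord_of (Orth E)) {S, T})"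
      using ST by (auto simp: least_def Upper_def sup_le_iff)
    then show ?thesis by blast
  qed
  have inf: "\<exists>s. greatest (ord_of (Orth E)) s (Lower (ord_of (Orth E)) {S, T})" if ST: "S \<in> orth" "T \<in> orth" for S T
  proof -
    obtain U where "U \<in> orth" "\<forall>x\<in>carrier E. \<zero> \<preceq> x \<longrightarrow> U x = S x \<curlywedge> T x" using orth_inf2[OF ST] by blast
    then have "greatest (ord_of (Orth E)) U (Lower (ord_of (Orth E)) {S, T})"
      using ST by (auto simp: greatest_def Lower_def le_inf_iff)
    then show ?thesis by blast
  qed
  show ?thesis
  proof (unfold_locales)
    show "x .=\<^bsub>ord_of (Orth E)\<^esub> y" if "x \<sqsubseteq>\<^bsub>ord_of (Orth E)\<^esub> y" "y \<sqsubseteq>\<^bsub>ord_of (Orth E)\<^esub> x"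
      "x \<in> carrier (ord_of (Orth E))" "y \<in> carrier (ord_of (Orth E))" for x y
      using that by (auto intro!: orth_eqI ord_antisym)
    show "x \<sqsubseteq>\<^bsub>ord_of (Orth E)\<^esub> z" if "x \<sqsubseteq>\<^bsub>ord_of (Orth E)\<^esub> y" "y \<sqsubseteq>\<^bsub>ord_of (Orth E)\<^esub> z"
      "x \<in> carrier (ord_of (Orth E))" "y \<in> carrier (ord_of (Orth E))" "z \<in> carrier (ord_of (Orth E))" for x y z
      using that by (auto intro: ord_trans[of "x u" "y u" "z u" for u])
  qed (use sup inf in auto)
qed

lemma vector_lattice_Orth: "vector_lattice (Orth E)"
  unfolding vector_lattice_def using module_Orth lattice_Orth by (auto intro: smult_mono)

text \<open>
  The pointwise infimum is additive: for \<open>N\<close> and \<open>N'\<close> in the family the infimum at \<open>x + y\<close> is below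
  \<open>(N \<curlywedge> N') (x + y) = (N \<curlywedge> N') x + (N \<curlywedge> N') y \<le> N x + N' y\<close>. It preserves bands as it is dominated by a
  member of the family.
\<close>

lemma orth_glb_nonneg:
  assumes M: "\<M> \<subseteq> orth" and ne: "\<M> \<noteq> {}" and pos: "\<And>M x. M \<in> \<M> \<Longrightarrow> x \<in> carrier E \<Longrightarrow> \<zero> \<preceq> x \<Longrightarrow> \<zero> \<preceq> M x"
  shows "\<exists>I\<in>orth. \<forall>x\<in>carrier E. \<zero> \<preceq> x \<longrightarrow> isglb ((\<lambda>M. M x) ` \<M>) (I x)"
proof -
  have MC [simp]: "M x \<in> carrier E" if "M \<in> \<M>" "x \<in> carrier E" for M x using that M by auto
  define f where "f x = (SOME s. isglb ((\<lambda>M. M x) ` \<M>) s)" for x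
  have f: "isglb ((\<lambda>M. M x) ` \<M>) (f x)" if "x \<in> carrier E" "\<zero> \<preceq> x" for x
  proof -
    have "\<exists>s. isglb ((\<lambda>M. M x) ` \<M>) s"
      by (rule glb_exists[where u = \<zero>]) (use that ne pos in auto)
    then show ?thesis unfolding f_def by (rule someI_ex)
  qed
  have fC [simp]: "f x \<in> carrier E" if "x \<in> carrier E" "\<zero> \<preceq> x" for x using isglbD(1)[OF f[OF that]] .
  have f_le: "f x \<preceq> M x" if "x \<in> carrier E" "\<zero> \<preceq> x" "M \<in> \<M>" for x M
    using isglbD(2)[OF f[OF that(1,2)]] that(3) by blast
  have f_gr: "u \<preceq> f x" if "x \<in> carrier E" "\<zero> \<preceq> x" "u \<in> carrier E" "\<And>M. M \<in> \<M> \<Longrightarrow> u \<preceq> M x" for x u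
    using isglbD(3)[OF f[OF that(1,2)] that(3)] that(4) by blast
  have f_pos: "\<zero> \<preceq> f x" if "x \<in> carrier E" "\<zero> \<preceq> x" for x
    using f_gr[OF that, of \<zero>] pos that by simp
  obtain M\<^sub>0 where M0: "M\<^sub>0 \<in> \<M>" using ne by blast
  have add: "f (x \<oplus> y) = f x \<oplus> f y" if [simp]: "x \<in> carrier E" "y \<in> carrier E" "\<zero> \<preceq> x" "\<zero> \<preceq> y" for x y
  proof (rule ord_antisym)
    show "f x \<oplus> f y \<preceq> f (x \<oplus> y)"
    proof (rule f_gr)
      fix N assume N: "N \<in> \<M>"
      then have "N (x \<oplus> y) = N x \<oplus> N y" using M by (auto intro: orth_add)
      then show "f x \<oplus> f y \<preceq> N (x \<oplus> y)" using N f_le by (simp add: add_mono')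
    qed simp_all
    have le: "f (x \<oplus> y) \<preceq> N x \<oplus> N' y" if N: "N \<in> \<M>" "N' \<in> \<M>" for N N'
    proof -
      obtain U where U: "U \<in> orth" "\<forall>x\<in>carrier E. \<zero> \<preceq> x \<longrightarrow> U x = N x \<curlywedge> N' x" using orth_inf2[of N N'] N M by blast
      have "f (x \<oplus> y) \<preceq> U (x \<oplus> y)" using f_le N U by (simp add: le_inf_iff)
      also have "\<dots> = U x \<oplus> U y" using U(1) by (simp add: orth_add)
      also have "\<dots> \<preceq> N x \<oplus> N' y" using U N by (intro add_mono') simp_all
      finally show ?thesis using U(1) N by simp
    qed
    have "f (x \<oplus> y) \<ominus> N x \<preceq> f y" if "N \<in> \<M>" for N
    proof (rule f_gr)
      show "f (x \<oplus> y) \<ominus> N x \<preceq> N' y" if "N' \<in> \<M>" for N'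
        using le[OF \<open>N \<in> \<M>\<close> that] \<open>N \<in> \<M>\<close> that a_comm[of "N' y" "N x"] by (simp add: le_diff_iff)
    qed (use that in simp_all)
    then have "f (x \<oplus> y) \<ominus> f y \<preceq> N x" if "N \<in> \<M>" for N
      using that by (simp add: le_diff_iff a_comm)
    then have "f (x \<oplus> y) \<ominus> f y \<preceq> f x" by (intro f_gr) simp_all
    then show "f (x \<oplus> y) \<preceq> f x \<oplus> f y" by (simp add: le_diff_iff)
  qed simp_all
  have sm: "f (r \<odot> x) = r \<odot> f x" if [simp]: "x \<in> carrier E" "\<zero> \<preceq> x" "0 \<le> r" for r x
  proof (cases "r = 0")
    case True
    have "f \<zero> \<preceq> M\<^sub>0 \<zero>" using f_le M0 by simp
    also have "M\<^sub>0 \<zero> = \<zero>" using M0 M by (auto intro: orth_zero)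
    finally have "f \<zero> = \<zero>" using f_pos by (intro ord_antisym) simp_all
    with True show ?thesis by simp
  next
    case False
    then have r: "0 < r" using that(3) by linarith
    have Mr: "N (r \<odot> x) = r \<odot> N x" if "N \<in> \<M>" for N using M that by (auto intro: orth_smult)
    have "(1/r) \<odot> f (r \<odot> x) \<preceq> N x" if "N \<in> \<M>" for N
      using smult_mono[OF f_le[OF _ _ that, of "r \<odot> x"], of "1/r"] that r by (simp add: Mr)
    then have "(1/r) \<odot> f (r \<odot> x) \<preceq> f x" by (intro f_gr) simp_all
    from smult_mono[OF this that(3)] r have 1: "f (r \<odot> x) \<preceq> r \<odot> f x" by simp
    have "r \<odot> f x \<preceq> f (r \<odot> x)"
      using f_le by (intro f_gr) (simp_all add: Mr smult_mono)
    with 1 show ?thesis by (intro ord_antisym) simp_all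
  qed
  have bands: "f x \<in> B" if B: "band E B" and x: "x \<in> B" "\<zero> \<preceq> x" for B x
  proof -
    have [simp]: "x \<in> carrier E" using bandD(1)[OF B] x by auto
    have "M\<^sub>0 x \<in> B" using M0 M orth_band[OF _ B x(1)] by blast
    then show ?thesis
      using f_pos[OF _ x(2)] f_le[OF _ x(2) M0] pos[OF M0 _ x(2)] x M0 by (intro bandD(7)[OF B, of "f x" "M\<^sub>0 x"]) simp_all
  qed
  obtain I where "I \<in> orth" "\<And>x. x \<in> carrier E \<Longrightarrow> \<zero> \<preceq> x \<Longrightarrow> I x = f x"
    by (rule orth_extend[of f]) (use fC add sm f_pos bands in auto)
  then show ?thesis using f by (intro bexI[of _ I]) simp_all
qed

lemma orth_lub:
  assumes M: "\<M> \<subseteq> orth" and ne: "\<M> \<noteq> {}" and U: "U \<in> orth"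
    and le: "\<And>M x. M \<in> \<M> \<Longrightarrow> x \<in> carrier E \<Longrightarrow> \<zero> \<preceq> x \<Longrightarrow> M x \<preceq> U x"
  shows "\<exists>I\<in>orth. \<forall>x\<in>carrier E. \<zero> \<preceq> x \<longrightarrow> islub ((\<lambda>M. M x) ` \<M>) (I x)"
proof -
  note [simp] = U
  have MC [simp]: "M x \<in> carrier E" if "M \<in> \<M>" "x \<in> carrier E" for M x using that M by auto
  let ?N = "(\<lambda>M. \<lambda>x\<in>carrier E. U x \<ominus> M x) ` \<M>"
  have "\<exists>I\<in>orth. \<forall>x\<in>carrier E. \<zero> \<preceq> x \<longrightarrow> isglb ((\<lambda>M. M x) ` ?N) (I x)"
    by (rule orth_glb_nonneg) (use M ne le in \<open>auto simp: diff_nonneg_iff intro!: minus_orth\<close>)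
  then obtain I where I: "I \<in> orth" "\<And>x. x \<in> carrier E \<Longrightarrow> \<zero> \<preceq> x \<Longrightarrow> isglb ((\<lambda>M. M x) ` ?N) (I x)" by blast
  note [simp] = I(1)
  have "islub ((\<lambda>M. M x) ` \<M>) (U x \<ominus> I x)" if [simp]: "x \<in> carrier E" "\<zero> \<preceq> x" for x
  proof (rule islubI)
    fix d assume "d \<in> (\<lambda>M. M x) ` \<M>"
    then obtain N where N: "N \<in> \<M>" "d = N x" by blast
    have "I x \<preceq> U x \<ominus> N x" using isglbD(2)[OF I(2)[OF that]] N by force
    then show "d \<preceq> U x \<ominus> I x" using N by (simp add: le_diff_iff a_comm)
  next
    fix u assume u [simp]: "u \<in> carrier E" and le: "\<And>d. d \<in> (\<lambda>M. M x) ` \<M> \<Longrightarrow> d \<preceq> u"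
    have "U x \<ominus> u \<preceq> I x"
    proof (rule isglbD(3)[OF I(2)[OF that]])
      fix d assume "d \<in> (\<lambda>M. M x) ` ?N"
      then obtain N where N: "N \<in> \<M>" "d = U x \<ominus> N x" by auto
      show "U x \<ominus> u \<preceq> d" using le[of "N x"] N by (simp add: le_diff_iff diff_normalize3)
    qed simp
    then show "U x \<ominus> I x \<preceq> u" by (simp add: le_diff_iff a_comm)
  qed simp
  then show ?thesis by (intro bexI[OF _ minus_orth[OF U I(1)]]) simp
qed

lemma dedekind_complete_Orth: "dedekind_complete (Orth E)"
  unfolding dedekind_complete_def
proof (intro allI impI, elim conjE)
  fix D assume D: "D \<subseteq> orth" "D \<noteq> {}" and "Upper (ord_of (Orth E)) D \<noteq> {}"
  then obtain U where "U \<in> Upper (ord_of (Orth E)) D" by blast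
  then have U: "U \<in> orth" "\<And>M x. M \<in> D \<Longrightarrow> x \<in> carrier E \<Longrightarrow> \<zero> \<preceq> x \<Longrightarrow> M x \<preceq> U x"
    using D(1) by (auto simp: Upper_def)
  have "\<exists>I\<in>orth. \<forall>x\<in>carrier E. \<zero> \<preceq> x \<longrightarrow> islub ((\<lambda>M. M x) ` D) (I x)"
    by (rule orth_lub[OF D U(1)]) (rule U(2))
  then obtain I where I: "I \<in> orth" "\<And>x. x \<in> carrier E \<Longrightarrow> \<zero> \<preceq> x \<Longrightarrow> islub ((\<lambda>M. M x) ` D) (I x)" by blast
  have 1: "M x \<preceq> I x" if "M \<in> D" "x \<in> carrier E" "\<zero> \<preceq> x" for M x
    using islubD(2)[OF I(2)[OF that(2,3)]] that(1) by blast
  have 2: "I x \<preceq> V x" if "V \<in> orth" "\<And>M. M \<in> D \<Longrightarrow> M x \<preceq> V x" "x \<in> carrier E" "\<zero> \<preceq> x" for V x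
    using islubD(3)[OF I(2)[OF that(3,4)]] that by blast
  have "I x \<preceq> V x" if "V \<in> Upper (ord_of (Orth E)) D" "x \<in> carrier E" "\<zero> \<preceq> x" for V x
    by (rule 2) (use that D(1) in \<open>auto simp: Upper_def\<close>)
  then have "least (ord_of (Orth E)) I (Upper (ord_of (Orth E)) D)"
    using I(1) 1 by (auto simp: least_def) (auto simp: Upper_def)
  then show "\<exists>s. least (ord_of (Orth E)) s (Upper (ord_of (Orth E)) D)" by blast
qed

lemma archimedean_Orth: "archimedean (Orth E)"
  unfolding archimedean_def
proof (intro ballI impI, elim conjE)
  fix S T assume ST [simp]: "S \<in> orth" "T \<in> orth" and S: "\<zero>\<^bsub>Orth E\<^esub> \<preceq>\<^bsub>Orth E\<^esub> S"
    and le: "\<forall>n::nat. real n \<odot>\<^bsub>Orth E\<^esub> S \<preceq>\<^bsub>Orth E\<^esub> T"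
  have "S x = \<zero>" if "x \<in> carrier E" "\<zero> \<preceq> x" for x
    using S le that by (intro arch_zero[of "S x" "T x"]) simp_all
  then show "S = \<zero>\<^bsub>Orth E\<^esub>" using zero_orth by (intro orth_eqI) simp_all
qed

lemma orth_vlattice_Orth: "orth_vlattice (Orth E)"
  by (intro orth_vlattice.intro dc_vlattice.intro vlattice.intro dc_vlattice_axioms.intro orth_vlattice_axioms.intro
    vector_lattice_Orth dedekind_complete_Orth archimedean_Orth)

interpretation O: orth_vlattice "Orth E"
  by (rule orth_vlattice_Orth)

lemma Orth_minus: assumes [simp]: "S \<in> orth" "T \<in> orth" shows "S \<ominus>\<^bsub>Orth E\<^esub> T = (\<lambda>x\<in>carrier E. S x \<ominus> T x)"
proof -
  have "(\<lambda>x\<in>carrier E. S x \<ominus> T x) \<oplus>\<^bsub>Orth E\<^esub> T = S"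
    using restrict_orth_eq[of S] by (simp cong: restrict_cong)
  then show ?thesis using O.minus_eq_iff(1)[of S T "\<lambda>x\<in>carrier E. S x \<ominus> T x"] minus_orth[of S T] by simp
qed

lemma Orth_sup:
  assumes [simp]: "S \<in> orth" "T \<in> orth" "x \<in> carrier E" "\<zero> \<preceq> x"
  shows "(S \<squnion>\<^bsub>ord_of (Orth E)\<^esub> T) x = S x \<curlyvee> T x"
proof -
  obtain U where U: "U \<in> orth" "\<forall>x\<in>carrier E. \<zero> \<preceq> x \<longrightarrow> U x = S x \<curlyvee> T x" using orth_sup2[of S T] by auto
  then have "S \<squnion>\<^bsub>ord_of (Orth E)\<^esub> T = U" by (intro O.sup_eqI) (auto simp: sup_le_iff)
  then show ?thesis using U by simp
qed

lemma Orth_inf: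
  assumes [simp]: "S \<in> orth" "T \<in> orth" "x \<in> carrier E" "\<zero> \<preceq> x"
  shows "(S \<sqinter>\<^bsub>ord_of (Orth E)\<^esub> T) x = S x \<curlywedge> T x"
proof -
  obtain U where U: "U \<in> orth" "\<forall>x\<in>carrier E. \<zero> \<preceq> x \<longrightarrow> U x = S x \<curlywedge> T x" using orth_inf2[of S T] by auto
  then have "S \<sqinter>\<^bsub>ord_of (Orth E)\<^esub> T = U" by (intro O.inf_eqI) (auto simp: le_inf_iff)
  then show ?thesis using U by simp
qed

lemma Orth_abs:
  assumes [simp]: "S \<in> orth" "x \<in> carrier E" "\<zero> \<preceq> x"
  shows "vabs (Orth E) S x = av (S x)"
proof -
  have "\<ominus>\<^bsub>Orth E\<^esub> S = (\<lambda>x\<in>carrier E. \<ominus> S x)"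
    using Orth_minus[OF zero_orth, of S] O.minus_zero_left[of S] by (simp cong: restrict_cong)
  then show ?thesis using neg_orth[of S] by (simp add: vabs_def Orth_sup)
qed

lemma Orth_abs_le:
  assumes [simp]: "S \<in> orth" "x \<in> carrier E"
  shows "av (S x) \<preceq> vabs (Orth E) S (av x)"
proof -
  have [simp]: "vabs (Orth E) S \<in> orth" by (rule O.av_closed) simp
  have "av (S (pp x \<ominus> pp (\<ominus> x))) \<preceq> av (S (pp x)) \<oplus> av (S (pp (\<ominus> x)))"
    using av_triangle_minus[of "S (pp x)" "S (pp (\<ominus> x))"] by (simp add: orth_minus)
  also have "\<dots> = vabs (Orth E) S (pp x \<oplus> pp (\<ominus> x))" by (simp add: Orth_abs orth_add)
  finally show ?thesis by (simp add: pp_minus_pp av_eq_pp[symmetric])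
qed

lemma Orth_glb_pointwise:
  assumes D: "D \<subseteq> orth" "D \<noteq> {}" and I: "vlattice.isglb (Orth E) D (\<lambda>x\<in>carrier E. \<zero>)" and x: "x \<in> carrier E" "\<zero> \<preceq> x"
  shows "isglb ((\<lambda>M. M x) ` D) \<zero>"
proof -
  have pos: "\<zero> \<preceq> M x" if "M \<in> D" "x \<in> carrier E" "\<zero> \<preceq> x" for M x
    using O.isglbD(2)[OF I that(1)] that by simp
  have "\<exists>J\<in>orth. \<forall>x\<in>carrier E. \<zero> \<preceq> x \<longrightarrow> isglb ((\<lambda>M. M x) ` D) (J x)"
    by (rule orth_glb_nonneg[OF D]) (rule pos)
  then obtain J where J: "J \<in> orth" "\<And>x. x \<in> carrier E \<Longrightarrow> \<zero> \<preceq> x \<Longrightarrow> isglb ((\<lambda>M. M x) ` D) (J x)" by blast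
  have "J \<preceq>\<^bsub>Orth E\<^esub> (\<lambda>x\<in>carrier E. \<zero>)"
    by (rule O.isglbD(3)[OF I J(1)]) (use isglbD(2)[OF J(2)] in auto)
  then have "J x \<preceq> \<zero>" using x by simp
  moreover have "\<zero> \<preceq> J x" by (rule isglbD(3)[OF J(2)[OF x]]) (use pos x in auto)
  ultimately have "J x = \<zero>" using J(1) x by (intro ord_antisym) simp_all
  then show ?thesis using J(2)[OF x] by simp
qed

end

section \<open>Uniqueness of Hausdorff uo-Lebesgue topologies\<close>

lemma directed_nat: "directed (UNIV::nat set) (\<le>)"
  unfolding directed_def by (auto intro!: reflp_onI transp_onI) (metis max.cobounded1 max.cobounded2)

context vlattice
begin

text \<open>
  Solid neighbourhoods of zero. They are kept apart from open sets because intersecting and halving keeps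
  them solid, whereas the interior of a solid set need not be at hand.
\<close>

definition snb :: "'a topology \<Rightarrow> 'a set \<Rightarrow> bool" where
  "snb \<tau> V \<longleftrightarrow> solid_in E V \<and> (\<exists>W. openin \<tau> W \<and> \<zero> \<in> W \<and> W \<subseteq> V)"

lemma snb_closed: "snb \<tau> V \<Longrightarrow> x \<in> V \<Longrightarrow> x \<in> carrier E"
  by (auto simp: snb_def solid_in_def)

lemma snb_zero: "snb \<tau> V \<Longrightarrow> \<zero> \<in> V"
  by (auto simp: snb_def)

lemma snb_solid: "snb \<tau> V \<Longrightarrow> y \<in> V \<Longrightarrow> x \<in> carrier E \<Longrightarrow> av x \<preceq> av y \<Longrightarrow> x \<in> V"
  by (auto simp: snb_def solid_in_def)

lemma snb_mono: "snb \<tau> V \<Longrightarrow> y \<in> V \<Longrightarrow> \<zero> \<preceq> x \<Longrightarrow> x \<preceq> y \<Longrightarrow> x \<in> carrier E \<Longrightarrow> x \<in> V"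
  using ord_trans[of \<zero> x y] snb_closed[of \<tau> V y] by (intro snb_solid[of \<tau> V y x]) simp_all

lemma snb_inter:
  assumes "snb \<tau> V" "snb \<tau> V'" shows "snb \<tau> (V \<inter> V')"
proof -
  obtain W W' where "openin \<tau> W" "\<zero> \<in> W" "W \<subseteq> V" "openin \<tau> W'" "\<zero> \<in> W'" "W' \<subseteq> V'" using assms by (auto simp: snb_def)
  then have "openin \<tau> (W \<inter> W') \<and> \<zero> \<in> W \<inter> W' \<and> W \<inter> W' \<subseteq> V \<inter> V'" by auto
  moreover have "solid_in E (V \<inter> V')" using assms unfolding snb_def solid_in_def by blast
  ultimately show ?thesis unfolding snb_def by blast
qed

lemma snb_finite_inter: "(\<And>k. k \<le> n \<Longrightarrow> snb \<tau> (V k)) \<Longrightarrow> snb \<tau> (\<Inter>k\<le>(n::nat). V k)"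
proof (induction n)
  case (Suc n)
  then have "snb \<tau> (V (Suc n) \<inter> (\<Inter>k\<le>n. V k))" by (intro snb_inter) auto
  then show ?case by (simp add: atMost_Suc)
qed simp

lemma snb_exists:
  assumes "locally_solid_linear_topology E \<tau>" "openin \<tau> U" "\<zero> \<in> U"
  shows "\<exists>V. snb \<tau> V \<and> V \<subseteq> U"
proof -
  have "\<exists>V W. solid_in E V \<and> V \<subseteq> U \<and> openin \<tau> W \<and> \<zero> \<in> W \<and> W \<subseteq> V"
    using assms by (simp add: locally_solid_linear_topology_def)
  then show ?thesis by (auto simp: snb_def)
qed

lemma add_nbhd:
  assumes ls: "locally_solid_linear_topology E \<tau>" and U: "openin \<tau> U" and xy: "x \<in> carrier E" "y \<in> carrier E" "x \<oplus> y \<in> U"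
  shows "\<exists>A B. openin \<tau> A \<and> openin \<tau> B \<and> x \<in> A \<and> y \<in> B \<and> (\<forall>a\<in>A. \<forall>b\<in>B. a \<oplus> b \<in> U)"
proof -
  have top: "topspace \<tau> = carrier E" and c: "continuous_map (prod_topology \<tau> \<tau>) \<tau> (\<lambda>(x, y). x \<oplus> y)"
    using ls by (simp_all add: locally_solid_linear_topology_def)
  let ?S = "{p \<in> topspace (prod_topology \<tau> \<tau>). (case p of (x, y) \<Rightarrow> x \<oplus> y) \<in> U}"
  have o: "openin (prod_topology \<tau> \<tau>) ?S"
    by (rule openin_continuous_map_preimage[OF c U])
  have m: "(x, y) \<in> ?S" using xy top by simp
  obtain A B where AB: "openin \<tau> A" "openin \<tau> B" "x \<in> A" "y \<in> B" "A \<times> B \<subseteq> ?S"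
    using openin_prod_topology_alt[THEN iffD1, rule_format, OF o m] by (elim exE conjE)
  have "a \<oplus> b \<in> U" if "a \<in> A" "b \<in> B" for a b using subsetD[OF AB(5), of "(a, b)"] that by simp
  then show ?thesis using AB(1-4) by blast
qed

lemma snb_halve:
  assumes ls: "locally_solid_linear_topology E \<tau>" and V: "snb \<tau> V"
  shows "\<exists>V'. snb \<tau> V' \<and> (\<forall>x\<in>V'. \<forall>y\<in>V'. x \<oplus> y \<in> V)"
proof -
  obtain W where W: "openin \<tau> W" "\<zero> \<in> W" "W \<subseteq> V" using V by (auto simp: snb_def)
  then obtain A B where AB: "openin \<tau> A" "openin \<tau> B" "\<zero> \<in> A" "\<zero> \<in> B" "\<forall>a\<in>A. \<forall>b\<in>B. a \<oplus> b \<in> W"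
    using add_nbhd[OF ls W(1), of \<zero> \<zero>] by auto
  then have "openin \<tau> (A \<inter> B)" "\<zero> \<in> A \<inter> B" by auto
  then obtain V' where "snb \<tau> V'" "V' \<subseteq> A \<inter> B" using snb_exists[OF ls] by blast
  then show ?thesis using AB(5) W(3) by blast
qed

lemma openin_iff_snb:
  assumes ls: "locally_solid_linear_topology E \<tau>"
  shows "openin \<tau> U \<longleftrightarrow> U \<subseteq> carrier E \<and> (\<forall>x\<in>U. \<exists>V. snb \<tau> V \<and> (\<forall>v\<in>V. x \<oplus> v \<in> U))"
proof
  assume U: "openin \<tau> U"
  then have UC: "U \<subseteq> carrier E" using openin_subset[OF U] ls by (simp add: locally_solid_linear_topology_def)
  have "\<exists>V. snb \<tau> V \<and> (\<forall>v\<in>V. x \<oplus> v \<in> U)" if x: "x \<in> U" for x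
  proof -
    have [simp]: "x \<in> carrier E" using x UC by auto
    obtain A B where AB: "openin \<tau> B" "x \<in> A" "\<zero> \<in> B" "\<forall>a\<in>A. \<forall>b\<in>B. a \<oplus> b \<in> U"
      using add_nbhd[OF ls U, of x \<zero>] x by auto
    obtain V where "snb \<tau> V" "V \<subseteq> B" using snb_exists[OF ls AB(1,3)] by blast
    then show ?thesis using AB by blast
  qed
  then show "U \<subseteq> carrier E \<and> (\<forall>x\<in>U. \<exists>V. snb \<tau> V \<and> (\<forall>v\<in>V. x \<oplus> v \<in> U))" using UC by blast
next
  assume U: "U \<subseteq> carrier E \<and> (\<forall>x\<in>U. \<exists>V. snb \<tau> V \<and> (\<forall>v\<in>V. x \<oplus> v \<in> U))"
  have "\<exists>T. openin \<tau> T \<and> x \<in> T \<and> T \<subseteq> U" if x: "x \<in> U" for x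
  proof -
    have [simp]: "x \<in> carrier E" using x U by auto
    obtain V where V: "snb \<tau> V" "\<forall>v\<in>V. x \<oplus> v \<in> U" using U x by blast
    obtain W where W: "openin \<tau> W" "\<zero> \<in> W" "W \<subseteq> V" using V by (auto simp: snb_def)
    obtain A B where AB: "openin \<tau> B" "\<ominus> x \<in> A" "x \<in> B" "\<forall>a\<in>A. \<forall>b\<in>B. a \<oplus> b \<in> W"
      using add_nbhd[OF ls W(1), of "\<ominus> x" x] W(2) by (auto simp: l_neg)
    have "b \<in> U" if b: "b \<in> B" for b
    proof -
      have [simp]: "b \<in> carrier E"
        using openin_subset[OF AB(1)] b ls by (auto simp: locally_solid_linear_topology_def)
      have "x \<oplus> (\<ominus> x \<oplus> b) \<in> U" using AB b W(3) V(2) by blast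
      then show ?thesis by (simp add: diff_normalize2)
    qed
    then show ?thesis using AB by blast
  qed
  then show "openin \<tau> U" using openin_subopen by blast
qed

text \<open>
  Normal sequences: the countable fragments of a locally solid topology. The point is that the elements
  common to all its members form an ideal that is closed under the suprema a Lebesgue topology controls.
\<close>

definition nseq :: "'a topology \<Rightarrow> (nat \<Rightarrow> 'a set) \<Rightarrow> bool" where
  "nseq \<tau> U \<longleftrightarrow> (\<forall>n. snb \<tau> (U n)) \<and> (\<forall>n. \<forall>x\<in>U (Suc n). \<forall>y\<in>U (Suc n). x \<oplus> y \<in> U n)"

lemma nseqD:
  assumes "nseq \<tau> U"
  shows "snb \<tau> (U n)" "x \<in> U (Suc n) \<Longrightarrow> y \<in> U (Suc n) \<Longrightarrow> x \<oplus> y \<in> U n"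
  using assms by (auto simp: nseq_def)

lemma nseq_decreasing:
  assumes U: "nseq \<tau> U" and "m \<le> n" shows "U n \<subseteq> U m"
proof -
  have "U (Suc k) \<subseteq> U k" for k
  proof
    fix x assume x: "x \<in> U (Suc k)"
    then have "x \<oplus> \<zero> \<in> U k" using nseqD(2)[OF U] snb_zero[OF nseqD(1)[OF U]] by blast
    then show "x \<in> U k" using snb_closed[OF nseqD(1)[OF U] x] by simp
  qed
  then show ?thesis using assms(2) by (rule lift_Suc_antimono_le)
qed

lemma nseq_exists:
  assumes ls: "locally_solid_linear_topology E \<tau>" and V: "snb \<tau> V"
  shows "\<exists>U. nseq \<tau> U \<and> U 0 = V"
proof -
  have "\<exists>U. \<forall>n. (snb \<tau> (U n) \<and> (n = 0 \<longrightarrow> U n = V)) \<and> (\<forall>x\<in>U (Suc n). \<forall>y\<in>U (Suc n). x \<oplus> y \<in> U n)"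
    by (rule dependent_nat_choice) (use V snb_halve[OF ls] in auto)
  then show ?thesis unfolding nseq_def by blast
qed

primrec psup :: "nat \<Rightarrow> (nat \<Rightarrow> 'a) \<Rightarrow> 'a" where
  "psup 0 x = x 0"
| "psup (Suc k) x = x 0 \<curlyvee> psup k (\<lambda>i. x (Suc i))"

lemma psup_closed [simp]: "(\<And>i. x i \<in> carrier E) \<Longrightarrow> psup k x \<in> carrier E"
  by (induction k arbitrary: x) auto

lemma psup_le_iff:
  assumes "\<And>i. x i \<in> carrier E" "u \<in> carrier E"
  shows "psup k x \<preceq> u \<longleftrightarrow> (\<forall>i\<le>k. x i \<preceq> u)"
  using assms(1)
proof (induction k arbitrary: x)
  case 0 then show ?case by simp
next
  case (Suc k)
  have "(\<forall>i\<le>Suc k. x i \<preceq> u) \<longleftrightarrow> x 0 \<preceq> u \<and> (\<forall>i\<le>k. x (Suc i) \<preceq> u)"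
    by (metis Suc_le_mono le0 not0_implies_Suc)
  then show ?case using Suc assms(2) by (simp add: sup_le_iff)
qed

text \<open>
  A supremum of positive elements is below their sum, and \<open>U (n+1) + U (n+2) + \<dots> + U (n+k)\<close> is contained in \<open>U n\<close>.
\<close>

lemma psup_nseq:
  assumes U: "nseq \<tau> U" and "\<And>i. x i \<in> carrier E" "\<And>i. \<zero> \<preceq> x i" "\<And>i. x i \<in> U (Suc (n + i))"
  shows "psup k x \<in> U n \<and> \<zero> \<preceq> psup k x"
  using assms(2-)
proof (induction k arbitrary: x n)
  case 0
  then show ?case using nseq_decreasing[OF U, of n "Suc n"] by (metis add_0_right le_SucI le_refl psup.simps(1) subsetD)
next
  case (Suc k)
  let ?r = "psup k (\<lambda>i. x (Suc i))"
  note [simp] = Suc.prems(1,2)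
  have x_shift: "x (Suc i) \<in> U (Suc (Suc n + i))" for i using Suc.prems(3)[of "Suc i"] by simp
  have r: "?r \<in> U (Suc n)" "\<zero> \<preceq> ?r" using Suc.IH[of "\<lambda>i. x (Suc i)" "Suc n"] x_shift by simp_all
  have "x 0 \<in> U (Suc n)" using Suc.prems(3)[of 0] by simp
  then have "x 0 \<oplus> ?r \<in> U n" using nseqD(2)[OF U] r by blast
  moreover have "x 0 \<curlyvee> ?r \<preceq> x 0 \<oplus> ?r" using le_add_nonneg[of ?r "x 0"] le_add_nonneg[of "x 0" ?r] r by (simp add: sup_le_iff)
  moreover have "\<zero> \<preceq> x 0 \<curlyvee> ?r" using ord_trans[OF Suc.prems(2) sup_ge(1)[of "x 0" ?r]] by simp
  ultimately show ?case using snb_mono[OF nseqD(1)[OF U]] by simp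
qed

end

context dc_vlattice
begin

text \<open>
  A downward directed set with infimum zero, indexed by itself, is an order null net.
\<close>

lemma Lebesgue_down:
  assumes \<tau>: "uo_Lebesgue E \<tau>" and D: "D \<subseteq> carrier E" "D \<noteq> {}"
    and dir: "\<And>a b. a \<in> D \<Longrightarrow> b \<in> D \<Longrightarrow> \<exists>c\<in>D. c \<preceq> a \<and> c \<preceq> b" and g: "isglb D \<zero>" and V: "snb \<tau> V"
  shows "\<exists>d\<in>D. d \<in> V"
proof -
  let ?leq = "\<lambda>u v. v \<preceq> u"
  have DC: "d \<in> carrier E" if "d \<in> D" for d using D that by auto
  have pos: "\<zero> \<preceq> d" if "d \<in> D" for d using isglbD(2)[OF g that] .
  have d: "directed D ?leq"
    unfolding directed_def
  proof (intro conjI reflp_onI transp_onI ballI)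
    show "c \<preceq> a" if "a \<in> D" "b \<in> D" "c \<in> D" "b \<preceq> a" "c \<preceq> b" for a b c
      using ord_trans[OF that(5,4)] DC that by blast
  qed (use D(2) dir DC in auto)
  have "onull D ?leq (\<lambda>a. av (a \<ominus> \<zero>) \<curlywedge> y)" if y: "y \<in> carrier E" for y
    unfolding onull_def
  proof (intro ballI impI)
    fix w assume w: "w \<in> carrier E" "\<forall>e\<in>evub D ?leq (\<lambda>a. av (a \<ominus> \<zero>) \<curlywedge> y). w \<preceq> e"
    have "d \<in> evub D ?leq (\<lambda>a. av (a \<ominus> \<zero>) \<curlywedge> y)" if d: "d \<in> D" for d
    proof (rule evubI[of _ d])
      fix a assume a: "a \<in> D" "a \<preceq> d"
      have "a \<curlywedge> y \<preceq> a" using DC[OF a(1)] y by simp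
      then show "av (a \<ominus> \<zero>) \<curlywedge> y \<preceq> d" using a DC[OF a(1)] DC[OF d] y pos[OF a(1)] ord_trans[of "a \<curlywedge> y" a d] by simp
    qed (use d DC in auto)
    then show "w \<preceq> \<zero>" using isglbD(3)[OF g w(1)] w(2) by blast
  qed
  then have "uo_conv E D ?leq (\<lambda>u. u) \<zero>" using uo_conv_iff[of D ?leq "\<lambda>u. u" \<zero>, OF d] DC by simp
  moreover have "net_in E D ?leq (\<lambda>u. u)" using d DC by (auto simp: net_in_def)
  ultimately have lim: "limitin \<tau> (\<lambda>u. u) \<zero> (tail_filter D ?leq)" using uo_Lebesgue_any_index[OF \<tau>] by blast
  obtain W where W: "openin \<tau> W" "\<zero> \<in> W" "W \<subseteq> V" using V by (auto simp: snb_def)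
  then have "eventually (\<lambda>u. u \<in> W) (tail_filter D ?leq)" using lim by (simp add: limitin_def)
  then obtain d where "d \<in> D" "\<forall>b\<in>D. b \<preceq> d \<longrightarrow> b \<in> W" unfolding eventually_tail_filter[OF d] by blast
  then show ?thesis using DC W(3) by (intro bexI[of _ d]) auto
qed

lemma nseq_lub:
  assumes \<tau>: "uo_Lebesgue E \<tau>" and U: "nseq \<tau> U"
    and xC [simp]: "\<And>i. x i \<in> carrier E" and x: "\<And>i. \<zero> \<preceq> x i" "\<And>i. x i \<in> U (Suc (Suc (n + i)))"
    and z: "islub (range x) z"
  shows "z \<in> U n"
proof -
  note [simp] = islubD(1)[OF z]
  have "psup k x \<in> U (Suc n) \<and> \<zero> \<preceq> psup k x" for k
    by (rule psup_nseq[OF U xC x(1)]) (use x(2) in simp)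
  then have ps: "psup k x \<in> U (Suc n)" "\<zero> \<preceq> psup k x" for k by blast+
  have z': "islub (range (\<lambda>k. psup k x)) z"
  proof (rule islubI)
    show "d \<preceq> z" if "d \<in> range (\<lambda>k. psup k x)" for d
      using that islubD(2)[OF z] by (auto simp: psup_le_iff)
    show "z \<preceq> u" if [simp]: "u \<in> carrier E" and u: "\<And>d. d \<in> range (\<lambda>k. psup k x) \<Longrightarrow> d \<preceq> u" for u
    proof (rule islubD(3)[OF z])
      fix d assume "d \<in> range x"
      then obtain k where k: "d = x k" by blast
      have "psup k x \<preceq> u" using u by blast
      then show "d \<preceq> u" by (simp add: psup_le_iff k)
    qed simp
  qed simp
  let ?D = "(\<lambda>d. z \<ominus> d) ` range (\<lambda>k. psup k x)"
  have mono: "psup j x \<preceq> psup k x" if "j \<le> k" for j k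
  proof -
    have "psup k x \<preceq> psup k x" by simp
    then have "\<forall>i\<le>k. x i \<preceq> psup k x" using psup_le_iff[of x "psup k x" k] by simp
    then show ?thesis using psup_le_iff[of x "psup k x" j] that by simp
  qed
  have "\<exists>d\<in>?D. d \<in> U (Suc n)"
  proof (rule Lebesgue_down[OF \<tau> _ _ _ _ nseqD(1)[OF U]])
    show "isglb ?D \<zero>" by (rule isglb_diff[OF _ z']) auto
    fix a b assume "a \<in> ?D" "b \<in> ?D"
    then obtain j k where jk: "a = z \<ominus> psup j x" "b = z \<ominus> psup k x" by blast
    have "z \<ominus> psup (max j k) x \<preceq> a" "z \<ominus> psup (max j k) x \<preceq> b"
      using mono[of j "max j k"] mono[of k "max j k"] by (simp_all add: jk le_diff_iff diff_normalize3)
    then show "\<exists>c\<in>?D. c \<preceq> a \<and> c \<preceq> b" by blast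
  qed auto
  then obtain k where "z \<ominus> psup k x \<in> U (Suc n)" by blast
  then have "(z \<ominus> psup k x) \<oplus> psup k x \<in> U n" using nseqD(2)[OF U] ps(1) by blast
  then show ?thesis by simp
qed

subsection \<open>Topologies coincide on order intervals\<close>

text \<open>
  To a normal sequence \<open>U\<close> of \<open>\<tau>\<close> belongs \<open>p U\<close>, the largest element below \<open>e\<close> that lies in all \<open>U n\<close>. These elements
  are directed downwards, and their infimum is zero because \<open>\<tau>\<close> is Hausdorff. As \<open>\<sigma>\<close> is Lebesgue, some \<open>p U\<close> is as small
  as desired with respect to \<open>\<sigma>\<close>, and by diagonalization there is one normal sequence \<open>W\<close> with \<open>p W\<close> in all members of a
  given normal sequence of \<open>\<sigma>\<close>. If each \<open>W n\<close> contained an element \<open>x n \<le> e\<close> outside of \<open>V\<close>, then the limit superior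
  of these elements would be below \<open>p W\<close>, so it would be small for \<open>\<sigma>\<close>; but the suprema of the tails
  approach it in \<open>\<sigma>\<close> and dominate the \<open>x n\<close>.
\<close>

lemma Amemiya:
  assumes \<tau>: "Hausdorff_uo_Lebesgue E \<tau>" and \<sigma>: "uo_Lebesgue E \<sigma>"
    and [simp]: "e \<in> carrier E" "\<zero> \<preceq> e" and V: "snb \<sigma> V"
  shows "\<exists>W. snb \<tau> W \<and> (\<forall>x\<in>W. \<zero> \<preceq> x \<and> x \<preceq> e \<longrightarrow> x \<in> V)"
proof -
  have \<tau>uo: "uo_Lebesgue E \<tau>" and haus: "Hausdorff_space \<tau>" using \<tau> by (auto simp: Hausdorff_uo_Lebesgue_def)
  have ls: "locally_solid_linear_topology E \<tau>" using \<tau>uo by (simp add: uo_Lebesgue_def)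
  have top: "topspace \<tau> = carrier E" using ls by (simp add: locally_solid_linear_topology_def)
  have ls\<sigma>: "locally_solid_linear_topology E \<sigma>" using \<sigma> by (simp add: uo_Lebesgue_def)
  define N where "N U = {z \<in> carrier E. \<zero> \<preceq> z \<and> z \<preceq> e \<and> (\<forall>n. z \<in> U n)}" for U :: "nat \<Rightarrow> 'a set"
  have NC: "N U \<subseteq> carrier E" for U by (auto simp: N_def)
  have N0: "\<zero> \<in> N U" if "nseq \<tau> U" for U using snb_zero[OF nseqD(1)[OF that]] by (simp add: N_def)
  define p where "p U = (SOME s. islub (N U) s)" for U
  have p: "islub (N U) (p U)" if "nseq \<tau> U" for U
  proof -
    have "N U \<noteq> {}" using N0[OF that] by blast
    then have "\<exists>s. islub (N U) s" by (rule lub_exists[OF NC, where u = e]) (simp_all add: N_def)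
    then show ?thesis unfolding p_def by (rule someI_ex)
  qed
  have pN: "p U \<in> N U" if U: "nseq \<tau> U" for U
  proof -
    note [simp] = islubD(1)[OF p[OF U]]
    let ?D = "(\<lambda>d. p U \<ominus> d) ` N U"
    have "p U \<in> U n" for n
    proof -
      have "\<exists>d\<in>?D. d \<in> U (Suc n)"
      proof (rule Lebesgue_down[OF \<tau>uo _ _ _ _ nseqD(1)[OF U]])
        show "isglb ?D \<zero>" by (rule isglb_diff[OF NC p[OF U]])
        show "?D \<subseteq> carrier E" using NC[of U] by (auto simp: subset_iff)
        show "?D \<noteq> {}" using N0[OF U] by blast
        fix a b assume "a \<in> ?D" "b \<in> ?D"
        then obtain c d where cd: "c \<in> N U" "d \<in> N U" "a = p U \<ominus> c" "b = p U \<ominus> d" by blast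
        have [simp]: "c \<in> carrier E" "d \<in> carrier E" "\<zero> \<preceq> c" "\<zero> \<preceq> d" using cd by (auto simp: N_def)
        have cd0: "\<zero> \<preceq> c \<curlyvee> d" using ord_trans[OF _ sup_ge(1)[of c d], of \<zero>] by simp
        have cdle: "c \<curlyvee> d \<preceq> c \<oplus> d" using le_add_nonneg[of d c] le_add_nonneg[of c d] by (simp add: sup_le_iff)
        have "c \<curlyvee> d \<in> U n" for n
        proof (rule snb_mono[OF nseqD(1)[OF U] _ cd0 cdle])
          show "c \<oplus> d \<in> U n" using cd nseqD(2)[OF U] by (auto simp: N_def)
        qed simp
        moreover have "c \<curlyvee> d \<preceq> e" using cd by (simp add: sup_le_iff N_def)
        ultimately have "c \<curlyvee> d \<in> N U" using cd0 by (simp add: N_def)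
        moreover have "p U \<ominus> (c \<curlyvee> d) \<preceq> a" "p U \<ominus> (c \<curlyvee> d) \<preceq> b"
          by (simp_all add: cd(3,4) le_diff_iff diff_normalize3)
        ultimately show "\<exists>c\<in>?D. c \<preceq> a \<and> c \<preceq> b" by blast
      qed
      then obtain d where d: "d \<in> N U" "p U \<ominus> d \<in> U (Suc n)" by blast
      have [simp]: "d \<in> carrier E" using d NC by auto
      have "d \<in> U (Suc n)" using d(1) by (simp add: N_def)
      then have "(p U \<ominus> d) \<oplus> d \<in> U n" using nseqD(2)[OF U d(2)] by blast
      then show ?thesis by simp
    qed
    moreover have "p U \<preceq> e" by (rule islubD(3)[OF p[OF U]]) (auto simp: N_def)
    moreover have "\<zero> \<preceq> p U" by (rule islubD(2)[OF p[OF U] N0[OF U]])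
    ultimately show ?thesis by (simp add: N_def)
  qed
  have p_mono: "p U \<preceq> p U'" if U: "nseq \<tau> U" and U': "nseq \<tau> U'" and sub: "\<And>z n. (\<forall>n. z \<in> U n) \<Longrightarrow> z \<in> U' n" for U U'
    using pN[OF U] sub by (intro islubD(2)[OF p[OF U']]) (auto simp: N_def)
  let ?D = "p ` {U. nseq \<tau> U}"
  have ex\<tau>: "\<exists>U. nseq \<tau> U"
  proof -
    have "openin \<tau> (carrier E)" using openin_topspace[of \<tau>] by (simp add: top)
    then obtain V where "snb \<tau> V" using snb_exists[OF ls, of "carrier E"] by blast
    then show ?thesis using nseq_exists[OF ls] by blast
  qed
  have D_dir: "\<exists>c\<in>?D. c \<preceq> a \<and> c \<preceq> b" if ab: "a \<in> ?D" "b \<in> ?D" for a b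
  proof -
    obtain U U' where U: "nseq \<tau> U" "nseq \<tau> U'" "a = p U" "b = p U'" using ab by blast
    have "nseq \<tau> (\<lambda>n. U n \<inter> U' n)" unfolding nseq_def
      using nseqD[OF U(1)] nseqD[OF U(2)] by (auto intro: snb_inter)
    moreover from this have "p (\<lambda>n. U n \<inter> U' n) \<preceq> a" "p (\<lambda>n. U n \<inter> U' n) \<preceq> b"
      unfolding U(3,4) by (rule p_mono; use U in blast)+
    ultimately show ?thesis by blast
  qed
  have D_glb: "isglb ?D \<zero>"
  proof (rule isglbI)
    show "\<zero> \<preceq> d" if "d \<in> ?D" for d using that pN by (auto simp: N_def)
    fix w assume w [simp]: "w \<in> carrier E" and le: "\<And>d. d \<in> ?D \<Longrightarrow> w \<preceq> d"
    have "pp w = \<zero>"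
    proof (rule ccontr)
      assume "pp w \<noteq> \<zero>"
      then obtain A B where AB: "openin \<tau> A" "openin \<tau> B" "\<zero> \<in> A" "pp w \<in> B" "disjnt A B"
        using haus unfolding Hausdorff_space_def top by (metis sup_closed w zero_closed)
      obtain V where V: "snb \<tau> V" "V \<subseteq> A" using snb_exists[OF ls AB(1,3)] by blast
      obtain U where U: "nseq \<tau> U" "U 0 = V" using nseq_exists[OF ls V(1)] by blast
      have "p U \<in> V" using pN[OF U(1)] U(2) by (auto simp: N_def)
      moreover have "pp w \<preceq> p U" using le U pN[OF U(1)] by (auto simp: sup_le_iff N_def)
      ultimately have "pp w \<in> V" using snb_mono[OF V(1), of "p U" "pp w"] by simp
      then show False using V(2) AB by (auto simp: disjnt_iff)
    qed
    then show "w \<preceq> \<zero>" using sup_ge(1)[of w \<zero>] by simp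
  qed simp
  \<comment> \<open>The diagonal sequence.\<close>
  obtain S where S: "nseq \<sigma> S" "S 0 = V" using nseq_exists[OF ls\<sigma> V] by blast
  have "\<exists>U. nseq \<tau> U \<and> p U \<in> S k" for k
  proof -
    have "\<exists>d\<in>?D. d \<in> S k"
      by (rule Lebesgue_down[OF \<sigma> _ _ D_dir D_glb nseqD(1)[OF S(1)]]) (use pN NC ex\<tau> in auto)
    then show ?thesis by blast
  qed
  then obtain Q where Q: "\<And>k. nseq \<tau> (Q k)" "\<And>k. p (Q k) \<in> S k" by metis
  define W where "W n = (\<Inter>k\<le>n. Q k n)" for n
  have W: "nseq \<tau> W"
    unfolding nseq_def
  proof (intro conjI allI ballI)
    show "snb \<tau> (W n)" for n unfolding W_def by (rule snb_finite_inter) (rule nseqD(1)[OF Q(1)])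
    fix n x y assume xy: "x \<in> W (Suc n)" "y \<in> W (Suc n)"
    have "x \<oplus> y \<in> Q k n" if "k \<le> n" for k using nseqD(2)[OF Q(1)] xy that by (auto simp: W_def)
    then show "x \<oplus> y \<in> W n" by (simp add: W_def)
  qed
  have pW: "p W \<in> S k" for k
  proof -
    have "p W \<preceq> p (Q k)"
    proof (rule p_mono[OF W Q(1)])
      fix z n assume "\<forall>n. z \<in> W n"
      then have "z \<in> Q k (max n k)" unfolding W_def by (meson INT_E atMost_iff max.cobounded2)
      then show "z \<in> Q k n" using nseq_decreasing[OF Q(1), of n "max n k" k] by auto
    qed
    then show ?thesis using snb_mono[OF nseqD(1)[OF S(1)] Q(2)] pN[OF W] by (auto simp: N_def)
  qed
  have "\<exists>n. \<forall>x\<in>W n. \<zero> \<preceq> x \<and> x \<preceq> e \<longrightarrow> x \<in> V"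
  proof (rule ccontr)
    assume "\<nexists>n. \<forall>x\<in>W n. \<zero> \<preceq> x \<and> x \<preceq> e \<longrightarrow> x \<in> V"
    then have "\<forall>n. \<exists>x. x \<in> W n \<and> \<zero> \<preceq> x \<and> x \<preceq> e \<and> x \<notin> V" by blast
    then obtain x where x: "\<And>n. x n \<in> W n" "\<And>n. \<zero> \<preceq> x n" "\<And>n. x n \<preceq> e" "\<And>n. x n \<notin> V" by metis
    have [simp]: "x n \<in> carrier E" for n using snb_closed[OF nseqD(1)[OF W] x(1)] .
    let ?x = "\<lambda>n i. x (Suc (Suc (n + i)))"
    have "\<exists>z. islub (range (?x n)) z" for n
      by (rule lub_exists[where u = e]) (use x in auto)
    then obtain z where z: "\<And>n. islub (range (?x n)) (z n)" by metis
    have zW: "z n \<in> W n" for n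
      by (rule nseq_lub[OF \<tau>uo W _ _ _ z]) (use x in simp_all)
    have [simp]: "z n \<in> carrier E" for n using islubD(1)[OF z] .
    have xz: "?x n i \<preceq> z n" for n i using islubD(2)[OF z[of n]] by blast
    have z0: "\<zero> \<preceq> z n" for n using ord_trans[OF x(2) xz[of n 0]] by simp
    have ze: "z n \<preceq> e" for n by (rule islubD(3)[OF z]) (use x in auto)
    \<comment> \<open>\<open>z n\<close> is the supremum of a tail, and \<open>y\<close> is the limit superior.\<close>
    have z_mono: "z n \<preceq> z m" if "m \<le> n" for m n
    proof (rule islubD(3)[OF z])
      fix d assume "d \<in> range (?x n)"
      then obtain i where "d = ?x n i" by blast
      also have "?x n i = ?x m (n - m + i)" using that by simp
      also have "\<dots> \<preceq> z m" by (rule xz)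
      finally show "d \<preceq> z m" .
    qed simp
    have "\<exists>y. isglb (range z) y" by (rule glb_exists[where u = \<zero>]) (use z0 in auto)
    then obtain y where y: "isglb (range z) y" ..
    note [simp] = isglbD(1)[OF y]
    have yz: "y \<preceq> z n" for n using isglbD(2)[OF y] by blast
    have y0: "\<zero> \<preceq> y" by (rule isglbD(3)[OF y]) (use z0 in auto)
    have "y \<in> W n" for n by (rule snb_mono[OF nseqD(1)[OF W] zW y0 yz]) simp
    then have "y \<in> N W" using y0 ord_trans[OF yz ze] by (simp add: N_def)
    then have "y \<preceq> p W" using islubD(2)[OF p[OF W]] by blast
    then have yS: "y \<in> S k" for k using snb_mono[OF nseqD(1)[OF S(1)] pW y0] by simp
    let ?D = "(\<lambda>n. z n \<ominus> y) ` UNIV"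
    have "\<exists>d\<in>?D. d \<in> S (Suc 0)"
    proof (rule Lebesgue_down[OF \<sigma> _ _ _ _ nseqD(1)[OF S(1)]])
      show "isglb ?D \<zero>"
      proof (rule isglbI)
        show "\<zero> \<preceq> d" if "d \<in> ?D" for d using that yz by (auto simp: diff_nonneg_iff)
        fix u assume [simp]: "u \<in> carrier E" and u: "\<And>d. d \<in> ?D \<Longrightarrow> u \<preceq> d"
        have "u \<oplus> y \<preceq> z n" for n using u[of "z n \<ominus> y"] by (simp add: le_diff_iff)
        then have "u \<oplus> y \<preceq> y" using isglbD(3)[OF y, of "u \<oplus> y"] by auto
        then show "u \<preceq> \<zero>" using add_le_cancel(1)[of u \<zero> y] by simp
      qed simp
      fix a b assume "a \<in> ?D" "b \<in> ?D"
      then obtain j k where jk: "a = z j \<ominus> y" "b = z k \<ominus> y" by blast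
      have "z (max j k) \<ominus> y \<preceq> a" "z (max j k) \<ominus> y \<preceq> b"
        using z_mono[of j "max j k"] z_mono[of k "max j k"] by (simp_all add: jk le_diff_iff)
      then show "\<exists>c\<in>?D. c \<preceq> a \<and> c \<preceq> b" by blast
    qed auto
    then obtain n where "z n \<ominus> y \<in> S (Suc 0)" by blast
    then have "(z n \<ominus> y) \<oplus> y \<in> S 0" using nseqD(2)[OF S(1)] yS by blast
    then have "z n \<in> V" using S(2) by simp
    then have "?x n 0 \<in> V" by (rule snb_mono[OF V _ x(2) xz]) simp
    then show False using x(4) by blast
  qed
  then show ?thesis using nseqD(1)[OF W] by blast
qed

subsection \<open>Order intervals suffice\<close>

text \<open>
  A lower bound \<open>q\<close> of the suprema of the tails of \<open>y \<curlywedge> u\<close> is disjoint from each \<open>y i\<close>, because the tail after \<open>i\<close>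
  is; hence it is disjoint from those suprema, and so from itself.
\<close>

lemma disjoint_seq_uo_null:
  assumes yC [simp]: "\<And>i. y i \<in> carrier E" and y0 [simp]: "\<And>i. \<zero> \<preceq> y i"
    and dis: "\<And>i j. i < j \<Longrightarrow> y i \<curlywedge> y j = \<zero>"
  shows "uo_conv E (UNIV::nat set) (\<le>) y \<zero>"
proof -
  have dir: "directed (UNIV::nat set) (\<le>)"
    by (rule directed_nat)
  have "onull (UNIV::nat set) (\<le>) (\<lambda>k. y k \<curlywedge> u)" if u [simp]: "u \<in> carrier E" "\<zero> \<preceq> u" for u
    unfolding onull_def
  proof (intro ballI impI)
    fix w assume [simp]: "w \<in> carrier E" and w: "\<forall>d\<in>evub (UNIV::nat set) (\<le>) (\<lambda>k. y k \<curlywedge> u). w \<preceq> d"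
    let ?q = "pp w"
    let ?S = "\<lambda>n. (\<lambda>k. y k \<curlywedge> u) ` {n..}"
    have lub: "\<exists>d. islub (?S n) d \<and> ?q \<preceq> d" for n
    proof -
      have "\<exists>d. islub (?S n) d" by (rule lub_exists[where u = u]) auto
      then obtain d where d: "islub (?S n) d" ..
      have ub: "y k \<curlywedge> u \<preceq> d" if "n \<le> k" for k using islubD(2)[OF d] that by blast
      have "\<zero> \<preceq> y n \<curlywedge> u" by simp
      then have "\<zero> \<preceq> d" using ord_trans[OF _ ub[of n], of \<zero>] islubD(1)[OF d] by simp
      moreover have "w \<preceq> d" using w ub islubD(1)[OF d] by (auto simp: evub_def)
      ultimately show ?thesis using d islubD(1)[OF d] by (auto simp: sup_le_iff)
    qed
    have null: "?q \<curlywedge> t = \<zero>" if t: "t \<in> carrier E" "\<zero> \<preceq> t" and yt: "\<And>k. n \<le> k \<Longrightarrow> y k \<curlywedge> t = \<zero>" for n t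
    proof -
      note [simp] = t
      obtain d where d: "islub (?S n) d" "?q \<preceq> d" using lub by blast
      note [simp] = islubD(1)[OF d(1)]
      have "d \<curlywedge> t \<preceq> \<zero>"
      proof (rule islubD(3)[OF islub_inf[OF _ d(1)]])
        fix a assume "a \<in> (\<lambda>d. d \<curlywedge> t) ` ?S n"
        then obtain k where k: "n \<le> k" "a = (y k \<curlywedge> u) \<curlywedge> t" by auto
        have "a \<preceq> y k \<curlywedge> t" unfolding k(2) by (rule inf_mono) simp_all
        then show "a \<preceq> \<zero>" using yt[OF k(1)] by simp
      qed auto
      moreover have "?q \<curlywedge> t \<preceq> d \<curlywedge> t" by (rule inf_mono[OF d(2)]) simp_all
      ultimately have "?q \<curlywedge> t \<preceq> \<zero>" using ord_trans[of "?q \<curlywedge> t" "d \<curlywedge> t" \<zero>] by simp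
      then show ?thesis by (intro ord_antisym) simp_all
    qed
    have "?q \<curlywedge> y i = \<zero>" for i
      by (rule null[of _ "Suc i"]) (use dis[of i] inf_commute in simp_all)
    then have "y i \<curlywedge> ?q = \<zero>" for i using inf_commute[of "y i" ?q] by simp
    then have "?q \<curlywedge> ?q = \<zero>" by (intro null[of _ 0]) simp_all
    then have "?q = \<zero>" using inf_absorb[of ?q ?q] by simp
    then show "w \<preceq> \<zero>" using sup_ge(1)[of w \<zero>] by simp
  qed
  then show ?thesis using uo_conv_iff[of UNIV "(\<le>)" y \<zero>, OF dir] by simp
qed

text \<open>
  Otherwise there are \<open>x n\<close> outside of \<open>V\<close> for which \<open>x n \<curlywedge> e n\<close> is as small as desired, even if \<open>e n\<close> is chosen to
  dominate all earlier terms. Then \<open>x k\<close> overlaps only little with the earlier terms, and also with all later ones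
  together. Removing the overlaps leaves a disjoint sequence that stays outside of a neighbourhood of zero, but disjoint
  sequences are uo-null.
\<close>

lemma uo_Lebesgue_unbounded:
  assumes \<sigma>: "uo_Lebesgue E \<sigma>" and V: "snb \<sigma> V"
  shows "\<exists>e V'. e \<in> carrier E \<and> \<zero> \<preceq> e \<and> snb \<sigma> V' \<and> (\<forall>x\<in>carrier E. \<zero> \<preceq> x \<and> x \<curlywedge> e \<in> V' \<longrightarrow> x \<in> V)"
proof (rule ccontr)
  assume neg: "\<not> ?thesis"
  have ls: "locally_solid_linear_topology E \<sigma>" using \<sigma> by (simp add: uo_Lebesgue_def)
  obtain S where S: "nseq \<sigma> S" "S 0 = V" using nseq_exists[OF ls V] by blast
  have "\<exists>x. x \<in> carrier E \<and> \<zero> \<preceq> x \<and> x \<curlywedge> e \<in> S n \<and> x \<notin> V" if "e \<in> carrier E" "\<zero> \<preceq> e" for e n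
    using neg nseqD(1)[OF S(1), of n] that by blast
  then obtain f where f: "\<And>e n. e \<in> carrier E \<Longrightarrow> \<zero> \<preceq> e \<Longrightarrow>
    f e n \<in> carrier E \<and> \<zero> \<preceq> f e n \<and> f e n \<curlywedge> e \<in> S n \<and> f e n \<notin> V" by metis
  \<comment> \<open>The offset 4 pays for three halvings: the supremum \<open>s k\<close> costs two, the final sum one more.\<close>
  define e where "e = rec_nat \<zero> (\<lambda>n en. en \<oplus> f en (n + 4))"
  have e_simps: "e 0 = \<zero>" "e (Suc n) = e n \<oplus> f (e n) (n + 4)" for n by (simp_all add: e_def)
  have e: "e n \<in> carrier E \<and> \<zero> \<preceq> e n" for n
    by (induction n) (use f in \<open>simp_all add: e_simps\<close>)
  define x where "x n = f (e n) (n + 4)" for n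
  have x: "x n \<in> carrier E" "\<zero> \<preceq> x n" "x n \<curlywedge> e n \<in> S (n + 4)" "x n \<notin> V" for n using f[of "e n" "n + 4"] e by (simp_all add: x_def)
  note [simp] = x(1,2) conjunct1[OF e] conjunct2[OF e]
  have e_Suc: "e (Suc n) = e n \<oplus> x n" for n by (simp add: e_simps x_def)
  have e_mono: "e m \<preceq> e n" if "m \<le> n" for m n
    using that
  proof (induction n rule: dec_induct)
    case (step n)
    then show ?case using ord_trans[of "e m" "e n" "e (Suc n)"] le_add_nonneg[of "x n" "e n"] by (simp add: e_Suc)
  qed simp
  have xe: "x m \<preceq> e n" if "m < n" for m n
    using e_mono[of "Suc m" n] that ord_trans[of "x m" "e (Suc m)" "e n"] le_add_nonneg[of "e m" "x m"] by (simp add: e_Suc)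
  have "\<exists>s. islub (range (\<lambda>i. x k \<curlywedge> x (Suc (k + i)))) s" for k
    by (rule lub_exists[where u = "x k"]) auto
  then obtain s where s: "\<And>k. islub (range (\<lambda>i. x k \<curlywedge> x (Suc (k + i)))) (s k)" by metis
  have [simp]: "s k \<in> carrier E" for k using islubD(1)[OF s] .
  have s_ge: "x k \<curlywedge> x j \<preceq> s k" if "k < j" for k j
  proof -
    obtain i where "j = Suc (k + i)" using less_imp_Suc_add[OF \<open>k < j\<close>] by blast
    then show ?thesis using islubD(2)[OF s[of k]] by blast
  qed
  have s0: "\<zero> \<preceq> s k" for k using ord_trans[OF _ s_ge[of k "Suc k"], of \<zero>] by simp
  have sS: "s k \<in> S 2" for k
  proof (rule nseq_lub[OF \<sigma> S(1) _ _ _ s])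
    fix i
    have "x k \<curlywedge> x (Suc (k + i)) \<preceq> x (Suc (k + i)) \<curlywedge> e (Suc (k + i))"
      using xe[of k "Suc (k + i)"] ord_trans[of "x k \<curlywedge> x (Suc (k + i))" "x k" "e (Suc (k + i))"] by (simp add: le_inf_iff)
    then have "x k \<curlywedge> x (Suc (k + i)) \<in> S (Suc (k + i) + 4)"
      by (intro snb_mono[OF nseqD(1)[OF S(1)] x(3)]) simp_all
    then show "x k \<curlywedge> x (Suc (k + i)) \<in> S (Suc (Suc (2 + i)))"
      using nseq_decreasing[OF S(1), of "Suc (Suc (2 + i))" "Suc (k + i) + 4"] by auto
  qed simp_all
  \<comment> \<open>\<open>e k\<close> dominates the earlier terms, and \<open>s k\<close> the overlaps with the later ones.\<close>
  define y where "y k = x k \<ominus> (x k \<curlywedge> (e k \<oplus> s k))" for k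
  have y_eq: "y k = pp (x k \<ominus> (e k \<oplus> s k))" for k by (simp add: y_def minus_inf_eq_pp)
  have yC [simp]: "y k \<in> carrier E" "\<zero> \<preceq> y k" for k by (simp_all add: y_eq)
  have y_le: "y k \<preceq> pp (x k \<ominus> t)" if "t \<in> carrier E" "x k \<curlywedge> t \<preceq> e k \<oplus> s k" for k t
  proof -
    have "x k \<curlywedge> t \<preceq> x k \<curlywedge> (e k \<oplus> s k)" using that s0 by (simp add: le_inf_iff)
    then have "x k \<ominus> (x k \<curlywedge> (e k \<oplus> s k)) \<preceq> x k \<ominus> (x k \<curlywedge> t)" using that by (simp add: le_diff_iff diff_normalize3)
    then show ?thesis using that by (simp add: y_def minus_inf_eq_pp)
  qed
  have dis: "y k \<curlywedge> y j = \<zero>" if kj: "k < j" for k j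
  proof -
    have "x k \<curlywedge> x j \<preceq> e k \<oplus> s k"
      using ord_trans[OF s_ge[OF kj] le_add_nonneg(2)[of "e k" "s k"]] by simp
    then have 1: "y k \<preceq> pp (x k \<ominus> x j)" by (intro y_le) simp_all
    have "x j \<curlywedge> x k \<preceq> e j"
      using ord_trans[OF inf_le(2)[of "x j" "x k"] xe[OF kj]] by simp
    then have "x j \<curlywedge> x k \<preceq> e j \<oplus> s j"
      using ord_trans[OF _ le_add_nonneg(1)[of "s j" "e j"], of "x j \<curlywedge> x k"] s0 by simp
    then have 2: "y j \<preceq> pp (x j \<ominus> x k)" by (intro y_le) simp_all
    have "pp (x k \<ominus> x j) \<curlywedge> pp (x j \<ominus> x k) = \<zero>" using pp_inf_pp[of "x k \<ominus> x j"] by (simp add: diff_normalize2)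
    then show ?thesis by (rule inf_eq_zeroI) (use 1 2 in simp_all)
  qed
  have yS: "y k \<notin> S 1" for k
  proof
    assume yk: "y k \<in> S 1"
    have xe': "x k \<curlywedge> e k \<in> S 2" using x(3) nseq_decreasing[OF S(1), of 2 "k + 4"] by auto
    have "x k \<curlywedge> (e k \<oplus> s k) \<preceq> (x k \<curlywedge> e k) \<oplus> s k"
    proof -
      have "x k \<curlywedge> (e k \<oplus> s k) = (e k \<oplus> s k) \<curlywedge> x k" by (simp add: inf_commute)
      also have "\<dots> \<preceq> (e k \<curlywedge> x k) \<oplus> (s k \<curlywedge> x k)" using s0 by (intro inf_add_le) simp_all
      also have "\<dots> \<preceq> (x k \<curlywedge> e k) \<oplus> s k" by (intro add_mono') (simp_all add: inf_commute)
      finally show ?thesis by simp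
    qed
    moreover have "(x k \<curlywedge> e k) \<oplus> s k \<in> S 1" using nseqD(2)[OF S(1), of _ 1] xe' sS by (simp add: numeral_2_eq_2)
    ultimately have "x k \<curlywedge> (e k \<oplus> s k) \<in> S 1"
      using s0 snb_mono[OF nseqD(1)[OF S(1)], of "(x k \<curlywedge> e k) \<oplus> s k" 1 "x k \<curlywedge> (e k \<oplus> s k)"] by simp
    then have "y k \<oplus> (x k \<curlywedge> (e k \<oplus> s k)) \<in> S 0" using nseqD(2)[OF S(1), of _ 0] yk by simp
    then have "x k \<in> V" by (simp add: y_def S(2))
    then show False using x(4) by blast
  qed
  have dir: "directed (UNIV::nat set) (\<le>)"
    by (rule directed_nat)
  have "limitin \<sigma> y \<zero> (tail_filter (UNIV::nat set) (\<le>))"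
    by (rule uo_Lebesgue_any_index[OF \<sigma> _ disjoint_seq_uo_null]) (use dir dis in \<open>auto simp: net_in_def\<close>)
  moreover obtain A where A: "openin \<sigma> A" "\<zero> \<in> A" "A \<subseteq> S 1" using nseqD(1)[OF S(1), of 1] by (auto simp: snb_def)
  ultimately have "eventually (\<lambda>k. y k \<in> A) (tail_filter (UNIV::nat set) (\<le>))" by (simp add: limitin_def)
  then obtain k where "y k \<in> A" unfolding eventually_tail_filter[OF dir] by blast
  then show False using A(3) yS by blast
qed

lemma uo_Lebesgue_coarser:
  assumes \<tau>: "Hausdorff_uo_Lebesgue E \<tau>" and \<sigma>: "uo_Lebesgue E \<sigma>" and V: "snb \<sigma> V"
  shows "\<exists>W. snb \<tau> W \<and> W \<subseteq> V"
proof -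
  obtain e V' where e: "e \<in> carrier E" "\<zero> \<preceq> e" and V': "snb \<sigma> V'"
    and unb: "\<And>x. x \<in> carrier E \<Longrightarrow> \<zero> \<preceq> x \<Longrightarrow> x \<curlywedge> e \<in> V' \<Longrightarrow> x \<in> V"
    using uo_Lebesgue_unbounded[OF \<sigma> V] by blast
  obtain W where W: "snb \<tau> W" "\<And>x. x \<in> W \<Longrightarrow> \<zero> \<preceq> x \<Longrightarrow> x \<preceq> e \<Longrightarrow> x \<in> V'"
    using Amemiya[OF \<tau> \<sigma> e V'] by blast
  have "x \<in> V" if x: "x \<in> W" for x
  proof -
    have [simp]: "x \<in> carrier E" using snb_closed[OF W(1) x] .
    note [simp] = e
    have "av x \<in> W" by (rule snb_solid[OF W(1) x]) simp_all
    then have "av x \<curlywedge> e \<in> W" by (rule snb_mono[OF W(1)]) simp_all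
    then have "av x \<curlywedge> e \<in> V'" by (rule W(2)) simp_all
    then have "av x \<in> V" by (intro unb) simp_all
    then show ?thesis by (rule snb_solid[OF V]) simp_all
  qed
  then show ?thesis using W(1) by blast
qed

theorem Hausdorff_uo_Lebesgue_unique:
  assumes \<tau>: "Hausdorff_uo_Lebesgue E \<tau>" and \<sigma>: "Hausdorff_uo_Lebesgue E \<sigma>"
  shows "\<tau> = \<sigma>"
proof -
  have ls: "locally_solid_linear_topology E \<tau>" "locally_solid_linear_topology E \<sigma>"
    and uo: "uo_Lebesgue E \<tau>" "uo_Lebesgue E \<sigma>"
    using \<tau> \<sigma> by (auto simp: Hausdorff_uo_Lebesgue_def uo_Lebesgue_def)
  have "openin \<tau> U \<longleftrightarrow> openin \<sigma> U" for U
    unfolding openin_iff_snb[OF ls(1)] openin_iff_snb[OF ls(2)]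
    using uo_Lebesgue_coarser[OF \<tau> uo(2)] uo_Lebesgue_coarser[OF \<sigma> uo(1)] by (meson subsetD)
  then show ?thesis by (simp add: topology_eq)
qed

lemma tau_hat_eq: "Hausdorff_uo_Lebesgue E \<tau> \<Longrightarrow> tau_hat E = \<tau>"
  unfolding tau_hat_def by (rule the_equality) (blast intro: Hausdorff_uo_Lebesgue_unique)+

end

section \<open>Comparing the modes of convergence\<close>

lemma net_in_OrthD:
  assumes "net_in (Orth E) A leq S"
  shows "directed A leq" "\<And>a. a \<in> A \<Longrightarrow> S a \<in> carrier (Orth E)"
  using assms by (auto simp: net_in_def)

context orth_vlattice
begin

interpretation O: orth_vlattice "Orth E"
  by (rule orth_vlattice_Orth)

lemma orth_diff_abs:
  assumes [simp]: "S \<in> orth" "T \<in> orth" "x \<in> carrier E"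
  shows "av (S x \<ominus> T x) \<preceq> vabs (Orth E) (S \<ominus>\<^bsub>Orth E\<^esub> T) (av x)"
  using Orth_abs_le[of "S \<ominus>\<^bsub>Orth E\<^esub> T" x] minus_orth[of S T] by (simp add: Orth_minus)

text \<open>
  If \<open>y\<close> dominates \<open>\<bar>S' - S\<^sub>\<alpha>\<bar>\<close>, then \<open>y \<bar>T\<bar>\<close> dominates the net after composition, and its infimum is evaluated pointwise at \<open>\<bar>T\<bar> x\<close>.
\<close>

lemma o_imp_o_rho:
  assumes net: "net_in (Orth E) A leq S" and S' [simp]: "S' \<in> orth" and T [simp]: "T \<in> orth"
    and conv: "order_conv (Orth E) A leq S S'"
  shows "order_conv (Orth E) A leq (\<lambda>a. compose (carrier E) (S a) T) (compose (carrier E) S' T)"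
proof -
  note dir = net_in_OrthD(1)[OF net] and SO [simp] = net_in_OrthD(2)[OF net]
  let ?T = "vabs (Orth E) T"
  let ?C = "\<lambda>S. compose (carrier E) S T"
  have TO [simp]: "?T \<in> orth" by (rule O.av_closed) simp
  obtain B :: "('a \<Rightarrow> 'a) set" and leqB y where y: "decreases_to_zero (Orth E) B leqB y"
    and dom: "\<And>b. b \<in> B \<Longrightarrow> \<exists>a\<^sub>0\<in>A. \<forall>a\<in>A. leq a\<^sub>0 a \<longrightarrow> vabs (Orth E) (S' \<ominus>\<^bsub>Orth E\<^esub> S a) \<preceq>\<^bsub>Orth E\<^esub> y b"
    using conv by (auto simp: order_conv_def)
  have yO [simp]: "y b \<in> orth" if "b \<in> B" for b using y that by (auto simp: decreases_to_zero_def net_in_def)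
  have yO': "y ` B \<subseteq> orth" "y ` B \<noteq> {}" using y by (auto simp: decreases_to_zero_def net_in_def directed_def)
  have g: "O.isglb (y ` B) (\<lambda>x\<in>carrier E. \<zero>)"
    using y O.greatest_Lower_iff[OF yO'(1)] by (simp add: decreases_to_zero_def)
  have ev: "compose (carrier E) (y b) ?T \<in> O.evub A leq (\<lambda>a. vabs (Orth E) (?C S' \<ominus>\<^bsub>Orth E\<^esub> ?C (S a)))"
    if b: "b \<in> B" for b
  proof -
    obtain a0 where a0: "a0 \<in> A" "\<forall>a\<in>A. leq a0 a \<longrightarrow> vabs (Orth E) (S' \<ominus>\<^bsub>Orth E\<^esub> S a) \<preceq>\<^bsub>Orth E\<^esub> y b"
      using dom[OF b] by blast
    show ?thesis
    proof (rule O.evubI[OF _ a0(1)])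
      fix a assume a: "a \<in> A" "leq a0 a"
      have "vabs (Orth E) (?C S' \<ominus>\<^bsub>Orth E\<^esub> ?C (S a)) x \<preceq> y b (?T x)" if x [simp]: "x \<in> carrier E" "\<zero> \<preceq> x" for x
      proof -
        have [simp]: "S' \<ominus>\<^bsub>Orth E\<^esub> S a \<in> orth" "?C S' \<ominus>\<^bsub>Orth E\<^esub> ?C (S a) \<in> orth"
          by (rule O.minus_closed'; use a in simp)+
        have [simp]: "vabs (Orth E) (S' \<ominus>\<^bsub>Orth E\<^esub> S a) \<in> orth" by (rule O.av_closed) simp
        have "?C S' \<ominus>\<^bsub>Orth E\<^esub> ?C (S a) = (\<lambda>x\<in>carrier E. ?C S' x \<ominus> ?C (S a) x)"
          by (rule Orth_minus) (use a in simp_all)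
        then have "vabs (Orth E) (?C S' \<ominus>\<^bsub>Orth E\<^esub> ?C (S a)) x = av (S' (T x) \<ominus> S a (T x))"
          using Orth_abs[of "?C S' \<ominus>\<^bsub>Orth E\<^esub> ?C (S a)" x, OF O.minus_closed'] a by (simp add: compose_eq)
        moreover have "av (S' (T x) \<ominus> S a (T x)) \<preceq> vabs (Orth E) (S' \<ominus>\<^bsub>Orth E\<^esub> S a) (av (T x))"
          using a by (intro orth_diff_abs) simp_all
        moreover have Tx: "av (T x) = ?T x" by (simp add: Orth_abs)
        moreover have "vabs (Orth E) (S' \<ominus>\<^bsub>Orth E\<^esub> S a) (av (T x)) \<preceq> y b (av (T x))"
          using a0(2) a by simp
        ultimately show ?thesis
          using a b ord_trans[of "av (S' (T x) \<ominus> S a (T x))" "vabs (Orth E) (S' \<ominus>\<^bsub>Orth E\<^esub> S a) (av (T x))" "y b (av (T x))"]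
          by simp
      qed
      then show "vabs (Orth E) (?C S' \<ominus>\<^bsub>Orth E\<^esub> ?C (S a)) \<preceq>\<^bsub>Orth E\<^esub> compose (carrier E) (y b) ?T"
        by (simp add: compose_def)
    qed (use b in simp)
  qed
  have "O.onull A leq (\<lambda>a. vabs (Orth E) (?C S' \<ominus>\<^bsub>Orth E\<^esub> ?C (S a)))"
    unfolding O.onull_def
  proof (intro ballI impI)
    fix w assume w: "w \<in> orth" and le: "\<forall>d\<in>O.evub A leq (\<lambda>a. vabs (Orth E) (?C S' \<ominus>\<^bsub>Orth E\<^esub> ?C (S a))). w \<preceq>\<^bsub>Orth E\<^esub> d"
    have "w x \<preceq> \<zero>" if x [simp]: "x \<in> carrier E" "\<zero> \<preceq> x" for x
    proof (rule isglbD(3)[OF Orth_glb_pointwise[OF yO' g, of "?T x"]])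
      show "\<zero> \<preceq> ?T x" by (simp add: Orth_abs)
      fix d assume "d \<in> (\<lambda>M. M (?T x)) ` y ` B"
      then obtain b where b: "b \<in> B" "d = y b (?T x)" by blast
      have "w \<preceq>\<^bsub>Orth E\<^esub> compose (carrier E) (y b) ?T" using le ev[OF b(1)] by blast
      then show "w x \<preceq> d" by (simp add: compose_def b(2))
    qed (use w in simp_all)
    then show "w \<preceq>\<^bsub>Orth E\<^esub> \<zero>\<^bsub>Orth E\<^esub>" by simp
  qed
  then show ?thesis using O.order_conv_iff[of A leq "\<lambda>a. ?C (S a)" "?C S'", OF dir] by simp
qed

lemma o_imp_SO:
  assumes net: "net_in (Orth E) A leq S" and S' [simp]: "S' \<in> orth" and conv: "order_conv (Orth E) A leq S S'"
    and x [simp]: "x \<in> carrier E"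
  shows "order_conv E A leq (\<lambda>a. S a x) (S' x)"
proof -
  note dir = net_in_OrthD(1)[OF net] and SO [simp] = net_in_OrthD(2)[OF net]
  obtain B :: "('a \<Rightarrow> 'a) set" and leqB y where y: "decreases_to_zero (Orth E) B leqB y"
    and dom: "\<And>b. b \<in> B \<Longrightarrow> \<exists>a\<^sub>0\<in>A. \<forall>a\<in>A. leq a\<^sub>0 a \<longrightarrow> vabs (Orth E) (S' \<ominus>\<^bsub>Orth E\<^esub> S a) \<preceq>\<^bsub>Orth E\<^esub> y b"
    using conv by (auto simp: order_conv_def)
  have yO [simp]: "y b \<in> orth" if "b \<in> B" for b using y that by (auto simp: decreases_to_zero_def net_in_def)
  have yO': "y ` B \<subseteq> orth" "y ` B \<noteq> {}" using y by (auto simp: decreases_to_zero_def net_in_def directed_def)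
  have g: "O.isglb (y ` B) (\<lambda>x\<in>carrier E. \<zero>)"
    using y O.greatest_Lower_iff[OF yO'(1)] by (simp add: decreases_to_zero_def)
  have ev: "y b (av x) \<in> evub A leq (\<lambda>a. av (S' x \<ominus> S a x))" if b: "b \<in> B" for b
  proof -
    obtain a0 where a0: "a0 \<in> A" "\<forall>a\<in>A. leq a0 a \<longrightarrow> vabs (Orth E) (S' \<ominus>\<^bsub>Orth E\<^esub> S a) \<preceq>\<^bsub>Orth E\<^esub> y b"
      using dom[OF b] by blast
    show ?thesis
    proof (rule evubI[OF _ a0(1)])
      fix a assume a: "a \<in> A" "leq a0 a"
      have [simp]: "vabs (Orth E) (S' \<ominus>\<^bsub>Orth E\<^esub> S a) \<in> orth" by (intro O.av_closed O.minus_closed' SO a S')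
      have "av (S' x \<ominus> S a x) \<preceq> vabs (Orth E) (S' \<ominus>\<^bsub>Orth E\<^esub> S a) (av x)" using a by (intro orth_diff_abs) simp_all
      also have "\<dots> \<preceq> y b (av x)" using a0(2) a by simp
      finally show "av (S' x \<ominus> S a x) \<preceq> y b (av x)" using a b by simp
    qed (use b in simp)
  qed
  have "onull A leq (\<lambda>a. av (S' x \<ominus> S a x))"
    unfolding onull_def
  proof (intro ballI impI)
    fix w assume w: "w \<in> carrier E" "\<forall>d\<in>evub A leq (\<lambda>a. av (S' x \<ominus> S a x)). w \<preceq> d"
    show "w \<preceq> \<zero>"
      by (rule isglbD(3)[OF Orth_glb_pointwise[OF yO' g, of "av x"]]) (use w ev in auto)
  qed
  then show ?thesis using order_conv_iff[of A leq "\<lambda>a. S a x" "S' x", OF dir] by simp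
qed

lemma SO_imp_SUO:
  assumes net: "net_in (Orth E) A leq S" and S' [simp]: "S' \<in> orth" and x: "x \<in> carrier E"
    and conv: "order_conv E A leq (\<lambda>a. S a x) (S' x)"
  shows "uo_conv E A leq (\<lambda>a. S a x) (S' x)"
  using net_in_OrthD[OF net] x by (intro order_conv_imp_uo_conv[OF _ _ _ conv]) simp_all

text \<open>
  Testing against the identity gives \<open>\<bar>S\<^sub>\<alpha> - S'\<bar> x \<curlywedge> x \<rightarrow> 0\<close> in order, and \<open>x\<close> suffices as a bound since
  \<open>\<bar>S\<^sub>\<alpha> - S'\<bar> x\<close> lies in the band generated by \<open>x\<close>.
\<close>

lemma uo_imp_SUO:
  assumes net: "net_in (Orth E) A leq S" and S' [simp]: "S' \<in> orth" and conv: "uo_conv (Orth E) A leq S S'"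
    and x [simp]: "x \<in> carrier E"
  shows "uo_conv E A leq (\<lambda>a. S a x) (S' x)"
proof -
  note dir = net_in_OrthD(1)[OF net] and SO [simp] = net_in_OrthD(2)[OF net]
  let ?R = "\<lambda>a. vabs (Orth E) (S a \<ominus>\<^bsub>Orth E\<^esub> S')"
  let ?I = "\<lambda>x\<in>carrier E. x"
  let ?x = "av x"
  have R [simp]: "?R a \<in> orth" if "a \<in> A" for a by (intro O.av_closed O.minus_closed' SO that S')
  have pos: "\<zero> \<preceq> ?R a z" if "a \<in> A" "z \<in> carrier E" "\<zero> \<preceq> z" for a z
    using that O.minus_closed'[OF SO[OF that(1)] S'] by (simp add: Orth_abs)
  have I: "?I \<in> orth" by (rule id_orth)
  have null: "O.onull A leq (\<lambda>a. ?R a \<sqinter>\<^bsub>ord_of (Orth E)\<^esub> ?I)"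
    using conv O.uo_conv_iff[of A leq S S', OF dir] I by simp
  have null': "onull A leq (\<lambda>a. ?R a ?x \<curlywedge> ?x)"
    unfolding onull_def
  proof (intro ballI impI)
    fix w assume w [simp]: "w \<in> carrier E" and le: "\<forall>d\<in>evub A leq (\<lambda>a. ?R a ?x \<curlywedge> ?x). w \<preceq> d"
    let ?D = "O.evub A leq (\<lambda>a. ?R a \<sqinter>\<^bsub>ord_of (Orth E)\<^esub> ?I)"
    have D: "?D \<subseteq> orth" by (auto simp: O.evub_def)
    obtain a1 where a1: "a1 \<in> A" using directedD(1)[OF dir] by blast
    have ne: "?I \<in> ?D"
      by (rule O.evubI[OF I a1], rule O.inf_le) (use I in simp_all)
    have "O.isglb ?D (\<lambda>x\<in>carrier E. \<zero>)"
    proof (rule O.isglbI)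
      show "(\<lambda>x\<in>carrier E. \<zero>) \<in> orth" by (rule zero_orth)
      fix d assume d: "d \<in> ?D"
      then obtain a0 where a0: "a0 \<in> A" "\<And>a. a \<in> A \<Longrightarrow> leq a0 a \<Longrightarrow> ?R a \<sqinter>\<^bsub>ord_of (Orth E)\<^esub> ?I \<preceq>\<^bsub>Orth E\<^esub> d"
        by (auto simp: O.evub_def)
      have dO [simp]: "d \<in> orth" using d D by blast
      have "\<zero> \<preceq> d z" if z [simp]: "z \<in> carrier E" "\<zero> \<preceq> z" for z
      proof -
        have "\<zero> \<preceq> ?R a0 z \<curlywedge> z" using pos a0(1) by simp
        also have "?R a0 z \<curlywedge> z = (?R a0 \<sqinter>\<^bsub>ord_of (Orth E)\<^esub> ?I) z" using a0(1) I by (simp add: Orth_inf)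
        also have "\<dots> \<preceq> d z" using a0(2)[OF a0(1) directedD(2)[OF dir a0(1)]] by simp
        finally show ?thesis using a0(1) I by (simp add: Orth_inf)
      qed
      then show "(\<lambda>x\<in>carrier E. \<zero>) \<preceq>\<^bsub>Orth E\<^esub> d" by simp
    next
      fix u assume "u \<in> orth" "\<And>d. d \<in> ?D \<Longrightarrow> u \<preceq>\<^bsub>Orth E\<^esub> d"
      then show "u \<preceq>\<^bsub>Orth E\<^esub> (\<lambda>x\<in>carrier E. \<zero>)" using O.onullD[OF null, of u] by simp
    qed
    then have "isglb ((\<lambda>M. M ?x) ` ?D) \<zero>" using ne by (intro Orth_glb_pointwise[OF D]) auto
    then show "w \<preceq> \<zero>"
    proof (rule isglbD(3))
      fix e assume "e \<in> (\<lambda>M. M ?x) ` ?D"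
      then obtain d where d: "d \<in> ?D" "e = d ?x" by blast
      then obtain a0 where a0: "a0 \<in> A" "\<And>a. a \<in> A \<Longrightarrow> leq a0 a \<Longrightarrow> ?R a \<sqinter>\<^bsub>ord_of (Orth E)\<^esub> ?I \<preceq>\<^bsub>Orth E\<^esub> d"
        by (auto simp: O.evub_def)
      have dO [simp]: "d \<in> orth" using d D by blast
      have "d ?x \<in> evub A leq (\<lambda>a. ?R a ?x \<curlywedge> ?x)"
      proof (rule evubI[OF _ a0(1)])
        fix a assume a: "a \<in> A" "leq a0 a"
        have "(?R a \<sqinter>\<^bsub>ord_of (Orth E)\<^esub> ?I) ?x \<preceq> d ?x" using a0(2)[OF a] by simp
        then show "?R a ?x \<curlywedge> ?x \<preceq> d ?x" using a I by (simp add: Orth_inf)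
      qed simp
      then show "w \<preceq> e" using le d(2) by blast
    qed simp
  qed
  have "onull A leq (\<lambda>a. ?R a ?x \<curlywedge> y)" if y: "y \<in> carrier E" "\<zero> \<preceq> y" for y
  proof (rule onull_inf_of_carrying[OF dir _ _ _ _ y _ null'])
    fix a t assume a: "a \<in> A" and t [simp]: "t \<in> carrier E" "\<zero> \<preceq> t" and tx: "t \<curlywedge> ?x = \<zero>"
    have "?x \<in> dcomp {t}" using tx inf_commute[of t ?x] by (simp add: dcomp_def)
    then have "?R a ?x \<in> dcomp {t}" using orth_band[OF R[OF a] band_dcomp] t by blast
    then show "t \<curlywedge> ?R a ?x = \<zero>" using pos[OF a, of ?x] a inf_commute[of t "?R a ?x"] by (simp add: dcomp_def)
  qed (use pos in simp_all)
  then have "onull A leq (\<lambda>a. av (S a x \<ominus> S' x) \<curlywedge> y)" if y: "y \<in> carrier E" "\<zero> \<preceq> y" for y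
  proof (rule onull_mono)
    fix a assume a: "a \<in> A"
    show "av (S a x \<ominus> S' x) \<curlywedge> y \<preceq> ?R a ?x \<curlywedge> y"
      using orth_diff_abs[of "S a" S' x] a y by (intro inf_mono) simp_all
  qed (use y in simp_all)
  then show ?thesis using uo_conv_iff[of A leq "\<lambda>a. S a x" "S' x", OF dir] by simp
qed

text \<open>
  A bound \<open>d\<close> for a tail at \<open>x\<close> bounds the value at \<open>x\<close> of the supremum of this tail in \<open>Orth E\<close>.
\<close>

lemma SUO_imp_uo:
  assumes net: "net_in (Orth E) A leq S" and S' [simp]: "S' \<in> orth"
    and conv: "\<And>x. x \<in> carrier E \<Longrightarrow> uo_conv E A leq (\<lambda>a. S a x) (S' x)"
  shows "uo_conv (Orth E) A leq S S'"
proof -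
  note dir = net_in_OrthD(1)[OF net] and SO [simp] = net_in_OrthD(2)[OF net]
  let ?R = "\<lambda>a. vabs (Orth E) (S a \<ominus>\<^bsub>Orth E\<^esub> S')"
  have R [simp]: "?R a \<in> orth" "S a \<ominus>\<^bsub>Orth E\<^esub> S' \<in> orth" if "a \<in> A" for a
    using that by (auto intro!: O.av_closed O.minus_closed')
  have "O.onull A leq (\<lambda>a. ?R a \<sqinter>\<^bsub>ord_of (Orth E)\<^esub> U)" if U [simp]: "U \<in> orth" and Upos: "\<zero>\<^bsub>Orth E\<^esub> \<preceq>\<^bsub>Orth E\<^esub> U" for U
    unfolding O.onull_def
  proof (intro ballI impI)
    fix W assume W [simp]: "W \<in> orth" and le: "\<forall>d\<in>O.evub A leq (\<lambda>a. ?R a \<sqinter>\<^bsub>ord_of (Orth E)\<^esub> U). W \<preceq>\<^bsub>Orth E\<^esub> d"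
    have "W x \<preceq> \<zero>" if x [simp]: "x \<in> carrier E" "\<zero> \<preceq> x" for x
    proof -
      have [simp]: "\<zero> \<preceq> U x" using Upos by simp
      have "onull A leq (\<lambda>a. av (S a x \<ominus> S' x) \<curlywedge> U x)"
        using conv[OF x(1)] uo_conv_iff[of A leq "\<lambda>a. S a x" "S' x", OF dir] by simp
      then show ?thesis
      proof (rule onullD)
        fix d assume "d \<in> evub A leq (\<lambda>a. av (S a x \<ominus> S' x) \<curlywedge> U x)"
        then obtain a0 where d [simp]: "d \<in> carrier E" and a0: "a0 \<in> A"
          "\<And>a. a \<in> A \<Longrightarrow> leq a0 a \<Longrightarrow> av (S a x \<ominus> S' x) \<curlywedge> U x \<preceq> d" unfolding evub_def by blast
        let ?M = "(\<lambda>a. ?R a \<sqinter>\<^bsub>ord_of (Orth E)\<^esub> U) ` {a\<in>A. leq a0 a}"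
        have MO: "?M \<subseteq> orth" by (auto intro!: O.inf_closed')
        have "\<exists>V\<in>orth. \<forall>x\<in>carrier E. \<zero> \<preceq> x \<longrightarrow> islub ((\<lambda>M. M x) ` ?M) (V x)"
        proof (rule orth_lub[OF MO _ U])
          show "?M \<noteq> {}" using a0(1) directedD(2)[OF dir] by blast
          show "M z \<preceq> U z" if M: "M \<in> ?M" and z: "z \<in> carrier E" "\<zero> \<preceq> z" for M z
          proof -
            obtain a where "a \<in> A" "M = ?R a \<sqinter>\<^bsub>ord_of (Orth E)\<^esub> U" using M by blast
            then show ?thesis using z by (simp add: Orth_inf)
          qed
        qed
        then obtain V where V [simp]: "V \<in> orth" and lub: "\<And>x. x \<in> carrier E \<Longrightarrow> \<zero> \<preceq> x \<Longrightarrow> islub ((\<lambda>M. M x) ` ?M) (V x)"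
          by blast
        have "V \<in> O.evub A leq (\<lambda>a. ?R a \<sqinter>\<^bsub>ord_of (Orth E)\<^esub> U)"
        proof (rule O.evubI[OF V a0(1)])
          fix a assume a: "a \<in> A" "leq a0 a"
          have "(?R a \<sqinter>\<^bsub>ord_of (Orth E)\<^esub> U) z \<preceq> V z" if "z \<in> carrier E" "\<zero> \<preceq> z" for z
            by (rule islubD(2)[OF lub[OF that]]) (use a in blast)
          then show "?R a \<sqinter>\<^bsub>ord_of (Orth E)\<^esub> U \<preceq>\<^bsub>Orth E\<^esub> V" by simp
        qed
        then have "W \<preceq>\<^bsub>Orth E\<^esub> V" using le by blast
        then have "W x \<preceq> V x" by simp
        moreover have "V x \<preceq> d"
        proof (rule islubD(3)[OF lub[OF x] d])
          fix e assume "e \<in> (\<lambda>M. M x) ` ?M"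
          then obtain a where a: "a \<in> A" "leq a0 a" "e = (?R a \<sqinter>\<^bsub>ord_of (Orth E)\<^esub> U) x" by blast
          have "e = ?R a x \<curlywedge> U x" unfolding a(3) by (rule Orth_inf) (use a(1) in simp_all)
          also have "?R a x = av (S a x \<ominus> S' x)"
            using Orth_abs[of "S a \<ominus>\<^bsub>Orth E\<^esub> S'" x, OF R(2)[OF a(1)]] Orth_minus[OF SO[OF a(1)] S'] by simp
          finally have "e = av (S a x \<ominus> S' x) \<curlywedge> U x" .
          then show "e \<preceq> d" using a0(2)[OF a(1,2)] by simp
        qed
        ultimately show "W x \<preceq> d" using ord_trans[of "W x" "V x" d] by simp
      qed simp
    qed
    then show "W \<preceq>\<^bsub>Orth E\<^esub> \<zero>\<^bsub>Orth E\<^esub>" by simp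
  qed
  then show ?thesis using O.uo_conv_iff[of A leq S S', OF dir] by simp
qed

end

section \<open>The topology of pointwise convergence on the orthomorphisms\<close>

lemma order_conv_cong: "(\<And>a. a \<in> A \<Longrightarrow> x a = y a) \<Longrightarrow> order_conv G A leq x l = order_conv G A leq y l"
  unfolding order_conv_def by (simp cong: conj_cong bex_cong ball_cong)

lemma uo_conv_cong: "(\<And>a. a \<in> A \<Longrightarrow> x a = y a) \<Longrightarrow> uo_conv G A leq x l = uo_conv G A leq y l"
  unfolding uo_conv_def by (intro ball_cong imp_cong refl order_conv_cong) simp

lemma limitin_tail_cong:
  assumes "directed A leq" "\<And>a. a \<in> A \<Longrightarrow> x a = y a"
  shows "limitin T x l (tail_filter A leq) = limitin T y l (tail_filter A leq)"
proof -
  have ne: "\<exists>a. a \<in> A" using assms(1) by (auto simp: directed_def)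
  then have ev: "eventually (\<lambda>a. x a = y a) (tail_filter A leq)" "eventually (\<lambda>a. y a = x a) (tail_filter A leq)"
    unfolding eventually_tail_filter[OF assms(1)] using assms(2) by auto
  show ?thesis using limitin_transform_eventually[OF ev(1)] limitin_transform_eventually[OF ev(2)] by blast
qed

context vlattice
begin

text \<open>
  The defining property of a uo-Lebesgue topology concerns null nets only; translation extends it to all limits.
\<close>

lemma limitin_shift:
  assumes ls: "locally_solid_linear_topology E \<tau>" and dir: "directed A leq"
    and x: "\<And>a. a \<in> A \<Longrightarrow> x a \<in> carrier E" and l: "l \<in> carrier E"
    and lim: "limitin \<tau> (\<lambda>a. x a \<ominus> l) \<zero> (tail_filter A leq)"
  shows "limitin \<tau> x l (tail_filter A leq)"
  unfolding limitin_def
proof (intro conjI allI impI)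
  show "l \<in> topspace \<tau>" using ls l by (simp add: locally_solid_linear_topology_def)
  fix U assume "openin \<tau> U \<and> l \<in> U"
  then have U: "openin \<tau> U" "l \<in> U" by blast+
  obtain V where V: "snb \<tau> V" "\<forall>v\<in>V. l \<oplus> v \<in> U" using U openin_iff_snb[OF ls, of U] by blast
  obtain W where W: "openin \<tau> W" "\<zero> \<in> W" "W \<subseteq> V" using V by (auto simp: snb_def)
  have "eventually (\<lambda>a. x a \<ominus> l \<in> W) (tail_filter A leq)" using lim W by (simp add: limitin_def)
  then obtain a0 where a0: "a0 \<in> A" "\<forall>a\<in>A. leq a0 a \<longrightarrow> x a \<ominus> l \<in> W" unfolding eventually_tail_filter[OF dir] by blast
  have "x a \<in> U" if a: "a \<in> A" "leq a0 a" for a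
  proof -
    have "l \<oplus> (x a \<ominus> l) \<in> U" using a0(2) a V(2) W(3) by blast
    then show ?thesis using x[OF a(1)] l by simp
  qed
  then show "eventually (\<lambda>a. x a \<in> U) (tail_filter A leq)" unfolding eventually_tail_filter[OF dir] using a0(1) by blast
qed

lemma uo_imp_tau:
  assumes \<tau>: "uo_Lebesgue E \<tau>" and dir: "directed A leq" and x: "\<And>a. a \<in> A \<Longrightarrow> x a \<in> carrier E"
    and l [simp]: "l \<in> carrier E" and conv: "uo_conv E A leq x l"
  shows "limitin \<tau> x l (tail_filter A leq)"
proof (rule limitin_shift[OF _ dir x l])
  show "locally_solid_linear_topology E \<tau>" using \<tau> by (simp add: uo_Lebesgue_def)
  have xl: "x a \<ominus> l \<in> carrier E" if "a \<in> A" for a using x[OF that] by simp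
  have "\<forall>y\<in>carrier E. \<zero> \<preceq> y \<longrightarrow> onull A leq (\<lambda>a. av (x a \<ominus> l) \<curlywedge> y)"
    using conv uo_conv_iff[of A leq x l, OF dir x l] by blast
  moreover have "onull A leq (\<lambda>a. av (x a \<ominus> l) \<curlywedge> y) = onull A leq (\<lambda>a. av ((x a \<ominus> l) \<ominus> \<zero>) \<curlywedge> y)" for y
    by (rule onull_cong) (simp add: xl)
  ultimately have "uo_conv E A leq (\<lambda>a. x a \<ominus> l) \<zero>"
    using uo_conv_iff[of A leq "\<lambda>a. x a \<ominus> l" \<zero>, OF dir xl] by simp
  moreover have "net_in E A leq (\<lambda>a. x a \<ominus> l)" using dir xl by (simp add: net_in_def)
  ultimately show "limitin \<tau> (\<lambda>a. x a \<ominus> l) \<zero> (tail_filter A leq)"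
    by (intro uo_Lebesgue_any_index[OF \<tau>])
qed

end

context orth_vlattice
begin

interpretation O: orth_vlattice "Orth E"
  by (rule orth_vlattice_Orth)

text \<open>
  Operators are extensional, so they are points of the product of copies of \<open>E\<close> indexed by its carrier.
\<close>

definition ptw :: "'a topology \<Rightarrow> ('a \<Rightarrow> 'a) topology" where
  "ptw \<tau> = subtopology (product_topology (\<lambda>_. \<tau>) (carrier E)) orth"

lemma topspace_ptw: "topspace \<tau> = carrier E \<Longrightarrow> topspace (ptw \<tau>) = orth"
  unfolding ptw_def by (auto simp: PiE_def orth_extensional)

lemma continuous_into_ptw:
  assumes "\<And>x. x \<in> carrier E \<Longrightarrow> continuous_map X \<tau> (\<lambda>p. f p x)" "f ` topspace X \<subseteq> orth"
  shows "continuous_map X (ptw \<tau>) f"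
  unfolding ptw_def continuous_map_in_subtopology continuous_map_componentwise
  using assms orth_extensional by (auto simp: image_subset_iff)

lemma continuous_eval_ptw: "x \<in> carrier E \<Longrightarrow> continuous_map (ptw \<tau>) \<tau> (\<lambda>S. S x)"
  unfolding ptw_def by (rule continuous_map_from_subtopology) (rule continuous_map_product_projection)

text \<open>
  Conditions on \<open>S i\<close> do not define solid sets, but conditions on \<open>S \<bar>i\<bar>\<close> do, because \<open>\<bar>S \<bar>i\<bar>\<bar> = \<bar>S\<bar> \<bar>i\<bar>\<close>. They are
  stronger, as \<open>\<bar>S i\<bar> \<le> \<bar>S\<bar> \<bar>i\<bar>\<close>.
\<close>

lemma locally_solid_ptw:
  assumes ls: "locally_solid_linear_topology E \<tau>"
  shows "locally_solid_linear_topology (Orth E) (ptw \<tau>)"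
proof -
  have top: "topspace \<tau> = carrier E"
    and cadd: "continuous_map (prod_topology \<tau> \<tau>) \<tau> (\<lambda>(x, y). x \<oplus> y)"
    and csm: "continuous_map (prod_topology euclideanreal \<tau>) \<tau> (\<lambda>(r, x). r \<odot> x)"
    using ls by (simp_all add: locally_solid_linear_topology_def)
  note topP = topspace_ptw[OF top]
  have 1: "continuous_map (prod_topology (ptw \<tau>) (ptw \<tau>)) (ptw \<tau>) (\<lambda>(S, T). S \<oplus>\<^bsub>Orth E\<^esub> T)"
  proof (rule continuous_into_ptw)
    fix x assume x: "x \<in> carrier E"
    have "continuous_map (prod_topology (ptw \<tau>) (ptw \<tau>)) (prod_topology \<tau> \<tau>) (\<lambda>p. (fst p x, snd p x))"
      using continuous_map_compose[OF continuous_map_fst continuous_eval_ptw[OF x]]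
        continuous_map_compose[OF continuous_map_snd continuous_eval_ptw[OF x]]
      by (intro continuous_map_pairedI) (simp_all add: o_def)
    from continuous_map_compose[OF this cadd] x
    show "continuous_map (prod_topology (ptw \<tau>) (ptw \<tau>)) \<tau> (\<lambda>p. (case p of (S, T) \<Rightarrow> S \<oplus>\<^bsub>Orth E\<^esub> T) x)"
      by (simp add: o_def case_prod_beta)
  qed (use add_orth in \<open>auto simp: topP\<close>)
  have 2: "continuous_map (prod_topology euclideanreal (ptw \<tau>)) (ptw \<tau>) (\<lambda>(r, T). r \<odot>\<^bsub>Orth E\<^esub> T)"
  proof (rule continuous_into_ptw)
    fix x assume x: "x \<in> carrier E"
    have "continuous_map (prod_topology euclideanreal (ptw \<tau>)) (prod_topology euclideanreal \<tau>) (\<lambda>p. (fst p, snd p x))"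
      using continuous_map_fst[of euclideanreal "ptw \<tau>"]
        continuous_map_compose[OF continuous_map_snd continuous_eval_ptw[OF x]]
      by (intro continuous_map_pairedI) (simp_all add: o_def)
    from continuous_map_compose[OF this csm] x
    show "continuous_map (prod_topology euclideanreal (ptw \<tau>)) \<tau> (\<lambda>p. (case p of (r, T) \<Rightarrow> r \<odot>\<^bsub>Orth E\<^esub> T) x)"
      by (simp add: o_def case_prod_beta)
  qed (use smult_orth in \<open>auto simp: topP\<close>)
  have 3: "\<exists>V W. solid_in (Orth E) V \<and> V \<subseteq> U \<and> openin (ptw \<tau>) W \<and> \<zero>\<^bsub>Orth E\<^esub> \<in> W \<and> W \<subseteq> V"
    if U: "openin (ptw \<tau>) U" "\<zero>\<^bsub>Orth E\<^esub> \<in> U" for U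
  proof -
    obtain U' where U': "openin (product_topology (\<lambda>_. \<tau>) (carrier E)) U'" "U = U' \<inter> orth"
      using U(1) unfolding ptw_def openin_subtopology by blast
    have "(\<lambda>x\<in>carrier E. \<zero>) \<in> U'" using U(2) U'(2) by simp
    then obtain B where B: "finite {i \<in> carrier E. B i \<noteq> topspace \<tau>}" "\<forall>i\<in>carrier E. openin \<tau> (B i)"
      "(\<lambda>x\<in>carrier E. \<zero>) \<in> Pi\<^sub>E (carrier E) B" "Pi\<^sub>E (carrier E) B \<subseteq> U'"
      using U'(1) unfolding openin_product_topology_alt by meson
    define F where "F = {i \<in> carrier E. B i \<noteq> topspace \<tau>}"
    have FC: "F \<subseteq> carrier E" and finF: "finite F" using B(1) by (auto simp: F_def)
    have "\<exists>V. snb \<tau> V \<and> V \<subseteq> B i" if "i \<in> F" for i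
    proof -
      have i: "i \<in> carrier E" using FC that by blast
      have "\<zero> \<in> B i" using PiE_mem[OF B(3) i] i by simp
      then show ?thesis using snb_exists[OF ls, of "B i"] B(2) i by blast
    qed
    then obtain V where V: "\<And>i. i \<in> F \<Longrightarrow> snb \<tau> (V i)" "\<And>i. i \<in> F \<Longrightarrow> V i \<subseteq> B i" by metis
    then have "\<forall>i\<in>F. \<exists>W. openin \<tau> W \<and> \<zero> \<in> W \<and> W \<subseteq> V i" by (simp add: snb_def)
    then obtain W where W: "\<And>i. i \<in> F \<Longrightarrow> openin \<tau> (W i)" "\<And>i. i \<in> F \<Longrightarrow> \<zero> \<in> W i" "\<And>i. i \<in> F \<Longrightarrow> W i \<subseteq> V i" by metis
    let ?V = "{S \<in> orth. \<forall>i\<in>F. S (av i) \<in> V i}"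
    let ?W = "{S \<in> orth. \<forall>i\<in>F. S (av i) \<in> W i}"
    have "solid_in (Orth E) ?V"
      unfolding solid_in_def
    proof (intro conjI ballI impI)
      fix S T assume S: "S \<in> orth" and T: "T \<in> ?V" and le: "vabs (Orth E) S \<preceq>\<^bsub>Orth E\<^esub> vabs (Orth E) T"
      have "S (av i) \<in> V i" if i: "i \<in> F" for i
      proof (rule snb_solid[OF V(1)[OF i]])
        have [simp]: "i \<in> carrier E" using FC i by blast
        show "T (av i) \<in> V i" using T i by blast
        show "S (av i) \<in> carrier E" using S by simp
        have "vabs (Orth E) S (av i) \<preceq> vabs (Orth E) T (av i)" using le by simp
        then show "av (S (av i)) \<preceq> av (T (av i))" using S T by (simp add: Orth_abs)
      qed
      then show "S \<in> ?V" using S by blast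
    qed auto
    moreover have "?V \<subseteq> U"
    proof
      fix S assume S: "S \<in> ?V"
      have "S i \<in> B i" if i: "i \<in> carrier E" for i
      proof (cases "i \<in> F")
        case True
        have "S i \<in> V i"
        proof (rule snb_solid[OF V(1)[OF True]])
          show "S (av i) \<in> V i" using S True by blast
          have "av (S i) \<preceq> vabs (Orth E) S (av i)" using Orth_abs_le S i by blast
          also have "\<dots> = av (S (av i))" using S i by (simp add: Orth_abs)
          finally show "av (S i) \<preceq> av (S (av i))" using S i by (simp add: Orth_abs)
        qed (use S i in simp)
        then show ?thesis using V(2)[OF True] by blast
      next
        case False
        then have "B i = carrier E" using i top by (simp add: F_def)
        then show ?thesis using S i by simp
      qed
      then have "S \<in> Pi\<^sub>E (carrier E) B" using S orth_extensional by (auto simp: PiE_def)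
      then show "S \<in> U" using B(4) U'(2) S by blast
    qed
    moreover have "openin (ptw \<tau>) ?W"
    proof -
      have "openin (ptw \<tau>) ((\<Inter>i\<in>F. {S \<in> topspace (ptw \<tau>). S (av i) \<in> W i}) \<inter> topspace (ptw \<tau>))"
        using FC W(1) by (intro openin_INT finF openin_continuous_map_preimage[OF continuous_eval_ptw]) auto
      also have "(\<Inter>i\<in>F. {S \<in> topspace (ptw \<tau>). S (av i) \<in> W i}) \<inter> topspace (ptw \<tau>) = ?W" by (auto simp: topP)
      finally show ?thesis .
    qed
    moreover have "\<zero>\<^bsub>Orth E\<^esub> \<in> ?W" using zero_orth W(2) FC by auto
    moreover have "?W \<subseteq> ?V" using W(3) by blast
    ultimately show ?thesis by blast
  qed
  show ?thesis unfolding locally_solid_linear_topology_def by (intro conjI topP 1 2 allI impI 3) blast+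
qed

lemma limitin_ptw_iff:
  assumes top: "topspace \<tau> = carrier E" and dir: "directed A leq" and S: "\<And>a. a \<in> A \<Longrightarrow> S a \<in> orth" and S': "S' \<in> orth"
  shows "limitin (ptw \<tau>) S S' (tail_filter A leq) \<longleftrightarrow> (\<forall>x\<in>carrier E. limitin \<tau> (\<lambda>a. S a x) (S' x) (tail_filter A leq))"
proof -
  have ne: "\<exists>a. a \<in> A" using dir by (auto simp: directed_def)
  have ev: "eventually (\<lambda>a. S a \<in> orth) (tail_filter A leq)"
    unfolding eventually_tail_filter[OF dir] using ne S by auto
  then have "eventually (\<lambda>a. S a \<in> topspace (product_topology (\<lambda>_. \<tau>) (carrier E))) (tail_filter A leq)"
    by (rule eventually_mono) (auto simp: PiE_def orth_extensional top)
  then show ?thesis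
    unfolding ptw_def limitin_subtopology limitin_componentwise using ev S' orth_extensional by simp
qed

lemma Hausdorff_uo_Lebesgue_ptw:
  assumes \<tau>: "Hausdorff_uo_Lebesgue E \<tau>"
  shows "Hausdorff_uo_Lebesgue (Orth E) (ptw \<tau>)"
proof -
  have uo: "uo_Lebesgue E \<tau>" and haus: "Hausdorff_space \<tau>" and ls: "locally_solid_linear_topology E \<tau>"
    using \<tau> by (auto simp: Hausdorff_uo_Lebesgue_def uo_Lebesgue_def)
  have top: "topspace \<tau> = carrier E" using ls by (simp add: locally_solid_linear_topology_def)
  have "limitin (ptw \<tau>) x \<zero>\<^bsub>Orth E\<^esub> (tail_filter A leq)"
    if net: "net_in (Orth E) A leq x" and conv: "uo_conv (Orth E) A leq x \<zero>\<^bsub>Orth E\<^esub>"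
    for A :: "(('a \<Rightarrow> 'a) set \<times> ('a \<Rightarrow> 'a)) set" and leq x
  proof -
    note dir = net_in_OrthD(1)[OF net] and SO = net_in_OrthD(2)[OF net]
    have z: "\<zero>\<^bsub>Orth E\<^esub> \<in> orth" using zero_orth by simp
    have "limitin \<tau> (\<lambda>a. x a y) (\<zero>\<^bsub>Orth E\<^esub> y) (tail_filter A leq)" if y: "y \<in> carrier E" for y
      by (rule uo_imp_tau[OF uo dir _ _ uo_imp_SUO[OF net z conv y]]) (use SO y in auto)
    then show ?thesis using limitin_ptw_iff[of \<tau> A leq x, OF top dir SO z] by blast
  qed
  moreover have "Hausdorff_space (ptw \<tau>)"
    unfolding ptw_def by (rule Hausdorff_space_subtopology) (simp add: Hausdorff_space_product_topology haus)
  ultimately show ?thesis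
    unfolding Hausdorff_uo_Lebesgue_def uo_Lebesgue_def using locally_solid_ptw[OF ls] by blast
qed

lemma tau_iff_Stau:
  assumes \<tau>: "Hausdorff_uo_Lebesgue E \<tau>" and net: "net_in (Orth E) A leq S" and S': "S' \<in> orth"
  shows "converges Mtau E A leq S S' \<longleftrightarrow> converges MStau E A leq S S'"
proof -
  have top: "topspace \<tau> = carrier E"
    using \<tau> by (simp add: Hausdorff_uo_Lebesgue_def uo_Lebesgue_def locally_solid_linear_topology_def)
  show ?thesis
    using limitin_ptw_iff[of \<tau> A leq S, OF top net_in_OrthD[OF net] S']
    by (simp add: tau_hat_eq[OF \<tau>] O.tau_hat_eq[OF Hausdorff_uo_Lebesgue_ptw[OF \<tau>]])
qed

lemma SUO_imp_Stau:
  assumes \<tau>: "Hausdorff_uo_Lebesgue E \<tau>" and net: "net_in (Orth E) A leq S" and S': "S' \<in> orth"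
    and conv: "converges MSUO E A leq S S'"
  shows "converges MStau E A leq S S'"
proof -
  have uo: "uo_Lebesgue E \<tau>" using \<tau> by (simp add: Hausdorff_uo_Lebesgue_def)
  have "limitin \<tau> (\<lambda>a. S a x) (S' x) (tail_filter A leq)" if x: "x \<in> carrier E" for x
    by (rule uo_imp_tau[OF uo net_in_OrthD(1)[OF net]]) (use net_in_OrthD(2)[OF net] S' x conv in auto)
  then show ?thesis by (simp add: tau_hat_eq[OF \<tau>])
qed

section \<open>The continuous pairs\<close>

lemma rho_apply: "S \<in> orth \<Longrightarrow> rho E T S = compose (carrier E) S T"
  by (simp add: rho_def)

lemma rho_eq_lam: "T \<in> orth \<Longrightarrow> rho E T = lam E T"
  unfolding rho_def lam_def using compose_orth_commute by (intro restrict_ext) simp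

lemma strong_rho:
  assumes net: "net_in (Orth E) A leq S" and S': "S' \<in> orth" and T: "T \<in> orth"
    and c: "c \<in> {MSO, MSUO, MStau}" and conv: "converges c E A leq S S'"
  shows "converges c E A leq (\<lambda>a. rho E T (S a)) (rho E T S')"
proof -
  note dir = net_in_OrthD(1)[OF net] and SO = net_in_OrthD(2)[OF net]
  have eq: "rho E T (S a) x = S a (T x)" if "a \<in> A" "x \<in> carrier E" for a x
    using rho_apply[OF SO[OF that(1)], of T] that(2) by (simp add: compose_eq)
  have eq': "rho E T S' x = S' (T x)" if "x \<in> carrier E" for x
    using rho_apply[OF S', of T] that by (simp add: compose_eq)
  show ?thesis
    using c
  proof (elim insertE emptyE)
    assume c: "c = MSO"
    have "order_conv E A leq (\<lambda>a. rho E T (S a) x) (rho E T S' x)" if x: "x \<in> carrier E" for x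
      using conv orth_closed[OF T x] x order_conv_cong[of A "\<lambda>a. rho E T (S a) x" "\<lambda>a. S a (T x)" E leq]
      by (simp add: c eq eq')
    then show ?thesis by (simp add: c)
  next
    assume c: "c = MSUO"
    have "uo_conv E A leq (\<lambda>a. rho E T (S a) x) (rho E T S' x)" if x: "x \<in> carrier E" for x
      using conv orth_closed[OF T x] x uo_conv_cong[of A "\<lambda>a. rho E T (S a) x" "\<lambda>a. S a (T x)" E leq]
      by (simp add: c eq eq')
    then show ?thesis by (simp add: c)
  next
    assume c: "c = MStau"
    have "limitin (tau_hat E) (\<lambda>a. rho E T (S a) x) (rho E T S' x) (tail_filter A leq)" if x: "x \<in> carrier E" for x
      using conv orth_closed[OF T x] x limitin_tail_cong[OF dir, of "\<lambda>a. rho E T (S a) x" "\<lambda>a. S a (T x)"]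
      by (simp add: c eq eq')
    then show ?thesis by (simp add: c)
  qed
qed

lemma rho_net:
  assumes net: "net_in (Orth E) A leq S" and T: "T \<in> orth"
  shows "net_in (Orth E) A leq (\<lambda>a. rho E T (S a))"
  using net_in_OrthD[OF net] T by (auto simp: net_in_def rho_apply)

text \<open>
  The pairs with order convergence as target are set aside: no other mode provides a bound for a tail in \<open>Orth E\<close>,
  and order convergence itself is preserved by composition for a separate reason (\<open>o_imp_o_rho\<close>).
\<close>

lemma converges_imp:
  assumes net: "net_in (Orth E) A leq S" and S': "S' \<in> orth" and conv: "converges c\<^sub>1 E A leq S S'"
    and pair: "(c\<^sub>1, c\<^sub>2) \<in> continuity_pairs" "c\<^sub>2 \<noteq> Mo" 
    and \<tau>: "{c\<^sub>1, c\<^sub>2} \<inter> {Mtau, MStau} \<noteq> {} \<Longrightarrow> \<exists>\<tau>. Hausdorff_uo_Lebesgue E \<tau>"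
  shows "converges c\<^sub>2 E A leq S S'"
proof -
  have o_SO: "converges Mo E A leq S S' \<Longrightarrow> converges MSO E A leq S S'"
    using o_imp_SO[OF net S'] by simp
  have SO_SUO: "converges MSO E A leq S S' \<Longrightarrow> converges MSUO E A leq S S'"
    using SO_imp_SUO[OF net S'] by simp
  have uo_SUO: "converges Muo E A leq S S' \<longleftrightarrow> converges MSUO E A leq S S'"
    using uo_imp_SUO[OF net S'] SUO_imp_uo[OF net S'] by auto
  have SUO_Stau: "converges MSUO E A leq S S' \<Longrightarrow> converges MStau E A leq S S'" if "\<exists>\<tau>. Hausdorff_uo_Lebesgue E \<tau>"
    using SUO_imp_Stau[OF _ net S'] that by blast
  have tau_Stau: "converges Mtau E A leq S S' \<longleftrightarrow> converges MStau E A leq S S'" if "\<exists>\<tau>. Hausdorff_uo_Lebesgue E \<tau>"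
    using tau_iff_Stau[OF _ net S'] that by blast
  show ?thesis
  proof (cases "{c\<^sub>1, c\<^sub>2} \<inter> {Mtau, MStau} = {}")
    case True
    then show ?thesis using conv pair o_SO SO_SUO uo_SUO
      by (cases c\<^sub>1; cases c\<^sub>2) (simp_all add: continuity_pairs_def del: converges.simps)
  next
    case False
    then show ?thesis using conv pair o_SO SO_SUO uo_SUO SUO_Stau[OF \<tau>[OF False]] tau_Stau[OF \<tau>[OF False]]
      by (cases c\<^sub>1; cases c\<^sub>2) (simp_all add: continuity_pairs_def del: converges.simps)
  qed
qed

lemma rho_continuous:
  assumes c: "(c\<^sub>1, c\<^sub>2) \<in> continuity_pairs" and T: "T \<in> orth"
    and \<tau>: "{c\<^sub>1, c\<^sub>2} \<inter> {Mtau, MStau} \<noteq> {} \<Longrightarrow> \<exists>\<tau>. Hausdorff_uo_Lebesgue E \<tau>"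
  shows "mode_continuous TYPE('i) E c\<^sub>1 c\<^sub>2 (rho E T)"
  unfolding mode_continuous_def
proof (intro allI ballI impI, elim conjE)
  fix A :: "'i set" and leq S S'
  assume S': "S' \<in> orth" and net: "net_in (Orth E) A leq S" and conv: "converges c\<^sub>1 E A leq S S'"
  have net': "net_in (Orth E) A leq (\<lambda>a. rho E T (S a))" and S'': "rho E T S' \<in> orth"
    using rho_net[OF net T] rho_apply[OF S'] compose_orth[OF S' T] by simp_all
  have via: "converges c\<^sub>2 E A leq (\<lambda>a. rho E T (S a)) (rho E T S')"
    if d: "d \<in> {MSO, MSUO, MStau}" "(c\<^sub>1, d) \<in> continuity_pairs" "(d, c\<^sub>2) \<in> continuity_pairs" "c\<^sub>2 \<noteq> Mo"
      "d = MStau \<Longrightarrow> {c\<^sub>1, c\<^sub>2} \<inter> {Mtau, MStau} \<noteq> {}" for d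
  proof -
    have "converges d E A leq S S'"
      by (rule converges_imp[OF net S' conv d(2)]) (use d \<tau> in auto)
    then have "converges d E A leq (\<lambda>a. rho E T (S a)) (rho E T S')" by (rule strong_rho[OF net S' T d(1)])
    then show ?thesis
      by (rule converges_imp[OF net' S'' _ d(3,4)]) (use d \<tau> in auto)
  qed
  show "converges c\<^sub>2 E A leq (\<lambda>a. rho E T (S a)) (rho E T S')"
  proof (cases "c\<^sub>2 = Mo")
    case True
    then have "c\<^sub>1 = Mo" using c by (auto simp: continuity_pairs_def)
    then have "order_conv (Orth E) A leq (\<lambda>a. compose (carrier E) (S a) T) (compose (carrier E) S' T)"
      using o_imp_o_rho[OF net S' T] conv by simp
    then have "order_conv (Orth E) A leq (\<lambda>a. rho E T (S a)) (rho E T S')"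
      using order_conv_cong[of A "\<lambda>a. rho E T (S a)" "\<lambda>a. compose (carrier E) (S a) T" "Orth E" leq]
        net_in_OrthD(2)[OF net] by (simp add: rho_apply S')
    then show ?thesis using True by simp
  next
    case False
    have "\<exists>d \<in> {MSO, MSUO, MStau}. (c\<^sub>1, d) \<in> continuity_pairs \<and> (d, c\<^sub>2) \<in> continuity_pairs \<and>
        (d = MStau \<longrightarrow> {c\<^sub>1, c\<^sub>2} \<inter> {Mtau, MStau} \<noteq> {})"
      using c False by (cases c\<^sub>1; cases c\<^sub>2) (simp_all add: continuity_pairs_def)
    then show ?thesis using via False by blast
  qed
qed

lemma rho_id: "S \<in> orth \<Longrightarrow> rho E (\<lambda>x\<in>carrier E. x) S = S"
  using restrict_orth_eq[of S] by (simp add: rho_apply compose_def cong: restrict_cong)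

lemma not_continuousI:
  fixes S :: "'i \<Rightarrow> 'a \<Rightarrow> 'a"
  assumes net: "net_in (Orth E) UNIV leq S" and S': "S' \<in> orth"
    and c: "converges c\<^sub>1 E UNIV leq S S'" "\<not> converges c\<^sub>2 E UNIV leq S S'"
  shows "\<not> mode_continuous TYPE('i) E c\<^sub>1 c\<^sub>2 (rho E (\<lambda>x\<in>carrier E. x))"
proof
  assume "mode_continuous TYPE('i) E c\<^sub>1 c\<^sub>2 (rho E (\<lambda>x\<in>carrier E. x))"
  then have "converges c\<^sub>2 E UNIV leq (\<lambda>a. rho E (\<lambda>x\<in>carrier E. x) (S a)) (rho E (\<lambda>x\<in>carrier E. x) S')"
    using net S' c(1) unfolding mode_continuous_def by blast
  moreover have "(\<lambda>a. rho E (\<lambda>x\<in>carrier E. x) (S a)) = S" using net_in_OrthD(2)[OF net] by (simp add: rho_id)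
  ultimately show False using c(2) S' by (simp add: rho_id)
qed

end

section \<open>Spaces of classes of measurable functions\<close>

text \<open>
  Functions are identified if they agree almost everywhere. Values of \<open>rep\<close> are only specified up to null
  sets, so everything is evaluated through \<open>L0_add\<close>, \<open>L0_smult\<close> and \<open>L0_le\<close>.
\<close>

definition cls :: "real measure \<Rightarrow> (real \<Rightarrow> real) \<Rightarrow> (real \<Rightarrow> real) set" where
  "cls M f = {g \<in> borel_measurable M. AE t in M. g t = f t}"

definition rep :: "(real \<Rightarrow> real) set \<Rightarrow> real \<Rightarrow> real" where
  "rep X = (SOME f. f \<in> X)"

text \<open>
  The predicate \<open>P\<close> selects an ideal of the space of all classes. The fields for the multiplication and the unit are
  filled arbitrarily.
\<close>

definition L0 :: "real measure \<Rightarrow> ((real \<Rightarrow> real) \<Rightarrow> bool) \<Rightarrow> (real \<Rightarrow> real) set vlat" where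
  "L0 M P = \<lparr>carrier = cls M ` {f \<in> borel_measurable M. P f},
     mult = (\<lambda>X Y. X), one = {}, zero = cls M (\<lambda>t. 0),
     add = (\<lambda>X Y. cls M (\<lambda>t. rep X t + rep Y t)),
     smult = (\<lambda>r X. cls M (\<lambda>t. r * rep X t)),
     vle = (\<lambda>X Y. AE t in M. rep X t \<le> rep Y t)\<rparr>"

lemma cls_eqI: "(AE t in M. f t = g t) \<Longrightarrow> cls M f = cls M g"
  unfolding cls_def by (auto elim: AE_mp)

lemma cls_eq_iff:
  assumes "f \<in> borel_measurable M" shows "cls M f = cls M g \<longleftrightarrow> (AE t in M. f t = g t)"
proof
  assume "cls M f = cls M g"
  moreover have "f \<in> cls M f" using assms by (simp add: cls_def)
  ultimately show "AE t in M. f t = g t" by (simp add: cls_def)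
qed (rule cls_eqI)

lemma rep_cls:
  assumes "f \<in> borel_measurable M"
  shows "rep (cls M f) \<in> borel_measurable M" "AE t in M. rep (cls M f) t = f t"
proof -
  have "f \<in> cls M f" using assms by (simp add: cls_def)
  then have "rep (cls M f) \<in> cls M f" unfolding rep_def by (rule someI[where P = "\<lambda>g. g \<in> cls M f"])
  then show "rep (cls M f) \<in> borel_measurable M" "AE t in M. rep (cls M f) t = f t" by (auto simp: cls_def)
qed

lemma L0_carrier: "carrier (L0 M P) = cls M ` {f \<in> borel_measurable M. P f}"
  and L0_zero: "zero (L0 M P) = cls M (\<lambda>t. 0)"
  by (simp_all add: L0_def)

lemma L0_add:
  assumes "f \<in> borel_measurable M" "g \<in> borel_measurable M"
  shows "add (L0 M P) (cls M f) (cls M g) = cls M (\<lambda>t. f t + g t)"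
proof -
  have "AE t in M. rep (cls M f) t + rep (cls M g) t = f t + g t"
    using rep_cls(2)[OF assms(1)] rep_cls(2)[OF assms(2)] by eventually_elim simp
  then show ?thesis unfolding L0_def by (simp add: cls_eqI)
qed

lemma L0_smult:
  assumes "f \<in> borel_measurable M"
  shows "smult (L0 M P) r (cls M f) = cls M (\<lambda>t. r * f t)"
proof -
  have "AE t in M. r * rep (cls M f) t = r * f t"
    using rep_cls(2)[OF assms(1)] by eventually_elim simp
  then have "cls M (\<lambda>t. r * rep (cls M f) t) = cls M (\<lambda>t. r * f t)" by (rule cls_eqI)
  then show ?thesis unfolding L0_def by simp
qed

lemma L0_le:
  assumes "f \<in> borel_measurable M" "g \<in> borel_measurable M"
  shows "vle (L0 M P) (cls M f) (cls M g) \<longleftrightarrow> (AE t in M. f t \<le> g t)"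
proof -
  have "AE t in M. (rep (cls M f) t \<le> rep (cls M g) t) = (f t \<le> g t)"
    using rep_cls(2)[OF assms(1)] rep_cls(2)[OF assms(2)] by eventually_elim simp
  then have "(AE t in M. rep (cls M f) t \<le> rep (cls M g) t) \<longleftrightarrow> (AE t in M. f t \<le> g t)"
    by (rule eventually_subst)
  then show ?thesis by (simp add: L0_def)
qed

text \<open>
  Among all sequences in \<open>F\<close> choose one whose pointwise supremum \<open>s\<close> has the largest integral of \<open>arctan s\<close>. The
  maximum is attained, since countably many sequences can be merged into one. Prepending a further \<open>f\<close> to the
  sequence cannot increase the integral, so that \<open>f \<le> s\<close> almost everywhere.
\<close>

lemma ess_SUP_of_sequence:
  fixes F :: "(real \<Rightarrow> real) set"
  assumes "finite_measure M" and F: "F \<subseteq> borel_measurable M" "F \<noteq> {}"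
    and h [measurable]: "h \<in> borel_measurable M" and le: "\<And>f. f \<in> F \<Longrightarrow> AE t in M. f t \<le> h t"
  shows "\<exists>\<sigma> s. range \<sigma> \<subseteq> F \<and> s \<in> borel_measurable M \<and> (\<forall>f\<in>F. AE t in M. f t \<le> s t) \<and>
    (AE t in M. s t = (SUP n::nat. \<sigma> n t) \<and> bdd_above (range (\<lambda>n. \<sigma> n t)))"
proof -
  interpret finite_measure M by fact
  \<comment> \<open>Cutting off at \<open>h\<close> keeps the suprema finite everywhere, not just almost everywhere.\<close>
  define S where "S \<sigma> t = (SUP n. min (\<sigma> n t) (h t))" for \<sigma> :: "nat \<Rightarrow> real \<Rightarrow> real" and t
  have bdd: "bdd_above (range (\<lambda>n. min (\<sigma> n t) (h t)))" for \<sigma> :: "nat \<Rightarrow> real \<Rightarrow> real" and t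
    by (rule bdd_aboveI[of _ "h t"]) auto
  have S_ge: "min (\<sigma> n t) (h t) \<le> S \<sigma> t" for \<sigma> n t
    unfolding S_def by (rule cSUP_upper[OF _ bdd]) simp
  have S_le: "S \<sigma> t \<le> u" if "\<And>n. min (\<sigma> n t) (h t) \<le> u" for \<sigma> t u
    unfolding S_def using that by (intro cSUP_least) auto
  have S_meas [measurable]: "S \<sigma> \<in> borel_measurable M" if "range \<sigma> \<subseteq> F" for \<sigma>
  proof -
    have [measurable]: "\<sigma> n \<in> borel_measurable M" for n using that F by blast
    show ?thesis unfolding S_def[abs_def] by (rule borel_measurable_cSUP) (auto intro: bdd)
  qed
  have bnd: "\<bar>arctan u\<bar> \<le> 2" for u
    using arctan_bounded[of u] pi_less_4 by linarith
  have int: "integrable M (\<lambda>t. arctan (S \<sigma> t))" if [measurable]: "range \<sigma> \<subseteq> F" for \<sigma>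
    using that bnd by (intro integrable_const_bound[where B = 2]) (auto intro!: measurable_compose[OF S_meas])
  let ?I = "\<lambda>\<sigma>. \<integral>t. arctan (S \<sigma> t) \<partial>M"
  let ?\<Sigma> = "{\<sigma> :: nat \<Rightarrow> real \<Rightarrow> real. range \<sigma> \<subseteq> F}"
  define c where "c = (SUP \<sigma>\<in>?\<Sigma>. ?I \<sigma>)"
  have bddI: "bdd_above (?I ` ?\<Sigma>)"
  proof (rule bdd_aboveI2)
    fix \<sigma> assume "\<sigma> \<in> ?\<Sigma>"
    then have "?I \<sigma> \<le> (\<integral>t. 2 \<partial>M)" using bnd by (intro integral_mono int) (auto simp: abs_le_iff)
    then show "?I \<sigma> \<le> (\<integral>t. 2 \<partial>M)" .
  qed
  obtain f\<^sub>0 where f0: "f\<^sub>0 \<in> F" using F by blast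
  then have ne: "?\<Sigma> \<noteq> {}" by (auto intro!: exI[of _ "\<lambda>_. f\<^sub>0"])
  have "\<exists>\<sigma>\<in>?\<Sigma>. c - 1 / Suc k < ?I \<sigma>" for k
    using less_cSUP_iff[OF ne bddI, of "c - 1 / Suc k"] by (simp add: c_def)
  then obtain \<sigma>' where \<sigma>': "\<And>k. range (\<sigma>' k) \<subseteq> F" "\<And>k. c - 1 / Suc k < ?I (\<sigma>' k)"
    by (simp add: Bex_def) metis
  define \<sigma> where "\<sigma> n = \<sigma>' (fst (prod_decode n)) (snd (prod_decode n))" for n
  have \<sigma>: "range \<sigma> \<subseteq> F" using \<sigma>'(1) by (auto simp: \<sigma>_def)
  have "S (\<sigma>' k) t \<le> S \<sigma> t" for k t
  proof (rule S_le)
    fix n show "min (\<sigma>' k n t) (h t) \<le> S \<sigma> t" using S_ge[of \<sigma> "prod_encode (k, n)" t] by (simp add: \<sigma>_def)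
  qed
  then have "?I (\<sigma>' k) \<le> ?I \<sigma>" for k
    using \<sigma> \<sigma>'(1) by (intro integral_mono int) (auto simp: arctan_le_iff)
  then have "c - 1 / Suc k \<le> ?I \<sigma>" for k using \<sigma>'(2)[of k] by (meson less_imp_le order_trans)
  then have "c \<le> ?I \<sigma> + 1 / Suc k" for k using diff_le_eq by blast
  note approx = this
  have c: "c \<le> ?I \<sigma>"
  proof (rule field_le_epsilon)
    fix e :: real assume "0 < e"
    then obtain k where "1 / Suc k < e" by (rule nat_approx_posE)
    then show "c \<le> ?I \<sigma> + e" using approx[of k] by linarith
  qed
  have upper: "AE t in M. f t \<le> S \<sigma> t" if f: "f \<in> F" for f
  proof -
    let ?\<tau> = "case_nat f \<sigma>"
    have "?\<tau> n \<in> F" for n using f \<sigma> by (cases n) auto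
    then have \<tau>: "range ?\<tau> \<subseteq> F" by blast
    have mono: "S \<sigma> t \<le> S ?\<tau> t" for t
    proof (rule S_le)
      fix n show "min (\<sigma> n t) (h t) \<le> S ?\<tau> t" using S_ge[of ?\<tau> "Suc n" t] by simp
    qed
    have "?I ?\<tau> \<le> c" unfolding c_def by (rule cSUP_upper[OF _ bddI]) (use \<tau> in simp)
    moreover have "(\<integral>t. arctan (S ?\<tau> t) - arctan (S \<sigma> t) \<partial>M) = ?I ?\<tau> - ?I \<sigma>"
      by (rule Bochner_Integration.integral_diff[OF int[OF \<tau>] int[OF \<sigma>]])
    moreover have "0 \<le> (\<integral>t. arctan (S ?\<tau> t) - arctan (S \<sigma> t) \<partial>M)"
      by (rule integral_nonneg_AE) (use mono in \<open>simp add: arctan_le_iff\<close>)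
    ultimately have "(\<integral>t. arctan (S ?\<tau> t) - arctan (S \<sigma> t) \<partial>M) = 0" using c by linarith
    then have "AE t in M. arctan (S ?\<tau> t) - arctan (S \<sigma> t) = 0"
      by (subst (asm) integral_nonneg_eq_0_iff_AE)
        (use mono int[OF \<tau>] int[OF \<sigma>] in \<open>auto simp: arctan_le_iff\<close>)
    then show ?thesis using le[OF f]
    proof eventually_elim
      case (elim t)
      then have "S ?\<tau> t = S \<sigma> t" by (simp add: arctan_eq_iff)
      moreover have "f t \<le> S ?\<tau> t" using S_ge[of ?\<tau> 0 t] elim(2) by simp
      ultimately show ?case by simp
    qed
  qed
  have "AE t in M. \<forall>n. \<sigma> n t \<le> h t" unfolding AE_all_countable using \<sigma> le by blast
  then have "AE t in M. S \<sigma> t = (SUP n. \<sigma> n t) \<and> bdd_above (range (\<lambda>n. \<sigma> n t))"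
  proof eventually_elim
    case (elim t)
    then have "min (\<sigma> n t) (h t) = \<sigma> n t" for n by (simp add: min_absorb1)
    then show ?case using bdd[of \<sigma> t] by (simp add: S_def)
  qed
  then show ?thesis using \<sigma> S_meas[OF \<sigma>] upper by blast
qed

locale L0_space = finite_measure M for M :: "real measure" +
  fixes P :: "(real \<Rightarrow> real) \<Rightarrow> bool"
  assumes P_zero: "P (\<lambda>t. 0)"
    and P_add: "P f \<Longrightarrow> P g \<Longrightarrow> P (\<lambda>t. f t + g t)"
    and P_smult: "P f \<Longrightarrow> P (\<lambda>t. r * f t)"
    and P_solid: "P g \<Longrightarrow> (AE t in M. \<bar>f t\<bar> \<le> \<bar>g t\<bar>) \<Longrightarrow> P f"
begin

abbreviation "E \<equiv> L0 M P"
abbreviation "mf \<equiv> {f \<in> borel_measurable M. P f}"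

lemma carrierE:
  assumes "X \<in> carrier E" obtains f where "f \<in> borel_measurable M" "P f" "X = cls M f"
  using assms by (auto simp: L0_carrier)

lemma cls_carrier [intro]: "f \<in> borel_measurable M \<Longrightarrow> P f \<Longrightarrow> cls M f \<in> carrier E"
  by (auto simp: L0_carrier)

lemma P_abs: "P f \<Longrightarrow> P (\<lambda>t. \<bar>f t\<bar>)"
  by (rule P_solid) auto

lemma P_between:
  assumes "P f" "P g" "AE t in M. \<bar>k t\<bar> \<le> \<bar>f t\<bar> + \<bar>g t\<bar>" shows "P k"
proof (rule P_solid[OF P_add[OF P_abs[OF assms(1)] P_abs[OF assms(2)]]])
  show "AE t in M. \<bar>k t\<bar> \<le> \<bar>\<bar>f t\<bar> + \<bar>g t\<bar>\<bar>" using assms(3) by eventually_elim simp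
qed

lemma P_max: "P f \<Longrightarrow> P g \<Longrightarrow> P (\<lambda>t. max (f t) (g t))"
  and P_min: "P f \<Longrightarrow> P g \<Longrightarrow> P (\<lambda>t. min (f t) (g t))"
  by (erule (1) P_between, auto)+

lemma abelian_group_L0: "abelian_group E"
proof (rule abelian_groupI)
  show "\<exists>y\<in>carrier E. y \<oplus>\<^bsub>E\<^esub> x = \<zero>\<^bsub>E\<^esub>" if "x \<in> carrier E" for x
  proof -
    obtain f where f: "f \<in> borel_measurable M" "P f" "x = cls M f" using \<open>x \<in> carrier E\<close> by (rule carrierE)
    let ?g = "\<lambda>t. (-1) * f t"
    have g: "?g \<in> borel_measurable M" using f(1) by simp
    have gP: "P ?g" by (rule P_smult[OF f(2)])
    have "cls M ?g \<oplus>\<^bsub>E\<^esub> x = \<zero>\<^bsub>E\<^esub>" unfolding f(3) L0_add[OF g f(1)] L0_zero by simp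
    then show ?thesis using cls_carrier[OF g gP] by blast
  qed
  show "x \<oplus>\<^bsub>E\<^esub> y \<in> carrier E" if "x \<in> carrier E" "y \<in> carrier E" for x y
    using that by (auto elim!: carrierE simp: L0_add intro!: cls_carrier P_add)
  show "\<zero>\<^bsub>E\<^esub> \<in> carrier E" using P_zero by (auto simp: L0_zero)
qed (auto elim!: carrierE simp: L0_add L0_zero algebra_simps)

lemma module_L0: "Module.module real_ring E"
proof (rule moduleI[OF cring_real_ring abelian_group_L0])
  show "a \<odot>\<^bsub>E\<^esub> x \<in> carrier E" if "x \<in> carrier E" for a x
    using that by (auto elim!: carrierE simp: L0_smult intro!: cls_carrier P_smult)
qed (auto elim!: carrierE simp: L0_add L0_smult algebra_simps)

lemma L0_sup:
  assumes f: "f \<in> borel_measurable M" "P f" and g: "g \<in> borel_measurable M" "P g"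
  shows "least (ord_of E) (cls M (\<lambda>t. max (f t) (g t))) (Upper (ord_of E) {cls M f, cls M g})"
proof -
  let ?m = "\<lambda>t. max (f t) (g t)"
  have m: "?m \<in> borel_measurable M" using f(1) g(1) by measurable
  have "cls M ?m \<preceq>\<^bsub>E\<^esub> U" if U: "U \<in> carrier E" "cls M f \<preceq>\<^bsub>E\<^esub> U" "cls M g \<preceq>\<^bsub>E\<^esub> U" for U
  proof -
    obtain u where u: "u \<in> borel_measurable M" "U = cls M u" using U(1) by (rule carrierE)
    have "AE t in M. f t \<le> u t" "AE t in M. g t \<le> u t"
      using U(2,3) f(1) g(1) by (simp_all add: u L0_le)
    then have "AE t in M. ?m t \<le> u t" by eventually_elim simp
    then show ?thesis using u m by (simp add: L0_le)
  qed
  moreover have "cls M f \<preceq>\<^bsub>E\<^esub> cls M ?m" "cls M g \<preceq>\<^bsub>E\<^esub> cls M ?m" using f(1) g(1) m by (simp_all add: L0_le)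
  moreover have "cls M ?m \<in> carrier E" "cls M f \<in> carrier E" "cls M g \<in> carrier E" using m f g P_max by auto
  ultimately show ?thesis unfolding least_def Upper_def by (auto 0 3)
qed

lemma L0_inf:
  assumes f: "f \<in> borel_measurable M" "P f" and g: "g \<in> borel_measurable M" "P g"
  shows "greatest (ord_of E) (cls M (\<lambda>t. min (f t) (g t))) (Lower (ord_of E) {cls M f, cls M g})"
proof -
  let ?m = "\<lambda>t. min (f t) (g t)"
  have m: "?m \<in> borel_measurable M" using f(1) g(1) by measurable
  have "U \<preceq>\<^bsub>E\<^esub> cls M ?m" if U: "U \<in> carrier E" "U \<preceq>\<^bsub>E\<^esub> cls M f" "U \<preceq>\<^bsub>E\<^esub> cls M g" for U
  proof -
    obtain u where u: "u \<in> borel_measurable M" "U = cls M u" using U(1) by (rule carrierE)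
    have "AE t in M. u t \<le> f t" "AE t in M. u t \<le> g t"
      using U(2,3) f(1) g(1) by (simp_all add: u L0_le)
    then have "AE t in M. u t \<le> ?m t" by eventually_elim simp
    then show ?thesis using u m by (simp add: L0_le)
  qed
  moreover have "cls M ?m \<preceq>\<^bsub>E\<^esub> cls M f" "cls M ?m \<preceq>\<^bsub>E\<^esub> cls M g" using f(1) g(1) m by (simp_all add: L0_le)
  moreover have "cls M ?m \<in> carrier E" "cls M f \<in> carrier E" "cls M g \<in> carrier E" using m f g P_min by auto
  ultimately show ?thesis unfolding greatest_def Lower_def by (auto 0 3)
qed

lemma vector_lattice_L0: "vector_lattice E"
proof -
  have "Lattice.lattice (ord_of E)"
  proof (unfold_locales)
    show "x .=\<^bsub>ord_of E\<^esub> y" if le: "x \<sqsubseteq>\<^bsub>ord_of E\<^esub> y" "y \<sqsubseteq>\<^bsub>ord_of E\<^esub> x"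
      "x \<in> carrier (ord_of E)" "y \<in> carrier (ord_of E)" for x y
    proof -
      obtain f g where f: "f \<in> borel_measurable M" "x = cls M f" and g: "g \<in> borel_measurable M" "y = cls M g"
        using le(3,4) by (auto elim!: carrierE)
      have "AE t in M. f t \<le> g t" "AE t in M. g t \<le> f t" using le(1,2) f g by (simp_all add: L0_le)
      then have "AE t in M. f t = g t" by eventually_elim simp
      then show ?thesis using cls_eqI f g by simp
    qed
    show "x \<sqsubseteq>\<^bsub>ord_of E\<^esub> z" if le: "x \<sqsubseteq>\<^bsub>ord_of E\<^esub> y" "y \<sqsubseteq>\<^bsub>ord_of E\<^esub> z"
      "x \<in> carrier (ord_of E)" "y \<in> carrier (ord_of E)" "z \<in> carrier (ord_of E)" for x y z
    proof -
      obtain f g k where f: "f \<in> borel_measurable M" "x = cls M f" "g \<in> borel_measurable M" "y = cls M g"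
          "k \<in> borel_measurable M" "z = cls M k"
        using le(3-) by (auto elim!: carrierE)
      have "AE t in M. f t \<le> g t" "AE t in M. g t \<le> k t" using le(1,2) f by (simp_all add: L0_le)
      then have "AE t in M. f t \<le> k t" by eventually_elim simp
      then show ?thesis using f by (simp add: L0_le)
    qed
    show "\<exists>s. least (ord_of E) s (Upper (ord_of E) {x, y})"
      if "x \<in> carrier (ord_of E)" "y \<in> carrier (ord_of E)" for x y
      using that L0_sup by (auto elim!: carrierE)
    show "\<exists>s. greatest (ord_of E) s (Lower (ord_of E) {x, y})"
      if "x \<in> carrier (ord_of E)" "y \<in> carrier (ord_of E)" for x y
      using that L0_inf by (auto elim!: carrierE)
  qed (auto elim!: carrierE simp: L0_le)
  moreover have "AE t in M. r * f t \<le> r * g t" if "AE t in M. f t \<le> g t" "0 \<le> r" for f g :: "real \<Rightarrow> real" and r :: real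
    using that(1) by eventually_elim (simp add: that(2) mult_left_mono)
  ultimately show ?thesis unfolding vector_lattice_def using module_L0
    by (intro conjI) (auto elim!: carrierE simp: L0_le L0_add L0_smult)
qed

lemma archimedean_L0: "archimedean E"
  unfolding archimedean_def
proof (intro ballI impI, elim conjE)
  fix x y assume "x \<in> carrier E" "y \<in> carrier E" and x0: "\<zero>\<^bsub>E\<^esub> \<preceq>\<^bsub>E\<^esub> x" and le: "\<forall>n::nat. real n \<odot>\<^bsub>E\<^esub> x \<preceq>\<^bsub>E\<^esub> y"
  then obtain f g where f: "f \<in> borel_measurable M" "x = cls M f" and g: "g \<in> borel_measurable M" "y = cls M g"
    by (auto elim!: carrierE)
  have "AE t in M. 0 \<le> f t" using x0 f by (simp add: L0_le L0_zero)
  moreover have "AE t in M. \<forall>n. real n * f t \<le> g t" using le f g by (simp add: L0_le L0_smult AE_all_countable)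
  ultimately have "AE t in M. f t = 0"
  proof eventually_elim
    case (elim t)
    show ?case
    proof (rule ccontr)
      assume "f t \<noteq> 0"
      then have "0 < f t" using elim(1) by simp
      then obtain n where "g t < real n * f t" using reals_Archimedean3 by blast
      then show False using elim(2) not_less by blast
    qed
  qed
  then show "x = \<zero>\<^bsub>E\<^esub>" unfolding f L0_zero by (rule cls_eqI)
qed

lemma dedekind_complete_L0: "dedekind_complete E"
  unfolding dedekind_complete_def
proof (intro allI impI, elim conjE)
  fix D assume D: "D \<subseteq> carrier E" "D \<noteq> {}" and "Upper (ord_of E) D \<noteq> {}"
  then obtain U where "U \<in> Upper (ord_of E) D" by blast
  then have U: "U \<in> carrier E" "\<And>X. X \<in> D \<Longrightarrow> X \<preceq>\<^bsub>E\<^esub> U" using D(1) by (auto simp: Upper_def)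
  obtain h where h: "h \<in> borel_measurable M" "P h" "U = cls M h" using U(1) by (rule carrierE)
  define F where "F = {f \<in> mf. cls M f \<in> D}"
  have DF: "\<exists>f\<in>F. X = cls M f" if "X \<in> D" for X using that D(1) by (auto simp: F_def elim!: carrierE)
  have F: "F \<subseteq> borel_measurable M" "F \<noteq> {}" using D(2) DF by (auto simp: F_def)
  have "\<exists>\<sigma> s. range \<sigma> \<subseteq> F \<and> s \<in> borel_measurable M \<and> (\<forall>f\<in>F. AE t in M. f t \<le> s t) \<and>
    (AE t in M. s t = (SUP n::nat. \<sigma> n t) \<and> bdd_above (range (\<lambda>n. \<sigma> n t)))"
  proof (rule ess_SUP_of_sequence[OF finite_measure_axioms F h(1)])
    show "AE t in M. f t \<le> h t" if "f \<in> F" for f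
      using U(2)[of "cls M f"] that h L0_le[of f M h P] by (simp add: F_def)
  qed
  then obtain \<sigma> s where \<sigma>: "range \<sigma> \<subseteq> F" and s: "s \<in> borel_measurable M" "\<forall>f\<in>F. AE t in M. f t \<le> s t"
    "AE t in M. s t = (SUP n::nat. \<sigma> n t) \<and> bdd_above (range (\<lambda>n. \<sigma> n t))" by blast
  have least: "AE t in M. s t \<le> u t" if "\<And>n. AE t in M. \<sigma> n t \<le> u t" for u
  proof -
    have "AE t in M. \<forall>n. \<sigma> n t \<le> u t" unfolding AE_all_countable using that by blast
    then show ?thesis using s(3) by eventually_elim (auto intro: cSUP_least)
  qed
  have \<sigma>F: "\<sigma> n \<in> borel_measurable M" "P (\<sigma> n)" "cls M (\<sigma> n) \<in> D" for n using \<sigma> by (auto simp: F_def)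
  have sP: "P s"
  proof (rule P_between[OF \<sigma>F(2)[of 0] h(2)])
    have "AE t in M. s t \<le> h t" using \<sigma>F U(2) h by (intro least) (metis L0_le)
    moreover have "AE t in M. \<sigma> 0 t \<le> s t" using s(2) \<sigma> by blast
    ultimately show "AE t in M. \<bar>s t\<bar> \<le> \<bar>\<sigma> 0 t\<bar> + \<bar>h t\<bar>" by eventually_elim simp
  qed
  have "least (ord_of E) (cls M s) (Upper (ord_of E) D)"
    unfolding least_def
  proof (intro conjI ballI)
    show "cls M s \<in> Upper (ord_of E) D" using s(1,2) sP DF by (fastforce simp: Upper_def L0_le F_def)
    fix V assume V: "V \<in> Upper (ord_of E) D"
    then obtain u where u: "u \<in> borel_measurable M" "V = cls M u" by (auto simp: Upper_def elim!: carrierE)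
    have "cls M (\<sigma> n) \<preceq>\<^bsub>E\<^esub> V" for n using V \<sigma>F(3)[of n] subsetD[OF D(1) \<sigma>F(3)[of n]] by (auto simp: Upper_def)
    then have "AE t in M. s t \<le> u t" using \<sigma>F(1) u by (intro least) (simp add: L0_le)
    then show "cls M s \<sqsubseteq>\<^bsub>ord_of E\<^esub> V" using s(1) u by (simp add: L0_le)
  qed (auto simp: Upper_def)
  then show "\<exists>s. least (ord_of E) s (Upper (ord_of E) D)" by blast
qed

lemma orth_vlattice_L0: "orth_vlattice E"
  by (intro orth_vlattice.intro dc_vlattice.intro vlattice.intro dc_vlattice_axioms.intro orth_vlattice_axioms.intro
    vector_lattice_L0 dedekind_complete_L0 archimedean_L0)

end

context L0_space
begin

interpretation V: orth_vlattice E
  by (rule orth_vlattice_L0)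

lemma cls_inf:
  assumes "f \<in> borel_measurable M" "P f" "g \<in> borel_measurable M" "P g"
  shows "cls M f \<sqinter>\<^bsub>ord_of E\<^esub> cls M g = cls M (\<lambda>t. min (f t) (g t))"
proof -
  have "greatest (ord_of E) (cls M (\<lambda>t. min (f t) (g t))) (Lower (ord_of E) {cls M f, cls M g})"
    by (rule L0_inf) (use assms in auto)
  then have "V.isglb {cls M f, cls M g} (cls M (\<lambda>t. min (f t) (g t)))"
    using cls_carrier assms by (subst (asm) V.greatest_Lower_iff) auto
  from V.isglbD[OF this] show ?thesis
    using assms cls_carrier by (intro V.inf_eqI) auto
qed

lemma cls_sup:
  assumes "f \<in> borel_measurable M" "P f" "g \<in> borel_measurable M" "P g"
  shows "cls M f \<squnion>\<^bsub>ord_of E\<^esub> cls M g = cls M (\<lambda>t. max (f t) (g t))"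
proof -
  have "least (ord_of E) (cls M (\<lambda>t. max (f t) (g t))) (Upper (ord_of E) {cls M f, cls M g})"
    by (rule L0_sup) (use assms in auto)
  then have "V.islub {cls M f, cls M g} (cls M (\<lambda>t. max (f t) (g t)))"
    using cls_carrier assms by (subst (asm) V.least_Upper_iff) auto
  from V.islubD[OF this] show ?thesis
    using assms cls_carrier by (intro V.sup_eqI) auto
qed

lemma P_diff: "P f \<Longrightarrow> P g \<Longrightarrow> P (\<lambda>t. f t - g t)"
  by (erule (1) P_between) auto

lemma P_uminus: "P f \<Longrightarrow> P (\<lambda>t. - f t)"
  using P_smult[of f "-1"] by simp

lemma cls_minus:
  assumes [measurable]: "f \<in> borel_measurable M" "g \<in> borel_measurable M" and "P f" "P g"
  shows "cls M f \<ominus>\<^bsub>E\<^esub> cls M g = cls M (\<lambda>t. f t - g t)"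
proof -
  have "cls M (\<lambda>t. f t - g t) \<oplus>\<^bsub>E\<^esub> cls M g = cls M f" by (subst L0_add) simp_all
  then show ?thesis
    using assms cls_carrier P_diff V.minus_eq_iff(1)[of "cls M f" "cls M g" "cls M (\<lambda>t. f t - g t)"] by simp
qed

lemma cls_neg:
  assumes [measurable]: "f \<in> borel_measurable M" and "P f"
  shows "\<ominus>\<^bsub>E\<^esub> cls M f = cls M (\<lambda>t. - f t)"
  using cls_minus[of "\<lambda>t. 0" f] assms P_zero cls_carrier[of f] V.minus_zero_left[of "cls M f"] by (simp add: L0_zero)

lemma cls_abs:
  assumes [measurable]: "f \<in> borel_measurable M" and "P f"
  shows "vabs E (cls M f) = cls M (\<lambda>t. \<bar>f t\<bar>)"
proof -
  have "vabs E (cls M f) = cls M (\<lambda>t. max (f t) (- f t))"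
    unfolding vabs_def using assms P_uminus by (simp add: cls_neg cls_sup)
  also have "(\<lambda>t. max (f t) (- f t)) = (\<lambda>t. \<bar>f t\<bar>)" by (auto simp: max_def)
  finally show ?thesis .
qed

definition mulop :: "(real \<Rightarrow> real) \<Rightarrow> (real \<Rightarrow> real) set \<Rightarrow> (real \<Rightarrow> real) set" where
  "mulop \<phi> = (\<lambda>X\<in>carrier E. cls M (\<lambda>t. \<phi> t * rep X t))"

lemma mulop_cls:
  assumes "f \<in> borel_measurable M" "P f" shows "mulop \<phi> (cls M f) = cls M (\<lambda>t. \<phi> t * f t)"
proof -
  have "AE t in M. \<phi> t * rep (cls M f) t = \<phi> t * f t" using rep_cls(2)[OF assms(1)] by eventually_elim simp
  then show ?thesis using assms cls_carrier by (simp add: mulop_def cls_eqI)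
qed

lemma P_mult: 
  assumes "\<And>t. \<bar>\<phi> t\<bar> \<le> k" "P f" shows "P (\<lambda>t. \<phi> t * f t)"
proof (rule P_solid[OF P_smult[OF assms(2), of k]])
  have "\<bar>\<phi> t * f t\<bar> \<le> \<bar>k * f t\<bar>" for t
    using assms(1)[of t] mult_right_mono[of "\<bar>\<phi> t\<bar>" "\<bar>k\<bar>" "\<bar>f t\<bar>"] by (simp add: abs_mult)
  then show "AE t in M. \<bar>\<phi> t * f t\<bar> \<le> \<bar>k * f t\<bar>" by simp
qed

lemma mulop_orth:
  assumes [measurable]: "\<phi> \<in> borel_measurable M" and \<phi>: "\<And>t. 0 \<le> \<phi> t" "\<And>t. \<phi> t \<le> k"
  shows "mulop \<phi> \<in> carrier (Orth E)"
proof -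
  have Pm: "P (\<lambda>t. \<phi> t * f t)" if "P f" for f by (rule P_mult[of \<phi> k]) (use \<phi> that in auto)
  have eq: "restrict (mulop \<phi>) (carrier E) = mulop \<phi>" by (auto simp: mulop_def)
  have "restrict (mulop \<phi>) (carrier E) \<in> carrier (Orth E)"
  proof (rule V.orthI_pos)
    show "mulop \<phi> X \<in> carrier E" if "X \<in> carrier E" for X
      using that Pm by (auto elim!: carrierE simp: mulop_cls intro!: cls_carrier)
    show "mulop \<phi> (X \<oplus>\<^bsub>E\<^esub> Y) = mulop \<phi> X \<oplus>\<^bsub>E\<^esub> mulop \<phi> Y" if "X \<in> carrier E" "Y \<in> carrier E" for X Y
      using that by (auto elim!: carrierE simp: mulop_cls L0_add P_add algebra_simps)
    show "mulop \<phi> (r \<odot>\<^bsub>E\<^esub> X) = r \<odot>\<^bsub>E\<^esub> mulop \<phi> X" if "X \<in> carrier E" for r X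
      using that by (auto elim!: carrierE simp: mulop_cls L0_smult P_smult algebra_simps)
    show "\<zero>\<^bsub>E\<^esub> \<preceq>\<^bsub>E\<^esub> mulop \<phi> X" if X: "X \<in> carrier E" "\<zero>\<^bsub>E\<^esub> \<preceq>\<^bsub>E\<^esub> X" for X
    proof -
      obtain f where f: "f \<in> borel_measurable M" "P f" "X = cls M f" using X(1) by (rule carrierE)
      have "AE t in M. 0 \<le> f t" using X(2) f by (simp add: L0_le L0_zero)
      then have "AE t in M. 0 \<le> \<phi> t * f t" by eventually_elim (simp add: \<phi>)
      then show ?thesis using f by (simp add: mulop_cls L0_le L0_zero)
    qed
    show "mulop \<phi> X \<in> B" if B: "band E B" and X: "X \<in> B" for B X
    proof -
      have "X \<in> carrier E" using V.bandD(1)[OF B] X by blast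
      then obtain f where f: "f \<in> borel_measurable M" "P f" "X = cls M f" by (rule carrierE)
      note [measurable] = f(1)
      have kB: "k \<odot>\<^bsub>E\<^esub> X \<in> B" by (rule V.bandD(6)[OF B X])
      have "\<bar>\<phi> t * f t\<bar> \<le> \<bar>k * f t\<bar>" for t
        using \<phi>[of t] mult_right_mono[of "\<bar>\<phi> t\<bar>" "\<bar>k\<bar>" "\<bar>f t\<bar>"] by (simp add: abs_mult)
      then have "vabs E (mulop \<phi> X) \<preceq>\<^bsub>E\<^esub> vabs E (k \<odot>\<^bsub>E\<^esub> X)"
        using f Pm P_smult by (simp add: mulop_cls L0_smult cls_abs L0_le)
      then show ?thesis
        using f Pm by (intro V.bandD(7)[OF B _ kB]) (auto simp: mulop_cls intro!: cls_carrier)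
    qed
  qed
  then show ?thesis by (simp add: eq)
qed

end

subsection \<open>Convergence in measure\<close>

lemma (in Metric_space) continuous_map_mtopologyI:
  assumes "\<And>x. x \<in> topspace X \<Longrightarrow> f x \<in> M"
    "\<And>x e. x \<in> topspace X \<Longrightarrow> 0 < e \<Longrightarrow> \<exists>U. openin X U \<and> x \<in> U \<and> (\<forall>y\<in>U. d (f x) (f y) < e)"
  shows "continuous_map X mtopology f"
  unfolding continuous_map
proof (intro conjI allI impI)
  show "f ` topspace X \<subseteq> topspace mtopology" using assms(1) by auto
  fix V assume V: "openin mtopology V"
  have "\<exists>T. openin X T \<and> x \<in> T \<and> T \<subseteq> {x \<in> topspace X. f x \<in> V}" if x: "x \<in> topspace X" "f x \<in> V" for x
  proof -
    obtain r where r: "r > 0" "mball (f x) r \<subseteq> V" using V x unfolding openin_mtopology by blast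
    obtain U where U: "openin X U" "x \<in> U" "\<forall>y\<in>U. d (f x) (f y) < r" using assms(2)[OF x(1) r(1)] by blast
    have "y \<in> topspace X" if "y \<in> U" for y using openin_subset[OF U(1)] that by blast
    then have "f y \<in> mball (f x) r" if "y \<in> U" for y using U(3) assms(1) x(1) that by simp
    then show ?thesis using U r openin_subset[OF U(1)] by blast
  qed
  then show "openin X {x \<in> topspace X. f x \<in> V}" by (subst openin_subopen) blast
qed

locale L0_full = L0_space M "\<lambda>_. True" for M :: "real measure"
begin

interpretation V: orth_vlattice E
  by (rule orth_vlattice_L0)

text \<open>
  The usual F-norm for convergence in measure. Truncation at one makes it finite for all measurable functions.
\<close>

definition fnorm :: "(real \<Rightarrow> real) \<Rightarrow> real" where
  "fnorm f = (\<integral>t. min 1 \<bar>f t\<bar> \<partial>M)"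

lemma integrable_min_abs: "integrable M (\<lambda>t. min 1 \<bar>f t\<bar>)" if "f \<in> borel_measurable M" for f :: "real \<Rightarrow> real"
  by (rule integrable_const_bound[where B = 1]) (use that in auto)

lemma fnorm_nonneg [simp]: "0 \<le> fnorm f"
  unfolding fnorm_def by (rule integral_nonneg_AE) simp

lemma fnorm_mono:
  assumes "f \<in> borel_measurable M" "g \<in> borel_measurable M" "AE t in M. \<bar>f t\<bar> \<le> \<bar>g t\<bar>"
  shows "fnorm f \<le> fnorm g"
  unfolding fnorm_def
proof (rule integral_mono_AE[OF integrable_min_abs integrable_min_abs])
  show "AE t in M. min 1 \<bar>f t\<bar> \<le> min 1 \<bar>g t\<bar>" using assms(3) by eventually_elim simp
qed (use assms in auto)

lemma fnorm_cong:
  assumes "f \<in> borel_measurable M" "g \<in> borel_measurable M" "AE t in M. f t = g t"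
  shows "fnorm f = fnorm g"
proof -
  have "AE t in M. \<bar>f t\<bar> \<le> \<bar>g t\<bar>" "AE t in M. \<bar>g t\<bar> \<le> \<bar>f t\<bar>" using assms(3) by (eventually_elim, simp)+
  then show ?thesis using assms(1,2) by (intro antisym fnorm_mono)
qed

lemma fnorm_add:
  assumes "f \<in> borel_measurable M" "g \<in> borel_measurable M"
  shows "fnorm (\<lambda>t. f t + g t) \<le> fnorm f + fnorm g"
proof -
  have "fnorm (\<lambda>t. f t + g t) \<le> (\<integral>t. min 1 \<bar>f t\<bar> + min 1 \<bar>g t\<bar> \<partial>M)"
    unfolding fnorm_def
    by (rule integral_mono) (use assms in \<open>auto intro!: integrable_min_abs Bochner_Integration.integrable_add\<close>)
  also have "\<dots> = fnorm f + fnorm g"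
    unfolding fnorm_def by (rule Bochner_Integration.integral_add) (use assms in \<open>auto intro!: integrable_min_abs\<close>)
  finally show ?thesis .
qed

lemma fnorm_eq_0_iff: "f \<in> borel_measurable M \<Longrightarrow> fnorm f = 0 \<longleftrightarrow> (AE t in M. f t = 0)"
proof -
  assume f: "f \<in> borel_measurable M"
  have "fnorm f = 0 \<longleftrightarrow> (AE t in M. min 1 \<bar>f t\<bar> = 0)"
    unfolding fnorm_def by (rule integral_nonneg_eq_0_iff_AE[OF integrable_min_abs[OF f]]) simp
  moreover have "(min 1 \<bar>u\<bar> = 0) = (u = 0)" for u :: real by (auto simp: min_def)
  ultimately show ?thesis by simp
qed

lemma fnorm_tendsto_0:
  assumes "\<And>n. f n \<in> borel_measurable M" "AE t in M. (\<lambda>n. f n t) \<longlonglongrightarrow> 0"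
  shows "(\<lambda>n. fnorm (f n)) \<longlonglongrightarrow> 0"
proof -
  have "(\<lambda>n. fnorm (f n)) \<longlonglongrightarrow> (\<integral>t. 0 \<partial>M)"
    unfolding fnorm_def
  proof (rule integral_dominated_convergence[where w = "\<lambda>_. 1"])
    show "AE t in M. (\<lambda>n. min 1 \<bar>f n t\<bar>) \<longlonglongrightarrow> 0"
      using assms(2)
    proof eventually_elim
      case (elim t)
      then have "(\<lambda>n. min 1 \<bar>f n t\<bar>) \<longlonglongrightarrow> min 1 \<bar>0\<bar>" by (intro tendsto_intros)
      then show ?case by simp
    qed
  qed (use assms(1) in auto)
  then show ?thesis by simp
qed

definition measure_dist :: "(real \<Rightarrow> real) set \<Rightarrow> (real \<Rightarrow> real) set \<Rightarrow> real" where
  "measure_dist X Y = fnorm (\<lambda>t. rep X t - rep Y t)"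

lemma measure_dist_cls:
  assumes [measurable]: "f \<in> borel_measurable M" "g \<in> borel_measurable M"
  shows "measure_dist (cls M f) (cls M g) = fnorm (\<lambda>t. f t - g t)"
  unfolding measure_dist_def
proof (rule fnorm_cong)
  note [measurable] = rep_cls(1)[OF assms(1)] rep_cls(1)[OF assms(2)]
  show "(\<lambda>t. rep (cls M f) t - rep (cls M g) t) \<in> borel_measurable M" "(\<lambda>t. f t - g t) \<in> borel_measurable M" by measurable
  show "AE t in M. rep (cls M f) t - rep (cls M g) t = f t - g t"
    using rep_cls(2)[OF assms(1)] rep_cls(2)[OF assms(2)] by eventually_elim simp
qed

lemma carrier_mE: assumes "X \<in> carrier E" obtains f where "f \<in> borel_measurable M" "X = cls M f"
  using carrierE[OF assms] by blast

lemma carrier_ex: "X \<in> carrier E \<Longrightarrow> \<exists>f. f \<in> borel_measurable M \<and> X = cls M f"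
  by (erule carrier_mE) blast

sublocale D: Metric_space "carrier E" measure_dist
proof
  show "0 \<le> measure_dist X Y" for X Y by (simp add: measure_dist_def)
  show "measure_dist X Y = measure_dist Y X" for X Y by (simp add: measure_dist_def fnorm_def abs_minus_commute)
  show "measure_dist X Y = 0 \<longleftrightarrow> X = Y" if XY: "X \<in> carrier E" "Y \<in> carrier E" for X Y
  proof -
    obtain f g where f: "f \<in> borel_measurable M" "X = cls M f" and g: "g \<in> borel_measurable M" "Y = cls M g"
      using carrier_ex[OF XY(1)] carrier_ex[OF XY(2)] by blast
    then show ?thesis by (simp add: measure_dist_cls fnorm_eq_0_iff cls_eq_iff)
  qed
  show "measure_dist X Z \<le> measure_dist X Y + measure_dist Y Z" if XYZ: "X \<in> carrier E" "Y \<in> carrier E" "Z \<in> carrier E" for X Y Z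
  proof -
    obtain f g h where f: "f \<in> borel_measurable M" "X = cls M f" and g: "g \<in> borel_measurable M" "Y = cls M g"
      and h: "h \<in> borel_measurable M" "Z = cls M h"
      using carrier_ex[OF XYZ(1)] carrier_ex[OF XYZ(2)] carrier_ex[OF XYZ(3)] by blast
    then show ?thesis using fnorm_add[of "\<lambda>t. f t - g t" "\<lambda>t. g t - h t"] by (simp add: measure_dist_cls)
  qed
qed

abbreviation "tm \<equiv> D.mtopology"

lemma locally_solid_tm: "locally_solid_linear_topology E tm"
proof -
  have 1: "continuous_map (prod_topology tm tm) tm (\<lambda>(X, Y). X \<oplus>\<^bsub>E\<^esub> Y)"
  proof (rule D.continuous_map_mtopologyI)
    fix p :: "(real \<Rightarrow> real) set \<times> (real \<Rightarrow> real) set" and e :: real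
    assume p: "p \<in> topspace (prod_topology tm tm)" and e: "0 < e"
    then obtain X Y where XY: "X \<in> carrier E" "Y \<in> carrier E" "p = (X, Y)" by auto
    obtain f g where f: "f \<in> borel_measurable M" "X = cls M f" and g: "g \<in> borel_measurable M" "Y = cls M g"
      using carrier_ex[OF XY(1)] carrier_ex[OF XY(2)] by blast
    let ?U = "D.mball X (e/2) \<times> D.mball Y (e/2)"
    have "measure_dist (X \<oplus>\<^bsub>E\<^esub> Y) (X' \<oplus>\<^bsub>E\<^esub> Y') < e" if "(X', Y') \<in> ?U" for X' Y'
    proof -
      obtain f' g' where f': "f' \<in> borel_measurable M" "X' = cls M f'" and g': "g' \<in> borel_measurable M" "Y' = cls M g'"
        using \<open>(X', Y') \<in> ?U\<close> by (auto elim!: carrier_mE)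
      have "measure_dist (X \<oplus>\<^bsub>E\<^esub> Y) (X' \<oplus>\<^bsub>E\<^esub> Y') = fnorm (\<lambda>t. (f t - f' t) + (g t - g' t))"
        using f g f' g' by (simp add: L0_add measure_dist_cls algebra_simps)
      also have "\<dots> \<le> measure_dist X X' + measure_dist Y Y'" using fnorm_add[of "\<lambda>t. f t - f' t" "\<lambda>t. g t - g' t"] f g f' g' by (simp add: measure_dist_cls)
      also have "\<dots> < e" using \<open>(X', Y') \<in> ?U\<close> by simp
      finally show ?thesis .
    qed
    moreover have "openin (prod_topology tm tm) ?U" by (simp add: openin_prod_Times_iff)
    moreover have "p \<in> ?U" using XY e by simp
    ultimately show "\<exists>U. openin (prod_topology tm tm) U \<and> p \<in> U \<and>
        (\<forall>q\<in>U. measure_dist (case p of (X, Y) \<Rightarrow> X \<oplus>\<^bsub>E\<^esub> Y) (case q of (X, Y) \<Rightarrow> X \<oplus>\<^bsub>E\<^esub> Y) < e)"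
      using XY(3) by (intro exI[of _ ?U]) auto
  qed auto
  have 2: "continuous_map (prod_topology euclideanreal tm) tm (\<lambda>(r, X). r \<odot>\<^bsub>E\<^esub> X)"
  proof (rule D.continuous_map_mtopologyI)
    fix p :: "real \<times> (real \<Rightarrow> real) set" and e :: real
    assume p: "p \<in> topspace (prod_topology euclideanreal tm)" and e: "0 < e"
    then obtain r X where X: "X \<in> carrier E" "p = (r, X)" by auto
    obtain f where f: "f \<in> borel_measurable M" "X = cls M f" using X(1) by (rule carrier_mE)
    note [measurable] = f(1)
    have "(\<lambda>n. fnorm (\<lambda>t. 1 / Suc n * f t)) \<longlonglongrightarrow> 0"
    proof (rule fnorm_tendsto_0)
      have "(\<lambda>n. 1 / Suc n * f t) \<longlonglongrightarrow> 0" for t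
        by (rule tendsto_mult_left_zero[OF LIMSEQ_Suc[OF lim_1_over_n]])
      then show "AE t in M. (\<lambda>n. 1 / Suc n * f t) \<longlonglongrightarrow> 0" by (rule AE_I2)
    qed measurable
    then have "eventually (\<lambda>n. fnorm (\<lambda>t. 1 / Suc n * f t) < e/2) sequentially"
      using e by (intro order_tendstoD) auto
    then obtain n where n: "fnorm (\<lambda>t. 1 / Suc n * f t) < e/2" by (auto simp: eventually_sequentially)
    let ?d = "1 / Suc n"
    obtain m :: nat where m: "\<bar>r\<bar> + 1 \<le> real m" using real_arch_simple by blast
    then have m0: "0 < m" using abs_ge_zero[of r] by (cases m) auto
    note m = m m0
    let ?U = "ball r ?d \<times> D.mball X (e / (2 * m))"
    have "measure_dist (r \<odot>\<^bsub>E\<^esub> X) (r' \<odot>\<^bsub>E\<^esub> X') < e" if U: "(r', X') \<in> ?U" for r' X'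
    proof -
      obtain f' where f': "f' \<in> borel_measurable M" "X' = cls M f'"
        using U by (auto elim!: carrier_mE)
      note [measurable] = f'(1)
      have r': "\<bar>r - r'\<bar> < ?d" using U by (simp add: dist_real_def)
      moreover have "?d \<le> 1" by simp
      ultimately have r'm: "\<bar>r'\<bar> \<le> m" using m(1) by linarith
      have "measure_dist (r \<odot>\<^bsub>E\<^esub> X) (r' \<odot>\<^bsub>E\<^esub> X') = fnorm (\<lambda>t. (r - r') * f t + r' * (f t - f' t))"
        using f f' by (simp add: L0_smult measure_dist_cls algebra_simps)
      also have "\<dots> \<le> fnorm (\<lambda>t. (r - r') * f t) + fnorm (\<lambda>t. r' * (f t - f' t))"
        by (rule fnorm_add) measurable
      also have "fnorm (\<lambda>t. (r - r') * f t) \<le> fnorm (\<lambda>t. ?d * f t)"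
      proof (rule fnorm_mono)
        have "\<bar>r - r'\<bar> * \<bar>f t\<bar> \<le> \<bar>?d\<bar> * \<bar>f t\<bar>" for t using r' by (intro mult_right_mono) simp_all
        then show "AE t in M. \<bar>(r - r') * f t\<bar> \<le> \<bar>?d * f t\<bar>" by (simp only: abs_mult) simp
      qed measurable
      also have "fnorm (\<lambda>t. r' * (f t - f' t)) \<le> m * measure_dist X X'"
      proof -
        have "fnorm (\<lambda>t. r' * (f t - f' t)) \<le> (\<integral>t. m * min 1 \<bar>f t - f' t\<bar> \<partial>M)"
          unfolding fnorm_def
        proof (rule integral_mono)
          fix t
          have a: "\<bar>r' * (f t - f' t)\<bar> \<le> m * \<bar>f t - f' t\<bar>" using r'm by (simp add: abs_mult mult_right_mono)
          have b: "1 \<le> real m" using m(2) by simp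
          show "min 1 \<bar>r' * (f t - f' t)\<bar> \<le> m * min 1 \<bar>f t - f' t\<bar>" using a b by (simp add: min_def)
        qed (auto intro!: integrable_min_abs integrable_mult_right)
        also have "\<dots> = m * measure_dist X X'" using f f' by (simp add: measure_dist_cls fnorm_def)
        finally show ?thesis .
      qed
      also have "m * measure_dist X X' < m * (e / (2 * m))" using U m(2) by (intro mult_strict_left_mono) auto
      also have "m * (e / (2 * m)) = e/2" using m(2) by simp
      finally show ?thesis using n by simp
    qed
    moreover have "openin (prod_topology euclideanreal tm) ?U" by (simp add: openin_prod_Times_iff)
    moreover have "p \<in> ?U" using X e m(2) by simp
    ultimately show "\<exists>U. openin (prod_topology euclideanreal tm) U \<and> p \<in> U \<and>
        (\<forall>q\<in>U. measure_dist (case p of (r, X) \<Rightarrow> r \<odot>\<^bsub>E\<^esub> X) (case q of (r, X) \<Rightarrow> r \<odot>\<^bsub>E\<^esub> X) < e)"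
      using X(2) by (intro exI[of _ ?U]) auto
  qed auto
  have 3: "\<exists>V W. solid_in E V \<and> V \<subseteq> U \<and> openin tm W \<and> \<zero>\<^bsub>E\<^esub> \<in> W \<and> W \<subseteq> V" if U: "openin tm U" "\<zero>\<^bsub>E\<^esub> \<in> U" for U
  proof -
    obtain r where r: "r > 0" "D.mball \<zero>\<^bsub>E\<^esub> r \<subseteq> U" using U unfolding D.openin_mtopology by blast
    have "solid_in E (D.mball \<zero>\<^bsub>E\<^esub> r)"
      unfolding solid_in_def
    proof (intro conjI ballI impI)
      fix X Y assume X: "X \<in> carrier E" and Y: "Y \<in> D.mball \<zero>\<^bsub>E\<^esub> r" and le: "vabs E X \<preceq>\<^bsub>E\<^esub> vabs E Y"
      obtain f g where f: "f \<in> borel_measurable M" "X = cls M f" and g: "g \<in> borel_measurable M" "Y = cls M g"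
        using X Y by (auto elim!: carrier_mE)
      have "AE t in M. \<bar>f t\<bar> \<le> \<bar>g t\<bar>" using le f g by (simp add: cls_abs L0_le)
      then have "fnorm (\<lambda>t. 0 - f t) \<le> fnorm (\<lambda>t. 0 - g t)" using f g by (intro fnorm_mono) auto
      then have "measure_dist \<zero>\<^bsub>E\<^esub> X \<le> measure_dist \<zero>\<^bsub>E\<^esub> Y"
        using measure_dist_cls[of "\<lambda>t. 0" f] measure_dist_cls[of "\<lambda>t. 0" g] f g by (simp add: L0_zero)
      then show "X \<in> D.mball \<zero>\<^bsub>E\<^esub> r" using X Y by simp
    qed auto
    then show ?thesis using r by (intro exI[of _ "D.mball \<zero>\<^bsub>E\<^esub> r"]) auto
  qed
  show ?thesis unfolding locally_solid_linear_topology_def by (intro conjI D.topspace_mtopology 1 2 allI impI 3) blast+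
qed

text \<open>
  Nets need not have dominated convergence, but by \<open>ess_SUP_of_sequence\<close> the infimum of \<open>D\<close> is already the
  infimum of a sequence, which is made decreasing since \<open>D\<close> is closed under infima.
\<close>

lemma small_of_glb_zero:
  assumes D: "D \<subseteq> carrier E" "D \<noteq> {}" and inf: "\<And>X Y. X \<in> D \<Longrightarrow> Y \<in> D \<Longrightarrow> X \<sqinter>\<^bsub>ord_of E\<^esub> Y \<in> D"
    and g: "V.isglb D \<zero>\<^bsub>E\<^esub>" and e: "0 < e"
  shows "\<exists>f. f \<in> borel_measurable M \<and> cls M f \<in> D \<and> fnorm f < e"
proof -
  define F where "F = {f \<in> borel_measurable M. cls M (\<lambda>t. - f t) \<in> D}"
  have F: "F \<subseteq> borel_measurable M" "F \<noteq> {}"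
  proof -
    show "F \<subseteq> borel_measurable M" by (auto simp: F_def)
    obtain X where X: "X \<in> D" using D by blast
    then have "X \<in> carrier E" using D by blast
    then obtain f where "f \<in> borel_measurable M" "X = cls M f" by (rule carrier_mE)
    then have "(\<lambda>t. - f t) \<in> F" using X by (simp add: F_def)
    then show "F \<noteq> {}" by blast
  qed
  have neg: "AE t in M. f t \<le> 0" if f: "f \<in> F" for f
  proof -
    have [measurable]: "f \<in> borel_measurable M" using f by (simp add: F_def)
    have "\<zero>\<^bsub>E\<^esub> \<preceq>\<^bsub>E\<^esub> cls M (\<lambda>t. - f t)" using V.isglbD(2)[OF g] f by (simp add: F_def)
    then show ?thesis by (simp add: L0_le L0_zero)
  qed
  have "\<exists>\<sigma> s. range \<sigma> \<subseteq> F \<and> s \<in> borel_measurable M \<and> (\<forall>f\<in>F. AE t in M. f t \<le> s t) \<and>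
    (AE t in M. s t = (SUP n::nat. \<sigma> n t) \<and> bdd_above (range (\<lambda>n. \<sigma> n t)))"
    by (rule ess_SUP_of_sequence[OF finite_measure_axioms F, of "\<lambda>_. 0"]) (use neg in auto)
  then obtain \<sigma> s where \<sigma>: "range \<sigma> \<subseteq> F" and s: "s \<in> borel_measurable M" "\<forall>f\<in>F. AE t in M. f t \<le> s t"
    "AE t in M. s t = (SUP n::nat. \<sigma> n t) \<and> bdd_above (range (\<lambda>n. \<sigma> n t))" by blast
  note [measurable] = s(1)
  have \<sigma>m [measurable]: "\<sigma> n \<in> borel_measurable M" and \<sigma>D: "cls M (\<lambda>t. - \<sigma> n t) \<in> D" for n using \<sigma> by (auto simp: F_def)
  have "cls M (\<lambda>t. - s t) \<preceq>\<^bsub>E\<^esub> \<zero>\<^bsub>E\<^esub>"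
  proof (rule V.isglbD(3)[OF g])
    show "cls M (\<lambda>t. - s t) \<in> carrier E" by (rule cls_carrier) auto
    fix X assume X: "X \<in> D"
    then have "X \<in> carrier E" using D by blast
    then obtain f where f: "f \<in> borel_measurable M" "X = cls M f" by (rule carrier_mE)
    then have fF: "(\<lambda>t. - f t) \<in> F" using X by (simp add: F_def)
    have "AE t in M. - f t \<le> s t" using bspec[OF s(2) fF] by simp
    then have "AE t in M. - s t \<le> f t" by eventually_elim simp
    then show "cls M (\<lambda>t. - s t) \<preceq>\<^bsub>E\<^esub> X" using f by (simp add: L0_le)
  qed
  then have s0: "AE t in M. 0 \<le> s t" by (simp add: L0_le L0_zero)
  define d where "d = rec_nat (\<lambda>t. - \<sigma> 0 t) (\<lambda>n dn t. min (dn t) (- \<sigma> (Suc n) t))"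
  have d_simps: "d 0 = (\<lambda>t. - \<sigma> 0 t)" "d (Suc n) = (\<lambda>t. min (d n t) (- \<sigma> (Suc n) t))" for n by (simp_all add: d_def)
  have d: "d n \<in> borel_measurable M \<and> cls M (d n) \<in> D" for n
  proof (induction n)
    case 0 then show ?case using \<sigma>D by (simp add: d_simps)
  next
    case (Suc n)
    then have [measurable]: "d n \<in> borel_measurable M" by simp
    show ?case using inf[OF conjunct2[OF Suc] \<sigma>D[of "Suc n"]] by (simp add: d_simps cls_inf)
  qed
  have d_le: "d n t \<le> - \<sigma> m t" if "m \<le> n" for m n t
    using that
  proof (induction n)
    case (Suc n)
    then show ?case by (cases "m = Suc n") (auto simp: d_simps)
  qed (simp add: d_simps)
  have d_ge: "0 \<le> d n t" if "\<And>m. \<sigma> m t \<le> 0" for n t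
    by (induction n) (use that in \<open>simp_all add: d_simps\<close>)
  have "AE t in M. \<forall>n. \<sigma> n t \<le> 0" unfolding AE_all_countable using \<sigma> neg by blast
  then have lim: "AE t in M. (\<lambda>n. d n t) \<longlonglongrightarrow> 0"
    using s0 s(3)
  proof eventually_elim
    case (elim t)
    show ?case
    proof (rule LIMSEQ_I)
      fix r :: real assume r: "0 < r"
      have "- r < (SUP n. \<sigma> n t)" using elim r by simp
      then obtain m where m: "- r < \<sigma> m t" using less_cSUP_iff[of UNIV "\<lambda>n. \<sigma> n t"] elim(3) by auto
      have "norm (d n t - 0) < r" if "m \<le> n" for n
        using d_le[OF that, of t] d_ge[of t n] elim(1) m by simp
      then show "\<exists>no. \<forall>n\<ge>no. norm (d n t - 0) < r" by blast
    qed
  qed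
  have "(\<lambda>n. fnorm (d n)) \<longlonglongrightarrow> 0" by (rule fnorm_tendsto_0) (use d lim in auto)
  then have "eventually (\<lambda>n. fnorm (d n) < e) sequentially" using e by (rule order_tendstoD)
  then obtain n where "fnorm (d n) < e" by (auto simp: eventually_sequentially)
  then show ?thesis using d by blast
qed

text \<open>
  For a uo-null net the eventual upper bounds of \<open>\<bar>x\<^sub>\<alpha>\<bar> \<curlywedge> 1\<close> have infimum zero, so one of them has small F-norm,
  which is not affected by the truncation at one.
\<close>

lemma Hausdorff_uo_Lebesgue_tm: "Hausdorff_uo_Lebesgue E tm"
proof -
  have "limitin tm x \<zero>\<^bsub>E\<^esub> (tail_filter A leq)"
    if net: "net_in E A leq x" and conv: "uo_conv E A leq x \<zero>\<^bsub>E\<^esub>"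
    for A :: "((real \<Rightarrow> real) set set \<times> (real \<Rightarrow> real) set) set" and leq x
  proof -
    have xE: "x a \<in> carrier E" if "a \<in> A" for a using net that by (auto simp: net_in_def)
    have dir: "directed A leq" using net by (simp add: net_in_def)
    let ?y = "cls M (\<lambda>t. 1)"
    have y: "?y \<in> carrier E" "\<zero>\<^bsub>E\<^esub> \<preceq>\<^bsub>E\<^esub> ?y" using cls_carrier by (auto simp: L0_le L0_zero)
    let ?z = "\<lambda>a. vabs E (x a \<ominus>\<^bsub>E\<^esub> \<zero>\<^bsub>E\<^esub>) \<sqinter>\<^bsub>ord_of E\<^esub> ?y"
    have null: "V.onull A leq ?z" using conv V.uo_conv_iff[of A leq x "\<zero>\<^bsub>E\<^esub>", OF dir xE] y by simp
    have z: "?z a \<in> carrier E" "\<zero>\<^bsub>E\<^esub> \<preceq>\<^bsub>E\<^esub> ?z a" if "a \<in> A" for a using xE[OF that] y by simp_all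
    let ?D = "V.evub A leq ?z"
    have D: "?D \<subseteq> carrier E" by (auto simp: V.evub_def)
    have "?y \<in> ?D" using V.directedD(1)[OF dir] by (auto simp: V.evub_def y xE)
    then have ne: "?D \<noteq> {}" by blast
    have pos: "\<zero>\<^bsub>E\<^esub> \<preceq>\<^bsub>E\<^esub> d" if d: "d \<in> ?D" for d
    proof -
      obtain a where a: "a \<in> A" "?z a \<preceq>\<^bsub>E\<^esub> d" using d V.directedD(2)[OF dir] unfolding V.evub_def by blast
      show ?thesis using V.ord_trans[OF z(2) a(2)] z a(1) D d by auto
    qed
    have inf: "d \<sqinter>\<^bsub>ord_of E\<^esub> e \<in> ?D" if de: "d \<in> ?D" "e \<in> ?D" for d e
    proof -
      obtain a b where ab: "a \<in> A" "\<And>c. c \<in> A \<Longrightarrow> leq a c \<Longrightarrow> ?z c \<preceq>\<^bsub>E\<^esub> d" "b \<in> A" "\<And>c. c \<in> A \<Longrightarrow> leq b c \<Longrightarrow> ?z c \<preceq>\<^bsub>E\<^esub> e"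
        using de unfolding V.evub_def by blast
      obtain c where c: "c \<in> A" "leq a c" "leq b c" using V.directedD(3)[OF dir ab(1,3)] by blast
      have [simp]: "d \<in> carrier E" "e \<in> carrier E" using de D by auto
      show ?thesis
        using c V.directedD(4)[OF dir ab(1) c(1)] V.directedD(4)[OF dir ab(3) c(1)] ab z
        by (intro V.evubI[of _ c]) (simp_all add: V.le_inf_iff)
    qed
    have g: "V.isglb ?D \<zero>\<^bsub>E\<^esub>"
      by (rule V.isglbI) (use pos V.onullD[OF null] in auto)
    show ?thesis
      unfolding D.limitin_metric
    proof (intro conjI allI impI)
      show "\<zero>\<^bsub>E\<^esub> \<in> carrier E" by simp
      fix e :: real assume e: "0 < e"
      obtain f where f: "f \<in> borel_measurable M" "cls M f \<in> ?D" "fnorm f < e"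
        using small_of_glb_zero[OF D ne inf g e] by blast
      obtain a0 where a0: "a0 \<in> A" "\<And>a. a \<in> A \<Longrightarrow> leq a0 a \<Longrightarrow> ?z a \<preceq>\<^bsub>E\<^esub> cls M f"
        using f(2) unfolding V.evub_def by blast
      have "measure_dist (x a) \<zero>\<^bsub>E\<^esub> < e" if a: "a \<in> A" "leq a0 a" for a
      proof -
        obtain k where k: "k \<in> borel_measurable M" "x a = cls M k" using xE[OF a(1)] by (rule carrier_mE)
        have "?z a = cls M (\<lambda>t. min \<bar>k t\<bar> 1)" using xE[OF a(1)] k by (simp add: cls_abs cls_inf)
        then have "AE t in M. min \<bar>k t\<bar> 1 \<le> f t" using a0(2)[OF a] k f by (simp add: L0_le)
        then have "AE t in M. min 1 \<bar>k t\<bar> \<le> min 1 \<bar>f t\<bar>" by eventually_elim (simp add: min_def split: if_splits)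
        then have "fnorm k \<le> fnorm f"
          unfolding fnorm_def by (intro integral_mono_AE integrable_min_abs k f)
        moreover have "measure_dist (x a) \<zero>\<^bsub>E\<^esub> = fnorm k" using measure_dist_cls[of k "\<lambda>t. 0"] k by (simp add: L0_zero)
        ultimately show ?thesis using f(3) by simp
      qed
      then show "\<forall>\<^sub>F a in tail_filter A leq. x a \<in> carrier E \<and> measure_dist (x a) \<zero>\<^bsub>E\<^esub> < e"
        unfolding eventually_tail_filter[OF dir] using a0(1) xE by blast
    qed
  qed
  then show ?thesis
    unfolding Hausdorff_uo_Lebesgue_def uo_Lebesgue_def
    using locally_solid_tm D.Hausdorff_space_mtopology by blast
qed

lemma tau_hat_tm: "tau_hat E = tm"
  by (rule V.tau_hat_eq[OF Hausdorff_uo_Lebesgue_tm])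

end

section \<open>The failing pairs\<close>

definition unit_interval :: "real measure" where
  "unit_interval = restrict_space lborel {0..1}"

lemma finite_measure_unit: "finite_measure unit_interval"
  by (rule finite_measureI) (simp add: unit_interval_def emeasure_restrict_space space_restrict_space)

lemma borel_unit: "f \<in> borel_measurable borel \<Longrightarrow> f \<in> borel_measurable unit_interval"
  unfolding unit_interval_def by (rule measurable_restrict_space1) simp

lemma AE_unit: "(AE t in unit_interval. Q t) \<longleftrightarrow> (AE t in lborel. t \<in> {0..1} \<longrightarrow> Q t)"
  unfolding unit_interval_def by (subst AE_restrict_space_iff) simp_all

lemma not_AE_unit:
  assumes "AE t in unit_interval. \<not> (a < t \<and> t < b)" "0 \<le> a" "a < b" "b \<le> 1"
  shows False
proof -
  have "AE t in lborel. t \<notin> {a<..<b}"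
    using assms(1) unfolding AE_unit by eventually_elim (use assms in auto)
  then have "emeasure lborel {a<..<b} = 0" by (subst (asm) AE_iff_measurable[where N = "{a<..<b}"]) auto
  then show False using assms by (simp add: emeasure_lborel_Ioo)
qed

text \<open>
  At a function that is nonzero almost everywhere near zero no tail of the spikes is bounded. On the ideal of the
  functions that vanish near zero every point escapes the late spikes, and only the whole operators stay unbounded.
\<close>

definition near_zero :: "(real \<Rightarrow> real) \<Rightarrow> bool" where
  "near_zero f \<longleftrightarrow> (\<exists>m::nat. AE t in unit_interval. t < 1 / Suc m \<longrightarrow> f t = 0)"

lemma L0_full_unit: "L0_full unit_interval"
  by (intro L0_full.intro L0_space.intro finite_measure_unit L0_space_axioms.intro) auto

lemma L0_space_near_zero: "L0_space unit_interval near_zero"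
proof (intro L0_space.intro finite_measure_unit L0_space_axioms.intro)
  show "near_zero (\<lambda>t. f t + g t)" if fg: "near_zero f" "near_zero g" for f g
  proof -
    obtain m k where "AE t in unit_interval. t < 1 / Suc m \<longrightarrow> f t = 0" "AE t in unit_interval. t < 1 / Suc k \<longrightarrow> g t = 0"
      using fg unfolding near_zero_def by blast
    then have "AE t in unit_interval. t < 1 / Suc (max m k) \<longrightarrow> f t + g t = 0"
    proof eventually_elim
      case (elim t)
      have "1 / real (Suc (max m k)) \<le> 1 / Suc m" "1 / real (Suc (max m k)) \<le> 1 / Suc k"
        by (intro divide_left_mono; simp)+
      then show ?case using elim by auto
    qed
    then show ?thesis unfolding near_zero_def by blast
  qed
  show "near_zero f" if g: "near_zero g" and le: "AE t in unit_interval. \<bar>f t\<bar> \<le> \<bar>g t\<bar>" for f g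
  proof -
    obtain m where "AE t in unit_interval. t < 1 / Suc m \<longrightarrow> g t = 0" using g unfolding near_zero_def by blast
    then have "AE t in unit_interval. t < 1 / Suc m \<longrightarrow> f t = 0" using le by eventually_elim auto
    then show ?thesis unfolding near_zero_def by blast
  qed
  show "near_zero (\<lambda>t. r * f t)" if f: "near_zero f" for f r
  proof -
    obtain m where "AE t in unit_interval. t < 1 / Suc m \<longrightarrow> f t = 0" using f unfolding near_zero_def by blast
    then have "AE t in unit_interval. t < 1 / Suc m \<longrightarrow> r * f t = 0" by eventually_elim auto
    then show ?thesis unfolding near_zero_def by blast
  qed
qed (simp add: near_zero_def)

lemma surj_nat_pair:
  assumes "infinite (UNIV :: 'i set)" shows "\<exists>p :: 'i \<Rightarrow> nat \<times> nat. surj p"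
proof -
  obtain f :: "nat \<Rightarrow> 'i" where f: "inj f" using assms unfolding infinite_iff_countable_subset by blast
  have "(prod_decode \<circ> inv_into UNIV f) (f (prod_encode q)) = q" for q using f by simp
  then have "surj (prod_decode \<circ> inv_into UNIV f)" by (rule surjI)
  then show ?thesis by blast
qed

text \<open>
  Only the first component directs the index set, so every tail contains all second components. A tail can thus
  be unbounded, or cover the whole interval, although convergence is decided by the first component alone.
\<close>

definition first_leq :: "('i \<Rightarrow> nat \<times> nat) \<Rightarrow> 'i \<Rightarrow> 'i \<Rightarrow> bool" where
  "first_leq p a b \<longleftrightarrow> fst (p a) \<le> fst (p b)"

lemma directed_first_leq: "surj p \<Longrightarrow> directed UNIV (first_leq p)"
  unfolding directed_def first_leq_def
  by (auto intro!: reflp_onI transp_onI) (metis le_cases)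

definition spike :: "nat \<times> nat \<Rightarrow> real \<Rightarrow> real" where
  "spike q t = real (snd q) * indicator {0<..<1 / Suc (fst q)} t"

definition sweep :: "nat \<times> nat \<Rightarrow> real \<Rightarrow> real" where
  "sweep q t = indicator {real (snd q) / Suc (fst q)..<real (Suc (snd q)) / Suc (fst q)} t"

lemma spike_props: "spike q \<in> borel_measurable borel" "0 \<le> spike q t" "spike q t \<le> real (snd q)"
  unfolding spike_def[abs_def] by (auto simp: indicator_def)

lemma sweep_props: "sweep q \<in> borel_measurable borel" "0 \<le> sweep q t" "sweep q t \<le> 1"
  unfolding sweep_def[abs_def] by (auto simp: indicator_def)

context
  fixes p :: "'i \<Rightarrow> nat \<times> nat"
  assumes p: "surj p"
begin

lemma dir: "directed UNIV (first_leq p)" using directed_first_leq[OF p] .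

lemma p_ex: "\<exists>a. p a = q" using p by (metis surjD)

text \<open>
  A measurable function that dominates \<open>spike (n, k)\<close> for all \<open>k\<close> would be infinite on an interval.
\<close>

lemma spike_unbounded:
  assumes le: "\<And>k::nat. AE t in unit_interval. spike (n, k) t * f t \<le> h t"
    and f: "\<And>t. a < t \<Longrightarrow> t < 1 / Suc n \<Longrightarrow> f t = 1" and a: "0 \<le> a" "a < 1 / Suc n"
  shows False
proof (rule not_AE_unit[OF _ a])
  have "AE t in unit_interval. \<forall>k. spike (n, k) t * f t \<le> h t" unfolding AE_all_countable using le by blast
  then show "AE t in unit_interval. \<not> (a < t \<and> t < 1 / Suc n)"
  proof eventually_elim
    case (elim t)
    show ?case
    proof
      assume t: "a < t \<and> t < 1 / Suc n"
      then have "spike (n, k) t * f t = real k" for k using f a by (simp add: spike_def)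
      then have "real k \<le> h t" for k using elim by metis
      then show False using reals_Archimedean2[of "h t"] by (meson not_less)
    qed
  qed
qed simp

definition spikes :: "((real \<Rightarrow> real) \<Rightarrow> bool) \<Rightarrow> 'i \<Rightarrow> (real \<Rightarrow> real) set \<Rightarrow> (real \<Rightarrow> real) set" where
  "spikes P a = L0_space.mulop unit_interval P (spike (p a))"

definition sweeps :: "'i \<Rightarrow> (real \<Rightarrow> real) set \<Rightarrow> (real \<Rightarrow> real) set" where
  "sweeps a = L0_space.mulop unit_interval (\<lambda>_. True) (sweep (p a))"

subsection \<open>All classes\<close>

interpretation F: L0_full unit_interval
  by (rule L0_full_unit)
interpretation V: orth_vlattice F.E
  by (rule F.orth_vlattice_L0)
interpretation O: orth_vlattice "Orth F.E"
  by (rule V.orth_vlattice_Orth)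

lemma net_spikes: "net_in (Orth F.E) UNIV (first_leq p) (spikes (\<lambda>_. True))"
proof -
  have "spikes (\<lambda>_. True) a \<in> carrier (Orth F.E)" for a
    unfolding spikes_def by (rule F.mulop_orth[OF borel_unit[OF spike_props(1)] spike_props(2,3)])
  then show ?thesis using dir by (simp add: net_in_def)
qed

lemma net_sweeps: "net_in (Orth F.E) UNIV (first_leq p) sweeps"
proof -
  have "sweeps a \<in> carrier (Orth F.E)" for a
    unfolding sweeps_def by (rule F.mulop_orth[OF borel_unit[OF sweep_props(1)] sweep_props(2,3)])
  then show ?thesis using dir by (simp add: net_in_def)
qed


lemma zero_Orth_apply: "X \<in> carrier F.E \<Longrightarrow> \<zero>\<^bsub>Orth F.E\<^esub> X = \<zero>\<^bsub>F.E\<^esub>"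
  by (simp add: Orth_simps)

text \<open>
  Every tail is carried by an interval \<open>(0, 1/(n+1))\<close>, and these intervals have empty intersection.
\<close>

lemma spikes_SUO: "converges MSUO F.E UNIV (first_leq p) (spikes (\<lambda>_. True)) \<zero>\<^bsub>Orth F.E\<^esub>"
proof -
  have "uo_conv F.E UNIV (first_leq p) (\<lambda>a. spikes (\<lambda>_. True) a X) \<zero>\<^bsub>F.E\<^esub>" if X: "X \<in> carrier F.E" for X
  proof -
    obtain f where f: "f \<in> borel_measurable unit_interval" "X = cls unit_interval f" using X by (rule F.carrier_mE)
    have sp: "(\<lambda>t. spike q t * f t) \<in> borel_measurable unit_interval" for q
      using f(1) borel_unit[OF spike_props(1)] by measurable
    have SX: "spikes (\<lambda>_. True) a X = cls unit_interval (\<lambda>t. spike (p a) t * f t)" for a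
      unfolding spikes_def f(2) by (rule F.mulop_cls) (use f in auto)
    have SE: "spikes (\<lambda>_. True) a X \<in> carrier F.E" for a unfolding SX using sp by blast
    have "V.onull UNIV (first_leq p) (\<lambda>a. vabs F.E (spikes (\<lambda>_. True) a X \<ominus>\<^bsub>F.E\<^esub> \<zero>\<^bsub>F.E\<^esub>) \<sqinter>\<^bsub>ord_of F.E\<^esub> Y)"
      if Y: "Y \<in> carrier F.E" "\<zero>\<^bsub>F.E\<^esub> \<preceq>\<^bsub>F.E\<^esub> Y" for Y
      unfolding V.onull_def
    proof (intro ballI impI)
      obtain g where g: "g \<in> borel_measurable unit_interval" "Y = cls unit_interval g" using Y(1) by (rule F.carrier_mE)
      note [measurable] = g(1)
      have g0: "AE t in unit_interval. 0 \<le> g t" using Y(2) g by (simp add: L0_le L0_zero)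
      fix W assume W: "W \<in> carrier F.E"
        and le: "\<forall>D\<in>V.evub UNIV (first_leq p) (\<lambda>a. vabs F.E (spikes (\<lambda>_. True) a X \<ominus>\<^bsub>F.E\<^esub> \<zero>\<^bsub>F.E\<^esub>) \<sqinter>\<^bsub>ord_of F.E\<^esub> Y).
          W \<preceq>\<^bsub>F.E\<^esub> D"
      obtain w where w: "w \<in> borel_measurable unit_interval" "W = cls unit_interval w" using W by (rule F.carrier_mE)
      let ?e = "\<lambda>n t. indicator {0<..<1 / real (Suc n)} t * g t"
      have em: "?e n \<in> borel_measurable unit_interval" for n
      proof -
        have [measurable]: "(indicator {0<..<1 / real (Suc n)} :: real \<Rightarrow> real) \<in> borel_measurable unit_interval"
          by (rule borel_unit) measurable
        show ?thesis by measurable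
      qed
      have "AE t in unit_interval. w t \<le> ?e n t" for n
      proof -
        obtain a0 where a0: "p a0 = (n, 0)" using p_ex by blast
        have "cls unit_interval (?e n) \<in> V.evub UNIV (first_leq p)
            (\<lambda>a. vabs F.E (spikes (\<lambda>_. True) a X \<ominus>\<^bsub>F.E\<^esub> \<zero>\<^bsub>F.E\<^esub>) \<sqinter>\<^bsub>ord_of F.E\<^esub> Y)"
        proof (rule V.evubI[of _ a0])
          show "cls unit_interval (?e n) \<in> carrier F.E" using em by blast
          fix a assume "first_leq p a0 a"
          then have na: "n \<le> fst (p a)" by (simp add: first_leq_def a0)
          have "AE t in unit_interval. min \<bar>spike (p a) t * f t\<bar> (g t) \<le> ?e n t"
            using g0
          proof eventually_elim
            case (elim t)
            have "1 / real (Suc (fst (p a))) \<le> 1 / real (Suc n)" using na by (intro divide_left_mono) auto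
            then show ?case using elim by (auto simp: spike_def indicator_def min_def)
          qed
          moreover have "vabs F.E (spikes (\<lambda>_. True) a X \<ominus>\<^bsub>F.E\<^esub> \<zero>\<^bsub>F.E\<^esub>) \<sqinter>\<^bsub>ord_of F.E\<^esub> Y =
              cls unit_interval (\<lambda>t. min \<bar>spike (p a) t * f t\<bar> (g t))"
            using SE[of a] sp[of "p a"] g by (simp add: SX F.cls_abs F.cls_inf)
          moreover have "(\<lambda>t. min \<bar>spike (p a) t * f t\<bar> (g t)) \<in> borel_measurable unit_interval"
            using sp[of "p a"] by measurable
          ultimately show "vabs F.E (spikes (\<lambda>_. True) a X \<ominus>\<^bsub>F.E\<^esub> \<zero>\<^bsub>F.E\<^esub>) \<sqinter>\<^bsub>ord_of F.E\<^esub> Y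
              \<preceq>\<^bsub>F.E\<^esub> cls unit_interval (?e n)"
            using em by (simp add: L0_le)
        qed simp
        then have "W \<preceq>\<^bsub>F.E\<^esub> cls unit_interval (?e n)" using le by blast
        then show ?thesis using w em by (simp add: L0_le)
      qed
      then have "AE t in unit_interval. \<forall>n. w t \<le> ?e n t" unfolding AE_all_countable by blast
      then have "AE t in unit_interval. w t \<le> 0"
      proof eventually_elim
        case (elim t)
        show ?case
        proof (cases "t > 0")
          case True
          then obtain n where "1 / Suc n < t" by (rule nat_approx_posE)
          then show ?thesis using elim[rule_format, of n] by (simp add: indicator_def)
        next
          case False
          then show ?thesis using elim[rule_format, of 0] by (simp add: indicator_def)
        qed
      qed
      then show "W \<preceq>\<^bsub>F.E\<^esub> \<zero>\<^bsub>F.E\<^esub>" using w by (simp add: L0_le L0_zero)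
    qed
    then show ?thesis using V.uo_conv_iff[of UNIV "first_leq p" "\<lambda>a. spikes (\<lambda>_. True) a X" "\<zero>\<^bsub>F.E\<^esub>", OF dir] SE by simp
  qed
  then show ?thesis by (simp add: zero_Orth_apply)
qed

lemma spikes_not_SO: "\<not> converges MSO F.E UNIV (first_leq p) (spikes (\<lambda>_. True)) \<zero>\<^bsub>Orth F.E\<^esub>"
proof
  let ?X = "cls unit_interval (\<lambda>t. 1)"
  assume "converges MSO F.E UNIV (first_leq p) (spikes (\<lambda>_. True)) \<zero>\<^bsub>Orth F.E\<^esub>"
  moreover have X: "?X \<in> carrier F.E" by auto
  ultimately have conv: "order_conv F.E UNIV (first_leq p) (\<lambda>a. spikes (\<lambda>_. True) a ?X) \<zero>\<^bsub>F.E\<^esub>"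
    by (simp add: zero_Orth_apply)
  have sp: "spike q \<in> borel_measurable unit_interval" for q using borel_unit[OF spike_props(1)] .
  have SX: "spikes (\<lambda>_. True) a ?X = cls unit_interval (spike (p a))" for a
    unfolding spikes_def by (subst F.mulop_cls) auto
  have SE: "spikes (\<lambda>_. True) a ?X \<in> carrier F.E" for a unfolding SX using sp by blast
  have null: "V.onull UNIV (first_leq p) (\<lambda>a. vabs F.E (\<zero>\<^bsub>F.E\<^esub> \<ominus>\<^bsub>F.E\<^esub> spikes (\<lambda>_. True) a ?X))"
    using V.order_conv_iff[of UNIV "first_leq p" "\<lambda>a. spikes (\<lambda>_. True) a ?X" "\<zero>\<^bsub>F.E\<^esub>", OF dir] conv SE by simp
  have nX: "\<not> ?X \<preceq>\<^bsub>F.E\<^esub> \<zero>\<^bsub>F.E\<^esub>"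
  proof
    assume "?X \<preceq>\<^bsub>F.E\<^esub> \<zero>\<^bsub>F.E\<^esub>"
    then have "AE t in unit_interval. False" by (simp add: L0_le L0_zero)
    then have "AE t in unit_interval. \<not> (0 < t \<and> t < 1)" by (rule eventually_mono) simp
    then show False by (rule not_AE_unit) simp_all
  qed
  have "V.evub UNIV (first_leq p) (\<lambda>a. vabs F.E (\<zero>\<^bsub>F.E\<^esub> \<ominus>\<^bsub>F.E\<^esub> spikes (\<lambda>_. True) a ?X)) \<noteq> {}"
    using V.onullD[OF null X] nX by auto
  then obtain D a0 where D: "D \<in> carrier F.E"
    "\<And>a. first_leq p a0 a \<Longrightarrow> vabs F.E (\<zero>\<^bsub>F.E\<^esub> \<ominus>\<^bsub>F.E\<^esub> spikes (\<lambda>_. True) a ?X) \<preceq>\<^bsub>F.E\<^esub> D"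
    unfolding V.evub_def by blast
  obtain h where h: "h \<in> borel_measurable unit_interval" "D = cls unit_interval h" using D(1) by (rule F.carrier_mE)
  show False
  proof (rule spike_unbounded[of "fst (p a0)" "\<lambda>_. 1" h 0])
    fix k
    obtain a where a: "p a = (fst (p a0), k)" using p_ex by blast
    have "vabs F.E (\<zero>\<^bsub>F.E\<^esub> \<ominus>\<^bsub>F.E\<^esub> spikes (\<lambda>_. True) a ?X) \<preceq>\<^bsub>F.E\<^esub> D" by (rule D(2)) (simp add: first_leq_def a)
    moreover have "vabs F.E (\<zero>\<^bsub>F.E\<^esub> \<ominus>\<^bsub>F.E\<^esub> spikes (\<lambda>_. True) a ?X) = cls unit_interval (\<lambda>t. \<bar>spike (p a) t\<bar>)"
      using SE[of a] sp[of "p a"] by (simp add: SX F.cls_abs)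
    ultimately have "AE t in unit_interval. \<bar>spike (p a) t\<bar> \<le> h t"
      using sp[of "p a"] h by (simp add: L0_le)
    then show "AE t in unit_interval. spike (fst (p a0), k) t * 1 \<le> h t" unfolding a by eventually_elim simp
  qed auto
qed

lemma sweeps_Stau: "converges MStau F.E UNIV (first_leq p) sweeps \<zero>\<^bsub>Orth F.E\<^esub>"
proof -
  have "limitin F.tm (\<lambda>a. sweeps a X) \<zero>\<^bsub>F.E\<^esub> (tail_filter UNIV (first_leq p))" if X: "X \<in> carrier F.E" for X
    unfolding F.D.limitin_metric
  proof (intro conjI allI impI)
    show "\<zero>\<^bsub>F.E\<^esub> \<in> carrier F.E" by simp
    fix e :: real assume "0 < e"
    then obtain n where n: "1 / Suc n < e" by (rule nat_approx_posE)
    obtain f where f: "f \<in> borel_measurable unit_interval" "X = cls unit_interval f" using X by (rule F.carrier_mE)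
    note [measurable] = f(1)
    have sm [measurable]: "sweep q \<in> borel_measurable unit_interval" for q using borel_unit[OF sweep_props(1)] .
    have SX: "sweeps a X = cls unit_interval (\<lambda>t. sweep (p a) t * f t)" for a
      unfolding sweeps_def f(2) by (rule F.mulop_cls) (use f in auto)
    have SE: "sweeps a X \<in> carrier F.E" for a unfolding SX by (rule F.cls_carrier) auto
    obtain a0 where a0: "p a0 = (n, 0)" using p_ex by blast
    have "F.measure_dist (sweeps a X) \<zero>\<^bsub>F.E\<^esub> < e" if a: "first_leq p a0 a" for a
    proof -
      let ?I = "{real (snd (p a)) / Suc (fst (p a))..<real (Suc (snd (p a))) / Suc (fst (p a))}"
      have "F.measure_dist (sweeps a X) \<zero>\<^bsub>F.E\<^esub> = F.fnorm (\<lambda>t. sweep (p a) t * f t)"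
        unfolding SX using F.measure_dist_cls[of "\<lambda>t. sweep (p a) t * f t" "\<lambda>t. 0"] by (simp add: L0_zero)
      also have "\<dots> \<le> (\<integral>t. indicator ?I t \<partial>unit_interval)"
        unfolding F.fnorm_def
      proof (rule integral_mono)
        show "integrable unit_interval (\<lambda>t. min 1 \<bar>sweep (p a) t * f t\<bar>)" by (rule F.integrable_min_abs) measurable
        show "integrable unit_interval (indicator ?I :: real \<Rightarrow> real)"
          by (rule F.integrable_const_bound[where B = 1]) (auto intro: borel_unit)
        show "min 1 \<bar>sweep (p a) t * f t\<bar> \<le> indicator ?I t" for t by (auto simp: sweep_def indicator_def)
      qed
      also have "\<dots> = measure lborel (?I \<inter> {0..1})"
        unfolding unit_interval_def
        by (simp add: space_restrict_space measure_restrict_space)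
      also have "\<dots> \<le> measure lborel ?I"
        by (rule measure_mono_fmeasurable) (auto simp: fmeasurable_def emeasure_lborel_Ico divide_right_mono)
      also have "\<dots> = 1 / Suc (fst (p a))"
        by (subst measure_lborel_Ico) (auto simp: divide_right_mono diff_divide_distrib[symmetric])
      also have "\<dots> \<le> 1 / Suc n" using a by (intro divide_left_mono) (auto simp: first_leq_def a0)
      finally show ?thesis using n by simp
    qed
    then show "\<forall>\<^sub>F a in tail_filter UNIV (first_leq p). sweeps a X \<in> carrier F.E \<and> F.measure_dist (sweeps a X) \<zero>\<^bsub>F.E\<^esub> < e"
      unfolding eventually_tail_filter[OF dir] using SE by blast
  qed
  then show ?thesis by (simp add: F.tau_hat_tm zero_Orth_apply)
qed

text \<open>
  For fixed \<open>n\<close> the intervals \<open>[k/(n+1), (k+1)/(n+1))\<close> cover the unit interval, so a bound for a tail is at least one.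
\<close>

lemma sweeps_not_SUO: "\<not> converges MSUO F.E UNIV (first_leq p) sweeps \<zero>\<^bsub>Orth F.E\<^esub>"
proof
  let ?X = "cls unit_interval (\<lambda>t. 1)"
  assume "converges MSUO F.E UNIV (first_leq p) sweeps \<zero>\<^bsub>Orth F.E\<^esub>"
  moreover have X: "?X \<in> carrier F.E" by auto
  ultimately have conv: "uo_conv F.E UNIV (first_leq p) (\<lambda>a. sweeps a ?X) \<zero>\<^bsub>F.E\<^esub>"
    by (simp add: zero_Orth_apply)
  have sp: "sweep q \<in> borel_measurable unit_interval" for q using borel_unit[OF sweep_props(1)] .
  have SX: "sweeps a ?X = cls unit_interval (sweep (p a))" for a
    unfolding sweeps_def by (subst F.mulop_cls) auto
  have SE: "sweeps a ?X \<in> carrier F.E" for a unfolding SX using sp by blast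
  have X0: "\<zero>\<^bsub>F.E\<^esub> \<preceq>\<^bsub>F.E\<^esub> ?X" by (simp add: L0_le L0_zero)
  let ?z = "\<lambda>a. vabs F.E (sweeps a ?X \<ominus>\<^bsub>F.E\<^esub> \<zero>\<^bsub>F.E\<^esub>) \<sqinter>\<^bsub>ord_of F.E\<^esub> ?X"
  have null: "V.onull UNIV (first_leq p) ?z"
    using V.uo_conv_iff[of UNIV "first_leq p" "\<lambda>a. sweeps a ?X" "\<zero>\<^bsub>F.E\<^esub>", OF dir] conv SE X X0 by simp
  have z: "?z a = cls unit_interval (sweep (p a))" for a
  proof -
    have "?z a = cls unit_interval (\<lambda>t. min \<bar>sweep (p a) t\<bar> 1)"
      using SE[of a] sp[of "p a"] by (simp add: SX F.cls_abs F.cls_inf)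
    also have "(\<lambda>t. min \<bar>sweep (p a) t\<bar> 1) = sweep (p a)"
      using sweep_props(2,3) by (auto simp: min_def abs_of_nonneg intro: antisym)
    finally show ?thesis .
  qed
  have "?X \<preceq>\<^bsub>F.E\<^esub> \<zero>\<^bsub>F.E\<^esub>"
  proof (rule V.onullD[OF null X])
    fix D assume "D \<in> V.evub UNIV (first_leq p) ?z"
    then obtain a0 where D: "D \<in> carrier F.E" "\<And>a. first_leq p a0 a \<Longrightarrow> ?z a \<preceq>\<^bsub>F.E\<^esub> D"
      unfolding V.evub_def by blast
    obtain h where h: "h \<in> borel_measurable unit_interval" "D = cls unit_interval h" using D(1) by (rule F.carrier_mE)
    let ?n = "fst (p a0)"
    have "AE t in unit_interval. sweep (?n, k) t \<le> h t" for k
    proof -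
      obtain a where a: "p a = (?n, k)" using p_ex by blast
      have "?z a \<preceq>\<^bsub>F.E\<^esub> D" by (rule D(2)) (simp add: first_leq_def a)
      then show ?thesis using sp[of "p a"] h by (simp add: z L0_le a)
    qed
    then have "AE t in unit_interval. \<forall>k. sweep (?n, k) t \<le> h t" unfolding AE_all_countable by blast
    moreover have "AE t in unit_interval. 0 \<le> t" unfolding AE_unit by simp
    ultimately have "AE t in unit_interval. 1 \<le> h t"
    proof eventually_elim
      case (elim t)
      define k where "k = nat \<lfloor>t * Suc ?n\<rfloor>"
      have "real k = of_int \<lfloor>t * Suc ?n\<rfloor>" using elim(2) by (simp add: k_def)
      then have "real k \<le> t * Suc ?n" "t * Suc ?n < real (Suc k)" by linarith+
      then have "sweep (?n, k) t = 1" by (simp add: sweep_def indicator_def field_simps)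
      then show ?case using elim(1) by metis
    qed
    then show "?X \<preceq>\<^bsub>F.E\<^esub> D" using h by (simp add: L0_le)
  qed
  then have "AE t in unit_interval. False" by (simp add: L0_le L0_zero)
  then have "AE t in unit_interval. \<not> (0 < t \<and> t < 1)" by (rule eventually_mono) simp
  then show False by (rule not_AE_unit) simp_all
qed

subsection \<open>Classes that vanish near zero\<close>

interpretation N: L0_space unit_interval near_zero
  by (rule L0_space_near_zero)
interpretation VN: orth_vlattice N.E
  by (rule N.orth_vlattice_L0)
interpretation ON: orth_vlattice "Orth N.E"
  by (rule VN.orth_vlattice_Orth)

lemma net_spikes_near_zero: "net_in (Orth N.E) UNIV (first_leq p) (spikes near_zero)"
proof -
  have "spikes near_zero a \<in> carrier (Orth N.E)" for a
    unfolding spikes_def by (rule N.mulop_orth[OF borel_unit[OF spike_props(1)] spike_props(2,3)])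
  then show ?thesis using dir by (simp add: net_in_def)
qed

text \<open>
  A function that vanishes near zero is annihilated by all sufficiently late spikes.
\<close>

lemma spikes_SO: "converges MSO N.E UNIV (first_leq p) (spikes near_zero) \<zero>\<^bsub>Orth N.E\<^esub>"
proof -
  have "order_conv N.E UNIV (first_leq p) (\<lambda>a. spikes near_zero a X) \<zero>\<^bsub>N.E\<^esub>" if X: "X \<in> carrier N.E" for X
  proof -
    obtain f where f: "f \<in> borel_measurable unit_interval" "near_zero f" "X = cls unit_interval f" using X by (rule N.carrierE)
    obtain m where m: "AE t in unit_interval. t < 1 / Suc m \<longrightarrow> f t = 0" using f(2) unfolding near_zero_def by blast
    have SE: "spikes near_zero a X \<in> carrier N.E" for a
      using net_spikes_near_zero VN.orth_closed X by (auto simp: net_in_def)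
    obtain a0 where a0: "p a0 = (m, 0)" using p_ex by blast
    have z: "spikes near_zero a X = \<zero>\<^bsub>N.E\<^esub>" if "first_leq p a0 a" for a
    proof -
      have "AE t in unit_interval. spike (p a) t * f t = 0"
        using m
      proof eventually_elim
        case (elim t)
        have "1 / real (Suc (fst (p a))) \<le> 1 / real (Suc m)" using that by (intro divide_left_mono) (auto simp: first_leq_def a0)
        then show ?case using elim by (auto simp: spike_def indicator_def)
      qed
      then show ?thesis unfolding spikes_def f(3) N.mulop_cls[OF f(1,2)] L0_zero by (rule cls_eqI)
    qed
    have "\<zero>\<^bsub>N.E\<^esub> \<in> VN.evub UNIV (first_leq p) (\<lambda>a. vabs N.E (\<zero>\<^bsub>N.E\<^esub> \<ominus>\<^bsub>N.E\<^esub> spikes near_zero a X))"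
      by (rule VN.evubI[of _ a0]) (simp_all add: z)
    then have "VN.onull UNIV (first_leq p) (\<lambda>a. vabs N.E (\<zero>\<^bsub>N.E\<^esub> \<ominus>\<^bsub>N.E\<^esub> spikes near_zero a X))"
      unfolding VN.onull_def by blast
    then show ?thesis
      using VN.order_conv_iff[of UNIV "first_leq p" "\<lambda>a. spikes near_zero a X" "\<zero>\<^bsub>N.E\<^esub>", OF dir] SE by simp
  qed
  then show ?thesis by (simp add: Orth_simps)
qed

lemma cls_tail: "cls unit_interval (indicator {1 / real (Suc m)..}) \<in> carrier N.E"
proof (rule N.cls_carrier)
  show "near_zero (indicator {1 / real (Suc m)..})" unfolding near_zero_def by (auto simp: indicator_def intro!: exI[of _ m])
qed (auto intro: borel_unit)

lemma spikes_not_o: "\<not> converges Mo N.E UNIV (first_leq p) (spikes near_zero) \<zero>\<^bsub>Orth N.E\<^esub>"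
proof
  assume "converges Mo N.E UNIV (first_leq p) (spikes near_zero) \<zero>\<^bsub>Orth N.E\<^esub>"
  then have conv: "order_conv (Orth N.E) UNIV (first_leq p) (spikes near_zero) \<zero>\<^bsub>Orth N.E\<^esub>" by simp
  have SO: "spikes near_zero a \<in> carrier (Orth N.E)" for a using net_spikes_near_zero by (auto simp: net_in_def)
  let ?z = "\<lambda>a. vabs (Orth N.E) (\<zero>\<^bsub>Orth N.E\<^esub> \<ominus>\<^bsub>Orth N.E\<^esub> spikes near_zero a)"
  have null: "ON.onull UNIV (first_leq p) ?z"
    using ON.order_conv_iff[of UNIV "first_leq p" "spikes near_zero" "\<zero>\<^bsub>Orth N.E\<^esub>", OF dir SO ON.zero_closed] conv by blast
  let ?I = "\<lambda>X\<in>carrier N.E. X"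
  have nI: "\<not> ?I \<preceq>\<^bsub>Orth N.E\<^esub> \<zero>\<^bsub>Orth N.E\<^esub>"
  proof
    let ?f = "indicator {1 / real (Suc 1)..} :: real \<Rightarrow> real"
    assume "?I \<preceq>\<^bsub>Orth N.E\<^esub> \<zero>\<^bsub>Orth N.E\<^esub>"
    moreover have "\<zero>\<^bsub>N.E\<^esub> \<preceq>\<^bsub>N.E\<^esub> cls unit_interval ?f"
      unfolding L0_zero by (subst L0_le) (auto intro: borel_unit)
    ultimately have "cls unit_interval ?f \<preceq>\<^bsub>N.E\<^esub> \<zero>\<^bsub>N.E\<^esub>" using cls_tail[of 1] by (simp add: Orth_simps)
    then have "AE t in unit_interval. ?f t \<le> 0" by (subst (asm) L0_zero, subst (asm) L0_le) (auto intro: borel_unit)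
    then have "AE t in unit_interval. \<not> (1/2 < t \<and> t < 1)" by eventually_elim (auto simp: indicator_def)
    then show False by (rule not_AE_unit) simp_all
  qed
  have "ON.evub UNIV (first_leq p) ?z \<noteq> {}" using ON.onullD[OF null VN.id_orth] nI by auto
  then obtain U a0 where U: "U \<in> carrier (Orth N.E)" "\<And>a. first_leq p a0 a \<Longrightarrow> ?z a \<preceq>\<^bsub>Orth N.E\<^esub> U"
    unfolding ON.evub_def by blast
  let ?n = "fst (p a0)"
  let ?f = "indicator {1 / real (Suc (Suc ?n))..} :: real \<Rightarrow> real"
  let ?X = "cls unit_interval ?f"
  have fm: "?f \<in> borel_measurable unit_interval" by (rule borel_unit) measurable
  have fn: "near_zero ?f" unfolding near_zero_def by (auto simp: indicator_def intro!: exI[of _ "Suc ?n"])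
  have X: "?X \<in> carrier N.E" by (rule cls_tail)
  have X0: "\<zero>\<^bsub>N.E\<^esub> \<preceq>\<^bsub>N.E\<^esub> ?X" using fm by (simp add: L0_zero L0_le)
  have "U ?X \<in> carrier N.E" by (rule VN.orth_closed[OF U(1) X])
  then obtain h where h: "h \<in> borel_measurable unit_interval" "U ?X = cls unit_interval h" by (rule N.carrierE)
  show False
  proof (rule spike_unbounded[of ?n ?f h "1 / real (Suc (Suc ?n))"])
    fix k
    obtain a where a: "p a = (?n, k)" using p_ex by blast
    have sm: "spike (p a) \<in> borel_measurable unit_interval" using borel_unit[OF spike_props(1)] .
    have "spikes near_zero a \<preceq>\<^bsub>Orth N.E\<^esub> ?z a"
      using ON.av_ge(1)[OF SO[of a]] ON.av_neg[OF SO[of a]] ON.minus_zero_left[OF SO[of a]] by simp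
    moreover have "?z a \<preceq>\<^bsub>Orth N.E\<^esub> U" by (rule U(2)) (simp add: first_leq_def a)
    moreover have zO: "?z a \<in> carrier (Orth N.E)" by (intro ON.av_closed ON.minus_closed' ON.zero_closed SO)
    ultimately have "spikes near_zero a \<preceq>\<^bsub>Orth N.E\<^esub> U" using ON.ord_trans[OF _ _ SO zO U(1)] by blast
    then have "spikes near_zero a ?X \<preceq>\<^bsub>N.E\<^esub> U ?X" using X X0 by (simp add: Orth_simps)
    moreover have "spikes near_zero a ?X = cls unit_interval (\<lambda>t. spike (p a) t * ?f t)"
      unfolding spikes_def by (rule N.mulop_cls[OF fm fn])
    moreover have "(\<lambda>t. spike (p a) t * ?f t) \<in> borel_measurable unit_interval" using sm fm by (rule borel_measurable_times)
    ultimately have "AE t in unit_interval. spike (p a) t * ?f t \<le> h t" using h(1) unfolding h(2) by (simp only: L0_le)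
    then show "AE t in unit_interval. spike (?n, k) t * ?f t \<le> h t" unfolding a .
  qed (auto simp: frac_less2)
qed

lemma admissible_near_zero: "admissible MSO Mo N.E"
  using N.vector_lattice_L0 N.archimedean_L0 N.dedekind_complete_L0 by (simp add: admissible_def)

lemma admissible_full: "admissible c\<^sub>1 c\<^sub>2 F.E"
  using F.vector_lattice_L0 F.archimedean_L0 F.dedekind_complete_L0 F.Hausdorff_uo_Lebesgue_tm
  unfolding admissible_def by blast

lemma not_continuous_pairs:
  assumes "(c\<^sub>1, c\<^sub>2) \<notin> continuity_pairs"
  shows "\<exists>E :: (real \<Rightarrow> real) set vlat. admissible c\<^sub>1 c\<^sub>2 E \<and>
    (\<exists>T\<in>carrier (Orth E). \<not> mode_continuous TYPE('i) E c\<^sub>1 c\<^sub>2 (rho E T))"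
proof (cases "c\<^sub>1 = MSO")
  case True
  then have c: "c\<^sub>1 = MSO" "c\<^sub>2 = Mo" using assms by (cases c\<^sub>2; simp add: continuity_pairs_def)+
  have "\<not> mode_continuous TYPE('i) N.E c\<^sub>1 c\<^sub>2 (rho N.E (\<lambda>x\<in>carrier N.E. x))"
    unfolding c by (rule VN.not_continuousI[OF net_spikes_near_zero ON.zero_closed spikes_SO spikes_not_o])
  then show ?thesis using admissible_near_zero VN.id_orth unfolding c by blast
next
  case False
  note H = F.Hausdorff_uo_Lebesgue_tm
  have sp: "converges c F.E UNIV (first_leq p) (spikes (\<lambda>_. True)) \<zero>\<^bsub>Orth F.E\<^esub>" if "c \<in> {Muo, Mtau, MSUO, MStau}" for c
  proof -
    have 1: "converges MStau F.E UNIV (first_leq p) (spikes (\<lambda>_. True)) \<zero>\<^bsub>Orth F.E\<^esub>"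
      by (rule V.SUO_imp_Stau[OF H net_spikes O.zero_closed spikes_SUO])
    have 2: "converges Mtau F.E UNIV (first_leq p) (spikes (\<lambda>_. True)) \<zero>\<^bsub>Orth F.E\<^esub>"
      using V.tau_iff_Stau[OF H net_spikes O.zero_closed] 1 by blast
    have 3: "converges Muo F.E UNIV (first_leq p) (spikes (\<lambda>_. True)) \<zero>\<^bsub>Orth F.E\<^esub>"
      using V.SUO_imp_uo[OF net_spikes O.zero_closed] spikes_SUO by simp
    show ?thesis using that 1 2 3 spikes_SUO by blast
  qed
  have nsp: "\<not> converges c F.E UNIV (first_leq p) (spikes (\<lambda>_. True)) \<zero>\<^bsub>Orth F.E\<^esub>" if "c \<in> {Mo, MSO}" for c
  proof -
    have "\<not> converges Mo F.E UNIV (first_leq p) (spikes (\<lambda>_. True)) \<zero>\<^bsub>Orth F.E\<^esub>"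
      using V.o_imp_SO[OF net_spikes O.zero_closed] spikes_not_SO by auto
    then show ?thesis using that spikes_not_SO by blast
  qed
  have sw: "converges c F.E UNIV (first_leq p) sweeps \<zero>\<^bsub>Orth F.E\<^esub>" if "c \<in> {Mtau, MStau}" for c
    using V.tau_iff_Stau[OF H net_sweeps O.zero_closed] sweeps_Stau that by blast
  have nsw: "\<not> converges c F.E UNIV (first_leq p) sweeps \<zero>\<^bsub>Orth F.E\<^esub>" if "c \<in> {Muo, MSUO}" for c
  proof -
    have "\<not> converges Muo F.E UNIV (first_leq p) sweeps \<zero>\<^bsub>Orth F.E\<^esub>"
      using V.uo_imp_SUO[OF net_sweeps O.zero_closed] sweeps_not_SUO by auto
    then show ?thesis using that sweeps_not_SUO by blast
  qed
  have "c\<^sub>1 \<in> {Muo, Mtau, MSUO, MStau} \<and> c\<^sub>2 \<in> {Mo, MSO} \<or> c\<^sub>1 \<in> {Mtau, MStau} \<and> c\<^sub>2 \<in> {Muo, MSUO}"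
    using assms False by (cases c\<^sub>1; cases c\<^sub>2) (simp_all add: continuity_pairs_def)
  then have "\<not> mode_continuous TYPE('i) F.E c\<^sub>1 c\<^sub>2 (rho F.E (\<lambda>x\<in>carrier F.E. x))"
    using V.not_continuousI[OF net_spikes O.zero_closed sp nsp] V.not_continuousI[OF net_sweeps O.zero_closed sw nsw] by blast
  then show ?thesis using admissible_full V.id_orth by blast
qed

end

section \<open>The theorem\<close>

theorem mainTheorem5:
  shows
    "(\<forall>E :: 'a vlat. vector_lattice E \<and> archimedean E \<and> dedekind_complete E \<longrightarrow>
        (\<forall>T\<in>carrier (Orth E). rho E T = lam E T)) \<and>
     (\<forall>c\<^sub>1 c\<^sub>2. (c\<^sub>1, c\<^sub>2) \<in> continuity_pairs \<longrightarrow>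
        (\<forall>E :: 'a vlat. admissible c\<^sub>1 c\<^sub>2 E \<longrightarrow>
          (\<forall>T\<in>carrier (Orth E). mode_continuous TYPE('i) E c\<^sub>1 c\<^sub>2 (rho E T)))) \<and>
     (\<forall>c\<^sub>1 c\<^sub>2. (c\<^sub>1, c\<^sub>2) \<notin> continuity_pairs \<longrightarrow>
        (\<exists>E :: (real \<Rightarrow> real) set vlat. admissible c\<^sub>1 c\<^sub>2 E \<and>
          (\<exists>T\<in>carrier (Orth E).
             \<not> mode_continuous
                 TYPE(((real \<Rightarrow> real) set \<Rightarrow> (real \<Rightarrow> real) set) set \<times>
                      ((real \<Rightarrow> real) set \<Rightarrow> (real \<Rightarrow> real) set)) E c\<^sub>1 c\<^sub>2 (rho E T))))"
proof (intro conjI allI impI ballI)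
  fix E :: "'a vlat" and T
  assume E: "vector_lattice E \<and> archimedean E \<and> dedekind_complete E" and T: "T \<in> carrier (Orth E)"
  interpret orth_vlattice E by (rule orth_vlatticeI) (use E in auto)
  show "rho E T = lam E T" by (rule rho_eq_lam[OF T])
next
  fix c\<^sub>1 c\<^sub>2 and E :: "'a vlat" and T
  assume c: "(c\<^sub>1, c\<^sub>2) \<in> continuity_pairs" and E: "admissible c\<^sub>1 c\<^sub>2 E" and T: "T \<in> carrier (Orth E)"
  interpret orth_vlattice E by (rule orth_vlatticeI) (use E in \<open>auto simp: admissible_def\<close>)
  show "mode_continuous TYPE('i) E c\<^sub>1 c\<^sub>2 (rho E T)"
    by (rule rho_continuous[OF c T]) (use E in \<open>auto simp: admissible_def\<close>)
next
  fix c\<^sub>1 c\<^sub>2 assume c: "(c\<^sub>1, c\<^sub>2) \<notin> continuity_pairs"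
  have "infinite (UNIV :: (real \<Rightarrow> real) set)"
    using infinite_UNIV_char_0[where 'a = real] finite_fun_UNIVD2[where 'a = real and 'b = real] by blast
  then have "infinite (UNIV :: (real \<Rightarrow> real) set set)" by (simp add: Finite_Set.finite_set)
  then have "infinite (UNIV :: ((real \<Rightarrow> real) set \<Rightarrow> (real \<Rightarrow> real) set) set)"
    using finite_fun_UNIVD2[where 'a = "(real \<Rightarrow> real) set" and 'b = "(real \<Rightarrow> real) set"] by blast
  then have "infinite (UNIV :: (((real \<Rightarrow> real) set \<Rightarrow> (real \<Rightarrow> real) set) set \<times> ((real \<Rightarrow> real) set \<Rightarrow> (real \<Rightarrow> real) set)) set)"
    by (simp add: finite_prod)
  then obtain p :: "((real \<Rightarrow> real) set \<Rightarrow> (real \<Rightarrow> real) set) set \<times> ((real \<Rightarrow> real) set \<Rightarrow> (real \<Rightarrow> real) set) \<Rightarrow> nat \<times> nat"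
    where "surj p" using surj_nat_pair by blast
  then show "\<exists>E :: (real \<Rightarrow> real) set vlat. admissible c\<^sub>1 c\<^sub>2 E \<and>
          (\<exists>T\<in>carrier (Orth E).
             \<not> mode_continuous
                 TYPE(((real \<Rightarrow> real) set \<Rightarrow> (real \<Rightarrow> real) set) set \<times>
                      ((real \<Rightarrow> real) set \<Rightarrow> (real \<Rightarrow> real) set)) E c\<^sub>1 c\<^sub>2 (rho E T))"
    using c by (rule not_continuous_pairs)
qed

end
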